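(* Let $A$ be a finite dimensional symmetric Hopf algebra over a field $\mathbf{k}$. Let $m,n\in\mathbb{Z}$, and let $M$ be an $A$-module that is the middle term of an exact sequence of $A$-modules $$0\to\Omega^m\mathbf{k}\to M\to\Omega^n\mathbf{k}\to 0$$ representing an element $\xi\in\widehat{\mathrm{Ext}}^1_A(\Omega^n\mathbf{k},\Omega^m\mathbf{k})\cong\widehat{\mathrm{H}}^{n+1-m}(A,\mathbf{k})$. Suppose that the map $\xi:\widehat{\mathrm{H}}^*(A,\mathbf{k})\to\widehat{\mathrm{H}}^*(A,\mathbf{k})$ given by multiplication by $\xi$ has a finite dimensional image (over $\mathbf{k}$), and suppose that the usual cohomology ring $\mathrm{H}^*(A,\mathbf{k})$ is Noetherian. Then the Tate cohomology $\widehat{\mathrm{H}}^*(A,M)$ is finitely generated as a module over $\widehat{\mathrm{H}}^*(A,\mathbf{k})$.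
   Context: All modules are finitely generated left modules. A finite dimensional Hopf algebra $A$ over $\mathbf{k}$ is symmetric if $A\cong \mathrm{Hom}_{\mathbf{k}}(A,\mathbf{k})$ as $A$-$A$-bimodules. $\mathbf{k}$ is the trivial $A$-module via the augmentation $\varepsilon$. $\mathrm{H}^*(A,\mathbf{k})=\mathrm{Ext}^*_A(\mathbf{k},\mathbf{k})$ is the usual cohomology ring. $\Omega$ is the Heller operator: $\Omega(M)$ is the kernel of a projective cover of $M$, $\Omega^{-1}(M)$ is the cokernel of an injective hull of $M$, $\Omega^n$ is the iterate, and $\Omega^0(M)$ is $M$ with its projective summands removed. $\underline{\mathrm{Hom}}_A(M,N)$ is the quotient of $\mathrm{Hom}_A(M,N)$ by the maps factoring through a projective module. Tate cohomology is $\widehat{\mathrm{Ext}}^n_A(M,N)\cong\underline{\mathrm{Hom}}_A(\Omega^nM,N)$ and $\widehat{\mathrm{H}}^*(A,M)=\widehat{\mathrm{Ext}}^*_A(\mathbf{k},M)\cong\bigoplus_{n\in\mathbb{Z}}\underline{\mathrm{Hom}}_A(\Omega^n\mathbf{k},M)$. Under the Yoneda product, $\widehat{\mathrm{H}}^*(A,\mathbf{k})$ is a graded(-commutative) ring and $\widehat{\mathrm{H}}^*(A,M)$ is a graded module over it. *)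

theory Defs
  imports "HOL-Library.Poly_Mapping" "HOL-Algebra.Ring_Divisibility" "HOL-Algebra.Product_Groups"
begin

section \<open>Finite dimensional symmetric Hopf algebras\<close>

text \<open>
  The ground field is a type \<open>'k\<close> and the algebra a type \<open>'a\<close> of class \<open>ring_1\<close>; the
  \<open>'k\<close>-structure is an explicit scalar multiplication.
\<close>

locale k_algebra = vector_space scale
  for scale :: "'k::field \<Rightarrow> 'a::ring_1 \<Rightarrow> 'a" +
  assumes scale_mult_left: "scale c x * y = scale c (x * y)"
    and scale_mult_right: "x * scale c y = scale c (x * y)"

definition finite_dimensional :: "('k::field \<Rightarrow> 'a::ring_1 \<Rightarrow> 'a) \<Rightarrow> bool" where
  "finite_dimensional scale \<longleftrightarrow> (\<exists>B. finite B \<and> module.span scale B = UNIV)"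

text \<open>
  Tensor powers of \<open>A\<close>: the word \<open>[x\<^sub>1, \<dots>, x\<^sub>r]\<close> stands for the pure tensor
  \<open>x\<^sub>1 \<otimes> \<dots> \<otimes> x\<^sub>r\<close> and a list of words for their sum.  The tensor powers of \<open>A\<close> are the
  (graded pieces of the) free vector space on words modulo the span of the multilinearity
  relations, so two lists of words of length \<open>r\<close> are related by \<open>tensor_eq\<close> iff the sums
  are equal in the \<open>r\<close>-fold tensor power over \<open>'k\<close>.  Every element of a tensor power is
  such a sum, because scalars can be absorbed in the first factor.
\<close>

definition multilinear_relations ::
    "('k::field \<Rightarrow> 'a::ring_1 \<Rightarrow> 'a) \<Rightarrow> ('a list \<Rightarrow>\<^sub>0 'k) set" where
  "multilinear_relations scale =
     {Poly_Mapping.single (xs @ [a + b] @ ys) 1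
        - Poly_Mapping.single (xs @ [a] @ ys) 1 - Poly_Mapping.single (xs @ [b] @ ys) 1
      | xs a b ys. True}
   \<union> {Poly_Mapping.single (xs @ [scale c a] @ ys) 1 - Poly_Mapping.single (xs @ [a] @ ys) c
      | xs c a ys. True}"

definition tensor_eq ::
    "('k::field \<Rightarrow> 'a::ring_1 \<Rightarrow> 'a) \<Rightarrow> 'a list list \<Rightarrow> 'a list list \<Rightarrow> bool" where
  "tensor_eq scale X Y \<longleftrightarrow>
     (\<Sum>w\<leftarrow>X. Poly_Mapping.single w 1) - (\<Sum>w\<leftarrow>Y. Poly_Mapping.single w 1)
       \<in> module.span (\<lambda>c. Poly_Mapping.map ((*) c)) (multilinear_relations scale)"

text \<open>
  The comultiplication is given in Sweedler form: \<open>\<Delta> a = [(x\<^sub>1, y\<^sub>1), \<dots>]\<close> means that the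
  coproduct of \<open>a\<close> is the sum of the \<open>x\<^sub>i \<otimes> y\<^sub>i\<close>.  The list is only a chosen representative;
  all axioms are equations in the tensor powers of \<open>A\<close>.
\<close>

locale hopf_algebra = k_algebra scale
  for scale :: "'k::field \<Rightarrow> 'a::ring_1 \<Rightarrow> 'a"
  and \<Delta> :: "'a \<Rightarrow> ('a \<times> 'a) list"
  and \<epsilon> :: "'a \<Rightarrow> 'k"
  and S :: "'a \<Rightarrow> 'a" +
  assumes comult_add:
      "tensor_eq scale [[x, y]. (x, y) \<leftarrow> \<Delta> (a + b)] [[x, y]. (x, y) \<leftarrow> \<Delta> a @ \<Delta> b]"
    and comult_scale:
      "tensor_eq scale [[x, y]. (x, y) \<leftarrow> \<Delta> (scale c a)] [[scale c x, y]. (x, y) \<leftarrow> \<Delta> a]"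
    and comult_mult:
      "tensor_eq scale [[x, y]. (x, y) \<leftarrow> \<Delta> (a * b)]
         [[x * x', y * y']. (x, y) \<leftarrow> \<Delta> a, (x', y') \<leftarrow> \<Delta> b]"
    and comult_one: "tensor_eq scale [[x, y]. (x, y) \<leftarrow> \<Delta> 1] [[1, 1]]"
    and coassoc:
      "tensor_eq scale [[u, v, y]. (x, y) \<leftarrow> \<Delta> a, (u, v) \<leftarrow> \<Delta> x]
         [[x, u, v]. (x, y) \<leftarrow> \<Delta> a, (u, v) \<leftarrow> \<Delta> y]"
    and counit_linear: "Vector_Spaces.linear scale (*) \<epsilon>"
    and counit_mult: "\<epsilon> (a * b) = \<epsilon> a * \<epsilon> b"
    and counit_one: "\<epsilon> 1 = 1"
    and counit_left: "(\<Sum>(x, y)\<leftarrow>\<Delta> a. scale (\<epsilon> x) y) = a"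
    and counit_right: "(\<Sum>(x, y)\<leftarrow>\<Delta> a. scale (\<epsilon> y) x) = a"
    and antipode_linear: "Vector_Spaces.linear scale scale S"
    and antipode_left: "(\<Sum>(x, y)\<leftarrow>\<Delta> a. S x * y) = scale (\<epsilon> a) 1"
    and antipode_right: "(\<Sum>(x, y)\<leftarrow>\<Delta> a. x * S y) = scale (\<epsilon> a) 1"

text \<open>
  The bimodule structure on the dual is \<open>(a f b)(y) = f (b y a)\<close>; \<open>\<phi>\<close> is an isomorphism of
  bimodules from \<open>A\<close> to its dual.
\<close>

definition symmetric_algebra :: "('k::field \<Rightarrow> 'a::ring_1 \<Rightarrow> 'a) \<Rightarrow> bool" where
  "symmetric_algebra scale \<longleftrightarrow>
     (\<exists>\<phi> :: 'a \<Rightarrow> 'a \<Rightarrow> 'k. bij_betw \<phi> UNIV {f. Vector_Spaces.linear scale (*) f} \<and>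
        (\<forall>x y. \<phi> (x + y) = (\<lambda>z. \<phi> x z + \<phi> y z)) \<and>
        (\<forall>a x b. \<phi> (a * x * b) = (\<lambda>y. \<phi> x (b * y * a))))"


section \<open>Finitely generated left modules\<close>

record ('a, 'm) lmod =
  carr :: "'m set"
  act :: "'a \<Rightarrow> 'm \<Rightarrow> 'm"

text \<open>The carrier is an additive subgroup of the ambient type (closure under negation
  follows from the action of \<open>-1\<close>).\<close>

definition left_module :: "('a::ring_1, 'm::ab_group_add) lmod \<Rightarrow> bool" where
  "left_module M \<longleftrightarrow>
     0 \<in> carr M \<and> (\<forall>x\<in>carr M. \<forall>y\<in>carr M. x + y \<in> carr M) \<and>
     (\<forall>a. \<forall>x\<in>carr M. act M a x \<in> carr M) \<and>
     (\<forall>x\<in>carr M. act M 1 x = x) \<and>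
     (\<forall>a b. \<forall>x\<in>carr M. act M (a * b) x = act M a (act M b x)) \<and>
     (\<forall>a b. \<forall>x\<in>carr M. act M (a + b) x = act M a x + act M b x) \<and>
     (\<forall>a. \<forall>x\<in>carr M. \<forall>y\<in>carr M. act M a (x + y) = act M a x + act M a y)"

definition fg_module :: "('a::ring_1, 'm::ab_group_add) lmod \<Rightarrow> bool" where
  "fg_module M \<longleftrightarrow> left_module M \<and>
     (\<exists>G. finite G \<and> G \<subseteq> carr M \<and> (\<forall>x\<in>carr M. \<exists>r. x = (\<Sum>g\<in>G. act M (r g) g)))"

definition is_submodule :: "'m set \<Rightarrow> ('a::ring_1, 'm::ab_group_add) lmod \<Rightarrow> bool" where
  "is_submodule L M \<longleftrightarrow> L \<subseteq> carr M \<and> left_module (M\<lparr>carr := L\<rparr>)"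

text \<open>Homomorphisms are extended by \<open>0\<close> outside the carrier, so that equality of
  homomorphisms is equality of functions.\<close>

definition lhom ::
    "('a::ring_1, 'm::ab_group_add) lmod \<Rightarrow> ('a, 'n::ab_group_add) lmod \<Rightarrow> ('m \<Rightarrow> 'n) set" where
  "lhom M N = {f. (\<forall>x\<in>carr M. f x \<in> carr N) \<and>
     (\<forall>x\<in>carr M. \<forall>y\<in>carr M. f (x + y) = f x + f y) \<and>
     (\<forall>a. \<forall>x\<in>carr M. f (act M a x) = act N a (f x)) \<and>
     (\<forall>x. x \<notin> carr M \<longrightarrow> f x = 0)}"

definition lker :: "('a, 'm) lmod \<Rightarrow> ('m \<Rightarrow> 'n::zero) \<Rightarrow> 'm set" where
  "lker M f = {x \<in> carr M. f x = 0}"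

definition short_exact ::
    "('a::ring_1, 'l::ab_group_add) lmod \<Rightarrow> ('l \<Rightarrow> 'm) \<Rightarrow> ('a, 'm::ab_group_add) lmod
      \<Rightarrow> ('m \<Rightarrow> 'n) \<Rightarrow> ('a, 'n::ab_group_add) lmod \<Rightarrow> bool" where
  "short_exact L \<alpha> M \<beta> N \<longleftrightarrow>
     \<alpha> \<in> lhom L M \<and> \<beta> \<in> lhom M N \<and> inj_on \<alpha> (carr L) \<and> \<alpha> ` carr L = lker M \<beta> \<and>
     \<beta> ` carr M = carr N"

text \<open>
  Projectivity and injectivity are tested on finitely generated modules carried by subgroups
  of the type \<open>nat \<Rightarrow>\<^sub>0 'a\<close>.  When \<open>'a\<close> is a finite dimensional algebra this is no
  restriction: finitely generated modules are finite dimensional vector spaces, and each of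
  them is isomorphic to a module with such a carrier (the action being arbitrary).
\<close>

definition projective :: "('a::ring_1, 'm::ab_group_add) lmod \<Rightarrow> bool" where
  "projective P \<longleftrightarrow> fg_module P \<and>
     (\<forall>(X :: ('a, nat \<Rightarrow>\<^sub>0 'a) lmod) (Y :: ('a, nat \<Rightarrow>\<^sub>0 'a) lmod). \<forall>g\<in>lhom X Y. \<forall>f\<in>lhom P Y.
        fg_module X \<and> fg_module Y \<and> g ` carr X = carr Y \<longrightarrow>
        (\<exists>h\<in>lhom P X. \<forall>x\<in>carr P. g (h x) = f x))"

definition injective :: "('a::ring_1, 'm::ab_group_add) lmod \<Rightarrow> bool" where
  "injective Q \<longleftrightarrow> fg_module Q \<and>
     (\<forall>(X :: ('a, nat \<Rightarrow>\<^sub>0 'a) lmod) (Y :: ('a, nat \<Rightarrow>\<^sub>0 'a) lmod). \<forall>g\<in>lhom X Y. \<forall>f\<in>lhom X Q.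
        fg_module X \<and> fg_module Y \<and> inj_on g (carr X) \<longrightarrow>
        (\<exists>h\<in>lhom Y Q. \<forall>x\<in>carr X. h (g x) = f x))"

definition projective_cover ::
    "('a::ring_1, 'p::ab_group_add) lmod \<Rightarrow> ('p \<Rightarrow> 'm) \<Rightarrow> ('a, 'm::ab_group_add) lmod \<Rightarrow> bool" where
  "projective_cover P p M \<longleftrightarrow> projective P \<and> p \<in> lhom P M \<and> p ` carr P = carr M \<and>
     (\<forall>L. is_submodule L P \<and> p ` L = carr M \<longrightarrow> L = carr P)"

definition injective_hull ::
    "('a::ring_1, 'm::ab_group_add) lmod \<Rightarrow> ('m \<Rightarrow> 'q) \<Rightarrow> ('a, 'q::ab_group_add) lmod \<Rightarrow> bool" where
  "injective_hull M i Q \<longleftrightarrow> injective Q \<and> i \<in> lhom M Q \<and> inj_on i (carr M) \<and>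
     (\<forall>L. is_submodule L Q \<and> L \<inter> i ` carr M = {0} \<longrightarrow> L = {0})"

definition no_projective_summand :: "('a::ring_1, 'm::ab_group_add) lmod \<Rightarrow> bool" where
  "no_projective_summand M \<longleftrightarrow>
     (\<forall>L L'. is_submodule L M \<and> is_submodule L' M \<and> L \<inter> L' = {0} \<and>
        carr M = {x + y | x y. x \<in> L \<and> y \<in> L'} \<and> projective (M\<lparr>carr := L\<rparr>) \<longrightarrow> L = {0})"

definition trivial_module :: "('a \<Rightarrow> 'k::field) \<Rightarrow> ('a, 'k) lmod" where
  "trivial_module \<epsilon> = \<lparr>carr = UNIV, act = (\<lambda>a x. \<epsilon> a * x)\<rparr>"


section \<open>Stable homomorphisms and the Heller operator\<close>

definition hom_group ::
    "('a::ring_1, 'm::ab_group_add) lmod \<Rightarrow> ('a, 'n::ab_group_add) lmod \<Rightarrow> ('m \<Rightarrow> 'n) monoid" where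
  "hom_group M N = \<lparr>carrier = lhom M N, monoid.mult = (\<lambda>f g x. f x + g x), one = (\<lambda>x. 0)\<rparr>"

definition projective_maps ::
    "('a::ring_1, 'm::ab_group_add) lmod \<Rightarrow> ('a, 'n::ab_group_add) lmod \<Rightarrow> ('m \<Rightarrow> 'n) set" where
  "projective_maps M N =
     {v \<circ> u | u v. \<exists>P :: ('a, nat \<Rightarrow>\<^sub>0 'a) lmod. projective P \<and> u \<in> lhom M P \<and> v \<in> lhom P N}"

definition stable_hom ::
    "('a::ring_1, 'm::ab_group_add) lmod \<Rightarrow> ('a, 'n::ab_group_add) lmod \<Rightarrow> ('m \<Rightarrow> 'n) set monoid" where
  "stable_hom M N = hom_group M N Mod projective_maps M N"

definition stable_class ::
    "('a::ring_1, 'm::ab_group_add) lmod \<Rightarrow> ('a, 'n::ab_group_add) lmod \<Rightarrow> ('m \<Rightarrow> 'n)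
      \<Rightarrow> ('m \<Rightarrow> 'n) set" where
  "stable_class M N f = projective_maps M N #>\<^bsub>hom_group M N\<^esub> f"

text \<open>
  The modules \<open>\<Omega>\<^sup>n M\<close> are determined only up to isomorphism; a Heller system is a choice of
  all of them, together with the projective covers and injective hulls that link them by
  short exact sequences
  \<open>0 \<rightarrow> Om (n + 1) \<rightarrow> Cov n \<rightarrow> Om n \<rightarrow> 0\<close>.
  For \<open>n \<ge> 0\<close> the map \<open>Cov n \<rightarrow> Om n\<close> is a projective cover, so \<open>Om (n + 1) = \<Omega> (Om n)\<close>; for
  \<open>n < 0\<close> the map \<open>Om (n + 1) \<rightarrow> Cov n\<close> is an injective hull, so \<open>Om n = \<Omega>\<^sup>-\<^sup>1 (Om (n + 1))\<close>.
  \<open>Om 0\<close> is \<open>M\<close> with its projective summands removed, with inclusion \<open>core_in\<close> and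
  projection \<open>core_out\<close>.  (Starting the iteration at \<open>Om 0\<close> rather than at \<open>M\<close> makes no
  difference, since projective summands, which are also injective here, do not contribute to
  kernels of projective covers or cokernels of injective hulls.)
\<close>

record ('a, 'u, 'm) heller =
  Om :: "int \<Rightarrow> ('a, 'u) lmod"
  Cov :: "int \<Rightarrow> ('a, 'u) lmod"
  inc :: "int \<Rightarrow> 'u \<Rightarrow> 'u"
  prj :: "int \<Rightarrow> 'u \<Rightarrow> 'u"
  core_in :: "'u \<Rightarrow> 'm"
  core_out :: "'m \<Rightarrow> 'u"

definition heller_system ::
    "('a::ring_1, 'm::ab_group_add) lmod \<Rightarrow> ('a, 'u::ab_group_add, 'm) heller \<Rightarrow> bool" where
  "heller_system M H \<longleftrightarrow>
     (\<forall>n. fg_module (Om H n) \<and> fg_module (Cov H n) \<and>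
        short_exact (Om H (n + 1)) (inc H n) (Cov H n) (prj H n) (Om H n)) \<and>
     (\<forall>n\<ge>0. projective_cover (Cov H n) (prj H n) (Om H n)) \<and>
     (\<forall>n<0. injective_hull (Om H (n + 1)) (inc H n) (Cov H n)) \<and>
     core_in H \<in> lhom (Om H 0) M \<and> core_out H \<in> lhom M (Om H 0) \<and>
     (\<forall>x\<in>carr (Om H 0). core_out H (core_in H x) = x) \<and>
     projective (M\<lparr>carr := lker M (core_out H)\<rparr>) \<and>
     no_projective_summand (Om H 0)"

text \<open>
  \<open>heller_shift H a b f j g\<close> says that \<open>g : Om (a + j) \<rightarrow> Om (b + j)\<close> represents the value of
  the functor \<open>\<Omega>\<^sup>j\<close> (for any integer \<open>j\<close>) on the stable class of \<open>f : Om a \<rightarrow> Om b\<close>: the two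
  maps belong to a family of maps between the sequences of the Heller system.
\<close>

definition heller_ladder ::
    "('a::ring_1, 'u::ab_group_add, 'm) heller \<Rightarrow> int \<Rightarrow> int \<Rightarrow> ('u \<Rightarrow> 'u) \<Rightarrow> ('u \<Rightarrow> 'u) \<Rightarrow> bool" where
  "heller_ladder H a b f g \<longleftrightarrow>
     (\<exists>h\<in>lhom (Cov H a) (Cov H b).
        (\<forall>x\<in>carr (Cov H a). prj H b (h x) = f (prj H a x)) \<and>
        (\<forall>x\<in>carr (Om H (a + 1)). h (inc H a x) = inc H b (g x)))"

definition heller_shift ::
    "('a::ring_1, 'u::ab_group_add, 'm) heller \<Rightarrow> int \<Rightarrow> int \<Rightarrow> ('u \<Rightarrow> 'u) \<Rightarrow> int \<Rightarrow> ('u \<Rightarrow> 'u)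
      \<Rightarrow> bool" where
  "heller_shift H a b f j g \<longleftrightarrow>
     (\<exists>F. (\<forall>i. F i \<in> lhom (Om H (a + i)) (Om H (b + i)) \<and>
               heller_ladder H (a + i) (b + i) (F i) (F (i + 1))) \<and>
          F 0 = f \<and> F j = g)"


section \<open>Tate cohomology\<close>

text \<open>
  In this section \<open>H\<close> is a Heller system of the trivial module \<open>T\<close>.  The abelian groups
  \<open>tate_deg H N n\<close> and their direct sum \<open>tate_sum H N\<close> are HOL-Algebra groups, hence
  written multiplicatively.
\<close>

definition tate_deg ::
    "('a::ring_1, 'u::ab_group_add, 'k) heller \<Rightarrow> ('a, 'm::ab_group_add) lmod \<Rightarrow> int
      \<Rightarrow> ('u \<Rightarrow> 'm) set monoid" where
  "tate_deg H N n = stable_hom (Om H n) N"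

definition tate_sum ::
    "('a::ring_1, 'u::ab_group_add, 'k) heller \<Rightarrow> ('a, 'm::ab_group_add) lmod
      \<Rightarrow> (int \<Rightarrow> ('u \<Rightarrow> 'm) set) monoid" where
  "tate_sum H N = sum_group UNIV (tate_deg H N)"

text \<open>
  Yoneda product of a class \<open>Y\<close> of maps \<open>y : \<Omega>\<^sup>b k \<rightarrow> N\<close> with a class \<open>Z\<close> of maps
  \<open>z : \<Omega>\<^sup>a k \<rightarrow> k\<close>: the class of \<open>y \<circ> \<Omega>\<^sup>b z\<close>, where \<open>z\<close> is regarded as a map to \<open>Om 0\<close>.  The
  union is over representatives, all of which give the same stable class.
\<close>

definition tate_mul ::
    "('a::ring_1, 'u::ab_group_add, 'k) heller \<Rightarrow> ('a, 'm::ab_group_add) lmod \<Rightarrow> int \<Rightarrow> int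
      \<Rightarrow> ('u \<Rightarrow> 'm) set \<Rightarrow> ('u \<Rightarrow> 'k) set \<Rightarrow> ('u \<Rightarrow> 'm) set" where
  "tate_mul H N b a Y Z =
     \<Union>{stable_class (Om H (a + b)) N (y \<circ> g) | y z g.
         y \<in> Y \<and> z \<in> Z \<and> heller_shift H a 0 (core_out H \<circ> z) b g}"

definition tate_prod ::
    "('a::ring_1, 'u::ab_group_add, 'k) heller \<Rightarrow> ('a, 'm::ab_group_add) lmod
      \<Rightarrow> (int \<Rightarrow> ('u \<Rightarrow> 'm) set) \<Rightarrow> (int \<Rightarrow> ('u \<Rightarrow> 'k) set) \<Rightarrow> (int \<Rightarrow> ('u \<Rightarrow> 'm) set)" where
  "tate_prod H N x r = (\<lambda>n. finprod (tate_deg H N n)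
     (\<lambda>b. tate_mul H N b (n - b) (x b) (r (n - b))) {b. x b \<noteq> \<one>\<^bsub>tate_deg H N b\<^esub>})"

text \<open>The Tate cohomology ring as an algebra over the ground field.\<close>

definition tate_ring ::
    "('a::ring_1, 'k::field) lmod \<Rightarrow> ('a, 'u::ab_group_add, 'k) heller
      \<Rightarrow> ('k, int \<Rightarrow> ('u \<Rightarrow> 'k) set) module" where
  "tate_ring T H =
     \<lparr>carrier = carrier (tate_sum H T),
      monoid.mult = tate_prod H T,
      one = (\<lambda>n. if n = 0 then stable_class (Om H 0) T (core_in H) else \<one>\<^bsub>tate_deg H T n\<^esub>),
      zero = \<one>\<^bsub>tate_sum H T\<^esub>,
      add = monoid.mult (tate_sum H T),
      smult = (\<lambda>c x n. \<Union>f\<in>x n. stable_class (Om H n) T (\<lambda>v. c * f v))\<rparr>"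

text \<open>
  The Tate cohomology of \<open>N\<close> with the action of the Tate cohomology ring by Yoneda product,
  i.e. by composition on the source side.  With the order of composition used here this is
  the action of a right module; the ring being graded-commutative, it is up to signs also
  the left action.  The ring multiplication and unit of the record are not used.
\<close>

definition tate_module ::
    "('a::ring_1, 'u::ab_group_add, 'k) heller \<Rightarrow> ('a, 'm::ab_group_add) lmod
      \<Rightarrow> (int \<Rightarrow> ('u \<Rightarrow> 'k) set, int \<Rightarrow> ('u \<Rightarrow> 'm) set) module" where
  "tate_module H N =
     \<lparr>carrier = carrier (tate_sum H N),
      monoid.mult = undefined, one = undefined,
      zero = \<one>\<^bsub>tate_sum H N\<^esub>,
      add = monoid.mult (tate_sum H N),
      smult = (\<lambda>r x. tate_prod H N x r)\<rparr>"

definition tate_homogeneous ::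
    "('a::ring_1, 'u::ab_group_add, 'k) heller \<Rightarrow> ('a, 'm::ab_group_add) lmod \<Rightarrow> int
      \<Rightarrow> ('u \<Rightarrow> 'm) set \<Rightarrow> (int \<Rightarrow> ('u \<Rightarrow> 'm) set)" where
  "tate_homogeneous H N d X = (\<lambda>n. if n = d then X else \<one>\<^bsub>tate_deg H N n\<^esub>)"

text \<open>\<open>V\<close> is spanned by finitely many of its elements, with coefficients from \<open>R\<close>.  With \<open>R\<close> a
  ring and \<open>V\<close> a submodule this says that \<open>V\<close> is finitely generated, and if \<open>R\<close> is a field
  that \<open>V\<close> is finite dimensional.\<close>

definition finitely_spanned :: "'r set \<Rightarrow> ('r, 'x) module \<Rightarrow> 'x set \<Rightarrow> bool" where
  "finitely_spanned R X V \<longleftrightarrow>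
     (\<exists>G. finite G \<and> G \<subseteq> V \<and>
        (\<forall>v\<in>V. \<exists>r. (\<forall>g\<in>G. r g \<in> R) \<and> v = (\<Oplus>\<^bsub>X\<^esub>g\<in>G. r g \<odot>\<^bsub>X\<^esub> g)))"

text \<open>
  \<open>extension_class H m n \<alpha> M \<beta> e\<close>: the map \<open>e : \<Omega>\<^sup>n\<^sup>+\<^sup>1 k \<rightarrow> \<Omega>\<^sup>m k\<close> represents the class of the
  extension \<open>0 \<rightarrow> \<Omega>\<^sup>m k \<rightarrow> M \<rightarrow> \<Omega>\<^sup>n k \<rightarrow> 0\<close> in the first Tate extension group, i.e. it is induced by a map
  from the sequence \<open>0 \<rightarrow> Om (n + 1) \<rightarrow> Cov n \<rightarrow> Om n \<rightarrow> 0\<close> over the identity of \<open>Om n\<close>.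
\<close>

definition extension_class ::
    "('a::ring_1, 'u::ab_group_add, 'k) heller \<Rightarrow> int \<Rightarrow> int \<Rightarrow> ('u \<Rightarrow> 'm)
      \<Rightarrow> ('a, 'm::ab_group_add) lmod \<Rightarrow> ('m \<Rightarrow> 'u) \<Rightarrow> ('u \<Rightarrow> 'u) \<Rightarrow> bool" where
  "extension_class H m n \<alpha> M \<beta> e \<longleftrightarrow>
     e \<in> lhom (Om H (n + 1)) (Om H m) \<and>
     (\<exists>h\<in>lhom (Cov H n) M.
        (\<forall>x\<in>carr (Cov H n). \<beta> (h x) = prj H n x) \<and>
        (\<forall>x\<in>carr (Om H (n + 1)). h (inc H n x) = \<alpha> (e x)))"

text \<open>
  The class \<open>\<xi>\<close> in degree \<open>n + 1 - m\<close> of the Tate cohomology ring corresponds to the extension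
  under the isomorphism of the stable homomorphisms \<open>\<Omega>\<^sup>n\<^sup>+\<^sup>1 k \<rightarrow> \<Omega>\<^sup>m k\<close> with the stable
  homomorphisms \<open>\<Omega>\<^sup>n\<^sup>+\<^sup>1\<^sup>-\<^sup>m k \<rightarrow> k\<close> given by the functor \<open>\<Omega>\<^sup>-\<^sup>m\<close>.
\<close>

definition represents_class ::
    "('a::ring_1, 'k::field) lmod \<Rightarrow> ('a, 'u::ab_group_add, 'k) heller \<Rightarrow> int \<Rightarrow> int \<Rightarrow> ('u \<Rightarrow> 'm)
      \<Rightarrow> ('a, 'm::ab_group_add) lmod \<Rightarrow> ('m \<Rightarrow> 'u) \<Rightarrow> ('u \<Rightarrow> 'k) set \<Rightarrow> bool" where
  "represents_class T H m n \<alpha> M \<beta> \<xi> \<longleftrightarrow>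
     \<xi> \<in> carrier (tate_deg H T (n + 1 - m)) \<and>
     (\<exists>z\<in>\<xi>. \<exists>e. extension_class H m n \<alpha> M \<beta> e \<and>
        heller_shift H (n + 1 - m) 0 (core_out H \<circ> z) m e)"


section \<open>The usual cohomology ring\<close>

record ('a, 'q, 'm) resolution =
  res :: "nat \<Rightarrow> ('a, 'q) lmod"
  bd :: "nat \<Rightarrow> 'q \<Rightarrow> 'q"
  aug :: "'q \<Rightarrow> 'm"

definition projective_resolution ::
    "('a::ring_1, 'm::ab_group_add) lmod \<Rightarrow> ('a, 'q::ab_group_add, 'm) resolution \<Rightarrow> bool" where
  "projective_resolution M Q \<longleftrightarrow>
     (\<forall>n. projective (res Q n) \<and> bd Q n \<in> lhom (res Q (Suc n)) (res Q n)) \<and>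
     aug Q \<in> lhom (res Q 0) M \<and> aug Q ` carr (res Q 0) = carr M \<and>
     bd Q 0 ` carr (res Q 1) = lker (res Q 0) (aug Q) \<and>
     (\<forall>n. bd Q (Suc n) ` carr (res Q (Suc (Suc n))) = lker (res Q (Suc n)) (bd Q n))"

text \<open>Here \<open>Q\<close> is a projective resolution of the trivial module \<open>T\<close>, and
  \<open>ext_deg T Q n\<close> is the group \<open>Ext\<^sup>n (T, T)\<close>, the quotient of cocycles by coboundaries.\<close>

definition cocycles ::
    "('a::ring_1, 'k::field) lmod \<Rightarrow> ('a, 'q::ab_group_add, 'k) resolution \<Rightarrow> nat
      \<Rightarrow> ('q \<Rightarrow> 'k) set" where
  "cocycles T Q n = {f \<in> lhom (res Q n) T. \<forall>x\<in>carr (res Q (Suc n)). f (bd Q n x) = 0}"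

definition coboundaries ::
    "('a::ring_1, 'k::field) lmod \<Rightarrow> ('a, 'q::ab_group_add, 'k) resolution \<Rightarrow> nat
      \<Rightarrow> ('q \<Rightarrow> 'k) set" where
  "coboundaries T Q n =
     (case n of 0 \<Rightarrow> {\<lambda>x. 0} | Suc m \<Rightarrow> {h \<circ> bd Q m | h. h \<in> lhom (res Q m) T})"

definition ext_deg ::
    "('a::ring_1, 'k::field) lmod \<Rightarrow> ('a, 'q::ab_group_add, 'k) resolution \<Rightarrow> nat
      \<Rightarrow> ('q \<Rightarrow> 'k) set monoid" where
  "ext_deg T Q n = (hom_group (res Q n) T)\<lparr>carrier := cocycles T Q n\<rparr> Mod coboundaries T Q n"

definition ext_class ::
    "('a::ring_1, 'k::field) lmod \<Rightarrow> ('a, 'q::ab_group_add, 'k) resolution \<Rightarrow> nat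
      \<Rightarrow> ('q \<Rightarrow> 'k) \<Rightarrow> ('q \<Rightarrow> 'k) set" where
  "ext_class T Q n f = coboundaries T Q n #>\<^bsub>hom_group (res Q n) T\<^esub> f"

text \<open>\<open>F\<close> is a chain map of degree \<open>-a\<close> that lifts the cocycle \<open>f : res a \<rightarrow> T\<close>.\<close>

definition cocycle_lift ::
    "('a::ring_1, 'q::ab_group_add, 'k::field) resolution \<Rightarrow> nat \<Rightarrow> ('q \<Rightarrow> 'k)
      \<Rightarrow> (nat \<Rightarrow> 'q \<Rightarrow> 'q) \<Rightarrow> bool" where
  "cocycle_lift Q a f F \<longleftrightarrow>
     (\<forall>i. F i \<in> lhom (res Q (a + i)) (res Q i)) \<and>
     (\<forall>x\<in>carr (res Q a). aug Q (F 0 x) = f x) \<and>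
     (\<forall>i. \<forall>x\<in>carr (res Q (Suc (a + i))). bd Q i (F (Suc i) x) = F i (bd Q (a + i) x))"

text \<open>Yoneda product of classes of degrees \<open>b\<close> and \<open>a\<close>; as for Tate cohomology, the
  union is over representatives of one class.\<close>

definition ext_mul ::
    "('a::ring_1, 'k::field) lmod \<Rightarrow> ('a, 'q::ab_group_add, 'k) resolution \<Rightarrow> nat \<Rightarrow> nat
      \<Rightarrow> ('q \<Rightarrow> 'k) set \<Rightarrow> ('q \<Rightarrow> 'k) set \<Rightarrow> ('q \<Rightarrow> 'k) set" where
  "ext_mul T Q b a Y Z =
     \<Union>{ext_class T Q (a + b) (y \<circ> F b) | y z F. y \<in> Y \<and> z \<in> Z \<and> cocycle_lift Q a z F}"

definition cohomology_ring ::
    "('a::ring_1, 'k::field) lmod \<Rightarrow> ('a, 'q::ab_group_add, 'k) resolution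
      \<Rightarrow> (nat \<Rightarrow> ('q \<Rightarrow> 'k) set) ring" where
  "cohomology_ring T Q =
     \<lparr>carrier = carrier (sum_group UNIV (ext_deg T Q)),
      monoid.mult = (\<lambda>x y n. finprod (ext_deg T Q n)
        (\<lambda>b. ext_mul T Q b (n - b) (x b) (y (n - b))) {..n}),
      one = (\<lambda>n. if n = 0 then ext_class T Q 0 (aug Q) else \<one>\<^bsub>ext_deg T Q n\<^esub>),
      zero = \<one>\<^bsub>sum_group UNIV (ext_deg T Q)\<^esub>,
      add = monoid.mult (sum_group UNIV (ext_deg T Q))\<rparr>"

end

theory Submission
  imports Defs "HOL-Library.Nat_Bijection"
begin

text \<open>
  Write \<open>hom i j\<close> for the maps \<open>\<Omega>\<^sup>i k \<rightarrow> \<Omega>\<^sup>j k\<close>, taken modulo maps that factor through projectives; the shift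
  \<open>Sh j\<close> identifies \<open>hom a b\<close> with \<open>hom (a + j) (b + j)\<close>.  The extension gives a long exact sequence
  \<open>hom j m \<rightarrow> Hom (\<Omega>\<^sup>j k) M \<rightarrow> hom j n \<rightarrow> hom (j + 1) m\<close> whose last map is multiplication by the extension
  class (\<open>exact_middle\<close>, \<open>connecting_null\<close>, \<open>connecting_lift\<close>).  Hence the Tate cohomology of the middle
  term is generated by the class of the inclusion together with lifts of generators of the kernel \<open>ann\<close>
  of multiplication by \<open>\<xi>\<close> (\<open>decomposition\<close>), and the theorem reduces to the finite generation of this
  kernel as a right ideal of the Tate cohomology ring.  As multiplication by \<open>\<xi>\<close> has finite dimensional
  image, the kernel is everything outside finitely many degrees (\<open>finite_image_bounded\<close>).

  It remains to see that a right ideal containing all sufficiently large positive and negative degrees is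
  finitely generated (\<open>cofinite_right_ideal_finitely_generated\<close>).  In positive degrees Tate cohomology is
  the usual cohomology (\<open>bar_surj\<close>, \<open>bar_mult\<close>), so the Noetherian hypothesis gives finitely many
  generators \<open>Z\<close> of the part of large positive degree (\<open>gideal_finitely_generated\<close>).  In the middle there are
  finitely many degrees, each finite dimensional (\<open>lhom_finite_dimensional\<close>).  The negative degrees come
  from duality: if no nonzero class of degree \<open>j\<close> is annihilated by \<open>Z\<close>, then \<open>Z\<close> generates degree
  \<open>- 1 - j\<close> (\<open>negative_degrees\<close>).  And \<open>Z\<close> annihilates nothing in large degrees
  (\<open>annihilator_bounded\<close>): the annihilator of \<open>Z\<close> in positive degrees is again finitely generated, and a
  class of large degree in it is a sum of products \<open>b r\<close> with \<open>b\<close> one of its generators and \<open>r\<close> of large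
  degree, hence with \<open>r\<close> in the ideal generated by \<open>Z\<close>, so that \<open>b r = 0\<close>.

  Passing between left and right ideals requires the graded commutativity of the cohomology ring
  (\<open>graded_commutative\<close>).  It is obtained from invariant bilinear maps \<open>X \<times> Y \<rightarrow> Z\<close>, that is, module maps
  on the tensor product: a pairing can be shifted in either variable, and the two shifts anticommute
  (\<open>bladder_anticommute\<close>).

  Two features of a symmetric Hopf algebra are used throughout.  The symmetrizing form identifies
  functionals on a module with homomorphisms to the regular module, so that projective and injective modules
  are both the modules with a dual basis.  And the form produces a two-sided integral, which detects the
  maps to the trivial module that factor through projectives.
\<close>

section \<open>Homomorphisms and null maps\<close>

definition regular :: "('a::ring_1, 'a) lmod" where
 "regular = \<lparr>carr = UNIV, act = (*)\<rparr>"

lemma regular_simps [simp]: "carr regular = UNIV" "act regular a x = a * x"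
 by (simp_all add: regular_def)

lemma left_module_regular [simp]: "left_module regular"
 by (simp add: left_module_def algebra_simps)

lemma lm_zero: "left_module M ==> 0 \<in> carr M"
 and lm_add: "left_module M ==> x \<in> carr M ==> y \<in> carr M ==> x + y \<in> carr M"
 and lm_act: "left_module M ==> x \<in> carr M ==> act M a x \<in> carr M"
 and lm_one: "left_module M ==> x \<in> carr M ==> act M 1 x = x"
 and lm_mult: "left_module M ==> x \<in> carr M ==> act M (a * b) x = act M a (act M b x)"
 and lm_act_add_left: "left_module M ==> x \<in> carr M ==> act M (a + b) x = act M a x + act M b x"
 and lm_act_add: "left_module M ==> x \<in> carr M ==> y \<in> carr M
    ==> act M a (x + y) = act M a x + act M a y"
 by (simp_all add: left_module_def)

lemma lm_act_zero: "left_module M ==> act M a 0 = 0"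
 using lm_act_add[of M 0 0 a] by (simp add: lm_zero)

lemma lm_zero_act: "left_module M ==> x \<in> carr M ==> act M 0 x = 0"
 using lm_act_add_left[of M x 0 0] by simp

lemma lm_minus_act: assumes "left_module M" "x \<in> carr M" shows "act M (- a) x = - act M a x"
 using lm_act_add_left[of M x a "- a"] assms by (simp add: lm_zero_act minus_unique)

lemma lm_minus: "left_module M ==> x \<in> carr M ==> - x \<in> carr M"
 using lm_act[of M x "- 1"] by (simp add: lm_minus_act lm_one)

lemma lm_act_minus: assumes "left_module M" "x \<in> carr M" shows "act M a (- x) = - act M a x"
 using lm_act_add[of M x "- x" a] assms by (simp add: lm_act_zero lm_minus minus_unique)

lemma lm_diff: "left_module M ==> x \<in> carr M ==> y \<in> carr M ==> x - y \<in> carr M"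
 using lm_add[of M x "- y"] by (simp add: lm_minus)

lemma lm_act_diff: "left_module M ==> x \<in> carr M ==> y \<in> carr M
  ==> act M a (x - y) = act M a x - act M a y"
 using lm_act_add[of M x "- y" a] by (simp add: lm_minus lm_act_minus)

lemma lm_diff_act: "left_module M ==> x \<in> carr M ==> act M (a - b) x = act M a x - act M b x"
 using lm_act_add_left[of M x a "- b"] by (simp add: lm_minus_act)

lemma lm_sum_list: "left_module M ==> (\<And>x. x \<in> set xs ==> f x \<in> carr M) ==> (\<Sum>x\<leftarrow>xs. f x) \<in> carr M"
 by (induction xs) (auto simp: lm_zero lm_add)

lemma lm_act_sum_list: "left_module M ==> (\<And>x. x \<in> set xs ==> f x \<in> carr M)
  ==> act M a (\<Sum>x\<leftarrow>xs. f x) = (\<Sum>x\<leftarrow>xs. act M a (f x))"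
 by (induction xs) (auto simp: lm_act_zero lm_act_add lm_sum_list)

lemma lm_sum_act: "left_module M ==> x \<in> carr M
  ==> act M (\<Sum>y\<leftarrow>xs. f y) x = (\<Sum>y\<leftarrow>xs. act M (f y) x)"
 by (induction xs) (auto simp: lm_zero_act lm_act_add_left)

lemmas lm_rules = lm_zero lm_add lm_act lm_minus lm_diff lm_sum_list

lemma lhom_in: "f \<in> lhom X Y ==> x \<in> carr X ==> f x \<in> carr Y"
 and lhom_add: "f \<in> lhom X Y ==> x \<in> carr X ==> y \<in> carr X ==> f (x + y) = f x + f y"
 and lhom_act: "f \<in> lhom X Y ==> x \<in> carr X ==> f (act X a x) = act Y a (f x)"
 and lhom_out: "f \<in> lhom X Y ==> x \<notin> carr X ==> f x = 0"
 by (simp_all add: lhom_def)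

lemma lhom_zero: "f \<in> lhom X Y ==> left_module X ==> f 0 = 0"
 using lhom_add[of f X Y 0 0] by (simp add: lm_zero)

lemma lhom_minus: assumes "f \<in> lhom X Y" "left_module X" "x \<in> carr X" shows "f (- x) = - f x"
 using lhom_add[of f X Y x "- x"] assms by (simp add: lhom_zero lm_minus minus_unique)

lemma lhom_diff: "f \<in> lhom X Y ==> left_module X ==> x \<in> carr X ==> y \<in> carr X
  ==> f (x - y) = f x - f y"
 using lhom_add[of f X Y x "- y"] by (simp add: lhom_minus lm_minus)

lemma lhom_sum_list: "f \<in> lhom X Y ==> left_module X ==> (\<And>x. x \<in> set xs ==> h x \<in> carr X)
  ==> f (\<Sum>x\<leftarrow>xs. h x) = (\<Sum>x\<leftarrow>xs. f (h x))"
 by (induction xs) (auto simp: lhom_zero lhom_add lm_sum_list)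

lemma lhom_eqI: "f \<in> lhom X Y ==> g \<in> lhom X Z ==> (\<And>x. x \<in> carr X ==> f x = g x) ==> f = g"
 by (rule ext, rule case_split[of "_ \<in> carr X"]) (auto simp: lhom_out)

definition restr :: "('a, 'm) lmod \<Rightarrow> ('m \<Rightarrow> 'n::zero) \<Rightarrow> 'm \<Rightarrow> 'n" where
 "restr X f x = (if x \<in> carr X then f x else 0)"

lemma restr_apply [simp]: "x \<in> carr X ==> restr X f x = f x"
 by (simp add: restr_def)

lemma restr_lhomI:
 assumes "left_module X" "\<And>x. x \<in> carr X ==> f x \<in> carr Y"
  "\<And>x y. x \<in> carr X ==> y \<in> carr X ==> f (x + y) = f x + f y"
  "\<And>a x. x \<in> carr X ==> f (act X a x) = act Y a (f x)"
 shows "restr X f \<in> lhom X Y"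
 using assms by (simp add: lhom_def restr_def lm_rules)

lemma restr_id: "left_module X ==> restr X (\<lambda>x. x) \<in> lhom X X"
 by (rule restr_lhomI) auto

lemma lhom_comp: "f \<in> lhom X Y ==> g \<in> lhom Y Z ==> left_module Y ==> g \<circ> f \<in> lhom X Z"
 using lhom_zero[of g Y Z] by (simp add: lhom_def)

lemma lhom_0: "left_module Y ==> (\<lambda>x. 0) \<in> lhom X Y"
 by (simp add: lhom_def lm_zero lm_act_zero)

lemma lhom_plus: "f \<in> lhom X Y ==> g \<in> lhom X Y ==> left_module Y ==> (\<lambda>x. f x + g x) \<in> lhom X Y"
 by (simp add: lhom_def lm_add lm_act_add algebra_simps)

lemma lhom_uminus: "f \<in> lhom X Y ==> left_module Y ==> (\<lambda>x. - f x) \<in> lhom X Y"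
 by (simp add: lhom_def lm_minus lm_act_minus)

lemma lhom_minus_fun: "f \<in> lhom X Y ==> g \<in> lhom X Y ==> left_module Y ==> (\<lambda>x. f x - g x) \<in> lhom X Y"
 by (simp add: lhom_def lm_diff lm_act_diff)

lemma lhom_rank_one: "g \<in> lhom X regular ==> w \<in> carr Y ==> left_module X ==> left_module Y
  ==> restr X (\<lambda>x. act Y (g x) w) \<in> lhom X Y"
 by (rule restr_lhomI) (auto simp: lm_rules lhom_add lhom_act lm_act_add_left lm_mult)

lemma lhom_lift_inj:
 assumes "left_module X" "left_module Y" "i \<in> lhom Y Z" "inj_on i (carr Y)" "f \<in> lhom X Z"
  "\<And>x. x \<in> carr X ==> f x \<in> i ` carr Y"
 obtains g where "g \<in> lhom X Y" "\<And>x. x \<in> carr X ==> i (g x) = f x"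
proof -
 let ?g = "\<lambda>x. inv_into (carr Y) i (f x)"
 have in_carr: "?g x \<in> carr Y" and ig: "i (?g x) = f x" if "x \<in> carr X" for x
  using assms(6)[OF that] by (simp_all add: inv_into_into f_inv_into_f)
 have inj: "y = y'" if "i y = i y'" "y \<in> carr Y" "y' \<in> carr Y" for y y'
  using that assms(4) by (simp add: inj_on_def)
 have "restr X ?g \<in> lhom X Y"
 proof (rule restr_lhomI)
  show "?g (x + y) = ?g x + ?g y" if "x \<in> carr X" "y \<in> carr X" for x y
  proof (rule inj)
   have xy: "x + y \<in> carr X" using that assms(1) by (simp add: lm_add)
   show "i (?g (x + y)) = i (?g x + ?g y)"
    unfolding ig[OF xy] lhom_add[OF assms(3) in_carr[OF that(1)] in_carr[OF that(2)]]
    using that by (simp add: ig lhom_add[OF assms(5)])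
   show "?g (x + y) \<in> carr Y" by (rule in_carr[OF xy])
  qed (use that assms(2) in_carr in \<open>simp add: lm_add\<close>)
  show "?g (act X a x) = act Y a (?g x)" if "x \<in> carr X" for x a
  proof (rule inj)
   have xy: "act X a x \<in> carr X" using that assms(1) by (simp add: lm_act)
   show "i (?g (act X a x)) = i (act Y a (?g x))"
    unfolding ig[OF xy] lhom_act[OF assms(3) in_carr[OF that]]
    using that by (simp add: ig lhom_act[OF assms(5)])
   show "?g (act X a x) \<in> carr Y" by (rule in_carr[OF xy])
  qed (use that assms(2) in_carr in \<open>simp add: lm_act\<close>)
 qed (use assms in_carr in auto)
 thus thesis
  by (rule that) (simp add: ig)
qed

lemma lhom_factor_surj:
 assumes "left_module X" "left_module Y" "p \<in> lhom X Y" "p ` carr X = carr Y" "f \<in> lhom X Z"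
  "\<And>x. x \<in> carr X ==> p x = 0 ==> f x = 0"
 obtains g where "g \<in> lhom Y Z" "\<And>x. x \<in> carr X ==> g (p x) = f x"
proof -
 let ?s = "inv_into (carr X) p"
 let ?g = "\<lambda>y. f (?s y)"
 have s: "?s y \<in> carr X" "p (?s y) = y" if "y \<in> carr Y" for y
  using that assms(4) by (auto simp: inv_into_into f_inv_into_f)
 have eq: "f x = f x'" if "p x = p x'" "x \<in> carr X" "x' \<in> carr X" for x x'
 proof -
  have "p (x - x') = 0"
   using that assms by (simp add: lhom_diff)
  with assms(6)[of "x - x'"] that assms show ?thesis
   by (simp add: lhom_diff lm_diff)
 qed
 have "restr Y ?g \<in> lhom Y Z"
 proof (rule restr_lhomI)
  show "?g (x + y) = ?g x + ?g y" if "x \<in> carr Y" "y \<in> carr Y" for x y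
   using that assms s
   by (subst lhom_add[OF assms(5), symmetric])
     (auto intro!: eq simp: lm_rules lhom_add[of p])
  show "?g (act Y a x) = act Z a (?g x)" if "x \<in> carr Y" for x a
   using that assms s
   by (subst lhom_act[OF assms(5), symmetric])
     (auto intro!: eq simp: lm_rules lhom_act[of p])
 qed (use assms s in \<open>auto simp: lhom_in\<close>)
 thus thesis
 proof (rule that)
  show "restr Y ?g (p x) = f x" if "x \<in> carr X" for x
   using that assms s[of "p x"] by (auto simp: lhom_in intro!: eq)
 qed
qed

text \<open>A finite sum of maps \<open>x \<mapsto> g(x) w\<close> through the regular module: these are the maps that factor
 through a finitely generated free module, described without mentioning that module.\<close>

definition null_map ::
  "('a::ring_1, 'm::ab_group_add) lmod \<Rightarrow> ('a, 'n::ab_group_add) lmod \<Rightarrow> ('m \<Rightarrow> 'n) \<Rightarrow> bool" where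
 "null_map X Y f \<longleftrightarrow> f \<in> lhom X Y \<and>
   (\<exists>L. set L \<subseteq> lhom X regular \<times> carr Y \<and>
     (\<forall>x\<in>carr X. f x = (\<Sum>p\<leftarrow>L. act Y (fst p x) (snd p))))"

text \<open>The identity is a null map; this is the dual basis characterization of finitely generated projective modules.\<close>

definition dual_basis :: "('a::ring_1, 'm::ab_group_add) lmod \<Rightarrow> bool" where
 "dual_basis P \<longleftrightarrow> left_module P \<and>
   (\<exists>L. set L \<subseteq> lhom P regular \<times> carr P \<and>
     (\<forall>x\<in>carr P. x = (\<Sum>p\<leftarrow>L. act P (fst p x) (snd p))))"

lemma null_lhom: "null_map X Y f ==> f \<in> lhom X Y"
 by (simp add: null_map_def)

lemma null_zero: "left_module Y ==> null_map X Y (\<lambda>x. 0)"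
 unfolding null_map_def by (auto simp: lhom_0 intro!: exI[of _ "[]"])

lemma null_plus: assumes "null_map X Y f" "null_map X Y g" "left_module Y"
 shows "null_map X Y (\<lambda>x. f x + g x)"
proof -
 from assms(1,2) obtain L L' where "set L \<subseteq> lhom X regular \<times> carr Y"
  "\<forall>x\<in>carr X. f x = (\<Sum>p\<leftarrow>L. act Y (fst p x) (snd p))" "set L' \<subseteq> lhom X regular \<times> carr Y"
  "\<forall>x\<in>carr X. g x = (\<Sum>p\<leftarrow>L'. act Y (fst p x) (snd p))"
  unfolding null_map_def by blast
 thus ?thesis using assms unfolding null_map_def
  by (intro conjI exI[of _ "L @ L'"]) (auto intro: lhom_plus)
qed

lemma null_comp_left: assumes "null_map X Y f" "h \<in> lhom Y Z" "left_module Y"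
 shows "null_map X Z (h \<circ> f)"
proof -
 from assms(1) obtain L where L: "set L \<subseteq> lhom X regular \<times> carr Y"
  "\<forall>x\<in>carr X. f x = (\<Sum>p\<leftarrow>L. act Y (fst p x) (snd p))"
  unfolding null_map_def by blast
 have "h (f x) = (\<Sum>p\<leftarrow>map (\<lambda>p. (fst p, h (snd p))) L. act Z (fst p x) (snd p))" if "x \<in> carr X" for x
 proof -
  have "h (f x) = (\<Sum>p\<leftarrow>L. h (act Y (fst p x) (snd p)))"
   using L that assms by (simp, intro lhom_sum_list[OF assms(2)]) (auto intro!: lm_act)
  also have "\<dots> = (\<Sum>p\<leftarrow>L. act Z (fst p x) (h (snd p)))"
   using L(1) by (intro arg_cong[of _ _ sum_list] map_cong) (auto simp: lhom_act[OF assms(2)])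
  finally show ?thesis by (simp add: o_def)
 qed
 thus ?thesis using assms L(1) null_lhom[OF assms(1)] unfolding null_map_def
  by (intro conjI exI[of _ "map (\<lambda>p. (fst p, h (snd p))) L"]) (auto intro: lhom_comp lhom_in)
qed

lemma null_comp_right: assumes "null_map X Y f" "h \<in> lhom W X" "left_module X"
 shows "null_map W Y (f \<circ> h)"
proof -
 from assms(1) obtain L where L: "set L \<subseteq> lhom X regular \<times> carr Y"
  "\<forall>x\<in>carr X. f x = (\<Sum>p\<leftarrow>L. act Y (fst p x) (snd p))"
  unfolding null_map_def by blast
 have "f (h x) = (\<Sum>p\<leftarrow>map (\<lambda>p. (fst p \<circ> h, snd p)) L. act Y (fst p x) (snd p))" if "x \<in> carr W" for x
  using L(2) lhom_in[OF assms(2) that] by (simp add: o_def)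
 thus ?thesis using assms L(1) null_lhom[OF assms(1)] unfolding null_map_def
  by (intro conjI exI[of _ "map (\<lambda>p. (fst p \<circ> h, snd p)) L"])
    (auto intro!: lhom_comp[OF assms(2) _ assms(3)])
qed

lemma null_uminus: assumes "null_map X Y f" "left_module Y" shows "null_map X Y (\<lambda>x. - f x)"
proof -
 have "restr Y (\<lambda>x. - x) \<in> lhom Y Y"
  by (rule restr_lhomI) (auto simp: assms lm_minus lm_act_minus)
 from null_comp_left[OF assms(1) this assms(2)] have "null_map X Y (restr Y (\<lambda>x. - x) \<circ> f)" .
 moreover have "restr Y (\<lambda>x. - x) \<circ> f = (\<lambda>x. - f x)"
  using null_lhom[OF assms(1)] assms(2) by (auto simp: fun_eq_iff restr_def lhom_def)
 ultimately show ?thesis by simp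
qed

lemma null_minus: "null_map X Y f ==> null_map X Y g ==> left_module Y ==> null_map X Y (\<lambda>x. f x - g x)"
 using null_plus[of X Y f "\<lambda>x. - g x"] null_uminus[of X Y g] by simp

lemma dual_basis_lm: "dual_basis P ==> left_module P"
 by (simp add: dual_basis_def)

lemma dual_basis_null_id: "dual_basis P ==> null_map P P (restr P (\<lambda>x. x))"
 unfolding dual_basis_def null_map_def by (auto simp: restr_id)

lemma null_through: assumes "dual_basis P" "u \<in> lhom X P" "v \<in> lhom P Y"
 shows "null_map X Y (v \<circ> u)"
proof -
 have "null_map X P (restr P (\<lambda>x. x) \<circ> u)"
  using null_comp_right[OF dual_basis_null_id[OF assms(1)] assms(2)] assms by (simp add: dual_basis_lm)
 moreover have "restr P (\<lambda>x. x) \<circ> u = u"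
  using assms by (auto simp: fun_eq_iff restr_def lhom_def dual_basis_lm lm_zero)
 ultimately show ?thesis using null_comp_left[OF _ assms(3)] assms by (simp add: dual_basis_lm)
qed

lemma null_mapI:
 assumes "set L \<subseteq> lhom X regular \<times> carr Y" "left_module X" "left_module Y"
 shows "null_map X Y (restr X (\<lambda>x. \<Sum>p\<leftarrow>L. act Y (fst p x) (snd p)))"
proof -
 from assms(1) have "restr X (\<lambda>x. \<Sum>p\<leftarrow>L. act Y (fst p x) (snd p)) \<in> lhom X Y"
 proof (induction L)
  case Nil
  thus ?case using lhom_0[OF assms(3), of X] by (simp add: restr_def)
 next
  case (Cons p L)
  hence "(\<lambda>x. restr X (\<lambda>x. act Y (fst p x) (snd p)) x + restr X (\<lambda>x. \<Sum>p\<leftarrow>L. act Y (fst p x) (snd p)) x)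
    \<in> lhom X Y"
   using assms by (intro lhom_plus lhom_rank_one Cons.IH) auto
  also have "(\<lambda>x. restr X (\<lambda>x. act Y (fst p x) (snd p)) x + restr X (\<lambda>x. \<Sum>p\<leftarrow>L. act Y (fst p x) (snd p)) x)
    = restr X (\<lambda>x. \<Sum>p\<leftarrow>p # L. act Y (fst p x) (snd p))"
   by (auto simp: restr_def fun_eq_iff)
  finally show ?case .
 qed
 thus ?thesis unfolding null_map_def using assms(1) by (intro conjI exI[of _ L]) auto
qed

text \<open>Null maps lift through epimorphisms: choose preimages of the vectors of the rank one summands.\<close>

lemma null_lift_surj:
 assumes f: "null_map X Y f" and g: "g \<in> lhom Z Y" "\<And>y. y \<in> carr Y ==> y \<in> g ` carr Z"
  and lm: "left_module X" "left_module Z"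
 obtains h where "null_map X Z h" "\<And>x. x \<in> carr X ==> g (h x) = f x"
proof -
 from f obtain L where L: "set L \<subseteq> lhom X regular \<times> carr Y"
  "\<forall>x\<in>carr X. f x = (\<Sum>p\<leftarrow>L. act Y (fst p x) (snd p))"
  unfolding null_map_def by blast
 let ?s = "inv_into (carr Z) g"
 have s: "?s w \<in> carr Z" "g (?s w) = w" if "w \<in> carr Y" for w
  using g(2)[OF that] by (simp_all add: inv_into_into f_inv_into_f)
 let ?L = "map (\<lambda>p. (fst p, ?s (snd p))) L"
 have "set ?L \<subseteq> lhom X regular \<times> carr Z" using L(1) s by auto
 thus thesis
 proof (rule that[OF null_mapI[OF _ lm]])
  fix x assume x: "x \<in> carr X"
  have "g (\<Sum>p\<leftarrow>L. act Z (fst p x) (?s (snd p))) = (\<Sum>p\<leftarrow>L. g (act Z (fst p x) (?s (snd p))))"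
   using L(1) s lm by (intro lhom_sum_list[OF g(1)]) (auto intro!: lm_act)
  also have "\<dots> = (\<Sum>p\<leftarrow>L. act Y (fst p x) (snd p))"
   using L(1) s by (intro arg_cong[of _ _ sum_list] map_cong) (auto simp: lhom_act[OF g(1)])
  finally show "g (restr X (\<lambda>x. \<Sum>p\<leftarrow>?L. act Z (fst p x) (snd p)) x) = f x"
   using L(2) x by (simp add: o_def)
 qed
qed

lemma dual_basis_lift:
 assumes P: "dual_basis P" and f: "f \<in> lhom P Y" and g: "g \<in> lhom Z Y" "g ` carr Z = carr Y"
  and lm: "left_module Z" "left_module Y"
 obtains h where "h \<in> lhom P Z" "\<And>x. x \<in> carr P ==> g (h x) = f x"
proof -
 have lP: "left_module P" using P by (rule dual_basis_lm)
 have "f \<circ> restr P (\<lambda>x. x) = f"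
  using lhom_out[OF f] lhom_zero[OF f lP] by (auto simp: fun_eq_iff restr_def)
 hence n: "null_map P Y f"
  using null_through[OF P restr_id[OF lP] f] by simp
 from g(2) have "y \<in> g ` carr Z" if "y \<in> carr Y" for y using that by simp
 thus thesis
 proof (rule null_lift_surj[OF n g(1) _ lP lm(1)])
  fix h assume "null_map P Z h" "\<And>x. x \<in> carr P ==> g (h x) = f x"
  thus thesis by (intro that[of h] null_lhom)
 qed
qed

text \<open>Equality in the stable module category.\<close>

definition steq ::
  "('a::ring_1, 'm::ab_group_add) lmod \<Rightarrow> ('a, 'n::ab_group_add) lmod \<Rightarrow> ('m \<Rightarrow> 'n) \<Rightarrow> ('m \<Rightarrow> 'n) \<Rightarrow> bool" where
 "steq X Y f g \<longleftrightarrow> f \<in> lhom X Y \<and> g \<in> lhom X Y \<and> null_map X Y (\<lambda>x. f x - g x)"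

lemma lhom_injI: "f \<in> lhom X Y ==> left_module X ==> (\<And>x. x \<in> carr X ==> f x = 0 ==> x = 0) ==> inj_on f (carr X)"
 unfolding inj_on_def using lhom_diff[of f X Y] lm_diff[of X] by (metis right_minus_eq)

lemma dual_basis_retract:
 assumes "dual_basis F" "left_module P" "s \<in> lhom P F" "\<pi> \<in> lhom F P" "\<And>x. x \<in> carr P ==> \<pi> (s x) = x"
 shows "dual_basis P"
 using null_through[OF assms(1,3,4)] assms(2,5) unfolding dual_basis_def null_map_def by auto

lemma steq_lhom: "steq X Y f g ==> f \<in> lhom X Y" "steq X Y f g ==> g \<in> lhom X Y"
 by (simp_all add: steq_def)

lemma steq_refl: "f \<in> lhom X Y ==> left_module Y ==> steq X Y f f"
 by (simp add: steq_def null_zero)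

lemma steq_sym: "steq X Y f g ==> left_module Y ==> steq X Y g f"
 using null_uminus[of X Y "\<lambda>x. f x - g x"] by (simp add: steq_def)

lemma steq_trans: "steq X Y f g ==> steq X Y g h ==> left_module Y ==> steq X Y f h"
 using null_plus[of X Y "\<lambda>x. f x - g x" "\<lambda>x. g x - h x"] by (simp add: steq_def)

lemma steq_plus: "steq X Y f f' ==> steq X Y g g' ==> left_module Y
  ==> steq X Y (\<lambda>x. f x + g x) (\<lambda>x. f' x + g' x)"
 using null_plus[of X Y "\<lambda>x. f x - f' x" "\<lambda>x. g x - g' x"]
 by (simp add: steq_def lhom_plus algebra_simps)

lemma steq_uminus: "steq X Y f f' ==> left_module Y ==> steq X Y (\<lambda>x. - f x) (\<lambda>x. - f' x)"
 using null_uminus[of X Y "\<lambda>x. f x - f' x"]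
 by (simp add: steq_def lhom_uminus algebra_simps)

lemma steq_minus: "steq X Y f f' ==> steq X Y g g' ==> left_module Y
  ==> steq X Y (\<lambda>x. f x - g x) (\<lambda>x. f' x - g' x)"
 using null_minus[of X Y "\<lambda>x. f x - f' x" "\<lambda>x. g x - g' x"]
 by (simp add: steq_def lhom_minus_fun algebra_simps)

lemma steq_comp: assumes "steq X Y f f'" "steq Y Z g g'" "left_module X" "left_module Y" "left_module Z"
 shows "steq X Z (g \<circ> f) (g' \<circ> f')"
proof -
 have l: "f \<in> lhom X Y" "f' \<in> lhom X Y" "g \<in> lhom Y Z" "g' \<in> lhom Y Z" using assms by (simp_all add: steq_def)
 have "null_map X Z (g \<circ> (\<lambda>x. f x - f' x))" "null_map X Z ((\<lambda>x. g x - g' x) \<circ> f')"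
  using assms null_comp_left[OF _ l(3), of X "\<lambda>x. f x - f' x"]
   null_comp_right[OF _ l(2), of Z "\<lambda>x. g x - g' x"] by (simp_all add: steq_def)
 from null_plus[OF this assms(5)]
 have n: "null_map X Z (\<lambda>x. g (f x - f' x) + (g (f' x) - g' (f' x)))" by simp
 have eq: "g (f x - f' x) + (g (f' x) - g' (f' x)) = g (f x) - g' (f' x)" for x
  by (cases "x \<in> carr X") (simp_all add: lhom_diff[OF l(3) assms(4)] lhom_in[OF l(1)] lhom_in[OF l(2)]
   lhom_out[OF l(1)] lhom_out[OF l(2)] lhom_zero[OF l(3) assms(4)] lhom_zero[OF l(4) assms(4)])
 have "null_map X Z (\<lambda>x. g (f x) - g' (f' x))" using n unfolding eq .
 moreover have "g \<circ> f \<in> lhom X Z" "g' \<circ> f' \<in> lhom X Z"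
  using l assms(4) by (simp_all add: lhom_comp[of _ X Y])
 ultimately show ?thesis by (simp add: steq_def)
qed

lemma steq_zero_iff: "left_module Y ==> steq X Y f (\<lambda>x. 0) \<longleftrightarrow> null_map X Y f"
 by (auto simp: steq_def lhom_0 null_lhom)

lemma steq_null: "steq X Y f g ==> null_map X Y g ==> left_module Y ==> null_map X Y f"
 using null_plus[of X Y "\<lambda>x. f x - g x" g] by (simp add: steq_def)

section \<open>Free modules\<close>

abbreviation lookup :: "(nat \<Rightarrow>\<^sub>0 'a::zero) \<Rightarrow> nat \<Rightarrow> 'a" where
 "lookup \<equiv> Poly_Mapping.lookup"

abbreviation lact :: "'a::ring_1 \<Rightarrow> (nat \<Rightarrow>\<^sub>0 'a) \<Rightarrow> (nat \<Rightarrow>\<^sub>0 'a)" where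
 "lact a \<equiv> Poly_Mapping.map ((*) a)"

lemma lookup_map_zero: "f 0 = 0 ==> lookup (Poly_Mapping.map f p) i = f (lookup p i)"
 by (simp add: Poly_Mapping.map.rep_eq when_def)

text \<open>The free module of rank \<open>r\<close> as a submodule of the carrier type of the test modules for projectivity.\<close>

definition free_module :: "nat \<Rightarrow> ('a::ring_1, nat \<Rightarrow>\<^sub>0 'a) lmod" where
 "free_module r = \<lparr>carr = {x. \<forall>i\<ge>r. lookup x i = 0}, act = lact\<rparr>"

lemma carr_free: "x \<in> carr (free_module r) \<longleftrightarrow> (\<forall>i\<ge>r. lookup x i = 0)"
 and act_free [simp]: "act (free_module r) = lact"
 by (simp_all add: free_module_def)

lemma lookup_lact [simp]: "lookup (lact a p) i = a * lookup p i"
 by (simp add: lookup_map_zero)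

lemma left_module_free [simp]: "left_module (free_module r)"
 by (auto simp: left_module_def carr_free lookup_add algebra_simps intro!: poly_mapping_eqI)

lemma free_sum: assumes "x \<in> carr (free_module r)"
 shows "x = (\<Sum>i<r. lact (lookup x i) (Poly_Mapping.single i 1))"
 using assms by (intro poly_mapping_eqI) (simp add: lookup_sum lookup_single when_def carr_free if_distrib
  linorder_not_less cong: if_cong)

lemma single_free: "i < r ==> Poly_Mapping.single i a \<in> carr (free_module r)"
 by (auto simp: carr_free lookup_single when_def)

lemma fg_free [simp]: "fg_module (free_module r :: ('a::ring_1, nat \<Rightarrow>\<^sub>0 'a) lmod)"
proof -
 let ?e = "\<lambda>i. Poly_Mapping.single i 1 :: nat \<Rightarrow>\<^sub>0 'a"
 have inj: "inj_on ?e {..<r}" by (auto simp: inj_on_def dest: arg_cong[of _ _ "\<lambda>p. lookup p _"])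
   (metis lookup_single_eq lookup_single_not_eq zero_neq_one)
 have "\<exists>c. x = (\<Sum>g\<in>?e ` {..<r}. act (free_module r) (c g) g)" if "x \<in> carr (free_module r)" for x :: "nat \<Rightarrow>\<^sub>0 'a"
 proof -
  have "x = (\<Sum>i<r. lact (lookup x (inv_into {..<r} ?e (?e i))) (?e i))"
   by (subst free_sum[OF that]) (rule sum.cong, simp_all add: inv_into_f_f[OF inj])
  thus ?thesis
   by (intro exI[of _ "\<lambda>g. lookup x (inv_into {..<r} ?e g)"]) (simp add: sum.reindex[OF inj])
 qed
 thus ?thesis unfolding fg_module_def
  by (intro conjI exI[of _ "?e ` {..<r}"]) (auto simp: single_free)
qed

lemma fg_lm: "fg_module M ==> left_module M"
 by (simp add: fg_module_def)

lemma lookup_lhom: "restr (free_module r) (\<lambda>x. lookup x i) \<in> lhom (free_module r) regular"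
 by (rule restr_lhomI) (auto simp: lookup_add)

lemma dual_basis_free: "dual_basis (free_module r)"
proof -
 let ?g = "\<lambda>i. restr (free_module r) (\<lambda>x. lookup x i)"
 let ?L = "map (\<lambda>i. (?g i, Poly_Mapping.single i 1)) [0..<r]"
 have "x = (\<Sum>p\<leftarrow>?L. act (free_module r) (fst p x) (snd p))" if "x \<in> carr (free_module r)" for x :: "nat \<Rightarrow>\<^sub>0 'a"
  using free_sum[OF that] that by (simp add: o_def interv_sum_list_conv_sum_set_nat atLeast0LessThan)
 thus ?thesis unfolding dual_basis_def
  by (intro conjI exI[of _ ?L]) (auto simp: lookup_lhom single_free)
qed

lemma lookup_sum_single:
 "lookup (\<Sum>i<n. Poly_Mapping.single i (F i)) k = (if k < n then F k else 0)"
 by (induction n) (auto simp: lookup_add lookup_single when_def less_Suc_eq)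

lemma free_into:
 assumes "set gs \<subseteq> lhom X regular" "left_module X"
 obtains u where "u \<in> lhom X (free_module (length gs))"
  "\<And>x i. x \<in> carr X ==> i < length gs ==> lookup (u x) i = (gs ! i) x"
proof -
 have gs: "gs ! i \<in> lhom X regular" if "i < length gs" for i
  using assms(1) that by (auto simp: subset_iff)
 let ?u = "\<lambda>x. \<Sum>i<length gs. Poly_Mapping.single i ((gs ! i) x)"
 have "restr X ?u \<in> lhom X (free_module (length gs))"
  by (rule restr_lhomI)
    (auto simp: assms carr_free lookup_sum_single lookup_add lhom_add[OF gs] lhom_act[OF gs] intro!: poly_mapping_eqI)
 thus thesis
  by (rule that) (simp add: lookup_sum_single)
qed

lemma free_out:
 assumes "set ws \<subseteq> carr Y" "left_module Y"
 obtains v where "v \<in> lhom (free_module (length ws)) Y"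
  "\<And>x. x \<in> carr (free_module (length ws)) ==> v x = (\<Sum>i<length ws. act Y (lookup x i) (ws ! i))"
proof -
 have ws: "ws ! i \<in> carr Y" if "i < length ws" for i
  using assms(1) that by (auto simp: subset_iff)
 have cl: "(\<Sum>i\<in>I. act Y (f i) (ws ! i)) \<in> carr Y" and
  ac: "act Y a (\<Sum>i\<in>I. act Y (f i) (ws ! i)) = (\<Sum>i\<in>I. act Y (a * f i) (ws ! i))" if "I \<subseteq> {..<length ws}" for I f a
 proof -
  from that have "finite I" by (rule finite_subset) simp
  from this that have "(\<Sum>i\<in>I. act Y (f i) (ws ! i)) \<in> carr Y \<and>
   act Y a (\<Sum>i\<in>I. act Y (f i) (ws ! i)) = (\<Sum>i\<in>I. act Y (a * f i) (ws ! i))"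
   by (induction I) (auto simp: lm_rules assms ws lm_act_add lm_act_zero lm_mult)
  thus "(\<Sum>i\<in>I. act Y (f i) (ws ! i)) \<in> carr Y"
   "act Y a (\<Sum>i\<in>I. act Y (f i) (ws ! i)) = (\<Sum>i\<in>I. act Y (a * f i) (ws ! i))" by auto
 qed
 have "restr (free_module (length ws)) (\<lambda>x. \<Sum>i<length ws. act Y (lookup x i) (ws ! i)) \<in> lhom (free_module (length ws)) Y"
  by (rule restr_lhomI)
    (auto simp: assms cl ac lookup_add lm_act_add_left ws sum.distrib)
 thus thesis by (rule that) simp
qed

text \<open>A null map factors through a free module whose rank is the number of its summands; this free module is among the
 test modules and is projective with respect to them.\<close>

lemma projective_maps_null:
 assumes "left_module X" "left_module Y" "null_map X Y f" shows "f \<in> projective_maps X Y"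
proof -
 have proj: "projective (free_module r :: ('a, nat \<Rightarrow>\<^sub>0 'a) lmod)" for r
  unfolding projective_def
 proof (intro conjI allI ballI impI fg_free)
  fix X Y :: "('a, nat \<Rightarrow>\<^sub>0 'a) lmod" and g f
  assume g: "g \<in> lhom X Y" and f: "f \<in> lhom (free_module r) Y"
   and *: "fg_module X \<and> fg_module Y \<and> g ` carr X = carr Y"
  obtain h where "h \<in> lhom (free_module r) X" "\<And>x. x \<in> carr (free_module r) ==> g (h x) = f x"
   using dual_basis_lift[OF dual_basis_free f g] * fg_lm by blast
  thus "\<exists>h\<in>lhom (free_module r) X. \<forall>x\<in>carr (free_module r). g (h x) = f x" by blast
 qed
 from assms(3) obtain L where L: "set L \<subseteq> lhom X regular \<times> carr Y"
  "\<And>x. x \<in> carr X ==> f x = (\<Sum>p\<leftarrow>L. act Y (fst p x) (snd p))"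
  unfolding null_map_def by blast
 from L(1) have L1: "set (map fst L) \<subseteq> lhom X regular" "set (map snd L) \<subseteq> carr Y" by auto
 obtain u where u: "u \<in> lhom X (free_module (length L))"
   "\<And>x i. x \<in> carr X ==> i < length L ==> lookup (u x) i = (map fst L ! i) x"
  by (rule free_into[OF L1(1) assms(1)]) (auto intro: that)
 obtain v where v: "v \<in> lhom (free_module (length L)) Y"
  "\<And>x. x \<in> carr (free_module (length L)) ==> v x = (\<Sum>i<length L. act Y (lookup x i) (map snd L ! i))"
  by (rule free_out[OF L1(2) assms(2)]) (auto intro: that)
 have "f = v \<circ> u"
 proof (rule lhom_eqI[OF null_lhom[OF assms(3)] lhom_comp[OF u(1) v(1)]])
  show "f x = (v \<circ> u) x" if "x \<in> carr X" for x
   using that L(2)[OF that] v(2)[OF lhom_in[OF u(1) that]] u(2)[OF that]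
   by (simp add: sum_list_sum_nth atLeast0LessThan)
 qed simp
 thus ?thesis unfolding projective_maps_def using proj u v by blast
qed

section \<open>Linear algebra inside modules\<close>

locale symmetric_hopf = hopf_algebra scale \<Delta> \<epsilon> S
 for scale :: "'k::field \<Rightarrow> 'a::ring_1 \<Rightarrow> 'a" and \<Delta> \<epsilon> S +
 assumes fin_dim: "finite_dimensional scale" and symm: "symmetric_algebra scale"
begin

text \<open>The action of the ground field on a module.\<close>

definition smul :: "('a, 'm) lmod \<Rightarrow> 'k \<Rightarrow> 'm \<Rightarrow> 'm" where
 "smul N c x = act N (scale c 1) x"

abbreviation pscale :: "'k \<Rightarrow> (nat \<Rightarrow>\<^sub>0 'a) \<Rightarrow> (nat \<Rightarrow>\<^sub>0 'a)" where
 "pscale c \<equiv> Poly_Mapping.map (scale c)"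

lemma lookup_pscale: "lookup (pscale c x) i = scale c (lookup x i)"
 by (simp add: lookup_map_zero)

sublocale V: vector_space pscale
 by unfold_locales (auto intro!: poly_mapping_eqI simp: lookup_pscale lookup_add algebra_simps)

sublocale VV: vector_space_pair pscale pscale ..

lemma V_projection:
 assumes "V.subspace U"
 obtains \<pi> where "Vector_Spaces.linear pscale pscale \<pi>" "\<And>x. \<pi> x \<in> U" "\<And>x. x \<in> U ==> \<pi> x = x"
 using VV.linear_exists_left_inverse_on[OF V.linear_id assms] by (auto simp: subset_iff)

lemma scale_one_mult: "scale c 1 * a = scale c a" "a * scale c 1 = scale c a"
 using scale_mult_left[of c 1 a] scale_mult_right[of a c 1] by simp_all

lemma smul_regular [simp]: "smul regular c x = scale c x"
 by (simp add: smul_def scale_one_mult)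

lemma smul_free [simp]: "smul (free_module r) c x = pscale c x"
 by (intro poly_mapping_eqI) (simp add: smul_def scale_one_mult lookup_pscale)

lemma smul_in: "left_module N ==> x \<in> carr N ==> smul N c x \<in> carr N"
 by (simp add: smul_def lm_act)

lemma act_scale: "left_module N ==> x \<in> carr N ==> act N (scale c a) x = smul N c (act N a x)"
 by (metis smul_def lm_mult scale_one_mult(1))

lemma act_smul: "left_module N ==> x \<in> carr N ==> act N a (smul N c x) = smul N c (act N a x)"
 by (metis smul_def lm_mult scale_one_mult)

lemma lhom_smul: "f \<in> lhom X Y ==> x \<in> carr X ==> f (smul X c x) = smul Y c (f x)"
 by (simp add: smul_def lhom_act)

lemma smul_add: "left_module N ==> x \<in> carr N ==> y \<in> carr N ==> smul N c (x + y) = smul N c x + smul N c y"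
 by (simp add: smul_def lm_act_add)

lemma smul_zero: "left_module N ==> smul N c 0 = 0"
 by (simp add: smul_def lm_act_zero)

text \<open>The section \<open>j\<close> exists because subspaces of a finite dimensional space have complements; it makes a
 finitely generated module a linear direct summand of a free module and gives access to linear algebra there.\<close>

lemma free_cover:
 assumes "fg_module N"
 obtains r q j where "q \<in> lhom (free_module r) N" "q ` carr (free_module r) = carr N"
  "\<And>x. x \<in> carr N ==> j x \<in> carr (free_module r)" "\<And>x. x \<in> carr N ==> q (j x) = x"
  "\<And>x y. x \<in> carr N ==> y \<in> carr N ==> j (x + y) = j x + j y"
  "\<And>x c. x \<in> carr N ==> j (smul N c x) = pscale c (j x)"
proof -
 from assms obtain G where N: "left_module N" and G: "finite G" "G \<subseteq> carr N"
  "\<And>x. x \<in> carr N ==> \<exists>r. x = (\<Sum>g\<in>G. act N (r g) g)"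
  by (auto simp: fg_module_def)
 from G(1) obtain gs where gs: "set gs = G" "distinct gs" using finite_distinct_list by blast
 define r where "r = length gs"
 let ?F = "free_module r :: ('a, nat \<Rightarrow>\<^sub>0 'a) lmod"
 from gs G have "set gs \<subseteq> carr N" by simp
 from free_out[OF this N] obtain q where q: "q \<in> lhom ?F N"
  "\<And>x. x \<in> carr ?F ==> q x = (\<Sum>i<r. act N (lookup x i) (gs ! i))"
  unfolding r_def by blast
 have surj: "\<exists>y\<in>carr ?F. q y = x" if "x \<in> carr N" for x
 proof -
  obtain c where "x = (\<Sum>g\<in>G. act N (c g) g)" using G(3) \<open>x \<in> carr N\<close> by blast
  also have "\<dots> = (\<Sum>i<r. act N (c (gs ! i)) (gs ! i))"
   using sum_list_distinct_conv_sum_set[OF gs(2), of "\<lambda>g. act N (c g) g"]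
   by (simp add: gs(1) sum_list_sum_nth r_def atLeast0LessThan)
  finally have x: "x = \<dots>" .
  let ?y = "\<Sum>i<r. Poly_Mapping.single i (c (gs ! i))"
  have l: "lookup ?y i = (if i < r then c (gs ! i) else 0)" for i
   by (simp add: lookup_sum_single)
  hence "?y \<in> carr ?F" by (simp add: carr_free)
  moreover have "q ?y = x" using q(2)[OF \<open>?y \<in> carr ?F\<close>] x by (simp add: l)
  ultimately show ?thesis by blast
 qed
 define K where "K = {x \<in> carr ?F. q x = 0}"
 have "V.subspace K"
  unfolding V.subspace_def K_def
  using lhom_smul[OF q(1)] smul_in[of ?F] N
  by (auto simp: lhom_zero[OF q(1)] lm_zero lm_add lhom_add[OF q(1)] smul_zero)
 then obtain \<pi> where \<pi>: "Vector_Spaces.linear pscale pscale \<pi>" "\<And>x. \<pi> x \<in> K" "\<And>x. x \<in> K ==> \<pi> x = x"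
  by (rule V_projection) (rule that)
 interpret \<pi>: Vector_Spaces.linear pscale pscale \<pi> by fact
 let ?j = "\<lambda>v. let x = inv_into (carr ?F) q v in x - \<pi> x"
 have j: "?j (q x) = x - \<pi> x" if x: "x \<in> carr ?F" for x
 proof -
  let ?x = "inv_into (carr ?F) q (q x)"
  have "?x \<in> carr ?F" "q ?x = q x" using x by (auto simp: inv_into_into f_inv_into_f)
  hence "?x - x \<in> K" using x by (simp add: K_def lm_diff lhom_diff[OF q(1)])
  from \<pi>(3)[OF this] show ?thesis by (simp add: \<pi>.diff Let_def algebra_simps)
 qed
 have K: "\<pi> x \<in> carr ?F" "q (\<pi> x) = 0" for x using \<pi>(2)[of x] by (auto simp: K_def)
 show thesis
 proof (rule that[OF q(1), of ?j])
  show "q ` carr ?F = carr N" using surj lhom_in[OF q(1)] by blast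
  fix v assume "v \<in> carr N"
  then obtain x where x: "x \<in> carr ?F" "v = q x" using surj by blast
  show "?j v \<in> carr ?F" "q (?j v) = v"
   unfolding x(2) j[OF x(1)] using x(1) K by (simp_all add: lm_diff lhom_diff[OF q(1)])
  show "?j (smul N c v) = pscale c (?j v)" for c
   using j[of "smul ?F c x"] x(1) smul_in[of ?F x c] unfolding x(2) j[OF x(1)] lhom_smul[OF q(1) x(1), symmetric]
   by (simp add: \<pi>.scale V.scale_right_diff_distrib)
  fix w assume "w \<in> carr N"
  then obtain y where y: "y \<in> carr ?F" "w = q y" using surj by blast
  show "?j (v + w) = ?j v + ?j w"
   using j[of "x + y"] x(1) y(1)
   unfolding x(2) j[OF x(1)] y(2) j[OF y(1)] lhom_add[OF q(1) x(1) y(1), symmetric]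
   by (simp add: \<pi>.add lm_add)
 qed
qed

text \<open>Linear functionals on a module.\<close>

definition klin :: "('a, 'm::ab_group_add) lmod \<Rightarrow> ('m \<Rightarrow> 'k) \<Rightarrow> bool" where
 "klin N \<phi> \<longleftrightarrow> (\<forall>x\<in>carr N. \<forall>y\<in>carr N. \<phi> (x + y) = \<phi> x + \<phi> y) \<and> (\<forall>c. \<forall>x\<in>carr N. \<phi> (smul N c x) = c * \<phi> x)"

text \<open>Linear subspaces of a module.\<close>

definition ksub :: "('a, 'm::ab_group_add) lmod \<Rightarrow> 'm set \<Rightarrow> bool" where
 "ksub N U \<longleftrightarrow> U \<subseteq> carr N \<and> 0 \<in> U \<and> (\<forall>x\<in>U. \<forall>y\<in>U. x + y \<in> U) \<and> (\<forall>c. \<forall>x\<in>U. smul N c x \<in> U)"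

lemma k_retraction:
 assumes "fg_module N" "ksub N U"
 obtains \<rho> where "\<And>x. x \<in> carr N ==> \<rho> x \<in> U" "\<And>x. x \<in> U ==> \<rho> x = x"
  "\<And>x y. x \<in> carr N ==> y \<in> carr N ==> \<rho> (x + y) = \<rho> x + \<rho> y"
  "\<And>x c. x \<in> carr N ==> \<rho> (smul N c x) = smul N c (\<rho> x)"
proof -
 from assms(1) obtain r q j where q: "q \<in> lhom (free_module r) N" "q ` carr (free_module r) = carr N"
  and j: "\<And>x. x \<in> carr N ==> j x \<in> carr (free_module r)" "\<And>x. x \<in> carr N ==> q (j x) = x"
  "\<And>x y. x \<in> carr N ==> y \<in> carr N ==> j (x + y) = j x + j y"
  "\<And>x c. x \<in> carr N ==> j (smul N c x) = pscale c (j x)"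
  by (rule free_cover) (rule that)
 have U: "U \<subseteq> carr N" "0 \<in> U" "\<And>x y. x \<in> U ==> y \<in> U ==> x + y \<in> U" "\<And>x c. x \<in> U ==> smul N c x \<in> U"
  using assms(2) by (auto simp: ksub_def)
 have j0: "j 0 = 0" using j(3)[of 0 0] U by auto
 have "V.subspace (j ` U)"
  unfolding V.subspace_def
 proof (intro conjI ballI allI)
  show "0 \<in> j ` U" using U(2) j0 by force
  show "x + y \<in> j ` U" if xy: "x \<in> j ` U" "y \<in> j ` U" for x y
  proof -
   obtain u v where "u \<in> U" "v \<in> U" "x = j u" "y = j v" using xy by blast
   thus ?thesis using j(3)[of u v] U(1,3) by (auto simp: image_iff subset_iff intro!: bexI[of _ "u + v"])
  qed
  show "pscale c x \<in> j ` U" if "x \<in> j ` U" for c x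
  proof -
   obtain u where "u \<in> U" "x = j u" using \<open>x \<in> j ` U\<close> by blast
   thus ?thesis using j(4)[of u c] U(1,4) by (auto simp: image_iff subset_iff intro!: bexI[of _ "smul N c u"])
  qed
 qed
 then obtain \<pi> where \<pi>: "Vector_Spaces.linear pscale pscale \<pi>" "\<And>x. \<pi> x \<in> j ` U" "\<And>x. x \<in> j ` U ==> \<pi> x = x"
  by (rule V_projection) (rule that)
 interpret \<pi>: Vector_Spaces.linear pscale pscale \<pi> by fact
 have p: "\<pi> x \<in> carr (free_module r)" for x
 proof -
  obtain u where "u \<in> U" "\<pi> x = j u" using \<pi>(2)[of x] by (rule imageE)
  thus ?thesis using U(1) by (auto intro: j(1))
 qed
 show thesis
 proof (rule that[of "\<lambda>x. q (\<pi> (j x))"])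
  show "q (\<pi> (j x)) \<in> U" if "x \<in> carr N" for x
  proof -
   obtain u where "u \<in> U" "\<pi> (j x) = j u" using \<pi>(2)[of "j x"] by (rule imageE)
   thus ?thesis using j(2)[of u] U(1) by auto
  qed
  show "q (\<pi> (j x)) = x" if "x \<in> U" for x
   using that U(1) j(2) \<pi>(3) by auto
  show "q (\<pi> (j (x + y))) = q (\<pi> (j x)) + q (\<pi> (j y))" if "x \<in> carr N" "y \<in> carr N" for x y
   using that p by (simp add: j(3) \<pi>.add lhom_add[OF q(1)])
  show "q (\<pi> (j (smul N c x))) = smul N c (q (\<pi> (j x)))" if "x \<in> carr N" for x c
   using lhom_smul[OF q(1) p, of c] that by (simp add: j(4) \<pi>.scale)
 qed
qed

lemma k_retraction_inj:
 assumes "left_module X" "fg_module Y" "i \<in> lhom X Y" "inj_on i (carr X)"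
 obtains \<rho> where "\<And>y. y \<in> carr Y ==> \<rho> y \<in> carr X" "\<And>x. x \<in> carr X ==> \<rho> (i x) = x"
  "\<And>x y. x \<in> carr Y ==> y \<in> carr Y ==> \<rho> (x + y) = \<rho> x + \<rho> y"
  "\<And>x c. x \<in> carr Y ==> \<rho> (smul Y c x) = smul X c (\<rho> x)"
proof -
 let ?U = "i ` carr X"
 have "ksub Y ?U" unfolding ksub_def
 proof (intro conjI ballI allI)
  show "0 \<in> ?U" using lhom_zero[OF assms(3,1)] lm_zero[OF assms(1)] by force
  show "x + y \<in> ?U" if "x \<in> ?U" "y \<in> ?U" for x y
   using that by (auto simp: lhom_add[OF assms(3), symmetric] lm_add[OF assms(1)])
  show "smul Y c x \<in> ?U" if "x \<in> ?U" for x c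
   using that by (auto simp: lhom_smul[OF assms(3), symmetric] smul_in[OF assms(1)])
 qed (use lhom_in[OF assms(3)] in auto)
 then obtain \<rho> where \<rho>: "\<And>x. x \<in> carr Y ==> \<rho> x \<in> ?U" "\<And>x. x \<in> ?U ==> \<rho> x = x"
  "\<And>x y. x \<in> carr Y ==> y \<in> carr Y ==> \<rho> (x + y) = \<rho> x + \<rho> y"
  "\<And>x c. x \<in> carr Y ==> \<rho> (smul Y c x) = smul Y c (\<rho> x)"
  using k_retraction[OF assms(2)] by blast
 let ?r = "\<lambda>y. inv_into (carr X) i (\<rho> y)"
 have r: "?r y = x" if "\<rho> y = i x" "x \<in> carr X" for x y
  using that inv_into_f_f[OF assms(4), of x] by simp
 show thesis
 proof (rule that[of ?r])
  show "?r y \<in> carr X" if "y \<in> carr Y" for y using \<rho>(1)[OF that] by (rule inv_into_into)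
  show "?r (i x) = x" if "x \<in> carr X" for x using that by (intro r) (simp_all add: \<rho>(2))
  show "?r (x + y) = ?r x + ?r y" if "x \<in> carr Y" "y \<in> carr Y" for x y
  proof -
   obtain u v where uv: "u \<in> carr X" "\<rho> x = i u" "v \<in> carr X" "\<rho> y = i v"
    using \<rho>(1)[OF \<open>x \<in> carr Y\<close>] \<rho>(1)[OF \<open>y \<in> carr Y\<close>] by blast
   thus ?thesis using that r[of "x + y" "u + v"]
    by (simp add: \<rho>(3) lhom_add[OF assms(3)] lm_add[OF assms(1)] inv_into_f_f[OF assms(4)])
  qed
  show "?r (smul Y c x) = smul X c (?r x)" if "x \<in> carr Y" for x c
  proof -
   obtain u where uv: "u \<in> carr X" "\<rho> x = i u" using \<rho>(1)[OF \<open>x \<in> carr Y\<close>] by blast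
   thus ?thesis using that r[of "smul Y c x" "smul X c u"]
    by (simp add: \<rho>(4) lhom_smul[OF assms(3)] smul_in[OF assms(1)] inv_into_f_f[OF assms(4)])
  qed
 qed
qed

end

context symmetric_hopf begin

section \<open>The symmetrizing form and the integral\<close>

lemma eps_add: "\<epsilon> (x + y) = \<epsilon> x + \<epsilon> y" and eps_scale: "\<epsilon> (scale c x) = c * \<epsilon> x"
 using counit_linear by (simp_all add: Vector_Spaces.linear_iff)

lemma vector_space_field: "vector_space ((*) :: 'k \<Rightarrow> 'k \<Rightarrow> 'k)"
 by unfold_locales (simp_all add: algebra_simps)

lemma klin_regular_iff: "klin regular f \<longleftrightarrow> Vector_Spaces.linear scale (*) f"
 unfolding klin_def Vector_Spaces.linear_iff
 using vector_space_field vector_space_axioms by auto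

lemma klinD: "klin N \<phi> ==> x \<in> carr N ==> y \<in> carr N ==> \<phi> (x + y) = \<phi> x + \<phi> y"
 "klin N \<phi> ==> x \<in> carr N ==> \<phi> (smul N c x) = c * \<phi> x"
 by (simp_all add: klin_def)

lemma ex_trace: "\<exists>t. klin regular t \<and> (\<forall>x y. t (x * y) = t (y * x)) \<and>
  (\<forall>f. klin regular f \<longrightarrow> (\<exists>a. \<forall>y. t (y * a) = f y)) \<and> (\<forall>a b. (\<forall>y. t (y * a) = t (y * b)) \<longrightarrow> a = b)"
proof -
 from symm obtain \<phi> :: "'a \<Rightarrow> 'a \<Rightarrow> 'k" where \<phi>: "bij_betw \<phi> UNIV {f. Vector_Spaces.linear scale (*) f}"
  "\<And>a x b. \<phi> (a * x * b) = (\<lambda>y. \<phi> x (b * y * a))"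
  unfolding symmetric_algebra_def by blast
 have 1: "\<phi> a y = \<phi> 1 (y * a)" "\<phi> a y = \<phi> 1 (a * y)" for a y
  using fun_cong[OF \<phi>(2)[of a 1 1], of y] fun_cong[OF \<phi>(2)[of 1 1 a], of y] by simp_all
 have "klin regular (\<phi> 1)" using \<phi>(1) unfolding klin_regular_iff bij_betw_def by auto
 moreover have "\<phi> 1 (x * y) = \<phi> 1 (y * x)" for x y using 1[of y x] by simp
 moreover have "\<exists>a. \<forall>y. \<phi> 1 (y * a) = f y" if "klin regular f" for f
 proof -
  from that have "f \<in> range \<phi>" using \<phi>(1) by (simp add: klin_regular_iff bij_betw_def)
  then obtain a where "f = \<phi> a" by blast
  thus ?thesis using 1(1)[of a] by (intro exI[of _ a]) simp
 qed
 moreover have "a = b" if "\<forall>y. \<phi> 1 (y * a) = \<phi> 1 (y * b)" for a b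
 proof -
  have "\<phi> a = \<phi> b" using that 1(1) by (intro ext) simp
  thus ?thesis using \<phi>(1) by (simp add: bij_betw_def inj_def)
 qed
 ultimately show ?thesis by blast
qed

text \<open>The symmetrizing form: the functional that corresponds to the unit under the bimodule isomorphism with the dual.\<close>

definition tr :: "'a \<Rightarrow> 'k" where
 "tr = (SOME t. klin regular t \<and> (\<forall>x y. t (x * y) = t (y * x)) \<and>
  (\<forall>f. klin regular f \<longrightarrow> (\<exists>a. \<forall>y. t (y * a) = f y)) \<and> (\<forall>a b. (\<forall>y. t (y * a) = t (y * b)) \<longrightarrow> a = b))"

lemma tr_props: "klin regular tr" "tr (x * y) = tr (y * x)"
  "klin regular f ==> \<exists>a. \<forall>y. tr (y * a) = f y" "(\<And>y. tr (y * a) = tr (y * b)) ==> a = b"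
 using someI_ex[OF ex_trace] unfolding tr_def[symmetric] by blast+

lemma tr_add: "tr (x + y) = tr x + tr y" and tr_scale: "tr (scale c x) = c * tr x"
 using tr_props(1) by (simp_all add: klin_def)

text \<open>Homomorphisms to the regular module correspond to functionals: \<open>f x\<close> is the element that represents
 the functional \<open>y \<mapsto> \<phi> (y x)\<close> under the form.\<close>

lemma functional_lhom:
 assumes "klin X \<phi>" "left_module X"
 obtains f where "f \<in> lhom X regular" "\<And>x y. x \<in> carr X ==> tr (y * f x) = \<phi> (act X y x)"
proof -
 define f where "f x = (SOME a. \<forall>y. tr (y * a) = \<phi> (act X y x))" for x
 have f: "tr (y * f x) = \<phi> (act X y x)" if x: "x \<in> carr X" for x y
 proof -
  have "klin regular (\<lambda>y. \<phi> (act X y x))"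
   using assms x by (simp add: klin_def lm_act_add_left lm_act act_scale)
  from someI_ex[OF tr_props(3)[OF this]] show ?thesis unfolding f_def by blast
 qed
 have "restr X f \<in> lhom X regular"
 proof (rule restr_lhomI)
  show "f (x + y) = f x + f y" if "x \<in> carr X" "y \<in> carr X" for x y
   by (rule tr_props(4))
     (use that assms in \<open>simp add: f lm_rules lm_act_add distrib_left tr_add klinD\<close>)
  show "f (act X a x) = act regular a (f x)" if "x \<in> carr X" for a x
  proof (rule tr_props(4))
   fix y
   show "tr (y * f (act X a x)) = tr (y * act regular a (f x))"
    using that assms f[OF that, of "y * a"] by (simp add: f lm_rules lm_mult mult.assoc)
  qed
 qed (use assms in auto)
 thus thesis by (rule that) (simp add: f)
qed

text \<open>The element that represents the augmentation under the symmetrizing form; it is a two-sided integral.\<close>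

definition sg :: 'a where "sg = (SOME s. \<forall>y. tr (y * s) = \<epsilon> y)"

lemma tr_sg: "tr (y * sg) = \<epsilon> y"
proof -
 have "klin regular \<epsilon>" by (simp add: klin_def eps_add eps_scale)
 from someI_ex[OF tr_props(3)[OF this]] show ?thesis unfolding sg_def by blast
qed

lemma mult_sg: "a * sg = scale (\<epsilon> a) sg" and sg_mult: "sg * a = scale (\<epsilon> a) sg"
proof -
 have "tr (y * (a * sg)) = tr (y * scale (\<epsilon> a) sg)" for y
  by (simp add: tr_sg mult.assoc[symmetric] scale_mult_right tr_scale counit_mult)
 thus "a * sg = scale (\<epsilon> a) sg" by (rule tr_props(4))
 have "tr (y * (sg * a)) = tr (y * scale (\<epsilon> a) sg)" for y
  using tr_props(2)[of "y * sg" a]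
  by (simp add: tr_sg mult.assoc[symmetric] scale_mult_right tr_scale counit_mult)
 thus "sg * a = scale (\<epsilon> a) sg" by (rule tr_props(4))
qed

lemma sg_nonzero: "sg \<noteq> 0"
proof
 assume "sg = 0"
 hence "\<epsilon> 1 = tr 0" using tr_sg[of 1] by simp
 moreover have "tr 0 = 0" using tr_scale[of 0 0] by simp
 ultimately show False by (simp add: counit_one)
qed

section \<open>Extension along monomorphisms\<close>

text \<open>The regular module is self-injective: a homomorphism to it is a functional, and functionals extend from subspaces.\<close>

lemma regular_extend:
 fixes X :: "('a, 'x::ab_group_add) lmod" and Y :: "('a, 'y::ab_group_add) lmod"
 assumes "left_module X" "fg_module Y" "i \<in> lhom X Y" "inj_on i (carr X)" "g \<in> lhom X regular"
 obtains h where "h \<in> lhom Y regular" "\<And>x. x \<in> carr X ==> h (i x) = g x"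
proof -
 obtain \<rho> where \<rho>: "\<And>y. y \<in> carr Y ==> \<rho> y \<in> carr X" "\<And>x. x \<in> carr X ==> \<rho> (i x) = x"
  "\<And>x y. x \<in> carr Y ==> y \<in> carr Y ==> \<rho> (x + y) = \<rho> x + \<rho> y"
  "\<And>x c. x \<in> carr Y ==> \<rho> (smul Y c x) = smul X c (\<rho> x)"
  by (rule k_retraction_inj[OF assms(1-4)]) (rule that)
 have "klin Y (\<lambda>y. tr (g (\<rho> y)))"
  by (simp add: klin_def \<rho> lhom_add[OF assms(5)] lhom_smul[OF assms(5)] tr_add tr_scale)
 then obtain h where h: "h \<in> lhom Y regular" "\<And>x y. x \<in> carr Y ==> tr (y * h x) = tr (g (\<rho> (act Y y x)))"
  by (rule functional_lhom[OF _ fg_lm[OF assms(2)]]) (rule that)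
 show thesis
 proof (rule that[OF h(1)])
  fix x assume x: "x \<in> carr X"
  show "h (i x) = g x"
  proof (rule tr_props(4))
   fix y
   have "tr (y * h (i x)) = tr (g (\<rho> (i (act X y x))))"
    using x by (simp add: h(2) lhom_in[OF assms(3)] lhom_act[OF assms(3)])
   also have "\<dots> = tr (y * g x)" using x assms(1) by (simp add: \<rho> lm_act lhom_act[OF assms(5)])
   finally show "tr (y * h (i x)) = tr (y * g x)" .
  qed
 qed
qed

lemma null_extend:
 fixes X :: "('a, 'x::ab_group_add) lmod" and Y :: "('a, 'y::ab_group_add) lmod" and C :: "('a, 'c::ab_group_add) lmod"
 assumes f: "null_map X C f" and i: "i \<in> lhom X Y" "inj_on i (carr X)"
  and lm: "left_module X" "fg_module Y" "left_module C"
 obtains h where "null_map Y C h" "\<And>x. x \<in> carr X ==> h (i x) = f x"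
proof -
 from f obtain L where L: "set L \<subseteq> lhom X regular \<times> carr C"
  "\<forall>x\<in>carr X. f x = (\<Sum>p\<leftarrow>L. act C (fst p x) (snd p))"
  unfolding null_map_def by blast
 have "\<forall>g\<in>lhom X regular. \<exists>h. h \<in> lhom Y regular \<and> (\<forall>x\<in>carr X. h (i x) = g x)"
 proof
  fix g :: "'x \<Rightarrow> 'a" assume "g \<in> lhom X regular"
  then obtain h where "h \<in> lhom Y regular" "\<And>x. x \<in> carr X ==> h (i x) = g x"
   by (rule regular_extend[OF lm(1,2) i]) (rule that)
  thus "\<exists>h. h \<in> lhom Y regular \<and> (\<forall>x\<in>carr X. h (i x) = g x)" by blast
 qed
 then obtain E where E: "\<And>g. g \<in> lhom X regular ==> E g \<in> lhom Y regular"
  "\<And>g x. g \<in> lhom X regular ==> x \<in> carr X ==> E g (i x) = g x"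
  by (metis bchoice)
 let ?L = "map (\<lambda>p. (E (fst p), snd p)) L"
 have "set ?L \<subseteq> lhom Y regular \<times> carr C" using L(1) E by auto
 thus thesis
 proof (rule that[OF null_mapI[OF _ fg_lm[OF lm(2)] lm(3)]])
  fix x assume x: "x \<in> carr X"
  have "(\<Sum>p\<leftarrow>L. act C (E (fst p) (i x)) (snd p)) = (\<Sum>p\<leftarrow>L. act C (fst p x) (snd p))"
   using L(1) E(2) x by (intro arg_cong[of _ _ sum_list] map_cong) auto
  thus "restr Y (\<lambda>x. \<Sum>p\<leftarrow>?L. act C (fst p x) (snd p)) (i x) = f x"
   using L(2) x lhom_in[OF i(1) x] by (simp add: o_def)
 qed
qed

lemma lhom_null_dual: assumes "dual_basis C" "f \<in> lhom X C" shows "null_map X C f"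
proof -
 have lC: "left_module C" using assms(1) by (rule dual_basis_lm)
 have "restr C (\<lambda>x. x) \<circ> f = f"
  using assms(2) lC by (auto simp: fun_eq_iff restr_def lhom_def lm_zero)
 thus ?thesis using null_through[OF assms restr_id[OF lC]] by simp
qed

lemma dual_basis_extend:
 fixes X :: "('a, 'x::ab_group_add) lmod" and Y :: "('a, 'y::ab_group_add) lmod" and C :: "('a, 'c::ab_group_add) lmod"
 assumes "dual_basis C" "f \<in> lhom X C" "i \<in> lhom X Y" "inj_on i (carr X)" "left_module X" "fg_module Y"
 obtains h where "h \<in> lhom Y C" "\<And>x. x \<in> carr X ==> h (i x) = f x"
proof (rule null_extend[OF lhom_null_dual[OF assms(1,2)] assms(3-6) dual_basis_lm[OF assms(1)]])
 fix h assume "null_map Y C h" "\<And>x. x \<in> carr X ==> h (i x) = f x"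
 thus thesis by (intro that[of h] null_lhom)
qed

text \<open>Every finitely generated module has an isomorphic copy among the test modules.\<close>

lemma test_copy:
 fixes N :: "('a, 'x::ab_group_add) lmod"
 assumes "fg_module N"
 obtains r and Y :: "('a, nat \<Rightarrow>\<^sub>0 'a) lmod" and j q where "fg_module Y" "j \<in> lhom N Y" "q \<in> lhom Y N"
  "\<And>x. x \<in> carr N ==> q (j x) = x" "\<And>y. y \<in> carr Y ==> j (q y) = y"
  "carr Y \<subseteq> carr (free_module r)" "\<And>c y. y \<in> carr Y ==> smul Y c y = pscale c y"
proof -
 obtain r q j where q: "q \<in> lhom (free_module r) N" "q ` carr (free_module r) = carr N"
  and j: "\<And>x. x \<in> carr N ==> j x \<in> carr (free_module r)" "\<And>x. x \<in> carr N ==> q (j x) = x"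
  "\<And>x y. x \<in> carr N ==> y \<in> carr N ==> j (x + y) = j x + j y"
  "\<And>x c. x \<in> carr N ==> j (smul N c x) = pscale c (j x)"
  by (rule free_cover[OF assms]) (rule that)
 have N: "left_module N" using assms by (rule fg_lm)
 define Y where "Y = \<lparr>carr = j ` carr N, act = (\<lambda>a w. j (act N a (q w)))\<rparr>"
 have Y: "carr Y = j ` carr N" "act Y a (j x) = j (act N a x)" if "x \<in> carr N" for a x
  using that by (simp_all add: Y_def j)
 have cY: "carr Y = j ` carr N" by (simp add: Y_def)
 have j0: "j 0 = 0" using j(3)[of 0 0] N by (simp add: lm_zero)
 have lY: "left_module Y"
  unfolding left_module_def cY
 proof (intro conjI ballI allI)
  show "0 \<in> j ` carr N" using j0 N by (force simp: lm_zero)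
 qed (use N in \<open>auto simp: Y(2) lm_rules j(3)[symmetric] lm_one lm_mult lm_act_add_left lm_act_add\<close>)
 obtain G where G: "finite G" "G \<subseteq> carr N" "\<And>x. x \<in> carr N ==> \<exists>r. x = (\<Sum>g\<in>G. act N (r g) g)"
  using assms by (auto simp: fg_module_def)
 have injG: "inj_on j G" by (rule inj_on_inverseI[of _ q]) (use G(2) j(2) in auto)
 have "\<exists>c. y = (\<Sum>g\<in>j ` G. act Y (c g) g)" if "y \<in> carr Y" for y
 proof -
  obtain x where x: "x \<in> carr N" "y = j x" using \<open>y \<in> carr Y\<close> cY by auto
  obtain c where c: "x = (\<Sum>g\<in>G. act N (c g) g)" using G(3)[OF x(1)] by blast
  have "(\<Sum>g\<in>I. act N (c g) g) \<in> carr N \<and> j (\<Sum>g\<in>I. act N (c g) g) = (\<Sum>g\<in>I. act Y (c g) (j g))" if "I \<subseteq> G" for I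
   using finite_subset[OF that G(1)] that
   by (induction I) (use G(2) N in \<open>auto simp: lm_rules j0 j(3) Y(2) subset_iff\<close>)
  from this[of G] have "y = (\<Sum>g\<in>G. act Y (c g) (j g))" using x(2) c by simp
  also have "\<dots> = (\<Sum>g\<in>G. act Y (c (q (j g))) (j g))"
   using G(2) j(2) by (intro sum.cong) (auto simp: subset_iff)
  also have "\<dots> = (\<Sum>g\<in>j ` G. act Y (c (q g)) g)" using injG by (simp add: sum.reindex)
  finally show ?thesis by (intro exI[of _ "\<lambda>g. c (q g)"])
 qed
 moreover have "j ` G \<subseteq> carr Y" using G(2) cY by auto
 ultimately have "fg_module Y" unfolding fg_module_def
  using lY G(1) by (intro conjI exI[of _ "j ` G"]) auto
 moreover have "restr N j \<in> lhom N Y"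
  by (rule restr_lhomI) (use N Y cY j in auto)
 moreover have "restr Y q \<in> lhom Y N"
  by (rule restr_lhomI) (use N Y(2) cY j lY in \<open>auto simp: lm_rules j(3)[symmetric]\<close>)
 moreover have "smul Y c y = pscale c y" if "y \<in> carr Y" for c y
  using that cY j(4) N by (auto simp: smul_def Y(2))
 ultimately show thesis
  by (intro that[of Y "restr N j" "restr Y q" r]) (use cY j in auto)
qed

lemma projective_dual_basis:
 fixes P :: "('a, 'x::ab_group_add) lmod"
 assumes "projective P" shows "dual_basis P"
proof -
 have fg: "fg_module P" using assms by (simp add: projective_def)
 have lP: "left_module P" by (rule fg_lm[OF fg])
 obtain Y :: "('a, nat \<Rightarrow>\<^sub>0 'a) lmod" and j q0 where Y: "fg_module Y" "j \<in> lhom P Y" "q0 \<in> lhom Y P"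
  "\<And>x. x \<in> carr P ==> q0 (j x) = x" "\<And>y. y \<in> carr Y ==> j (q0 y) = y"
  by (rule test_copy[OF fg]) (rule that)
 obtain r q where q: "q \<in> lhom (free_module r) P" "q ` carr (free_module r) = carr P"
  by (rule free_cover[OF fg]) (rule that)
 have "(j \<circ> q) ` carr (free_module r) = carr Y"
  unfolding image_comp[symmetric] q(2) using lhom_in[OF Y(2)] lhom_in[OF Y(3)] Y(5)
  by (metis (no_types, lifting) image_eqI image_subsetI subsetI subset_antisym)
 moreover have "j \<circ> q \<in> lhom (free_module r) Y" by (rule lhom_comp[OF q(1) Y(2) lP])
 ultimately have "\<exists>h\<in>lhom P (free_module r). \<forall>x\<in>carr P. (j \<circ> q) (h x) = j x"
  using assms Y(1,2) fg_free unfolding projective_def by blast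
 then obtain h where h: "h \<in> lhom P (free_module r)" "\<And>x. x \<in> carr P ==> j (q (h x)) = j x" by auto
 show ?thesis
 proof (rule dual_basis_retract[OF dual_basis_free lP h(1) q(1)])
  fix x assume x: "x \<in> carr P"
  have "q (h x) \<in> carr P" by (rule lhom_in[OF q(1) lhom_in[OF h(1) x]])
  from Y(4)[OF this] h(2)[OF x] Y(4)[OF x] show "q (h x) = x" by simp
 qed
qed

lemma tr_zero: "tr 0 = 0"
 using tr_scale[of 0 0] by simp

text \<open>Embed an isomorphic copy into a free module by functionals and split the embedding by injectivity.\<close>

lemma injective_dual_basis:
 fixes P :: "('a, 'x::ab_group_add) lmod"
 assumes "injective P" shows "dual_basis P"
proof -
 have fg: "fg_module P" using assms by (simp add: injective_def)
 have lP: "left_module P" by (rule fg_lm[OF fg])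
 obtain r and Y :: "('a, nat \<Rightarrow>\<^sub>0 'a) lmod" and j q where Y: "fg_module Y" "j \<in> lhom P Y" "q \<in> lhom Y P"
  "\<And>x. x \<in> carr P ==> q (j x) = x" "\<And>y. y \<in> carr Y ==> j (q y) = y"
  "carr Y \<subseteq> carr (free_module r)" "\<And>c y. y \<in> carr Y ==> smul Y c y = pscale c y"
  by (rule test_copy[OF fg]) (rule that)
 have lY: "left_module Y" by (rule fg_lm[OF Y(1)])
 obtain B where B: "finite B" "span B = UNIV" using fin_dim unfolding finite_dimensional_def by blast
 have "\<exists>f. f \<in> lhom Y regular \<and> (\<forall>w\<in>carr Y. \<forall>y. tr (y * f w) = tr (b * lookup (act Y y w) i))" for b i
 proof -
  have "klin Y (\<lambda>w. tr (b * lookup w i))"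
   by (simp add: klin_def Y(7) lookup_add lookup_pscale distrib_left tr_add scale_mult_right tr_scale)
  then obtain f where "f \<in> lhom Y regular" "\<And>w y. w \<in> carr Y ==> tr (y * f w) = tr (b * lookup (act Y y w) i)"
   by (rule functional_lhom[OF _ lY]) (rule that)
  thus ?thesis by blast
 qed
 then obtain F where F: "\<And>b i. F b i \<in> lhom Y regular"
   "\<And>b i w y. w \<in> carr Y ==> tr (y * F b i w) = tr (b * lookup (act Y y w) i)" by metis
 have "finite ((\<lambda>(b, i). F b i) ` (B \<times> {..<r}))" using B(1) by blast
 then obtain gs where gs: "set gs = (\<lambda>(b, i). F b i) ` (B \<times> {..<r})" using finite_list by blast
 hence "set gs \<subseteq> lhom Y regular" using F(1) by auto
 then obtain u where u: "u \<in> lhom Y (free_module (length gs))"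
  "\<And>x i. x \<in> carr Y ==> i < length gs ==> lookup (u x) i = (gs ! i) x"
  by (rule free_into[OF _ lY]) (rule that)
 have "inj_on u (carr Y)"
 proof (rule lhom_injI[OF u(1) lY])
  fix w assume w: "w \<in> carr Y" "u w = 0"
  have gw: "g w = 0" if "g \<in> set gs" for g
   using that u(2)[OF w(1)] w(2) by (auto simp: in_set_conv_nth)
  hence z: "tr (b * lookup w i) = 0" if "b \<in> B" "i < r" for b i
  proof -
   have "F b i w = 0" by (rule gw) (use that gs in auto)
   thus ?thesis using F(2)[OF w(1), of 1 b i] w(1) lY by (simp add: lm_one tr_zero)
  qed
  have "lookup w i = 0" for i
  proof (cases "i < r")
   case True
   have "tr (y * lookup w i) = tr (y * 0)" for y
   proof -
    have "y \<in> span B" using B by simp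
    thus ?thesis
     by (induction rule: span_induct_alt)
       (use z True in \<open>simp_all add: distrib_right tr_add scale_mult_left tr_scale tr_zero\<close>)
   qed
   thus ?thesis by (rule tr_props(4))
  qed (use subsetD[OF Y(6) w(1)] in \<open>simp add: carr_free\<close>)
  thus "w = 0" by (intro poly_mapping_eqI) simp
 qed
 hence "\<exists>h\<in>lhom (free_module (length gs)) P. \<forall>x\<in>carr Y. h (u x) = q x"
  using assms Y(1,3) fg_free u(1) unfolding injective_def by blast
 then obtain h where h: "h \<in> lhom (free_module (length gs)) P" "\<And>x. x \<in> carr Y ==> h (u x) = q x" by auto
 show ?thesis
  by (rule dual_basis_retract[OF dual_basis_free lP lhom_comp[OF Y(2) u(1) lY] h(1)])
    (simp add: h(2) lhom_in[OF Y(2)] Y(4))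
qed

lemma projective_maps_iff:
 fixes X :: "('a, 'x::ab_group_add) lmod" and Y :: "('a, 'y::ab_group_add) lmod"
 assumes "left_module X" "left_module Y" shows "f \<in> projective_maps X Y \<longleftrightarrow> null_map X Y f"
proof
 assume "f \<in> projective_maps X Y"
 thus "null_map X Y f"
  unfolding projective_maps_def using null_through projective_dual_basis by fastforce
qed (rule projective_maps_null[OF assms])

end

context symmetric_hopf begin

section \<open>Duality\<close>

abbreviation T :: "('a, 'k) lmod" where "T \<equiv> trivial_module \<epsilon>"

lemma carr_T [simp]: "carr T = UNIV" and act_T [simp]: "act T a x = \<epsilon> a * x"
 by (simp_all add: trivial_module_def)

lemma smul_T [simp]: "smul T c x = c * x"
 by (simp add: smul_def eps_scale counit_one)

lemma left_module_T [simp]: "left_module T"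
 by (simp add: left_module_def counit_one counit_mult eps_add algebra_simps)

lemma fg_T [simp]: "fg_module T"
proof -
 have "x = (\<Sum>g\<in>{1}. act T (scale x 1) g)" for x by (simp add: eps_scale counit_one)
 thus ?thesis unfolding fg_module_def
  by (intro conjI exI[of _ "{1::'k}"]) (auto intro!: exI[of _ "\<lambda>_. scale _ 1"])
qed

lemma null_T_zero:
 assumes "null_map N T f" "left_module N" "v \<in> carr N" "act N sg v = 0" shows "f v = 0"
proof -
 from assms(1) obtain L where L: "set L \<subseteq> lhom N regular \<times> carr T"
  "\<forall>x\<in>carr N. f x = (\<Sum>p\<leftarrow>L. act T (fst p x) (snd p))"
  unfolding null_map_def by blast
 have "\<epsilon> (g v) = 0" if g: "g \<in> lhom N regular" for g
 proof -
  have "scale (\<epsilon> (g v)) sg = g (act N sg v)" by (simp add: lhom_act[OF g assms(3)] sg_mult)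
  also have "\<dots> = 0" using lhom_zero[OF g assms(2)] assms(4) by simp
  finally show ?thesis using sg_nonzero by simp
 qed
 hence "(\<Sum>p\<leftarrow>L. act T (fst p v) (snd p)) = (\<Sum>p\<leftarrow>L. 0)"
  using L(1) by (intro arg_cong[of _ _ sum_list] map_cong) auto
 thus ?thesis using L(2) assms(3) by simp
qed

text \<open>A map to the trivial module that vanishes on the kernel of the integral is a functional of \<open>sg v\<close>;
 extending this functional to the module gives the factorization.\<close>

lemma null_T_I:
 assumes "f \<in> lhom N T" "fg_module N" "\<And>v. v \<in> carr N ==> act N sg v = 0 ==> f v = 0"
 shows "null_map N T f"
proof -
 have lN: "left_module N" by (rule fg_lm[OF assms(2)])
 let ?U = "act N sg ` carr N"
 have "ksub N ?U" unfolding ksub_def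
 proof (intro conjI ballI allI)
  show "0 \<in> ?U" using lm_act_zero[OF lN] lm_zero[OF lN] by force
  show "x + y \<in> ?U" if "x \<in> ?U" "y \<in> ?U" for x y
   using that by (auto simp: lm_act_add[OF lN, symmetric] lm_add[OF lN])
  show "smul N c x \<in> ?U" if "x \<in> ?U" for x c
   using that by (auto simp: act_smul[OF lN, symmetric] smul_in[OF lN])
 qed (use lm_act[OF lN] in auto)
 then obtain \<rho> where \<rho>: "\<And>x. x \<in> carr N ==> \<rho> x \<in> ?U" "\<And>x. x \<in> ?U ==> \<rho> x = x"
  "\<And>x y. x \<in> carr N ==> y \<in> carr N ==> \<rho> (x + y) = \<rho> x + \<rho> y"
  "\<And>x c. x \<in> carr N ==> \<rho> (smul N c x) = smul N c (\<rho> x)"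
  by (rule k_retraction[OF assms(2)]) (rule that)
 define s where "s x = inv_into (carr N) (act N sg) (\<rho> x)" for x
 have s: "s x \<in> carr N" "act N sg (s x) = \<rho> x" if "x \<in> carr N" for x
  using \<rho>(1)[OF that] by (simp_all add: s_def inv_into_into f_inv_into_f)
 have fs: "f u = f v" if "u \<in> carr N" "v \<in> carr N" "act N sg u = act N sg v" for u v
  using assms(3)[of "u - v"] that
  by (simp add: lm_diff[OF lN] lm_act_diff[OF lN] lhom_diff[OF assms(1) lN])
 have "klin N (\<lambda>w. f (s w))"
  unfolding klin_def
 proof (intro conjI ballI allI)
  fix x y assume xy: "x \<in> carr N" "y \<in> carr N"
  have "f (s (x + y)) = f (s x + s y)"
   by (rule fs) (use xy lN s in \<open>simp_all add: lm_add lm_act_add \<rho>\<close>)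
  thus "f (s (x + y)) = f (s x) + f (s y)" using xy s by (simp add: lhom_add[OF assms(1)])
 next
  fix c x assume x: "x \<in> carr N"
  have "f (s (smul N c x)) = f (smul N c (s x))"
   by (rule fs) (use x lN s in \<open>simp_all add: smul_in act_smul \<rho>\<close>)
  thus "f (s (smul N c x)) = c * f (s x)" using x s by (simp add: lhom_smul[OF assms(1)])
 qed
 then obtain g where g: "g \<in> lhom N regular" "\<And>x y. x \<in> carr N ==> tr (y * g x) = f (s (act N y x))"
  by (rule functional_lhom[OF _ lN]) (rule that)
 have "f x = (\<Sum>p\<leftarrow>[(g, 1)]. act T (fst p x) (snd p))" if x: "x \<in> carr N" for x
 proof -
  have "\<epsilon> (g x) = tr (sg * g x)" using tr_props(2)[of sg "g x"] by (simp add: tr_sg)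
  also have "\<dots> = f (s (act N sg x))" by (rule g(2)[OF x])
  also have "\<dots> = f x" by (rule fs) (use x s lN \<rho> in \<open>auto simp: lm_act\<close>)
  finally show ?thesis by simp
 qed
 thus ?thesis unfolding null_map_def using assms(1) g(1)
  by (intro conjI exI[of _ "[(g, 1)]"]) auto
qed

lemma k_separation:
 assumes "fg_module N" "ksub N U" "v \<in> carr N" "v \<notin> U"
 obtains \<phi> where "klin N \<phi>" "\<And>u. u \<in> U ==> \<phi> u = 0" "\<phi> v \<noteq> 0"
proof -
 have lN: "left_module N" by (rule fg_lm[OF assms(1)])
 obtain \<rho> where \<rho>: "\<And>x. x \<in> carr N ==> \<rho> x \<in> U" "\<And>x. x \<in> U ==> \<rho> x = x"
  "\<And>x y. x \<in> carr N ==> y \<in> carr N ==> \<rho> (x + y) = \<rho> x + \<rho> y"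
  "\<And>x c. x \<in> carr N ==> \<rho> (smul N c x) = smul N c (\<rho> x)"
  by (rule k_retraction[OF assms(1,2)]) (rule that)
 have UN: "u \<in> carr N" if "u \<in> U" for u using that assms(2) by (auto simp: ksub_def)
 define w where "w = v - \<rho> v"
 have w: "w \<in> carr N" "w \<noteq> 0"
  using \<rho>(1)[OF assms(3)] UN assms(3,4) lN by (auto simp: w_def lm_diff)
 have sd: "smul N (c - d) x = smul N c x - smul N d x" if "x \<in> carr N" for c d x
  using that lN by (simp add: smul_def scale_left_diff_distrib lm_diff_act)
 have sa: "smul N (c + d) x = smul N c x + smul N d x" if "x \<in> carr N" for c d x
  using that lN by (simp add: smul_def scale_left_distrib lm_act_add_left)
 have sm: "smul N (c * d) x = smul N c (smul N d x)" if "x \<in> carr N" for c d x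
  using that lN lm_mult[OF lN that, of "scale c 1" "scale d 1"]
  by (simp add: smul_def scale_one_mult mult.commute)
 have s1: "smul N 1 x = x" if "x \<in> carr N" for x
  using that lN by (simp add: smul_def lm_one)
 have inj: "c = d" if "smul N c w = smul N d w" for c d
 proof (rule ccontr)
  assume "c \<noteq> d"
  hence "w = smul N (inverse (c - d) * (c - d)) w" by (simp add: s1 w)
  also have "\<dots> = smul N (inverse (c - d)) (smul N c w - smul N d w)" by (simp only: sm[OF w(1)] sd[OF w(1)])
  also have "\<dots> = 0" using that lN by (simp add: smul_zero)
  finally show False using w by simp
 qed
 let ?W = "range (\<lambda>c. smul N c w)"
 have "ksub N ?W" unfolding ksub_def
 proof (intro conjI ballI allI)
  show "0 \<in> ?W" using sd[OF w(1), of 0 0] by (intro range_eqI[of _ _ 0]) simp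
 qed (use w lN in \<open>auto simp: smul_in sa[symmetric] sm[symmetric]\<close>)
 then obtain \<pi> where \<pi>: "\<And>x. x \<in> carr N ==> \<pi> x \<in> ?W" "\<And>x. x \<in> ?W ==> \<pi> x = x"
  "\<And>x y. x \<in> carr N ==> y \<in> carr N ==> \<pi> (x + y) = \<pi> x + \<pi> y"
  "\<And>x c. x \<in> carr N ==> \<pi> (smul N c x) = smul N c (\<pi> x)"
  by (rule k_retraction[OF assms(1)]) (rule that)
 define \<phi> where "\<phi> x = (THE c. \<pi> (x - \<rho> x) = smul N c w)" for x
 have \<phi>: "\<phi> x = c" if "\<pi> (x - \<rho> x) = smul N c w" for x c
  unfolding \<phi>_def using that inj by (intro the_equality) auto
 have xr: "x - \<rho> x \<in> carr N" if "x \<in> carr N" for x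
  using that \<rho>(1) UN lN by (simp add: lm_diff)
 have ex: "\<exists>c. \<pi> (x - \<rho> x) = smul N c w" if "x \<in> carr N" for x
  using \<pi>(1)[OF xr[OF that]] by auto
 show thesis
 proof (rule that[of \<phi>])
  show "klin N \<phi>" unfolding klin_def
  proof (intro conjI ballI allI)
   fix x y assume xy: "x \<in> carr N" "y \<in> carr N"
   obtain c where c: "\<pi> (x - \<rho> x) = smul N c w" using ex xy by blast
   obtain d where d: "\<pi> (y - \<rho> y) = smul N d w" using ex xy by blast
   have e: "x + y - \<rho> (x + y) = (x - \<rho> x) + (y - \<rho> y)" using xy by (simp add: \<rho>)
   have "\<pi> (x + y - \<rho> (x + y)) = smul N (c + d) w"
    unfolding e using xr xy c d w by (simp add: \<pi> sa)
   thus "\<phi> (x + y) = \<phi> x + \<phi> y" using \<phi>[OF c] \<phi>[OF d] \<phi>[of "x + y"] by simp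
  next
   fix c x assume x: "x \<in> carr N"
   obtain d where d: "\<pi> (x - \<rho> x) = smul N d w" using ex x by blast
   have e: "smul N c x - \<rho> (smul N c x) = smul N c (x - \<rho> x)"
    unfolding \<rho>(4)[OF x] using x \<rho>(1)[OF x] UN lN by (simp add: smul_def lm_act_diff)
   have "\<pi> (smul N c x - \<rho> (smul N c x)) = smul N (c * d) w"
    unfolding e using xr x d w by (simp add: \<pi> sm)
   thus "\<phi> (smul N c x) = c * \<phi> x" using \<phi>[OF d] \<phi>[of "smul N c x"] by simp
  qed
  show "\<phi> u = 0" if "u \<in> U" for u
  proof (rule \<phi>)
   have "\<pi> (0 + 0) = \<pi> 0 + \<pi> 0" using lN by (intro \<pi>(3)) (simp_all add: lm_zero)
   thus "\<pi> (u - \<rho> u) = smul N 0 w" using that w lN by (simp add: \<rho> smul_def lm_zero_act)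
  qed
  have "\<phi> v = 1"
  proof (rule \<phi>)
   have "w \<in> ?W" by (rule range_eqI[of _ _ 1]) (simp add: s1 w)
   thus "\<pi> (v - \<rho> v) = smul N 1 w" using \<pi>(2)[of w] w by (simp add: w_def[symmetric] s1)
  qed
  thus "\<phi> v \<noteq> 0" by simp
 qed
qed

text \<open>The elementary half of Tate duality. The kernel of the integral on \<open>N\<close>, modulo the augmentation ideal,
 is dual to the stable homomorphisms from \<open>N\<close> to the trivial module. A functional that separates
 \<open>v\<close> from the span would be a homomorphism to the trivial module that is stably nonzero but becomes
 null on all \<open>Ni\<close>.\<close>

lemma sg_kernel_span:
 fixes N :: "('a, 'n::ab_group_add) lmod" and Ni :: "'i \<Rightarrow> ('a, 'u::ab_group_add) lmod"
 assumes N: "fg_module N" and Ni: "\<And>i. i \<in> I ==> fg_module (Ni i)" and Z: "\<And>i. i \<in> I ==> Z i \<in> lhom (Ni i) N"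
  and ann: "\<And>f. f \<in> lhom N T ==> (\<And>i. i \<in> I ==> null_map (Ni i) T (f \<circ> Z i)) ==> null_map N T f"
  and v: "v \<in> carr N" "act N sg v = 0"
 obtains xs ps where "\<And>i x. (i, x) \<in> set xs ==> i \<in> I \<and> x \<in> carr (Ni i) \<and> act (Ni i) sg x = 0"
  "\<And>a x. (a, x) \<in> set ps ==> \<epsilon> a = 0 \<and> x \<in> carr N"
  "v = (\<Sum>q\<leftarrow>xs. Z (fst q) (snd q)) + (\<Sum>p\<leftarrow>ps. act N (fst p) (snd p))"
proof -
 have lN: "left_module N" by (rule fg_lm[OF N])
 have lNi: "left_module (Ni i)" if "i \<in> I" for i by (rule fg_lm[OF Ni[OF that]])
 define A where "A = (SIGMA i:I. {x \<in> carr (Ni i). act (Ni i) sg x = 0})"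
 define B where "B = {a. \<epsilon> a = 0} \<times> carr N"
 define \<Phi> where "\<Phi> xs ps = (\<Sum>q\<leftarrow>xs. Z (fst q) (snd q)) + (\<Sum>p\<leftarrow>ps. act N (fst p) (snd p))" for xs ps
 define U where "U = {\<Phi> xs ps | xs ps. set xs \<subseteq> A \<and> set ps \<subseteq> B}"
 have UI: "\<Phi> xs ps \<in> U" if "set xs \<subseteq> A" "set ps \<subseteq> B" for xs ps using that by (auto simp: U_def)
 have ZA: "Z (fst q) (snd q) \<in> carr N" if "q \<in> A" for q
  using that lhom_in[OF Z] by (auto simp: A_def)
 have sZ: "smul N c (Z (fst q) (snd q)) = Z (fst q) (smul (Ni (fst q)) c (snd q))" if "q \<in> A" for q c
  using that lhom_smul[OF Z] by (auto simp: A_def)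
 have BN: "act N (fst p) (snd p) \<in> carr N" if "p \<in> B" for p
  using that lm_act[OF lN] by (auto simp: B_def)
 have "ksub N U" unfolding ksub_def
 proof (intro conjI ballI allI subsetI)
  fix x assume "x \<in> U"
  then obtain xs ps where x: "x = \<Phi> xs ps" "set xs \<subseteq> A" "set ps \<subseteq> B" by (auto simp: U_def)
  have s1: "(\<Sum>q\<leftarrow>xs. Z (fst q) (snd q)) \<in> carr N"
   using x(2) ZA by (intro lm_sum_list[OF lN]) auto
  have s2: "(\<Sum>p\<leftarrow>ps. act N (fst p) (snd p)) \<in> carr N"
   using x(3) BN by (intro lm_sum_list[OF lN]) auto
  show "x \<in> carr N" unfolding x(1) \<Phi>_def by (rule lm_add[OF lN s1 s2])
  show "smul N c x \<in> U" for c
  proof -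
   have "smul N c (\<Sum>q\<leftarrow>xs. Z (fst q) (snd q)) = (\<Sum>q\<leftarrow>xs. smul N c (Z (fst q) (snd q)))"
    unfolding smul_def using x(2) ZA by (intro lm_act_sum_list[OF lN]) auto
   also have "\<dots> = (\<Sum>q\<leftarrow>map (\<lambda>q. (fst q, smul (Ni (fst q)) c (snd q))) xs. Z (fst q) (snd q))"
    unfolding map_map o_def fst_conv snd_conv using x(2) sZ
    by (intro arg_cong[of _ _ sum_list] map_cong refl) blast
   finally have e1: "smul N c (\<Sum>q\<leftarrow>xs. Z (fst q) (snd q)) = \<dots>" .
   have "smul N c (\<Sum>p\<leftarrow>ps. act N (fst p) (snd p)) = (\<Sum>p\<leftarrow>ps. smul N c (act N (fst p) (snd p)))"
    unfolding smul_def using x(3) BN by (intro lm_act_sum_list[OF lN]) auto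
   also have "\<dots> = (\<Sum>p\<leftarrow>map (\<lambda>p. (scale c (fst p), snd p)) ps. act N (fst p) (snd p))"
    unfolding map_map o_def fst_conv snd_conv using x(3)
    by (intro arg_cong[of _ _ sum_list] map_cong refl act_scale[OF lN, symmetric]) (auto simp: B_def)
   finally have e2: "smul N c (\<Sum>p\<leftarrow>ps. act N (fst p) (snd p)) = \<dots>" .
   have "smul N c x = \<Phi> (map (\<lambda>q. (fst q, smul (Ni (fst q)) c (snd q))) xs) (map (\<lambda>p. (scale c (fst p), snd p)) ps)"
    unfolding x(1) \<Phi>_def smul_add[OF lN s1 s2] e1 e2 ..
   also have "\<dots> \<in> U"
    using x(2,3) by (intro UI) (auto simp: A_def B_def smul_in[OF lNi] act_smul[OF lNi] smul_zero[OF lNi] eps_scale)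
   finally show ?thesis .
  qed
  show "x + y \<in> U" if "y \<in> U" for y
  proof -
   obtain xs' ps' where y: "y = \<Phi> xs' ps'" "set xs' \<subseteq> A" "set ps' \<subseteq> B"
    using \<open>y \<in> U\<close> by (auto simp: U_def)
   have "x + y = \<Phi> (xs @ xs') (ps @ ps')" by (simp add: x y \<Phi>_def algebra_simps)
   thus ?thesis using x y by (simp add: UI)
  qed
 next
  show "0 \<in> U" using UI[of "[]" "[]"] by (simp add: \<Phi>_def)
 qed
 have "v \<in> U"
 proof (rule ccontr)
  assume "v \<notin> U"
  then obtain \<phi> where \<phi>: "klin N \<phi>" "\<And>u. u \<in> U ==> \<phi> u = 0" "\<phi> v \<noteq> 0"
   by (rule k_separation[OF N \<open>ksub N U\<close> v(1)]) (rule that)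
  have "restr N \<phi> \<in> lhom N T"
  proof (rule restr_lhomI)
   fix a x assume x: "x \<in> carr N"
   have "\<epsilon> (a - scale (\<epsilon> a) 1) = 0"
    using eps_add[of "a - scale (\<epsilon> a) 1" "scale (\<epsilon> a) 1"] by (simp add: eps_scale counit_one)
   hence "\<phi> (act N (a - scale (\<epsilon> a) 1) x) = 0"
    using UI[of "[]" "[(a - scale (\<epsilon> a) 1, x)]"] x by (intro \<phi>(2)) (simp add: \<Phi>_def B_def)
   moreover have "act N a x = act N (a - scale (\<epsilon> a) 1) x + smul N (\<epsilon> a) x"
    using lm_diff_act[OF lN x] by (simp add: smul_def)
   ultimately show "\<phi> (act N a x) = act T a (\<phi> x)"
    using x lN klinD[OF \<phi>(1)] by (simp add: lm_act smul_in)
  qed (use lN klinD[OF \<phi>(1)] in auto)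
  moreover have "null_map (Ni i) T (restr N \<phi> \<circ> Z i)" if i: "i \<in> I" for i
  proof (rule null_T_I[OF lhom_comp[OF Z[OF i] calculation lN] Ni[OF i]])
   fix x assume x: "x \<in> carr (Ni i)" "act (Ni i) sg x = 0"
   hence "Z i x \<in> U" using UI[of "[(i, x)]" "[]"] i by (simp add: \<Phi>_def A_def)
   thus "(restr N \<phi> \<circ> Z i) x = 0" using \<phi>(2) by (simp add: restr_def)
  qed
  ultimately have "null_map N T (restr N \<phi>)" by (rule ann)
  from null_T_zero[OF this lN v] show False using \<phi>(3) v by simp
 qed
 then obtain xs ps where "v = \<Phi> xs ps" "set xs \<subseteq> A" "set ps \<subseteq> B" by (auto simp: U_def)
 thus thesis by (intro that[of xs ps]) (auto simp: \<Phi>_def A_def B_def)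
qed

lemma lhom_sum_list_maps: "left_module Y ==> (\<And>q. q \<in> set xs ==> F q \<in> lhom X Y)
  ==> (\<lambda>x. \<Sum>q\<leftarrow>xs. F q x) \<in> lhom X Y"
 by (induction xs) (simp_all add: lhom_0 lhom_plus)

text \<open>The sequence \<open>0 \<rightarrow> T \<rightarrow> C \<rightarrow> W \<rightarrow> 0\<close> is compared with the
 embedding of the trivial module into the regular one by the integral. Up to null maps, a map \<open>W \<rightarrow>
 N\<close> then corresponds to a vector of \<open>N\<close> in the kernel of the integral, to which
 \<open>sg_kernel_span\<close> applies.\<close>

lemma stable_maps_from_cosyzygy:
 fixes N :: "('a, 'n::ab_group_add) lmod" and Ni :: "'i \<Rightarrow> ('a, 'u::ab_group_add) lmod"
  and C :: "('a, 'c::ab_group_add) lmod" and W :: "('a, 'w::ab_group_add) lmod"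
 assumes N: "fg_module N" and Ni: "\<And>i. i \<in> I ==> fg_module (Ni i)" and Z: "\<And>i. i \<in> I ==> Z i \<in> lhom (Ni i) N"
  and ann: "\<And>f. f \<in> lhom N T ==> (\<And>i. i \<in> I ==> null_map (Ni i) T (f \<circ> Z i)) ==> null_map N T f"
  and C: "dual_basis C" "fg_module C" and W: "left_module W"
  and p: "p \<in> lhom C W" "p ` carr C = carr W"
  and i0: "i0 \<in> lhom T C" "inj i0" "range i0 = lker C p"
  and w: "w \<in> lhom W N"
 obtains xs where "\<And>i h. (i, h) \<in> set xs ==> i \<in> I \<and> h \<in> lhom W (Ni i)"
  "steq W N w (\<lambda>y. \<Sum>q\<leftarrow>xs. Z (fst q) (snd q y))"
proof -
 have lN: "left_module N" by (rule fg_lm[OF N])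
 have lNi: "left_module (Ni i)" if "i \<in> I" for i by (rule fg_lm[OF Ni[OF that]])
 have lC: "left_module C" by (rule fg_lm[OF C(2)])
 have fr: "fg_module (regular :: ('a, 'a) lmod)"
  unfolding fg_module_def by (intro conjI exI[of _ "{1}"]) (auto intro!: exI[of _ "\<lambda>_. _"])
 define e where "e s = scale s sg" for s
 have e: "e \<in> lhom T regular"
  unfolding lhom_def e_def by (simp add: scale_left_distrib scale_mult_right mult_sg mult.commute)
 have ie: "inj e" unfolding inj_def e_def using sg_nonzero by simp
 have i0s: "i0 s = smul C s (i0 1)" for s using lhom_smul[OF i0(1), of 1 s] by simp
 have i0p: "p (i0 s) = 0" "i0 s \<in> carr C" for s using i0(3) by (auto simp: lker_def)
 have dr: "dual_basis (regular :: ('a, 'a) lmod)"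
  unfolding dual_basis_def by (intro conjI exI[of _ "[(\<lambda>x. x, 1)]"]) (auto simp: lhom_def)
 obtain h where h: "h \<in> lhom regular C" "\<And>s. h (e s) = i0 s"
 proof (rule dual_basis_extend[OF C(1) i0(1) e _ _ fr])
  fix h assume "h \<in> lhom regular C" "\<And>x. x \<in> carr T ==> h (e x) = i0 x"
  thus thesis by (intro that[of h]) auto
 qed (use ie in auto)
 obtain q where q: "q \<in> lhom C regular" "\<And>s. q (i0 s) = e s"
 proof (rule regular_extend[OF left_module_T C(2) i0(1) _ e])
  fix h assume "h \<in> lhom C regular" "\<And>x. x \<in> carr T ==> h (i0 x) = e x"
  thus thesis by (intro that[of h]) auto
 qed (use i0 in auto)
 define u where "u = h 1"
 have u: "u \<in> carr C" by (simp add: u_def lhom_in[OF h(1)])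
 have hu: "h a = act C a u" for a using lhom_act[OF h(1), of 1 a] by (simp add: u_def)
 have ku: "\<exists>s. x = i0 s" if "x \<in> carr C" "p x = 0" for x using that i0(3) by (auto simp: lker_def)
 define v where "v = w (p u)"
 have v: "v \<in> carr N" by (simp add: v_def lhom_in[OF w] lhom_in[OF p(1)] u)
 have "act N sg v = w (p (act C sg u))"
  by (simp add: v_def lhom_act[OF w] lhom_act[OF p(1)] lhom_in[OF p(1)] u)
 also have "act C sg u = i0 1" using h(2)[of 1] by (simp add: hu e_def)
 also have "w (p (i0 1)) = 0" by (simp add: i0p lhom_zero[OF w W])
 finally have sv: "act N sg v = 0" .
 obtain xs ps where xs: "\<And>i x. (i, x) \<in> set xs ==> i \<in> I \<and> x \<in> carr (Ni i) \<and> act (Ni i) sg x = 0"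
  and ps: "\<And>a x. (a, x) \<in> set ps ==> \<epsilon> a = 0 \<and> x \<in> carr N"
  and vsum: "v = (\<Sum>q\<leftarrow>xs. Z (fst q) (snd q)) + (\<Sum>p\<leftarrow>ps. act N (fst p) (snd p))"
  by (rule sg_kernel_span[OF N Ni Z ann v sv]) (assumption | rule that)+
 have "\<exists>g. g \<in> lhom W (Ni i) \<and> (\<forall>x\<in>carr C. g (p x) = act (Ni i) (q x) y)"
  if "i \<in> I" "y \<in> carr (Ni i)" "act (Ni i) sg y = 0" for i y
 proof -
  obtain g where "g \<in> lhom W (Ni i)" "\<And>x. x \<in> carr C ==> g (p x) = restr C (\<lambda>x. act (Ni i) (q x) y) x"
  proof (rule lhom_factor_surj[OF lC W p lhom_rank_one[OF q(1) \<open>y \<in> carr (Ni i)\<close> lC lNi[OF \<open>i \<in> I\<close>]]])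
   fix x assume x: "x \<in> carr C" "p x = 0"
   then obtain s where "x = i0 s" using ku by blast
   thus "restr C (\<lambda>x. act (Ni i) (q x) y) x = 0"
    using x \<open>y \<in> carr (Ni i)\<close> \<open>act (Ni i) sg y = 0\<close> lNi[OF \<open>i \<in> I\<close>]
    by (simp add: q e_def act_scale smul_zero)
  qed (rule that)
  thus ?thesis by (intro exI[of _ g]) simp
 qed
 then obtain G where G: "\<And>i y. i \<in> I ==> y \<in> carr (Ni i) ==> act (Ni i) sg y = 0 ==> G i y \<in> lhom W (Ni i)"
  "\<And>i y x. i \<in> I ==> y \<in> carr (Ni i) ==> act (Ni i) sg y = 0 ==> x \<in> carr C ==> G i y (p x) = act (Ni i) (q x) y"
  by metis
 have "\<exists>g. g \<in> lhom W regular \<and> (\<forall>x\<in>carr C. g (p x) = q x * a)" if "\<epsilon> a = 0" for a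
 proof -
  have "restr C (\<lambda>x. act regular (q x) a) \<in> lhom C regular" by (rule lhom_rank_one[OF q(1) _ lC]) auto
  then obtain g where "g \<in> lhom W regular" "\<And>x. x \<in> carr C ==> g (p x) = restr C (\<lambda>x. act regular (q x) a) x"
  proof (rule lhom_factor_surj[OF lC W p])
   fix x assume x: "x \<in> carr C" "p x = 0"
   then obtain s where "x = i0 s" using ku by blast
   thus "restr C (\<lambda>x. act regular (q x) a) x = 0"
    using x \<open>\<epsilon> a = 0\<close> by (simp add: q e_def scale_mult_left sg_mult)
  qed (rule that)
  thus ?thesis by (intro exI[of _ g]) simp
 qed
 then obtain E where E: "\<And>a. \<epsilon> a = 0 ==> E a \<in> lhom W regular"
  "\<And>a x. \<epsilon> a = 0 ==> x \<in> carr C ==> E a (p x) = q x * a" by metis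
 define R where "R = restr W (\<lambda>y. \<Sum>p\<leftarrow>map (\<lambda>p. (E (fst p), snd p)) ps. act N (fst p y) (snd p))"
 have R: "null_map W N R" unfolding R_def
  by (rule null_mapI[OF _ W lN]) (use ps E in auto)
 let ?xs = "map (\<lambda>p. (fst p, G (fst p) (snd p))) xs"
 have xs': "i \<in> I \<and> g \<in> lhom W (Ni i)" if "(i, g) \<in> set ?xs" for i g
  using that xs G(1) by auto
 define F where "F y = (\<Sum>p\<leftarrow>?xs. Z (fst p) (snd p y))" for y
 have F: "F \<in> lhom W N"
  unfolding F_def
 proof (rule lhom_sum_list_maps[OF lN])
  fix p assume "p \<in> set ?xs"
  hence "fst p \<in> I \<and> snd p \<in> lhom W (Ni (fst p))" using xs'[of "fst p" "snd p"] by simp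
  thus "(\<lambda>y. Z (fst p) (snd p y)) \<in> lhom W N"
   using lhom_comp[of "snd p" W "Ni (fst p)" "Z (fst p)" N] Z lNi by (simp add: o_def)
 qed
 have "restr C (\<lambda>x. x) \<in> lhom C C" "restr C (\<lambda>x. act C (q x) u) \<in> lhom C C"
  using lhom_rank_one[OF q(1) u lC lC] restr_id[OF lC] by auto
 from lhom_minus_fun[OF this lC]
 obtain \<kappa> where \<kappa>: "\<kappa> \<in> lhom W C" "\<And>x. x \<in> carr C ==> \<kappa> (p x) = restr C (\<lambda>x. x) x - restr C (\<lambda>x. act C (q x) u) x"
 proof (rule lhom_factor_surj[OF lC W p])
  fix x assume x: "x \<in> carr C" "p x = 0"
  then obtain s where "x = i0 s" using ku by blast
  thus "restr C (\<lambda>x. x) x - restr C (\<lambda>x. act C (q x) u) x = 0"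
   using x h(2)[of s] by (simp add: q hu)
 qed (rule that)
 have K: "null_map W N ((w \<circ> p) \<circ> \<kappa>)"
  by (rule null_through[OF C(1) \<kappa>(1) lhom_comp[OF p(1) w W]])
 have FR: "F (p x) + R (p x) = act N (q x) v" if x: "x \<in> carr C" for x
 proof -
  have "act N (q x) v = act N (q x) (\<Sum>q\<leftarrow>xs. Z (fst q) (snd q)) + act N (q x) (\<Sum>p\<leftarrow>ps. act N (fst p) (snd p))"
   unfolding vsum by (rule lm_act_add[OF lN]) (use xs ps lhom_in[OF Z] lm_act[OF lN] in \<open>force intro!: lm_sum_list[OF lN]\<close>)+
  also have "act N (q x) (\<Sum>q\<leftarrow>xs. Z (fst q) (snd q)) = (\<Sum>p\<leftarrow>xs. act N (q x) (Z (fst p) (snd p)))"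
   using xs lhom_in[OF Z] by (intro lm_act_sum_list[OF lN]) force
  also have "\<dots> = F (p x)"
   unfolding F_def using xs x by (auto simp: o_def G(2) lhom_act[OF Z] intro!: arg_cong[of _ _ sum_list])
  also have "act N (q x) (\<Sum>p\<leftarrow>ps. act N (fst p) (snd p)) = (\<Sum>p\<leftarrow>ps. act N (q x) (act N (fst p) (snd p)))"
   using ps lm_act[OF lN] by (intro lm_act_sum_list[OF lN]) force
  also have "\<dots> = R (p x)"
   unfolding R_def using ps x lhom_in[OF p(1) x]
   by (auto simp: o_def E(2) lm_mult[OF lN] intro!: arg_cong[of _ _ sum_list])
  finally show ?thesis by simp
 qed
 have eq: "w y - F y = R y + ((w \<circ> p) \<circ> \<kappa>) y" for y
 proof (cases "y \<in> carr W")
  case True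
  then obtain x where x: "x \<in> carr C" "y = p x" using p(2) by auto
  have "((w \<circ> p) \<circ> \<kappa>) y = w (p (x - act C (q x) u))" using x by (simp add: \<kappa>)
  also have "\<dots> = w (p x) - act N (q x) v"
   using x u lC W by (simp add: lm_act lm_diff lhom_diff[OF p(1)] lhom_diff[OF w] lhom_in[OF p(1)]
    lhom_act[OF p(1)] lhom_act[OF w] v_def)
  also have "act N (q x) v = F y + R y" using FR[OF x(1)] x(2) by simp
  finally show ?thesis using x(2) by (simp add: algebra_simps)
 next
  case False
  thus ?thesis using lhom_out[OF w] lhom_out[OF F] lhom_out[OF null_lhom[OF R]] lhom_out[OF null_lhom[OF K]]
   by auto
 qed
 show thesis
 proof (rule that[of ?xs])
  have "null_map W N (\<lambda>y. w y - F y)" unfolding eq by (rule null_plus[OF R K lN])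
  thus "steq W N w (\<lambda>y. \<Sum>p\<leftarrow>?xs. Z (fst p) (snd p y))"
   using w F unfolding steq_def F_def by simp
 qed (rule xs')
qed

end

section \<open>The Heller shift\<close>

locale hopf_heller = symmetric_hopf scale \<Delta> \<epsilon> S
 for scale :: "'k::field \<Rightarrow> 'a::ring_1 \<Rightarrow> 'a" and \<Delta> \<epsilon> S +
 fixes H :: "('a, 'u::ab_group_add, 'k) heller"
 assumes heller: "heller_system (trivial_module \<epsilon>) H"
begin

abbreviation hom :: "int \<Rightarrow> int \<Rightarrow> ('u \<Rightarrow> 'u) set" where "hom i j \<equiv> lhom (Om H i) (Om H j)"
abbreviation nul :: "int \<Rightarrow> int \<Rightarrow> ('u \<Rightarrow> 'u) \<Rightarrow> bool" where "nul i j \<equiv> null_map (Om H i) (Om H j)"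
abbreviation seq :: "int \<Rightarrow> int \<Rightarrow> ('u \<Rightarrow> 'u) \<Rightarrow> ('u \<Rightarrow> 'u) \<Rightarrow> bool" where "seq i j \<equiv> steq (Om H i) (Om H j)"
abbreviation ladder :: "int \<Rightarrow> int \<Rightarrow> ('u \<Rightarrow> 'u) \<Rightarrow> ('u \<Rightarrow> 'u) \<Rightarrow> bool" where "ladder \<equiv> heller_ladder H"
abbreviation shift :: "int \<Rightarrow> int \<Rightarrow> ('u \<Rightarrow> 'u) \<Rightarrow> int \<Rightarrow> ('u \<Rightarrow> 'u) \<Rightarrow> bool" where "shift \<equiv> heller_shift H"

lemma Om_fg [simp]: "fg_module (Om H n)" and Cov_fg [simp]: "fg_module (Cov H n)"
 and Om_Cov_exact: "short_exact (Om H (n + 1)) (inc H n) (Cov H n) (prj H n) (Om H n)"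
 using heller by (simp_all add: heller_system_def)

lemma Om_lm [simp]: "left_module (Om H n)" and Cov_lm [simp]: "left_module (Cov H n)"
 by (simp_all add: fg_lm)

lemma inc_lhom: "inc H n \<in> lhom (Om H (n + 1)) (Cov H n)" and prj_lhom: "prj H n \<in> lhom (Cov H n) (Om H n)"
 and inc_inj: "inj_on (inc H n) (carr (Om H (n + 1)))" and prj_surj: "prj H n ` carr (Cov H n) = carr (Om H n)"
 and inc_ker: "inc H n ` carr (Om H (n + 1)) = lker (Cov H n) (prj H n)"
 using Om_Cov_exact by (simp_all add: short_exact_def)

lemma prj_inc: "x \<in> carr (Om H (n + 1)) ==> prj H n (inc H n x) = 0"
 using inc_ker[of n] by (auto simp: lker_def)

lemma ker_prj: "x \<in> carr (Cov H n) ==> prj H n x = 0 ==> x \<in> inc H n ` carr (Om H (n + 1))"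
 using inc_ker[of n] by (auto simp: lker_def)

lemma Cov_dual [simp]: "dual_basis (Cov H n)"
proof (cases "n \<ge> 0")
 case True
 hence "projective (Cov H n)" using heller by (simp add: heller_system_def projective_cover_def)
 thus ?thesis by (rule projective_dual_basis)
next
 case False
 hence "injective (Cov H n)" using heller by (simp add: heller_system_def injective_hull_def)
 thus ?thesis by (rule injective_dual_basis)
qed

lemma factor_inc:
 fixes X :: "('a, 'x::ab_group_add) lmod"
 assumes "left_module X" "f \<in> lhom X (Cov H b)" "\<And>x. x \<in> carr X ==> prj H b (f x) = 0"
 obtains g where "g \<in> lhom X (Om H (b + 1))" "\<And>x. x \<in> carr X ==> inc H b (g x) = f x"
 by (rule lhom_lift_inj[OF assms(1) Om_lm inc_lhom inc_inj assms(2)])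
   (use assms lhom_in[OF assms(2)] ker_prj in \<open>auto intro: that\<close>)

lemma factor_prj:
 fixes Y :: "('a, 'y::ab_group_add) lmod"
 assumes "f \<in> lhom (Cov H a) Y" "\<And>x. x \<in> carr (Om H (a + 1)) ==> f (inc H a x) = 0"
 obtains g where "g \<in> lhom (Om H a) Y" "\<And>x. x \<in> carr (Cov H a) ==> g (prj H a x) = f x"
proof (rule lhom_factor_surj[OF Cov_lm Om_lm prj_lhom prj_surj assms(1)])
 show "f x = 0" if "x \<in> carr (Cov H a)" "prj H a x = 0" for x
  using ker_prj[OF that] assms(2) by auto
qed (rule that)

lemma ladder_up: assumes "f \<in> hom a b" obtains g where "g \<in> hom (a + 1) (b + 1)" "ladder a b f g"
proof -
 obtain h where h: "h \<in> lhom (Cov H a) (Cov H b)" "\<And>x. x \<in> carr (Cov H a) ==> prj H b (h x) = (f \<circ> prj H a) x"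
  by (rule dual_basis_lift[OF Cov_dual lhom_comp[OF prj_lhom assms Om_lm] prj_lhom prj_surj Cov_lm Om_lm]) (rule that)
 have "prj H b ((h \<circ> inc H a) x) = 0" if "x \<in> carr (Om H (a + 1))" for x
  using that lhom_in[OF inc_lhom that] by (simp add: h(2) prj_inc lhom_zero[OF assms])
 then obtain g where "g \<in> hom (a + 1) (b + 1)" "\<And>x. x \<in> carr (Om H (a + 1)) ==> inc H b (g x) = (h \<circ> inc H a) x"
  by (rule factor_inc[OF Om_lm lhom_comp[OF inc_lhom h(1) Cov_lm]]) (assumption | rule that)+
 thus thesis using h by (intro that[of g]) (auto simp: heller_ladder_def)
qed

lemma ladder_down: assumes "g \<in> hom (a + 1) (b + 1)" obtains f where "f \<in> hom a b" "ladder a b f g"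
proof -
 obtain h where h: "h \<in> lhom (Cov H a) (Cov H b)"
  "\<And>x. x \<in> carr (Om H (a + 1)) ==> h (inc H a x) = (inc H b \<circ> g) x"
  by (rule dual_basis_extend[OF Cov_dual lhom_comp[OF assms inc_lhom Om_lm] inc_lhom inc_inj Om_lm Cov_fg]) (rule that)
 have "(prj H b \<circ> h) (inc H a x) = 0" if "x \<in> carr (Om H (a + 1))" for x
  using that lhom_in[OF assms that] by (simp add: h(2) prj_inc)
 then obtain f where "f \<in> hom a b" "\<And>x. x \<in> carr (Cov H a) ==> f (prj H a x) = (prj H b \<circ> h) x"
  by (rule factor_prj[OF lhom_comp[OF h(1) prj_lhom Cov_lm]]) (assumption | rule that)+
 thus thesis using h by (intro that[of f]) (auto simp: heller_ladder_def)
qed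

lemma ladder_minus: assumes "ladder a b f g" "ladder a b f' g'" "g \<in> hom (a + 1) (b + 1)" "g' \<in> hom (a + 1) (b + 1)"
 shows "ladder a b (\<lambda>x. f x - f' x) (\<lambda>x. g x - g' x)"
proof -
 from assms obtain h h' where h: "h \<in> lhom (Cov H a) (Cov H b)" "h' \<in> lhom (Cov H a) (Cov H b)"
  "\<forall>x\<in>carr (Cov H a). prj H b (h x) = f (prj H a x)" "\<forall>x\<in>carr (Om H (a + 1)). h (inc H a x) = inc H b (g x)"
  "\<forall>x\<in>carr (Cov H a). prj H b (h' x) = f' (prj H a x)" "\<forall>x\<in>carr (Om H (a + 1)). h' (inc H a x) = inc H b (g' x)"
  by (auto simp: heller_ladder_def)
 show ?thesis unfolding heller_ladder_def
  by (intro bexI[of _ "\<lambda>x. h x - h' x"] conjI ballI)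
    (use h in \<open>auto simp: lhom_minus_fun lhom_diff[OF prj_lhom] lhom_diff[OF inc_lhom]
     lhom_in[OF h(1)] lhom_in[OF h(2)] lhom_in[OF assms(3)] lhom_in[OF assms(4)]\<close>)
qed

lemma ladder_comp: assumes "ladder a b f g" "ladder b c f' g'" "g \<in> hom (a + 1) (b + 1)"
 shows "ladder a c (f' \<circ> f) (g' \<circ> g)"
proof -
 from assms obtain h h' where h: "h \<in> lhom (Cov H a) (Cov H b)" "h' \<in> lhom (Cov H b) (Cov H c)"
  "\<forall>x\<in>carr (Cov H a). prj H b (h x) = f (prj H a x)" "\<forall>x\<in>carr (Om H (a + 1)). h (inc H a x) = inc H b (g x)"
  "\<forall>x\<in>carr (Cov H b). prj H c (h' x) = f' (prj H b x)" "\<forall>x\<in>carr (Om H (b + 1)). h' (inc H b x) = inc H c (g' x)"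
  by (auto simp: heller_ladder_def)
 show ?thesis unfolding heller_ladder_def
  by (intro bexI[of _ "h' \<circ> h"] conjI ballI lhom_comp[OF h(1,2) Cov_lm])
    (use h in \<open>auto simp: lhom_in[OF h(1)] lhom_in[OF assms(3)]\<close>)
qed

abbreviation idm :: "int \<Rightarrow> 'u \<Rightarrow> 'u" where "idm i \<equiv> restr (Om H i) (\<lambda>x. x)"

lemma idm_hom: "idm i \<in> hom i i"
 by (simp add: restr_id)

lemma idm_comp: "f \<in> lhom X (Om H i) ==> idm i \<circ> f = f"
 by (auto simp: fun_eq_iff restr_def lhom_def lm_zero)

lemma comp_idm: "f \<in> lhom (Om H i) Y ==> f \<circ> idm i = f"
 by (rule ext) (auto simp: restr_def lhom_zero lhom_out[of f "Om H i" Y])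

lemma ladder_id: "ladder a a (idm a) (idm (a + 1))"
 unfolding heller_ladder_def
 by (intro bexI[of _ "restr (Cov H a) (\<lambda>x. x)"] conjI ballI restr_id)
   (auto simp: lhom_in[OF prj_lhom] lhom_in[OF inc_lhom])

text \<open>A null map between two objects lifts to a null map of the covers; what remains of the ladder then factors through a
 cover.\<close>

lemma ladder_null_up: assumes "ladder a b f g" "nul a b f" "g \<in> hom (a + 1) (b + 1)"
 shows "nul (a + 1) (b + 1) g"
proof -
 from assms obtain h where h: "h \<in> lhom (Cov H a) (Cov H b)"
  "\<forall>x\<in>carr (Cov H a). prj H b (h x) = f (prj H a x)" "\<forall>x\<in>carr (Om H (a + 1)). h (inc H a x) = inc H b (g x)"
  by (auto simp: heller_ladder_def)
 obtain k where k: "null_map (Om H a) (Cov H b) k" "\<And>x. x \<in> carr (Om H a) ==> prj H b (k x) = f x"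
  by (rule null_lift_surj[OF assms(2) prj_lhom _ Om_lm Cov_lm]) (use prj_surj that in auto)
 have k': "k \<in> lhom (Om H a) (Cov H b)" using k(1) by (rule null_lhom)
 let ?d = "\<lambda>x. h x - (k \<circ> prj H a) x"
 have d: "?d \<in> lhom (Cov H a) (Cov H b)"
  by (rule lhom_minus_fun[OF h(1) lhom_comp[OF prj_lhom k' Om_lm] Cov_lm])
 have "prj H b (?d x) = 0" if "x \<in> carr (Cov H a)" for x
  using that h(2) k(2)[OF lhom_in[OF prj_lhom that]] lhom_in[OF h(1) that] lhom_in[OF k' lhom_in[OF prj_lhom that]]
  by (simp add: lhom_diff[OF prj_lhom])
 then obtain w where w: "w \<in> lhom (Cov H a) (Om H (b + 1))" "\<And>x. x \<in> carr (Cov H a) ==> inc H b (w x) = ?d x"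
  by (rule factor_inc[OF Cov_lm d]) (assumption | rule that)+
 have "w \<circ> inc H a = g"
 proof (rule lhom_eqI[OF lhom_comp[OF inc_lhom w(1) Cov_lm] assms(3)])
  fix x assume x: "x \<in> carr (Om H (a + 1))"
  have "inc H b (w (inc H a x)) = inc H b (g x)"
   using x lhom_in[OF inc_lhom x] h(3) by (simp add: w(2) prj_inc lhom_zero[OF k'])
  thus "(w \<circ> inc H a) x = g x"
   using inc_inj[of b] lhom_in[OF w(1) lhom_in[OF inc_lhom x]] lhom_in[OF assms(3) x] by (simp add: inj_on_def)
 qed
 thus ?thesis using null_through[OF Cov_dual inc_lhom w(1)] by simp
qed

lemma ladder_null_down: assumes "ladder a b f g" "nul (a + 1) (b + 1) g" "f \<in> hom a b"
 shows "nul a b f"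
proof -
 from assms obtain h where h: "h \<in> lhom (Cov H a) (Cov H b)"
  "\<forall>x\<in>carr (Cov H a). prj H b (h x) = f (prj H a x)" "\<forall>x\<in>carr (Om H (a + 1)). h (inc H a x) = inc H b (g x)"
  by (auto simp: heller_ladder_def)
 obtain k where k: "null_map (Cov H a) (Om H (b + 1)) k" "\<And>x. x \<in> carr (Om H (a + 1)) ==> k (inc H a x) = g x"
  by (rule null_extend[OF assms(2) inc_lhom inc_inj Om_lm Cov_fg Om_lm]) (rule that)
 have k': "k \<in> lhom (Cov H a) (Om H (b + 1))" using k(1) by (rule null_lhom)
 let ?d = "\<lambda>x. h x - (inc H b \<circ> k) x"
 have d: "?d \<in> lhom (Cov H a) (Cov H b)"
  by (rule lhom_minus_fun[OF h(1) lhom_comp[OF k' inc_lhom Om_lm] Cov_lm])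
 have "?d (inc H a x) = 0" if "x \<in> carr (Om H (a + 1))" for x
  using that h(3) k(2)[OF that] by simp
 then obtain w where w: "w \<in> lhom (Om H a) (Cov H b)" "\<And>x. x \<in> carr (Cov H a) ==> w (prj H a x) = ?d x"
  by (rule factor_prj[OF d]) (assumption | rule that)+
 have "prj H b \<circ> w = f"
 proof (rule lhom_eqI[OF lhom_comp[OF w(1) prj_lhom Cov_lm] assms(3)])
  fix y assume "y \<in> carr (Om H a)"
  then obtain x where x: "x \<in> carr (Cov H a)" "y = prj H a x" using prj_surj[of a] by auto
  have "prj H b (w y) = prj H b (h x) - prj H b (inc H b (k x))"
   using x lhom_in[OF h(1) x(1)] lhom_in[OF inc_lhom lhom_in[OF k' x(1)]] by (simp add: w(2) lhom_diff[OF prj_lhom])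
  thus "(prj H b \<circ> w) y = f y" using x h(2) lhom_in[OF k' x(1)] by (simp add: prj_inc)
 qed
 thus ?thesis using null_through[OF Cov_dual w(1) prj_lhom] by simp
qed

text \<open>A choice of all shifts of one map, as in the definition of the shift relation.\<close>

definition chain :: "int \<Rightarrow> int \<Rightarrow> (int \<Rightarrow> 'u \<Rightarrow> 'u) \<Rightarrow> bool" where
 "chain a b F \<longleftrightarrow> (\<forall>i. F i \<in> hom (a + i) (b + i) \<and> ladder (a + i) (b + i) (F i) (F (i + 1)))"

lemma shift_chain: "shift a b f j g \<longleftrightarrow> (\<exists>F. chain a b F \<and> F 0 = f \<and> F j = g)"
 by (simp add: heller_shift_def chain_def)

text \<open>Projectivity of the covers continues a ladder upwards and their injectivity continues it downwards.\<close>

lemma chain_ex: assumes "f \<in> hom a b" shows "\<exists>F. chain a b F \<and> F 0 = f"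
proof -
 have "\<exists>U. \<forall>n. (U n \<in> hom (a + int n) (b + int n) \<and> (n = 0 \<longrightarrow> U n = f)) \<and>
   ladder (a + int n) (b + int n) (U n) (U (Suc n))"
 proof (rule dependent_nat_choice)
  show "\<exists>x. x \<in> hom (a + int 0) (b + int 0) \<and> (0 = (0::nat) \<longrightarrow> x = f)" using assms by auto
  fix x n assume "x \<in> hom (a + int n) (b + int n) \<and> (n = 0 \<longrightarrow> x = f)"
  then obtain g where "g \<in> hom (a + int n + 1) (b + int n + 1)" "ladder (a + int n) (b + int n) x g"
   using ladder_up by blast
  thus "\<exists>y. (y \<in> hom (a + int (Suc n)) (b + int (Suc n)) \<and> (Suc n = 0 \<longrightarrow> y = f)) \<and>
     ladder (a + int n) (b + int n) x y" by (intro exI[of _ g]) (simp add: algebra_simps)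
 qed
 then obtain U where U: "\<And>n. U n \<in> hom (a + int n) (b + int n)" "U 0 = f"
  "\<And>n. ladder (a + int n) (b + int n) (U n) (U (Suc n))" by auto
 have "\<exists>D. \<forall>n. (D n \<in> hom (a - int n) (b - int n) \<and> (n = 0 \<longrightarrow> D n = f)) \<and>
   ladder (a - int (Suc n)) (b - int (Suc n)) (D (Suc n)) (D n)"
 proof (rule dependent_nat_choice)
  show "\<exists>x. x \<in> hom (a - int 0) (b - int 0) \<and> (0 = (0::nat) \<longrightarrow> x = f)" using assms by auto
  fix x n assume "x \<in> hom (a - int n) (b - int n) \<and> (n = 0 \<longrightarrow> x = f)"
  hence "x \<in> hom (a - int (Suc n) + 1) (b - int (Suc n) + 1)" by simp
  then obtain g where "g \<in> hom (a - int (Suc n)) (b - int (Suc n))" "ladder (a - int (Suc n)) (b - int (Suc n)) g x"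
   by (rule ladder_down)
  thus "\<exists>y. (y \<in> hom (a - int (Suc n)) (b - int (Suc n)) \<and> (Suc n = 0 \<longrightarrow> y = f)) \<and>
     ladder (a - int (Suc n)) (b - int (Suc n)) y x" by (intro exI[of _ g]) simp
 qed
 then obtain D where D: "\<And>n. D n \<in> hom (a - int n) (b - int n)" "D 0 = f"
  "\<And>n. ladder (a - int (Suc n)) (b - int (Suc n)) (D (Suc n)) (D n)" by auto
 define F where "F i = (if i \<ge> 0 then U (nat i) else D (nat (- i)))" for i :: int
 have "F i \<in> hom (a + i) (b + i)" for i
  using U(1)[of "nat i"] D(1)[of "nat (- i)"] by (cases "i \<ge> 0") (simp_all add: F_def)
 moreover have "ladder (a + i) (b + i) (F i) (F (i + 1))" for i
 proof (cases "i \<ge> 0")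
  case True
  thus ?thesis using U(3)[of "nat i"] by (simp add: F_def nat_add_distrib)
 next
  case False
  define n where "n = nat (- i) - 1"
  have n: "nat (- i) = Suc n" "i = - int (Suc n)" using False by (simp_all add: n_def)
  have "F (i + 1) = D n" using U(2) D(2) by (cases n) (auto simp: F_def n(2) nat_add_distrib)
  moreover have "F i = D (Suc n)" using False by (simp add: F_def n(1))
  moreover have "a + i = a - int (Suc n)" "b + i = b - int (Suc n)" using n(2) by simp_all
  ultimately show ?thesis using D(3)[of n] by (simp only:)
 qed
 moreover have "F 0 = f" using U(2) by (simp add: F_def)
 ultimately show ?thesis unfolding chain_def by blast
qed

lemma chain_null: assumes "chain a b F" "nul (a + i) (b + i) (F i)" shows "nul (a + j) (b + j) (F j)"
proof (induction j rule: int_induct[where k = i])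
 case base
 thus ?case by (rule assms(2))
next
 case (step1 j)
 thus ?case using ladder_null_up[of "a + j" "b + j" "F j" "F (j + 1)"] assms(1)
  by (simp add: chain_def add.assoc)
next
 case (step2 j)
 have "ladder (a + (j - 1)) (b + (j - 1)) (F (j - 1)) (F (j - 1 + 1))" "F (j - 1) \<in> hom (a + (j - 1)) (b + (j - 1))"
  using assms(1) by (simp_all only: chain_def)
 thus ?case using ladder_null_down[of "a + (j - 1)" "b + (j - 1)" "F (j - 1)" "F (j - 1 + 1)"] step2 by simp
qed

lemma chain_minus: assumes "chain a b F" "chain a b G" shows "chain a b (\<lambda>i x. F i x - G i x)"
 unfolding chain_def
proof (intro allI conjI)
 fix i
 have "F i \<in> hom (a + i) (b + i)" "G i \<in> hom (a + i) (b + i)"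
  "F (i + 1) \<in> hom (a + i + 1) (b + i + 1)" "G (i + 1) \<in> hom (a + i + 1) (b + i + 1)"
  "ladder (a + i) (b + i) (F i) (F (i + 1))" "ladder (a + i) (b + i) (G i) (G (i + 1))"
  using assms by (simp_all add: chain_def add.assoc)
 thus "(\<lambda>x. F i x - G i x) \<in> hom (a + i) (b + i)"
  "ladder (a + i) (b + i) (\<lambda>x. F i x - G i x) (\<lambda>x. F (i + 1) x - G (i + 1) x)"
  by (auto intro: lhom_minus_fun ladder_minus)
qed

lemma chain_comp: assumes "chain a b F" "chain b c G" shows "chain a c (\<lambda>i. G i \<circ> F i)"
 unfolding chain_def
proof (intro allI conjI)
 fix i
 have "F i \<in> hom (a + i) (b + i)" "G i \<in> hom (b + i) (c + i)"
  "F (i + 1) \<in> hom (a + i + 1) (b + i + 1)"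
  "ladder (a + i) (b + i) (F i) (F (i + 1))" "ladder (b + i) (c + i) (G i) (G (i + 1))"
  using assms by (simp_all add: chain_def add.assoc)
 thus "G i \<circ> F i \<in> hom (a + i) (c + i)" "ladder (a + i) (c + i) (G i \<circ> F i) (G (i + 1) \<circ> F (i + 1))"
  using lhom_comp[OF _ _ Om_lm] ladder_comp by auto
qed

lemma chain_id: "chain a a (\<lambda>i. idm (a + i))"
 using ladder_id by (simp add: chain_def idm_hom add.assoc[symmetric])

lemma chain_shift: assumes "chain a b F" shows "chain (a + j) (b + j) (\<lambda>i. F (i + j))"
 unfolding chain_def
proof (intro allI)
 fix i
 have "F (i + j) \<in> hom (a + (i + j)) (b + (i + j)) \<and>
   ladder (a + (i + j)) (b + (i + j)) (F (i + j)) (F (i + j + 1))"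
  using assms unfolding chain_def by (rule spec)
 thus "F (i + j) \<in> hom (a + j + i) (b + j + i) \<and>
   ladder (a + j + i) (b + j + i) (F (i + j)) (F (i + 1 + j))" by (simp add: ac_simps)
qed

text \<open>A choice of the value of the shift functor on representatives.\<close>

definition Sh :: "int \<Rightarrow> int \<Rightarrow> int \<Rightarrow> ('u \<Rightarrow> 'u) \<Rightarrow> 'u \<Rightarrow> 'u" where
 "Sh j a b f = (SOME g. shift a b f j g)"

lemma Sh_chain: assumes "f \<in> hom a b" obtains F where "chain a b F" "F 0 = f" "F j = Sh j a b f"
proof -
 from chain_ex[OF assms] have "\<exists>g. shift a b f j g" unfolding shift_chain by blast
 hence "shift a b f j (Sh j a b f)" unfolding Sh_def by (rule someI_ex)
 thus thesis using that by (auto simp: shift_chain)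
qed

lemma chain_hom: "chain a b F ==> F j \<in> hom (a + j) (b + j)"
 by (simp add: chain_def)

lemma chain_unique: assumes "chain a b F" "chain a b G" "seq (a + i) (b + i) (F i) (G i)"
 shows "seq (a + j) (b + j) (F j) (G j)"
 using chain_null[OF chain_minus[OF assms(1,2)]] assms chain_hom[OF assms(1)] chain_hom[OF assms(2)]
 by (auto simp: steq_def)

lemma chain_Sh: assumes "chain a b F" "seq a b (F 0) f" shows "seq (a + j) (b + j) (F j) (Sh j a b f)"
proof -
 obtain G where "chain a b G" "G 0 = f" "G j = Sh j a b f" using Sh_chain steq_lhom(2)[OF assms(2)] by blast
 thus ?thesis using chain_unique[OF assms(1), of G 0 j] assms(2) by simp
qed

lemma shift_hom: "shift a b f j g ==> f \<in> hom a b" "shift a b f j g ==> g \<in> hom (a + j) (b + j)"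
 unfolding shift_chain using chain_hom[of a b _ 0] chain_hom[of a b _ j] by auto

lemma shift_Sh: assumes "shift a b f j g" shows "seq (a + j) (b + j) g (Sh j a b f)"
 using assms chain_Sh[of a b _ f j] shift_hom(1)[OF assms] by (auto simp: shift_chain steq_refl)

lemma Sh_shift: assumes "f \<in> hom a b" shows "shift a b f j (Sh j a b f)"
 using Sh_chain[OF assms, of j] unfolding shift_chain by blast

lemma Sh_hom: assumes "f \<in> hom a b" shows "Sh j a b f \<in> hom (a + j) (b + j)"
proof -
 obtain F where "chain a b F" "F 0 = f" "F j = Sh j a b f" using Sh_chain[OF assms] by blast
 thus ?thesis using chain_hom[of a b F j] by simp
qed

lemma Sh_cong: assumes "seq a b f g" shows "seq (a + j) (b + j) (Sh j a b f) (Sh j a b g)"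
proof -
 obtain F where "chain a b F" "F 0 = f" "F j = Sh j a b f" using Sh_chain[OF steq_lhom(1)[OF assms]] by blast
 thus ?thesis using chain_Sh[of a b F g j] assms by simp
qed

lemma Sh_comp: assumes "f \<in> hom a b" "g \<in> hom b c"
 shows "seq (a + j) (c + j) (Sh j a c (g \<circ> f)) (Sh j b c g \<circ> Sh j a b f)"
proof -
 obtain F where F: "chain a b F" "F 0 = f" "F j = Sh j a b f" using Sh_chain[OF assms(1)] by blast
 obtain G where G: "chain b c G" "G 0 = g" "G j = Sh j b c g" using Sh_chain[OF assms(2)] by blast
 have "seq (a + j) (c + j) (G j \<circ> F j) (Sh j a c (g \<circ> f))"
  using chain_Sh[OF chain_comp[OF F(1) G(1)], of "g \<circ> f" j] F G lhom_comp[OF assms Om_lm] by (simp add: steq_refl)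
 thus ?thesis using F G by (simp add: steq_sym)
qed

lemma Sh_0: assumes "f \<in> hom a b" shows "Sh 0 a b f = f"
proof -
 obtain F where "chain a b F" "F 0 = f" "F 0 = Sh 0 a b f" using Sh_chain[OF assms] by blast
 thus ?thesis by simp
qed

lemma Sh_Sh: assumes "f \<in> hom a b"
 shows "seq (a + (j + k)) (b + (j + k)) (Sh k (a + j) (b + j) (Sh j a b f)) (Sh (j + k) a b f)"
proof -
 obtain F where F: "chain a b F" "F 0 = f" "F j = Sh j a b f" using Sh_chain[OF assms] by blast
 have h: "Sh j a b f \<in> hom (a + j) (b + j)" by (rule Sh_hom[OF assms])
 have "seq (a + j + k) (b + j + k) (F (k + j)) (Sh k (a + j) (b + j) (Sh j a b f))"
  using chain_Sh[OF chain_shift[OF F(1)], of j "Sh j a b f" k] F h by (simp add: steq_refl)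
 hence "seq (a + (j + k)) (b + (j + k)) (F (j + k)) (Sh k (a + j) (b + j) (Sh j a b f))"
  by (simp add: ac_simps)
 moreover have "seq (a + (j + k)) (b + (j + k)) (F (j + k)) (Sh (j + k) a b f)"
  using chain_Sh[OF F(1), of f] F assms by (simp add: steq_refl)
 ultimately show ?thesis
  using steq_trans[OF steq_sym[OF _ Om_lm] _ Om_lm] by blast
qed

lemma Sh_null: assumes "nul a b f" shows "nul (a + j) (b + j) (Sh j a b f)"
proof -
 obtain F where F: "chain a b F" "F 0 = f" "F j = Sh j a b f" using Sh_chain[OF null_lhom[OF assms]] by blast
 thus ?thesis using chain_null[OF F(1), of 0 j] assms by simp
qed

lemma Sh_null_rev: assumes "f \<in> hom a b" "nul (a + j) (b + j) (Sh j a b f)" shows "nul a b f"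
proof -
 obtain F where F: "chain a b F" "F 0 = f" "F j = Sh j a b f" using Sh_chain[OF assms(1)] by blast
 thus ?thesis using chain_null[OF F(1), of j 0] assms by simp
qed

lemma Sh_minus: assumes "f \<in> hom a b" "g \<in> hom a b"
 shows "seq (a + j) (b + j) (Sh j a b (\<lambda>x. f x - g x)) (\<lambda>x. Sh j a b f x - Sh j a b g x)"
proof -
 obtain F where F: "chain a b F" "F 0 = f" "F j = Sh j a b f" using Sh_chain[OF assms(1)] by blast
 obtain G where G: "chain a b G" "G 0 = g" "G j = Sh j a b g" using Sh_chain[OF assms(2)] by blast
 have "seq (a + j) (b + j) (\<lambda>x. F j x - G j x) (Sh j a b (\<lambda>x. f x - g x))"
  using chain_Sh[OF chain_minus[OF F(1) G(1)], of "\<lambda>x. f x - g x" j] F G lhom_minus_fun[OF assms Om_lm]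
  by (simp add: steq_refl)
 thus ?thesis using F G by (simp add: steq_sym)
qed

lemma Sh_zero: "seq (a + j) (b + j) (Sh j a b (\<lambda>x. 0)) (\<lambda>x. 0)"
 using Sh_null[OF null_zero[OF Om_lm]] by (simp add: steq_zero_iff)

lemma Sh_uminus: assumes "f \<in> hom a b"
 shows "seq (a + j) (b + j) (Sh j a b (\<lambda>x. - f x)) (\<lambda>x. - Sh j a b f x)"
proof -
 have z: "(\<lambda>x. 0) \<in> hom a b" by (simp add: lhom_0)
 have "seq (a + j) (b + j) (\<lambda>x. Sh j a b (\<lambda>x. 0) x - Sh j a b f x) (\<lambda>x. 0 - Sh j a b f x)"
  by (rule steq_minus[OF Sh_zero steq_refl[OF Sh_hom[OF assms] Om_lm] Om_lm])
 from steq_trans[OF Sh_minus[OF z assms] this Om_lm] show ?thesis by simp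
qed

lemma Sh_plus: assumes "f \<in> hom a b" "g \<in> hom a b"
 shows "seq (a + j) (b + j) (Sh j a b (\<lambda>x. f x + g x)) (\<lambda>x. Sh j a b f x + Sh j a b g x)"
proof -
 have m: "(\<lambda>x. - g x) \<in> hom a b" using assms by (simp add: lhom_uminus)
 have "seq (a + j) (b + j) (\<lambda>x. Sh j a b f x - Sh j a b (\<lambda>x. - g x) x) (\<lambda>x. Sh j a b f x - (- Sh j a b g x))"
  by (rule steq_minus[OF steq_refl[OF Sh_hom[OF assms(1)] Om_lm] Sh_uminus[OF assms(2)] Om_lm])
 from steq_trans[OF Sh_minus[OF assms(1) m] this Om_lm] show ?thesis by simp
qed

lemma Sh_id: "seq (a + j) (a + j) (Sh j a a (idm a)) (idm (a + j))"
 using chain_Sh[OF chain_id, of a "idm a" j] by (simp add: steq_refl idm_hom steq_sym)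

lemma ladder_Sh: assumes "f \<in> hom a b" "g \<in> hom (a + 1) (b + 1)" "ladder a b f g"
 shows "seq (a + 1) (b + 1) g (Sh 1 a b f)"
proof -
 obtain F where F: "chain a b F" "F 0 = f" "F 1 = Sh 1 a b f" using Sh_chain[OF assms(1)] by blast
 have "ladder (a + 0) (b + 0) (F 0) (F (0 + 1))" using F(1) unfolding chain_def by blast
 hence l: "ladder a b f (Sh 1 a b f)" using F by simp
 have "nul (a + 1) (b + 1) (\<lambda>x. g x - Sh 1 a b f x)"
  by (rule ladder_null_up[OF ladder_minus[OF assms(3) l assms(2) Sh_hom[OF assms(1)]]])
    (simp_all add: null_zero lhom_minus_fun assms(2) Sh_hom[OF assms(1)])
 thus ?thesis using assms by (simp add: steq_def Sh_hom)
qed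

section \<open>The core of the trivial module\<close>

lemma core_in_lhom: "core_in H \<in> lhom (Om H 0) T" and core_out_lhom: "core_out H \<in> lhom T (Om H 0)"
 and core_out_in: "x \<in> carr (Om H 0) ==> core_out H (core_in H x) = x"
 using heller by (simp_all add: heller_system_def)

text \<open>The core of the trivial module is the module itself or zero, as the module is one dimensional; in the second case
 it is projective.\<close>

lemma core_cases: "dual_basis T \<or> (\<forall>s. core_in H (core_out H s) = s)"
proof -
 define c where "c = core_in H (core_out H 1)"
 have cs: "core_in H (core_out H s) = s * c" for s
 proof -
  have "core_out H s = smul (Om H 0) s (core_out H 1)" using lhom_smul[OF core_out_lhom, of 1 s] by simp
  thus ?thesis using lhom_smul[OF core_in_lhom lhom_in[OF core_out_lhom], of 1 s] by (simp add: c_def)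
 qed
 have "c * c = c"
  using cs[of c] core_out_in[OF lhom_in[OF core_out_lhom], of 1] by (simp add: c_def)
 then consider "c = 1" | "c = 0" by auto
 thus ?thesis
 proof cases
  case 2
  have "core_out H s = 0" for s
   using core_out_in[OF lhom_in[OF core_out_lhom], of s] cs[of s] 2 lhom_zero[OF core_out_lhom] by simp
  hence "T\<lparr>carr := lker T (core_out H)\<rparr> = T" by (simp add: lker_def trivial_module_def)
  hence "projective T" using heller by (simp add: heller_system_def)
  thus ?thesis using projective_dual_basis by blast
 qed (use cs in auto)
qed

text \<open>The identity of \<open>\<Omega>\<^sup>0 k\<close> factors through the trivial module, and shifts of null maps are
 null.\<close>

lemma null_if_projective:
 assumes "dual_basis T" "f \<in> lhom (Om H i) Y" shows "null_map (Om H i) Y f"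
proof -
 have "core_out H \<circ> core_in H = idm 0"
  by (rule lhom_eqI[OF lhom_comp[OF core_in_lhom core_out_lhom left_module_T] idm_hom]) (simp add: core_out_in)
 hence "nul 0 0 (idm 0)" using null_through[OF assms(1) core_in_lhom core_out_lhom] by simp
 hence "nul (0 + i) (0 + i) (Sh i 0 0 (idm 0))" by (rule Sh_null)
 hence "nul i i (idm i)" using steq_null[OF steq_sym[OF Sh_id Om_lm] _ Om_lm, of 0 i] by simp
 from null_comp_left[OF this assms(2) Om_lm] show ?thesis using comp_idm[OF assms(2)] by simp
qed

end

lemma sum_list_cong: "(\<And>x. x \<in> set xs ==> f x = g x) ==> (\<Sum>x\<leftarrow>xs. f x) = (\<Sum>x\<leftarrow>xs. g x)"
 by (induction xs) auto

lemma sum_list_swap: "(\<Sum>x\<leftarrow>xs. \<Sum>y\<leftarrow>ys. f x y) = (\<Sum>y\<leftarrow>ys. \<Sum>x\<leftarrow>xs. (f x y :: 'b::ab_group_add))"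
 by (induction xs) (simp_all add: sum_list_addf)

lemma sum_list_uminus: "(\<Sum>x\<leftarrow>xs. - f x) = - (\<Sum>x\<leftarrow>xs. (f x :: 'b::ab_group_add))"
 by (induction xs) simp_all

context symmetric_hopf begin

section \<open>Evaluation of bilinear forms on coproducts\<close>

text \<open>Bilinear forms on the algebra; they are the means to read off equations in the tensor square.\<close>

definition kbilform :: "('a \<Rightarrow> 'a \<Rightarrow> 'k) \<Rightarrow> bool" where
 "kbilform b \<longleftrightarrow> (\<forall>x y z. b (x + y) z = b x z + b y z) \<and> (\<forall>x y z. b x (y + z) = b x y + b x z) \<and>
   (\<forall>c x y. b (scale c x) y = c * b x y) \<and> (\<forall>c x y. b x (scale c y) = c * b x y)"

fun word_eval :: "('a \<Rightarrow> 'a \<Rightarrow> 'k) \<Rightarrow> 'a list \<Rightarrow> 'k" where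
 "word_eval b [x, y] = b x y"
| "word_eval b _ = 0"

lemma word_eval_add: "kbilform b ==>
  word_eval b (xs @ [x + y] @ ys) = word_eval b (xs @ [x] @ ys) + word_eval b (xs @ [y] @ ys)"
 and word_eval_scale: "kbilform b ==> word_eval b (xs @ [scale c x] @ ys) = c * word_eval b (xs @ [x] @ ys)"
 by (cases xs; cases "tl xs"; cases "tl (tl xs)"; cases ys; cases "tl ys"; force simp: kbilform_def)+

definition form_eval :: "('a \<Rightarrow> 'a \<Rightarrow> 'k) \<Rightarrow> ('a list \<Rightarrow>\<^sub>0 'k) \<Rightarrow> 'k" where
 "form_eval b p = Sum_any (\<lambda>w. Poly_Mapping.lookup p w * word_eval b w)"

lemma form_eval_finite: "finite {w. Poly_Mapping.lookup p w * word_eval b w \<noteq> 0}"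
 by (rule finite_subset[OF _ finite_keys[of p]]) (auto simp: in_keys_iff)

lemma form_eval_add: "form_eval b (p + q) = form_eval b p + form_eval b q"
 unfolding form_eval_def using Sum_any.distrib[OF form_eval_finite[of p b] form_eval_finite[of q b]]
 by (simp add: lookup_add distrib_right)

lemma form_eval_map: "form_eval b (Poly_Mapping.map ((*) c) p) = c * form_eval b p"
 unfolding form_eval_def using Sum_any_right_distrib[OF form_eval_finite[of p b], of c]
 by (simp add: Poly_Mapping.map.rep_eq when_def mult.assoc) (rule Sum_any.cong, simp)

lemma form_eval_single: "form_eval b (Poly_Mapping.single w c) = c * word_eval b w"
 unfolding form_eval_def lookup_single by (simp add: when_mult Sum_any_when_equal)

lemma form_eval_zero: "form_eval b 0 = 0"
 by (simp add: form_eval_def)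

lemma form_eval_minus: "form_eval b (p - q) = form_eval b p - form_eval b q"
 using form_eval_add[of b "p - q" q] by simp

lemma form_eval_words: "form_eval b (\<Sum>w\<leftarrow>X. Poly_Mapping.single w 1) = (\<Sum>w\<leftarrow>X. word_eval b w)"
 by (induction X) (simp_all add: form_eval_zero form_eval_add form_eval_single)

lemma lookup_map_mult: "Poly_Mapping.lookup (Poly_Mapping.map ((*) (c::'k)) p) i = c * Poly_Mapping.lookup p i"
 by (simp add: Poly_Mapping.map.rep_eq when_def)

text \<open>A bilinear form, extended to words, kills the multilinearity relations.\<close>

lemma tensor_eq_eval:
 assumes "tensor_eq scale X Y" "kbilform b"
 shows "(\<Sum>w\<leftarrow>X. word_eval b w) = (\<Sum>w\<leftarrow>Y. word_eval b w)"
proof -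
 interpret W: Modules.module "\<lambda>c::'k. Poly_Mapping.map ((*) c) :: ('a list \<Rightarrow>\<^sub>0 'k) \<Rightarrow> _"
  by unfold_locales (auto intro!: poly_mapping_eqI simp: lookup_map_mult lookup_add algebra_simps)
 have "W.subspace {p. form_eval b p = 0}"
  unfolding W.subspace_def by (simp add: form_eval_zero form_eval_add form_eval_map)
 moreover have "multilinear_relations scale \<subseteq> {p. form_eval b p = 0}"
  unfolding multilinear_relations_def
  using word_eval_add[OF assms(2)] word_eval_scale[OF assms(2)]
  by (auto simp: form_eval_minus form_eval_single simp del: append_Cons)
 ultimately have "W.span (multilinear_relations scale) \<subseteq> {p. form_eval b p = 0}"
  by (intro W.span_minimal)
 with assms(1) have "form_eval b ((\<Sum>w\<leftarrow>X. Poly_Mapping.single w 1) - (\<Sum>w\<leftarrow>Y. Poly_Mapping.single w 1)) = 0"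
  unfolding tensor_eq_def by blast
 thus ?thesis by (simp add: form_eval_minus form_eval_words)
qed

lemma word_eval_pairs: "(\<Sum>w\<leftarrow>[[x, y]. (x, y) \<leftarrow> L]. word_eval b w) = (\<Sum>p\<leftarrow>L. b (fst p) (snd p))"
 by (induction L) auto

lemma sweedler_add: "kbilform b ==>
  (\<Sum>p\<leftarrow>\<Delta> (x + y). b (fst p) (snd p)) = (\<Sum>p\<leftarrow>\<Delta> x. b (fst p) (snd p)) + (\<Sum>p\<leftarrow>\<Delta> y. b (fst p) (snd p))"
 using tensor_eq_eval[OF comult_add[of x y], of b] unfolding word_eval_pairs by simp

lemma sweedler_scale: assumes "kbilform b"
 shows "(\<Sum>p\<leftarrow>\<Delta> (scale c x). b (fst p) (snd p)) = c * (\<Sum>p\<leftarrow>\<Delta> x. b (fst p) (snd p))"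
proof -
 have "(\<Sum>w\<leftarrow>[[scale c x, y]. (x, y) \<leftarrow> L]. word_eval b w) = c * (\<Sum>p\<leftarrow>L. b (fst p) (snd p))" for L
  using assms by (induction L) (auto simp: kbilform_def distrib_left)
 thus ?thesis using tensor_eq_eval[OF comult_scale[of c x] assms] unfolding word_eval_pairs by simp
qed

lemma sweedler_mult: assumes "kbilform b"
 shows "(\<Sum>p\<leftarrow>\<Delta> (x * y). b (fst p) (snd p)) =
  (\<Sum>p\<leftarrow>\<Delta> x. \<Sum>q\<leftarrow>\<Delta> y. b (fst p * fst q) (snd p * snd q))"
proof -
 have 1: "(\<Sum>w\<leftarrow>[[x * x', y * y']. (x', y') \<leftarrow> L']. word_eval b w) =
   (\<Sum>q\<leftarrow>L'. b (x * fst q) (y * snd q))" for L' x y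
  by (induction L') auto
 have "(\<Sum>w\<leftarrow>[[x * x', y * y']. (x, y) \<leftarrow> L, (x', y') \<leftarrow> L']. word_eval b w) =
   (\<Sum>p\<leftarrow>L. \<Sum>q\<leftarrow>L'. b (fst p * fst q) (snd p * snd q))" for L L'
  by (induction L) (auto simp: 1[unfolded map_map])
 thus ?thesis using tensor_eq_eval[OF comult_mult[of x y] assms] unfolding word_eval_pairs by simp
qed

section \<open>Invariant bilinear maps\<close>

text \<open>The homomorphisms \<open>X \<otimes> Y \<rightarrow> Z\<close> for the diagonal action on the tensor product, in
 the form of bilinear functions; the last clause is linearity over the algebra.\<close>

definition bilin :: "('a, 'x::ab_group_add) lmod \<Rightarrow> ('a, 'y::ab_group_add) lmod \<Rightarrow> ('a, 'z::ab_group_add) lmod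
  \<Rightarrow> ('x \<Rightarrow> 'y \<Rightarrow> 'z) \<Rightarrow> bool" where
 "bilin X Y Z B \<longleftrightarrow>
   (\<forall>x\<in>carr X. \<forall>y\<in>carr Y. B x y \<in> carr Z \<and>
    (\<forall>x'\<in>carr X. B (x + x') y = B x y + B x' y) \<and> (\<forall>y'\<in>carr Y. B x (y + y') = B x y + B x y') \<and>
    (\<forall>c. B (smul X c x) y = smul Z c (B x y) \<and> B x (smul Y c y) = smul Z c (B x y)) \<and>
    (\<forall>a. act Z a (B x y) = (\<Sum>p\<leftarrow>\<Delta> a. B (act X (fst p) x) (act Y (snd p) y))))"

lemma bl_in: "bilin X Y Z B ==> x \<in> carr X ==> y \<in> carr Y ==> B x y \<in> carr Z"
 and bl_addl: "bilin X Y Z B ==> x \<in> carr X ==> x' \<in> carr X ==> y \<in> carr Y ==> B (x + x') y = B x y + B x' y"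
 and bl_addr: "bilin X Y Z B ==> x \<in> carr X ==> y \<in> carr Y ==> y' \<in> carr Y ==> B x (y + y') = B x y + B x y'"
 and bl_sl: "bilin X Y Z B ==> x \<in> carr X ==> y \<in> carr Y ==> B (smul X c x) y = smul Z c (B x y)"
 and bl_sr: "bilin X Y Z B ==> x \<in> carr X ==> y \<in> carr Y ==> B x (smul Y c y) = smul Z c (B x y)"
 and bl_inv: "bilin X Y Z B ==> x \<in> carr X ==> y \<in> carr Y
   ==> act Z a (B x y) = (\<Sum>p\<leftarrow>\<Delta> a. B (act X (fst p) x) (act Y (snd p) y))"
 unfolding bilin_def by blast+

lemma bl_zerol: "bilin X Y Z B ==> left_module X ==> y \<in> carr Y ==> B 0 y = 0"
 using bl_addl[of X Y Z B 0 0 y] by (simp add: lm_zero)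

lemma bl_zeror: "bilin X Y Z B ==> left_module Y ==> x \<in> carr X ==> B x 0 = 0"
 using bl_addr[of X Y Z B x 0 0] by (simp add: lm_zero)

lemma bl_minusl: "bilin X Y Z B ==> left_module X ==> x \<in> carr X ==> x' \<in> carr X ==> y \<in> carr Y
  ==> B (x - x') y = B x y - B x' y"
 using bl_addl[of X Y Z B "x - x'" x' y] by (simp add: lm_diff)

lemma bl_minusr: "bilin X Y Z B ==> left_module Y ==> x \<in> carr X ==> y' \<in> carr Y ==> y \<in> carr Y
  ==> B x (y - y') = B x y - B x y'"
 using bl_addr[of X Y Z B x "y - y'" y'] by (simp add: lm_diff)

lemma bilinI:
 assumes "\<And>x y. x \<in> carr X ==> y \<in> carr Y ==> B x y \<in> carr Z"
  "\<And>x x' y. x \<in> carr X ==> x' \<in> carr X ==> y \<in> carr Y ==> B (x + x') y = B x y + B x' y"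
  "\<And>x y y'. x \<in> carr X ==> y \<in> carr Y ==> y' \<in> carr Y ==> B x (y + y') = B x y + B x y'"
  "\<And>c x y. x \<in> carr X ==> y \<in> carr Y ==> B (smul X c x) y = smul Z c (B x y)"
  "\<And>c x y. x \<in> carr X ==> y \<in> carr Y ==> B x (smul Y c y) = smul Z c (B x y)"
  "\<And>a x y. x \<in> carr X ==> y \<in> carr Y ==> act Z a (B x y) = (\<Sum>p\<leftarrow>\<Delta> a. B (act X (fst p) x) (act Y (snd p) y))"
 shows "bilin X Y Z B"
 unfolding bilin_def using assms by (intro ballI conjI allI)

lemma bilin_comp: assumes "bilin X Y Z B" "f \<in> lhom Z W" "left_module X" "left_module Y" "left_module Z"
 shows "bilin X Y W (\<lambda>x y. f (B x y))"
proof (rule bilinI)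
 fix a x y assume xy: "x \<in> carr X" "y \<in> carr Y"
 have "act W a (f (B x y)) = f (\<Sum>p\<leftarrow>\<Delta> a. B (act X (fst p) x) (act Y (snd p) y))"
  using xy by (simp add: lhom_act[OF assms(2), symmetric] bl_in[OF assms(1)] bl_inv[OF assms(1)])
 also have "\<dots> = (\<Sum>p\<leftarrow>\<Delta> a. f (B (act X (fst p) x) (act Y (snd p) y)))"
  using xy assms by (intro lhom_sum_list[OF assms(2)] bl_in[OF assms(1)] lm_act) auto
 finally show "act W a (f (B x y)) = \<dots>" .
qed (use assms in \<open>auto simp: bl_in[OF assms(1)] bl_addl[OF assms(1)] bl_addr[OF assms(1)] bl_sl[OF assms(1)]
  bl_sr[OF assms(1)] lhom_in[OF assms(2)] lhom_add[OF assms(2)] lhom_smul[OF assms(2)]\<close>)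

lemma bilin_pre: assumes "bilin X Y Z B" "f \<in> lhom X' X" "g \<in> lhom Y' Y" "left_module X'" "left_module Y'"
 shows "bilin X' Y' Z (\<lambda>x y. B (f x) (g y))"
 using lhom_in[OF assms(2)] lhom_in[OF assms(3)]
 by (intro bilinI) (auto simp: bl_in[OF assms(1)] bl_addl[OF assms(1)] bl_addr[OF assms(1)] bl_sl[OF assms(1)]
  bl_sr[OF assms(1)] bl_inv[OF assms(1)] lhom_add[OF assms(2)] lhom_smul[OF assms(2)] lhom_add[OF assms(3)]
  lhom_smul[OF assms(3)] lhom_act[OF assms(2)] lhom_act[OF assms(3)])

lemma smul_uminus: "left_module N ==> x \<in> carr N ==> smul N c (- x) = - smul N c x"
 by (simp add: smul_def lm_act_minus)

lemma bilin_plus: assumes B: "bilin X Y Z B" and C: "bilin X Y Z C" and lm: "left_module Z"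
 shows "bilin X Y Z (\<lambda>x y. B x y + C x y)"
 by (intro bilinI) (auto simp: lm_add[OF lm] lm_act_add[OF lm] smul_add[OF lm] sum_list_addf
  bl_in[OF B] bl_addl[OF B] bl_addr[OF B] bl_sl[OF B] bl_sr[OF B] bl_inv[OF B]
  bl_in[OF C] bl_addl[OF C] bl_addr[OF C] bl_sl[OF C] bl_sr[OF C] bl_inv[OF C])

lemma bilin_uminus: assumes B: "bilin X Y Z B" and lm: "left_module Z"
 shows "bilin X Y Z (\<lambda>x y. - B x y)"
 by (intro bilinI) (auto simp: lm_minus[OF lm] lm_act_minus[OF lm] smul_uminus[OF lm] sum_list_uminus
  bl_in[OF B] bl_addl[OF B] bl_addr[OF B] bl_sl[OF B] bl_sr[OF B] bl_inv[OF B])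

lemma bilin_minus: assumes B: "bilin X Y Z B" and C: "bilin X Y Z C" and lm: "left_module Z"
 shows "bilin X Y Z (\<lambda>x y. B x y - C x y)"
 using bilin_plus[OF B bilin_uminus[OF C lm] lm] by simp

lemma bilin_zero: "left_module Z ==> bilin X Y Z (\<lambda>x y. 0)"
 by (intro bilinI) (auto simp: lm_zero lm_act_zero smul_zero)

lemma bilin_rank_one: assumes G: "bilin X Y regular G" and w: "w \<in> carr Z" "left_module Z"
 shows "bilin X Y Z (\<lambda>x y. act Z (G x y) w)"
 by (intro bilinI) (auto simp: lm_act[OF w(2)] lm_act_add_left[OF w(2)] w act_scale lm_mult[OF w(2), symmetric]
  lm_sum_act[OF w(2), symmetric] bl_inv[OF G, simplified]
  bl_in[OF G] bl_addl[OF G] bl_addr[OF G] bl_sl[OF G, simplified] bl_sr[OF G, simplified])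

lemma bilin_sum_list: "left_module Z ==> (\<And>q. q \<in> set L ==> bilin X Y Z (F q)) ==>
  bilin X Y Z (\<lambda>x y. \<Sum>q\<leftarrow>L. F q x y)"
 by (induction L) (auto simp: bilin_zero bilin_plus)

text \<open>Bilinear forms with values in the ground field.\<close>

definition kbil :: "('a, 'x::ab_group_add) lmod \<Rightarrow> ('a, 'y::ab_group_add) lmod \<Rightarrow> ('x \<Rightarrow> 'y \<Rightarrow> 'k) \<Rightarrow> bool" where
 "kbil X Y \<beta> \<longleftrightarrow> (\<forall>x\<in>carr X. \<forall>y\<in>carr Y.
   (\<forall>x'\<in>carr X. \<beta> (x + x') y = \<beta> x y + \<beta> x' y) \<and> (\<forall>y'\<in>carr Y. \<beta> x (y + y') = \<beta> x y + \<beta> x y') \<and>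
   (\<forall>c. \<beta> (smul X c x) y = c * \<beta> x y \<and> \<beta> x (smul Y c y) = c * \<beta> x y))"

lemma tr_sum_list: "tr (\<Sum>x\<leftarrow>xs. f x) = (\<Sum>x\<leftarrow>xs. tr (f x))"
 by (induction xs) (simp_all add: tr_add tr_zero)

text \<open>Invariant bilinear maps to the regular module correspond to bilinear forms, by the symmetrizing form.\<close>

lemma kbil_bilin:
 assumes \<beta>: "kbil X Y \<beta>" and lm: "left_module X" "left_module Y"
 obtains B where "bilin X Y regular B"
  "\<And>a x y. x \<in> carr X ==> y \<in> carr Y ==> tr (a * B x y) = (\<Sum>p\<leftarrow>\<Delta> a. \<beta> (act X (fst p) x) (act Y (snd p) y))"
proof -
 have b: "\<beta> (x + x') y = \<beta> x y + \<beta> x' y" "\<beta> (smul X c x) y = c * \<beta> x y"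
   if "x \<in> carr X" "x' \<in> carr X" "y \<in> carr Y" for x x' y c
  using \<beta> that by (simp_all add: kbil_def)
 have b': "\<beta> x (y + y') = \<beta> x y + \<beta> x y'" "\<beta> x (smul Y c y) = c * \<beta> x y"
   if "x \<in> carr X" "y \<in> carr Y" "y' \<in> carr Y" for x y y' c
  using \<beta> that by (simp_all add: kbil_def)
 have kf: "kbilform (\<lambda>u v. \<beta> (act X u x) (act Y v y))" if "x \<in> carr X" "y \<in> carr Y" for x y
  unfolding kbilform_def using that lm by (simp add: lm_act_add_left act_scale lm_act b b')
 define B where "B x y = (SOME z. \<forall>a. tr (a * z) = (\<Sum>p\<leftarrow>\<Delta> a. \<beta> (act X (fst p) x) (act Y (snd p) y)))" for x y
 have B: "tr (a * B x y) = (\<Sum>p\<leftarrow>\<Delta> a. \<beta> (act X (fst p) x) (act Y (snd p) y))"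
  if xy: "x \<in> carr X" "y \<in> carr Y" for x y a
 proof -
  have "klin regular (\<lambda>a. \<Sum>p\<leftarrow>\<Delta> a. \<beta> (act X (fst p) x) (act Y (snd p) y))"
   unfolding klin_def using sweedler_add[OF kf[OF xy]] sweedler_scale[OF kf[OF xy]] by simp
  from someI_ex[OF tr_props(3)[OF this]] show ?thesis unfolding B_def by blast
 qed
 have "bilin X Y regular B"
 proof (rule bilinI)
  fix x x' y assume "x \<in> carr X" "x' \<in> carr X" "y \<in> carr Y"
  thus "B (x + x') y = B x y + B x' y" using lm
   by (intro tr_props(4)) (simp add: B lm_add distrib_left tr_add lm_act_add lm_act b sum_list_addf)
 next
  fix x y y' assume "x \<in> carr X" "y' \<in> carr Y" "y \<in> carr Y"
  thus "B x (y + y') = B x y + B x y'" using lm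
   by (intro tr_props(4)) (simp add: B lm_add distrib_left tr_add lm_act_add lm_act b' sum_list_addf)
 next
  fix c x y assume "x \<in> carr X" "y \<in> carr Y"
  thus "B (smul X c x) y = smul regular c (B x y)" "B x (smul Y c y) = smul regular c (B x y)"
   using lm
   by (auto intro!: tr_props(4) simp: B smul_in act_smul lm_act b b' scale_mult_right tr_scale sum_list_const_mult)
 next
  fix a x y assume xy: "x \<in> carr X" "y \<in> carr Y"
  show "act regular a (B x y) = (\<Sum>p\<leftarrow>\<Delta> a. B (act X (fst p) x) (act Y (snd p) y))"
  proof (rule tr_props(4))
   fix c
   have "tr (c * act regular a (B x y)) = (\<Sum>p\<leftarrow>\<Delta> (c * a). \<beta> (act X (fst p) x) (act Y (snd p) y))"
    using B[OF xy, of "c * a"] by (simp add: mult.assoc)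
   also have "\<dots> = (\<Sum>p\<leftarrow>\<Delta> c. \<Sum>q\<leftarrow>\<Delta> a. \<beta> (act X (fst p * fst q) x) (act Y (snd p * snd q) y))"
    by (rule sweedler_mult[OF kf[OF xy]])
   also have "\<dots> = (\<Sum>q\<leftarrow>\<Delta> a. \<Sum>p\<leftarrow>\<Delta> c. \<beta> (act X (fst p) (act X (fst q) x)) (act Y (snd p) (act Y (snd q) y)))"
    using xy lm by (subst sum_list_swap) (simp add: lm_mult)
   also have "\<dots> = (\<Sum>q\<leftarrow>\<Delta> a. tr (c * B (act X (fst q) x) (act Y (snd q) y)))"
    using xy lm by (intro sum_list_cong B[symmetric] lm_act)
   also have "\<dots> = tr (c * (\<Sum>p\<leftarrow>\<Delta> a. B (act X (fst p) x) (act Y (snd p) y)))"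
    by (simp add: sum_list_const_mult[symmetric] tr_sum_list)
   finally show "tr (c * act regular a (B x y)) = \<dots>" .
  qed
 qed auto
 thus thesis by (rule that) (rule B)
qed

lemma tr_bilin: assumes "bilin X Y regular G" "x \<in> carr X" "y \<in> carr Y"
 shows "tr (a * G x y) = (\<Sum>p\<leftarrow>\<Delta> a. tr (G (act X (fst p) x) (act Y (snd p) y)))"
 using bl_inv[OF assms, of a] by (simp add: tr_sum_list)

text \<open>Translated into bilinear forms, this extends a form that is given on \<open>X \<times> R\<close> and on \<open>P
 \<times> Y\<close>; linear retractions of \<open>P\<close> and \<open>R\<close> give the extension as an explicit
 combination of the two.\<close>

lemma bilin_extend_both:
 fixes X :: "('a, 'x::ab_group_add) lmod" and Y :: "('a, 'y::ab_group_add) lmod"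
  and P :: "('a, 'p::ab_group_add) lmod" and R :: "('a, 'r::ab_group_add) lmod"
 assumes lm: "left_module X" "left_module Y" "fg_module P" "fg_module R"
  and i: "i \<in> lhom X P" "inj_on i (carr X)" and k: "k \<in> lhom Y R" "inj_on k (carr Y)"
  and G1: "bilin P Y regular G1" and G2: "bilin X R regular G2"
  and agree: "\<And>x y. x \<in> carr X ==> y \<in> carr Y ==> G1 (i x) y = G2 x (k y)"
 obtains G where "bilin P R regular G" "\<And>p y. p \<in> carr P ==> y \<in> carr Y ==> G p (k y) = G1 p y"
  "\<And>x r. x \<in> carr X ==> r \<in> carr R ==> G (i x) r = G2 x r"
proof -
 have lP: "left_module P" and lR: "left_module R" using lm by (simp_all add: fg_lm)
 obtain \<rho> where \<rho>: "\<And>y. y \<in> carr P ==> \<rho> y \<in> carr X" "\<And>x. x \<in> carr X ==> \<rho> (i x) = x"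
  "\<And>x y. x \<in> carr P ==> y \<in> carr P ==> \<rho> (x + y) = \<rho> x + \<rho> y"
  "\<And>x c. x \<in> carr P ==> \<rho> (smul P c x) = smul X c (\<rho> x)"
  by (rule k_retraction_inj[OF lm(1,3) i]) (rule that)
 obtain \<sigma> where \<sigma>: "\<And>y. y \<in> carr R ==> \<sigma> y \<in> carr Y" "\<And>x. x \<in> carr Y ==> \<sigma> (k x) = x"
  "\<And>x y. x \<in> carr R ==> y \<in> carr R ==> \<sigma> (x + y) = \<sigma> x + \<sigma> y"
  "\<And>x c. x \<in> carr R ==> \<sigma> (smul R c x) = smul Y c (\<sigma> x)"
  by (rule k_retraction_inj[OF lm(2,4) k]) (rule that)
 \<comment> \<open>The last term accounts for the product of the two submodules, where both extensions are given.\<close>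
 define \<beta> where "\<beta> p r = tr (G1 p (\<sigma> r)) + (tr (G2 (\<rho> p) r) - tr (G1 (i (\<rho> p)) (\<sigma> r)))" for p r
 note ii = lhom_in[OF i(1)] lhom_add[OF i(1)] lhom_smul[OF i(1)]
 have "kbil P R \<beta>" unfolding kbil_def \<beta>_def
  using bl_addl[OF G1] bl_addr[OF G1] bl_addl[OF G2] bl_addr[OF G2]
   bl_sl[OF G1] bl_sr[OF G1] bl_sl[OF G2] bl_sr[OF G2]
  by (simp add: \<rho> \<sigma> ii tr_add tr_scale algebra_simps)
 then obtain G where G: "bilin P R regular G"
  "\<And>a x y. x \<in> carr P ==> y \<in> carr R ==> tr (a * G x y) = (\<Sum>p\<leftarrow>\<Delta> a. \<beta> (act P (fst p) x) (act R (snd p) y))"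
  by (rule kbil_bilin[OF _ lP lR]) (rule that)
 show thesis
 proof (rule that[OF G(1)])
  fix p y assume py: "p \<in> carr P" "y \<in> carr Y"
  have "\<beta> (act P u p) (act R v (k y)) = tr (G1 (act P u p) (act Y v y))" for u v
   using py lm lP lm_act[OF lP py(1)] lm_act[OF lm(2) py(2)]
   by (simp add: \<beta>_def lhom_act[OF k(1), symmetric] \<sigma> agree \<rho>)
  thus "G p (k y) = G1 p y"
   using py lhom_in[OF k(1)] by (intro tr_props(4)) (simp add: G(2) tr_bilin[OF G1])
 next
  fix x r assume xr: "x \<in> carr X" "r \<in> carr R"
  have "\<beta> (act P u (i x)) (act R v r) = tr (G2 (act X u x) (act R v r))" for u v
   using xr lm_act[OF lm(1) xr(1)] by (simp add: \<beta>_def lhom_act[OF i(1), symmetric] \<rho>)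
  thus "G (i x) r = G2 x r"
   using xr lhom_in[OF i(1)] by (intro tr_props(4)) (simp add: G(2) tr_bilin[OF G2])
 qed
qed

lemma bilin_extend:
 fixes X :: "('a, 'x::ab_group_add) lmod" and Y :: "('a, 'y::ab_group_add) lmod"
  and P :: "('a, 'p::ab_group_add) lmod" and R :: "('a, 'r::ab_group_add) lmod"
 assumes lm: "left_module X" "left_module Y" "fg_module P" "fg_module R"
  and i: "i \<in> lhom X P" "inj_on i (carr X)" and k: "k \<in> lhom Y R" "inj_on k (carr Y)"
  and G0: "bilin X Y regular G0"
 obtains G where "bilin P R regular G" "\<And>x y. x \<in> carr X ==> y \<in> carr Y ==> G (i x) (k y) = G0 x y"
proof -
 have lP: "left_module P" and lR: "left_module R" using lm by (simp_all add: fg_lm)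
 obtain \<rho> where \<rho>: "\<And>y. y \<in> carr P ==> \<rho> y \<in> carr X" "\<And>x. x \<in> carr X ==> \<rho> (i x) = x"
  "\<And>x y. x \<in> carr P ==> y \<in> carr P ==> \<rho> (x + y) = \<rho> x + \<rho> y"
  "\<And>x c. x \<in> carr P ==> \<rho> (smul P c x) = smul X c (\<rho> x)"
  by (rule k_retraction_inj[OF lm(1,3) i]) (rule that)
 obtain \<sigma> where \<sigma>: "\<And>y. y \<in> carr R ==> \<sigma> y \<in> carr Y" "\<And>x. x \<in> carr Y ==> \<sigma> (k x) = x"
  "\<And>x y. x \<in> carr R ==> y \<in> carr R ==> \<sigma> (x + y) = \<sigma> x + \<sigma> y"
  "\<And>x c. x \<in> carr R ==> \<sigma> (smul R c x) = smul Y c (\<sigma> x)"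
  by (rule k_retraction_inj[OF lm(2,4) k]) (rule that)
 have "kbil P R (\<lambda>p r. tr (G0 (\<rho> p) (\<sigma> r)))" unfolding kbil_def
  using bl_addl[OF G0] bl_addr[OF G0] bl_sl[OF G0] bl_sr[OF G0] by (simp add: \<rho> \<sigma> tr_add tr_scale)
 then obtain G where G: "bilin P R regular G"
  "\<And>a x y. x \<in> carr P ==> y \<in> carr R ==> tr (a * G x y) =
    (\<Sum>p\<leftarrow>\<Delta> a. tr (G0 (\<rho> (act P (fst p) x)) (\<sigma> (act R (snd p) y))))"
  by (rule kbil_bilin[OF _ lP lR]) (rule that)
 show thesis
 proof (rule that[OF G(1)])
  fix x y assume xy: "x \<in> carr X" "y \<in> carr Y"
  have "G0 (\<rho> (act P u (i x))) (\<sigma> (act R v (k y))) = G0 (act X u x) (act Y v y)" for u v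
   using xy lm_act[OF lm(1) xy(1)] lm_act[OF lm(2) xy(2)]
   by (simp add: lhom_act[OF i(1), symmetric] lhom_act[OF k(1), symmetric] \<rho> \<sigma>)
  thus "G (i x) (k y) = G0 x y"
   using xy lhom_in[OF i(1)] lhom_in[OF k(1)] by (intro tr_props(4)) (simp add: G(2) tr_bilin[OF G0])
 qed
qed

text \<open>The analogue of null maps for invariant bilinear maps: factorization through a free module.\<close>

definition bilin_null :: "('a, 'x::ab_group_add) lmod \<Rightarrow> ('a, 'y::ab_group_add) lmod \<Rightarrow> ('a, 'z::ab_group_add) lmod
  \<Rightarrow> ('x \<Rightarrow> 'y \<Rightarrow> 'z) \<Rightarrow> bool" where
 "bilin_null X Y Z B \<longleftrightarrow> bilin X Y Z B \<and>
   (\<exists>L. set L \<subseteq> {G. bilin X Y regular G} \<times> carr Z \<and>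
    (\<forall>x\<in>carr X. \<forall>y\<in>carr Y. B x y = (\<Sum>q\<leftarrow>L. act Z (fst q x y) (snd q))))"

lemma bilin_null_dual:
 assumes "bilin X Y C B" "dual_basis C" "f \<in> lhom C Z" "left_module X" "left_module Y" "bilin X Y Z D"
  "\<And>x y. x \<in> carr X ==> y \<in> carr Y ==> D x y = f (B x y)"
 shows "bilin_null X Y Z D"
proof -
 have lC: "left_module C" using assms(2) by (rule dual_basis_lm)
 from assms(2) obtain L where L: "set L \<subseteq> lhom C regular \<times> carr C"
  "\<forall>x\<in>carr C. x = (\<Sum>p\<leftarrow>L. act C (fst p x) (snd p))" by (auto simp: dual_basis_def)
 let ?L = "map (\<lambda>p. (\<lambda>x y. fst p (B x y), f (snd p))) L"
 have "set ?L \<subseteq> {G. bilin X Y regular G} \<times> carr Z"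
  by (auto dest!: subsetD[OF L(1)] intro: bilin_comp[OF assms(1) _ assms(4,5) lC] lhom_in[OF assms(3)])
 moreover have "D x y = (\<Sum>q\<leftarrow>?L. act Z (fst q x y) (snd q))" if xy: "x \<in> carr X" "y \<in> carr Y" for x y
 proof -
  have "D x y = f (\<Sum>p\<leftarrow>L. act C (fst p (B x y)) (snd p))"
   using L(2) bl_in[OF assms(1) xy] assms(7)[OF xy] by simp
  also have "\<dots> = (\<Sum>p\<leftarrow>L. f (act C (fst p (B x y)) (snd p)))"
   by (intro lhom_sum_list[OF assms(3) lC]) (auto dest!: subsetD[OF L(1)] intro: lm_act[OF lC])
  also have "\<dots> = (\<Sum>p\<leftarrow>L. act Z (fst p (B x y)) (f (snd p)))"
   using L(1) by (intro sum_list_cong lhom_act[OF assms(3)]) auto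
  finally show ?thesis by (simp add: o_def)
 qed
 ultimately show ?thesis unfolding bilin_null_def using assms(6) by blast
qed

text \<open>A dual basis of the target reduces the extension problem to maps into the regular module.\<close>

lemma bilin_extend_dual:
 fixes X :: "('a, 'x::ab_group_add) lmod" and Y :: "('a, 'y::ab_group_add) lmod"
  and P :: "('a, 'p::ab_group_add) lmod" and R :: "('a, 'r::ab_group_add) lmod"
  and C :: "('a, 'c::ab_group_add) lmod"
 assumes lm: "left_module X" "left_module Y" "fg_module P" "fg_module R" and C: "dual_basis C"
  and i: "i \<in> lhom X P" "inj_on i (carr X)" and k: "k \<in> lhom Y R" "inj_on k (carr Y)"
  and h1: "bilin P Y C h1" and h2: "bilin X R C h2"
  and agree: "\<And>x y. x \<in> carr X ==> y \<in> carr Y ==> h1 (i x) y = h2 x (k y)"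
 obtains h where "bilin P R C h" "\<And>p y. p \<in> carr P ==> y \<in> carr Y ==> h p (k y) = h1 p y"
  "\<And>x r. x \<in> carr X ==> r \<in> carr R ==> h (i x) r = h2 x r"
proof -
 have lP: "left_module P" and lR: "left_module R" and lC: "left_module C"
  using lm C by (simp_all add: fg_lm dual_basis_lm)
 from C obtain L where L: "set L \<subseteq> lhom C regular \<times> carr C"
  "\<And>x. x \<in> carr C ==> x = (\<Sum>p\<leftarrow>L. act C (fst p x) (snd p))" by (auto simp: dual_basis_def)
 have "\<exists>G. bilin P R regular G \<and> (\<forall>p\<in>carr P. \<forall>y\<in>carr Y. G p (k y) = g (h1 p y)) \<and>
   (\<forall>x\<in>carr X. \<forall>r\<in>carr R. G (i x) r = g (h2 x r))" if g: "g \<in> lhom C regular" for g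
 proof -
  have "bilin P Y regular (\<lambda>x y. g (h1 x y))" "bilin X R regular (\<lambda>x y. g (h2 x y))"
   by (rule bilin_comp[OF h1 g lP lm(2) lC], rule bilin_comp[OF h2 g lm(1) lR lC])
  then obtain G where "bilin P R regular G" "\<And>p y. p \<in> carr P ==> y \<in> carr Y ==> G p (k y) = g (h1 p y)"
    "\<And>x r. x \<in> carr X ==> r \<in> carr R ==> G (i x) r = g (h2 x r)"
   by (rule bilin_extend_both[OF lm i k]) (simp add: agree, rule that)
  thus ?thesis by blast
 qed
 then obtain E where E: "\<And>g. g \<in> lhom C regular ==> bilin P R regular (E g)"
  "\<And>g p y. g \<in> lhom C regular ==> p \<in> carr P ==> y \<in> carr Y ==> E g p (k y) = g (h1 p y)"
  "\<And>g x r. g \<in> lhom C regular ==> x \<in> carr X ==> r \<in> carr R ==> E g (i x) r = g (h2 x r)"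
  by metis
 show thesis
 proof (rule that)
  show "bilin P R C (\<lambda>p r. \<Sum>q\<leftarrow>L. act C (E (fst q) p r) (snd q))"
   using L(1) by (intro bilin_sum_list bilin_rank_one E lC) auto
  fix p y assume py: "p \<in> carr P" "y \<in> carr Y"
  have "(\<Sum>q\<leftarrow>L. act C (E (fst q) p (k y)) (snd q)) = (\<Sum>q\<leftarrow>L. act C (fst q (h1 p y)) (snd q))"
   using L(1) py E(2) by (intro sum_list_cong) auto
  thus "(\<Sum>q\<leftarrow>L. act C (E (fst q) p (k y)) (snd q)) = h1 p y"
   using L(2)[OF bl_in[OF h1 py]] by simp
 next
  fix x r assume xr: "x \<in> carr X" "r \<in> carr R"
  have "(\<Sum>q\<leftarrow>L. act C (E (fst q) (i x) r) (snd q)) = (\<Sum>q\<leftarrow>L. act C (fst q (h2 x r)) (snd q))"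
   using L(1) xr E(3) by (intro sum_list_cong) auto
  thus "(\<Sum>q\<leftarrow>L. act C (E (fst q) (i x) r) (snd q)) = h2 x r"
   using L(2)[OF bl_in[OF h2 xr]] by simp
 qed
qed

lemma bilin_null_extend:
 fixes X :: "('a, 'x::ab_group_add) lmod" and Y :: "('a, 'y::ab_group_add) lmod"
  and P :: "('a, 'p::ab_group_add) lmod" and R :: "('a, 'r::ab_group_add) lmod"
  and Z :: "('a, 'z::ab_group_add) lmod"
 assumes lm: "left_module X" "left_module Y" "fg_module P" "fg_module R" and Z: "left_module Z"
  and i: "i \<in> lhom X P" "inj_on i (carr X)" and k: "k \<in> lhom Y R" "inj_on k (carr Y)"
  and D: "bilin_null X Y Z D"
 obtains D' where "bilin P R Z D'" "\<And>x y. x \<in> carr X ==> y \<in> carr Y ==> D' (i x) (k y) = D x y"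
proof -
 from D obtain L where L: "set L \<subseteq> {G. bilin X Y regular G} \<times> carr Z"
  "\<And>x y. x \<in> carr X ==> y \<in> carr Y ==> D x y = (\<Sum>q\<leftarrow>L. act Z (fst q x y) (snd q))"
  by (auto simp: bilin_null_def)
 have "\<exists>G. bilin P R regular G \<and> (\<forall>x\<in>carr X. \<forall>y\<in>carr Y. G (i x) (k y) = g x y)"
  if g: "bilin X Y regular g" for g
 proof -
  obtain G where "bilin P R regular G" "\<And>x y. x \<in> carr X ==> y \<in> carr Y ==> G (i x) (k y) = g x y"
   by (rule bilin_extend[OF lm i k g]) (rule that)
  thus ?thesis by blast
 qed
 then obtain E where E: "\<And>g. bilin X Y regular g ==> bilin P R regular (E g)"
  "\<And>g x y. bilin X Y regular g ==> x \<in> carr X ==> y \<in> carr Y ==> E g (i x) (k y) = g x y"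
  by metis
 show thesis
 proof (rule that)
  show "bilin P R Z (\<lambda>p r. \<Sum>q\<leftarrow>L. act Z (E (fst q) p r) (snd q))"
   using L(1) by (intro bilin_sum_list bilin_rank_one E Z) auto
  fix x y assume xy: "x \<in> carr X" "y \<in> carr Y"
  have "(\<Sum>q\<leftarrow>L. act Z (E (fst q) (i x) (k y)) (snd q)) = (\<Sum>q\<leftarrow>L. act Z (fst q x y) (snd q))"
   using L(1) xy E(2) by (intro sum_list_cong) auto
  thus "(\<Sum>q\<leftarrow>L. act Z (E (fst q) (i x) (k y)) (snd q)) = D x y"
   using L(2)[OF xy] by simp
 qed
qed

lemma bilin_factor:
 assumes lm: "left_module P" "left_module R" "left_module X" "left_module Y"
  and p: "p \<in> lhom P X" "p ` carr P = carr X" and q: "q \<in> lhom R Y" "q ` carr R = carr Y"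
  and B: "bilin P R Z B"
  and z1: "\<And>x r. x \<in> carr P ==> p x = 0 ==> r \<in> carr R ==> B x r = 0"
  and z2: "\<And>x r. x \<in> carr P ==> q r = 0 ==> r \<in> carr R ==> B x r = 0"
 obtains B' where "bilin X Y Z B'" "\<And>x r. x \<in> carr P ==> r \<in> carr R ==> B' (p x) (q r) = B x r"
proof -
 define s where "s = inv_into (carr P) p"
 define t where "t = inv_into (carr R) q"
 have s: "s x \<in> carr P" "p (s x) = x" if "x \<in> carr X" for x
  using that p(2) by (auto simp: s_def inv_into_into f_inv_into_f)
 have t: "t x \<in> carr R" "q (t x) = x" if "x \<in> carr Y" for x
  using that q(2) by (auto simp: t_def inv_into_into f_inv_into_f)
 have eq: "B x r = B x' r'" if "x \<in> carr P" "x' \<in> carr P" "r \<in> carr R" "r' \<in> carr R" "p x = p x'" "q r = q r'" for x x' r r'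
 proof -
  have "B (x - x') r = 0" using that lm by (intro z1) (simp_all add: lm_diff lhom_diff[OF p(1)])
  moreover have "B x' (r - r') = 0" using that lm by (intro z2) (simp_all add: lm_diff lhom_diff[OF q(1)])
  ultimately show ?thesis using that by (simp add: bl_minusl[OF B lm(1)] bl_minusr[OF B lm(2)])
 qed
 have eqs: "B (s (p x)) (t (q r)) = B x r" if "x \<in> carr P" "r \<in> carr R" for x r
  using that s[of "p x"] t[of "q r"] lhom_in[OF p(1)] lhom_in[OF q(1)] by (intro eq) auto
 show thesis
 proof (rule that)
  show "bilin X Y Z (\<lambda>x y. B (s x) (t y))"
  proof (rule bilinI)
   fix x y assume xy: "x \<in> carr X" "y \<in> carr Y"
   show "B (s x) (t y) \<in> carr Z" using xy s t by (simp add: bl_in[OF B])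
   show "B (s (x + x')) (t y) = B (s x) (t y) + B (s x') (t y)" if "x' \<in> carr X" for x'
    using xy s t that lm by (subst bl_addl[OF B, symmetric]) (auto intro!: eq simp: lm_add lhom_add[OF p(1)])
   show "B (s x) (t (y + y')) = B (s x) (t y) + B (s x) (t y')" if "y' \<in> carr Y" for y'
    using xy s t that lm by (subst bl_addr[OF B, symmetric]) (auto intro!: eq simp: lm_add lhom_add[OF q(1)])
   show "B (s (smul X c x)) (t y) = smul Z c (B (s x) (t y))" for c
    using xy s t lm by (subst bl_sl[OF B, symmetric]) (auto intro!: eq simp: smul_in lhom_smul[OF p(1)])
   show "B (s x) (t (smul Y c y)) = smul Z c (B (s x) (t y))" for c
    using xy s t lm by (subst bl_sr[OF B, symmetric]) (auto intro!: eq simp: smul_in lhom_smul[OF q(1)])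
   show "act Z a (B (s x) (t y)) = (\<Sum>c\<leftarrow>\<Delta> a. B (s (act X (fst c) x)) (t (act Y (snd c) y)))" for a
    using xy s t lm by (subst bl_inv[OF B]) (auto intro!: sum_list_cong eq simp: lm_act lhom_act[OF p(1)] lhom_act[OF q(1)])
  qed
 qed (rule eqs)
qed

lemma bilin_extend_to_dual:
 fixes X :: "('a, 'x::ab_group_add) lmod" and Y :: "('a, 'y::ab_group_add) lmod"
  and P :: "('a, 'p::ab_group_add) lmod" and R :: "('a, 'r::ab_group_add) lmod"
  and C :: "('a, 'c::ab_group_add) lmod"
 assumes lm: "left_module X" "left_module Y" "fg_module P" "fg_module R" and C: "dual_basis C"
  and i: "i \<in> lhom X P" "inj_on i (carr X)" and k: "k \<in> lhom Y R" "inj_on k (carr Y)"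
  and B: "bilin X Y C B"
 shows "\<exists>h. bilin P R C h \<and> (\<forall>x\<in>carr X. \<forall>y\<in>carr Y. h (i x) (k y) = B x y)"
proof -
 have lC: "left_module C" using C by (rule dual_basis_lm)
 have "restr C (\<lambda>x. x) (B x y) = B x y" if "x \<in> carr X" "y \<in> carr Y" for x y using bl_in[OF B that] by simp
 hence "bilin_null X Y C B"
  by (intro bilin_null_dual[OF B C restr_id[OF lC] lm(1,2) B]) simp
 then obtain h where "bilin P R C h" "\<And>x y. x \<in> carr X ==> y \<in> carr Y ==> h (i x) (k y) = B x y"
  by (rule bilin_null_extend[OF lm lC i k]) (rule that)
 thus ?thesis by blast
qed

lemma bilin_cong: assumes "bilin X Y Z B" "left_module X" "left_module Y"
  "\<And>x y. x \<in> carr X ==> y \<in> carr Y ==> B x y = B' x y"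
 shows "bilin X Y Z B'"
 using assms(1,2,3) unfolding bilin_def by (simp add: assms(4)[symmetric] lm_add lm_act smul_in)

end

context hopf_heller begin

section \<open>Graded commutativity\<close>

text \<open>A map of short exact sequences in the first variable; it moves the first variable and the value down by one.\<close>

definition bladder1 :: "int \<Rightarrow> int \<Rightarrow> int \<Rightarrow> ('u \<Rightarrow> 'u \<Rightarrow> 'u) \<Rightarrow> ('u \<Rightarrow> 'u \<Rightarrow> 'u) \<Rightarrow> bool" where
 "bladder1 i j l B B' \<longleftrightarrow> (\<exists>h. bilin (Cov H i) (Om H j) (Cov H l) h \<and>
   (\<forall>x\<in>carr (Om H (i + 1)). \<forall>y\<in>carr (Om H j). h (inc H i x) y = inc H l (B x y)) \<and>
   (\<forall>x\<in>carr (Cov H i). \<forall>y\<in>carr (Om H j). prj H l (h x y) = B' (prj H i x) y))"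

definition bladder2 :: "int \<Rightarrow> int \<Rightarrow> int \<Rightarrow> ('u \<Rightarrow> 'u \<Rightarrow> 'u) \<Rightarrow> ('u \<Rightarrow> 'u \<Rightarrow> 'u) \<Rightarrow> bool" where
 "bladder2 i j l B B' \<longleftrightarrow> (\<exists>h. bilin (Om H i) (Cov H j) (Cov H l) h \<and>
   (\<forall>x\<in>carr (Om H i). \<forall>y\<in>carr (Om H (j + 1)). h x (inc H j y) = inc H l (B x y)) \<and>
   (\<forall>x\<in>carr (Om H i). \<forall>y\<in>carr (Cov H j). prj H l (h x y) = B' x (prj H j y)))"

abbreviation bhom :: "int \<Rightarrow> int \<Rightarrow> int \<Rightarrow> ('u \<Rightarrow> 'u \<Rightarrow> 'u) \<Rightarrow> bool" where
 "bhom i j l \<equiv> bilin (Om H i) (Om H j) (Om H l)"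

abbreviation bnul :: "int \<Rightarrow> int \<Rightarrow> int \<Rightarrow> ('u \<Rightarrow> 'u \<Rightarrow> 'u) \<Rightarrow> bool" where
 "bnul i j l \<equiv> bilin_null (Om H i) (Om H j) (Om H l)"

lemma idm_surj: "idm j ` carr (Om H j) = carr (Om H j)" and idm_inj: "inj_on (idm j) (carr (Om H j))"
 by (auto simp: inj_on_def)

lemma bladder1_ex: assumes B: "bhom (i + 1) j (l + 1) B"
 obtains B' where "bhom i j l B'" "bladder1 i j l B B'"
proof -
 have incB: "bilin (Om H (i + 1)) (Om H j) (Cov H l) (\<lambda>x y. inc H l (B x y))"
  by (rule bilin_comp[OF B inc_lhom]) simp_all
 obtain h where h: "bilin (Cov H i) (Om H j) (Cov H l) h"
  "\<And>x y. x \<in> carr (Om H (i + 1)) ==> y \<in> carr (Om H j) ==> h (inc H i x) (idm j y) = inc H l (B x y)"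
  using bilin_extend_to_dual[OF Om_lm Om_lm Cov_fg Om_fg Cov_dual inc_lhom inc_inj idm_hom idm_inj incB] by blast
 have h': "h (inc H i x) y = inc H l (B x y)" if "x \<in> carr (Om H (i + 1))" "y \<in> carr (Om H j)" for x y
  using h(2)[OF that] that by simp
 have ph: "bilin (Cov H i) (Om H j) (Om H l) (\<lambda>x y. prj H l (h x y))"
  by (rule bilin_comp[OF h(1) prj_lhom]) simp_all
 obtain B' where B': "bhom i j l B'"
  "\<And>x r. x \<in> carr (Cov H i) ==> r \<in> carr (Om H j) ==> B' (prj H i x) (idm j r) = prj H l (h x r)"
 proof (rule bilin_factor[OF Cov_lm Om_lm Om_lm Om_lm prj_lhom prj_surj idm_hom idm_surj ph])
  show "prj H l (h x r) = 0" if x: "x \<in> carr (Cov H i)" "prj H i x = 0" "r \<in> carr (Om H j)" for x r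
  proof -
   obtain x' where "x' \<in> carr (Om H (i + 1))" "x = inc H i x'" using ker_prj[OF x(1,2)] by blast
   thus ?thesis using x h' bl_in[OF B] by (simp add: prj_inc)
  qed
  show "prj H l (h x r) = 0" if "x \<in> carr (Cov H i)" "idm j r = 0" "r \<in> carr (Om H j)" for x r
   using that bl_zeror[OF ph Om_lm, of x] by simp
 qed (rule that)
 show thesis
 proof (rule that[OF B'(1)])
  show "bladder1 i j l B B'" unfolding bladder1_def using h(1) h' B'(2) by (intro exI[of _ h]) auto
 qed
qed

lemma bladder2_ex: assumes B: "bhom i (j + 1) (l + 1) B"
 obtains B' where "bhom i j l B'" "bladder2 i j l B B'"
proof -
 have incB: "bilin (Om H i) (Om H (j + 1)) (Cov H l) (\<lambda>x y. inc H l (B x y))"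
  by (rule bilin_comp[OF B inc_lhom]) simp_all
 obtain h where h: "bilin (Om H i) (Cov H j) (Cov H l) h"
  "\<And>x y. x \<in> carr (Om H i) ==> y \<in> carr (Om H (j + 1)) ==> h (idm i x) (inc H j y) = inc H l (B x y)"
  using bilin_extend_to_dual[OF Om_lm Om_lm Om_fg Cov_fg Cov_dual idm_hom idm_inj inc_lhom inc_inj incB] by blast
 have h': "h x (inc H j y) = inc H l (B x y)" if "x \<in> carr (Om H i)" "y \<in> carr (Om H (j + 1))" for x y
  using h(2)[OF that] that by simp
 have ph: "bilin (Om H i) (Cov H j) (Om H l) (\<lambda>x y. prj H l (h x y))"
  by (rule bilin_comp[OF h(1) prj_lhom]) simp_all
 obtain B' where B': "bhom i j l B'"
  "\<And>x r. x \<in> carr (Om H i) ==> r \<in> carr (Cov H j) ==> B' (idm i x) (prj H j r) = prj H l (h x r)"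
 proof (rule bilin_factor[OF Om_lm Cov_lm Om_lm Om_lm idm_hom idm_surj prj_lhom prj_surj ph])
  show "prj H l (h x r) = 0" if x: "x \<in> carr (Om H i)" "prj H j r = 0" "r \<in> carr (Cov H j)" for x r
  proof -
   obtain x' where "x' \<in> carr (Om H (j + 1))" "r = inc H j x'" using ker_prj[OF x(3,2)] by blast
   thus ?thesis using x h' bl_in[OF B] by (simp add: prj_inc)
  qed
  show "prj H l (h x r) = 0" if "x \<in> carr (Om H i)" "idm i x = 0" "r \<in> carr (Cov H j)" for x r
   using that bl_zerol[OF ph Om_lm, of r] by simp
 qed (rule that)
 show thesis
 proof (rule that[OF B'(1)])
  show "bladder2 i j l B B'" unfolding bladder2_def using h(1) h' B'(2) by (intro exI[of _ h]) auto
 qed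
qed

text \<open>The bilinear map on the cover differs from a null extension by a map that factors through the projection.\<close>

lemma bladder1_null:
 assumes "bladder1 i j l D D'" "bnul (i + 1) j (l + 1) D" "bhom i j l D'" shows "bnul i j l D'"
proof -
 obtain h where h: "bilin (Cov H i) (Om H j) (Cov H l) h"
   "\<And>x y. x \<in> carr (Om H (i + 1)) ==> y \<in> carr (Om H j) ==> h (inc H i x) y = inc H l (D x y)"
   "\<And>x y. x \<in> carr (Cov H i) ==> y \<in> carr (Om H j) ==> prj H l (h x y) = D' (prj H i x) y"
  using assms(1) unfolding bladder1_def by blast
 obtain E where E: "bilin (Cov H i) (Om H j) (Om H (l + 1)) E"
  "\<And>x y. x \<in> carr (Om H (i + 1)) ==> y \<in> carr (Om H j) ==> E (inc H i x) (idm j y) = D x y"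
  by (rule bilin_null_extend[OF Om_lm Om_lm Cov_fg Om_fg Om_lm inc_lhom inc_inj idm_hom idm_inj assms(2)]) (rule that)
 have E': "E (inc H i x) y = D x y" if "x \<in> carr (Om H (i + 1))" "y \<in> carr (Om H j)" for x y
  using E(2)[OF that] that by simp
 have K: "bilin (Cov H i) (Om H j) (Cov H l) (\<lambda>x y. h x y - inc H l (E x y))"
  by (intro bilin_minus h(1) bilin_comp[OF E(1) inc_lhom]) simp_all
 obtain W where W: "bilin (Om H i) (Om H j) (Cov H l) W"
  "\<And>x r. x \<in> carr (Cov H i) ==> r \<in> carr (Om H j) ==> W (prj H i x) (idm j r) = h x r - inc H l (E x r)"
 proof (rule bilin_factor[OF Cov_lm Om_lm Om_lm Om_lm prj_lhom prj_surj idm_hom idm_surj K])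
  show "h x r - inc H l (E x r) = 0" if x: "x \<in> carr (Cov H i)" "prj H i x = 0" "r \<in> carr (Om H j)" for x r
  proof -
   obtain x' where "x' \<in> carr (Om H (i + 1))" "x = inc H i x'" using ker_prj[OF x(1,2)] by blast
   thus ?thesis using x h(2) E' by simp
  qed
  show "h x r - inc H l (E x r) = 0" if "x \<in> carr (Cov H i)" "idm j r = 0" "r \<in> carr (Om H j)" for x r
   using that bl_zeror[OF K Om_lm, of x] by simp
 qed (rule that)
 show ?thesis
 proof (rule bilin_null_dual[OF W(1) Cov_dual prj_lhom Om_lm Om_lm assms(3)])
  fix z y assume "z \<in> carr (Om H i)" and y: "y \<in> carr (Om H j)"
  then obtain x where x: "x \<in> carr (Cov H i)" "z = prj H i x" using prj_surj[of i] by auto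
  have "prj H l (W z y) = prj H l (h x y) - prj H l (inc H l (E x y))"
   using W(2)[OF x(1) y] x y bl_in[OF h(1) x(1) y] lhom_in[OF inc_lhom bl_in[OF E(1) x(1) y]]
   by (simp add: lhom_diff[OF prj_lhom])
  thus "D' z y = prj H l (W z y)" using x y h(3) bl_in[OF E(1) x(1) y] by (simp add: prj_inc)
 qed
qed

text \<open>Extending to the product of two covers and comparing the two ways round the square of short exact sequences: the
 two composite shifts are the two parts of a map that is defined on the product of the covers, whence the sign.\<close>

lemma bladder_anticommute:
 assumes B: "bhom (i + 1) (j + 1) (l + 1 + 1) B" and B1: "bhom i (j + 1) (l + 1) B1" and B2: "bhom (i + 1) j (l + 1) B2"
  and B12: "bhom i j l B12" and B21: "bhom i j l B21"
  and b1: "bladder1 i (j + 1) (l + 1) B B1" and b2: "bladder2 (i + 1) j (l + 1) B B2"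
  and b12: "bladder2 i j l B1 B12" and b21: "bladder1 i j l B2 B21"
 shows "bnul i j l (\<lambda>x y. B12 x y + B21 x y)"
proof -
 obtain h1 where h1: "bilin (Cov H i) (Om H (j + 1)) (Cov H (l + 1)) h1"
   "\<And>x y. x \<in> carr (Om H (i + 1)) ==> y \<in> carr (Om H (j + 1)) ==> h1 (inc H i x) y = inc H (l + 1) (B x y)"
   "\<And>x y. x \<in> carr (Cov H i) ==> y \<in> carr (Om H (j + 1)) ==> prj H (l + 1) (h1 x y) = B1 (prj H i x) y"
  using b1 unfolding bladder1_def by blast
 obtain h2 where h2: "bilin (Om H (i + 1)) (Cov H j) (Cov H (l + 1)) h2"
   "\<And>x y. x \<in> carr (Om H (i + 1)) ==> y \<in> carr (Om H (j + 1)) ==> h2 x (inc H j y) = inc H (l + 1) (B x y)"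
   "\<And>x y. x \<in> carr (Om H (i + 1)) ==> y \<in> carr (Cov H j) ==> prj H (l + 1) (h2 x y) = B2 x (prj H j y)"
  using b2 unfolding bladder2_def by blast
 obtain u where u: "bilin (Om H i) (Cov H j) (Cov H l) u"
   "\<And>x y. x \<in> carr (Om H i) ==> y \<in> carr (Om H (j + 1)) ==> u x (inc H j y) = inc H l (B1 x y)"
   "\<And>x y. x \<in> carr (Om H i) ==> y \<in> carr (Cov H j) ==> prj H l (u x y) = B12 x (prj H j y)"
  using b12 unfolding bladder2_def by blast
 obtain v where v: "bilin (Cov H i) (Om H j) (Cov H l) v"
   "\<And>x y. x \<in> carr (Om H (i + 1)) ==> y \<in> carr (Om H j) ==> v (inc H i x) y = inc H l (B2 x y)"
   "\<And>x y. x \<in> carr (Cov H i) ==> y \<in> carr (Om H j) ==> prj H l (v x y) = B21 (prj H i x) y"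
  using b21 unfolding bladder1_def by blast
 obtain h where h: "bilin (Cov H i) (Cov H j) (Cov H (l + 1)) h"
  "\<And>p y. p \<in> carr (Cov H i) ==> y \<in> carr (Om H (j + 1)) ==> h p (inc H j y) = h1 p y"
  "\<And>x r. x \<in> carr (Om H (i + 1)) ==> r \<in> carr (Cov H j) ==> h (inc H i x) r = h2 x r"
 proof (rule bilin_extend_dual[OF Om_lm Om_lm Cov_fg Cov_fg Cov_dual inc_lhom inc_inj inc_lhom inc_inj h1(1) h2(1)])
  show "h1 (inc H i x) y = h2 x (inc H j y)" if "x \<in> carr (Om H (i + 1))" "y \<in> carr (Om H (j + 1))" for x y
   using that by (simp add: h1(2) h2(2))
 qed (rule that)
 define D where "D p r = inc H l (prj H (l + 1) (h p r)) - (u (prj H i p) r + v p (prj H j r))" for p r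
 have idc: "restr (Cov H i) (\<lambda>x. x) \<in> lhom (Cov H i) (Cov H i)" for i by (simp add: restr_id)
 have bu: "bilin (Cov H i) (Cov H j) (Cov H l) (\<lambda>p r. u (prj H i p) (restr (Cov H j) (\<lambda>x. x) r))"
  by (rule bilin_pre[OF u(1) prj_lhom idc]) simp_all
 have bv: "bilin (Cov H i) (Cov H j) (Cov H l) (\<lambda>p r. v (restr (Cov H i) (\<lambda>x. x) p) (prj H j r))"
  by (rule bilin_pre[OF v(1) idc prj_lhom]) simp_all
 have bh: "bilin (Cov H i) (Cov H j) (Cov H l) (\<lambda>p r. inc H l (prj H (l + 1) (h p r)))"
  by (intro bilin_comp[OF bilin_comp[OF h(1) prj_lhom] inc_lhom]) simp_all
 have "bilin (Cov H i) (Cov H j) (Cov H l) (\<lambda>p r. inc H l (prj H (l + 1) (h p r)) -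
   (u (prj H i p) (restr (Cov H j) (\<lambda>x. x) r) + v (restr (Cov H i) (\<lambda>x. x) p) (prj H j r)))"
  by (intro bilin_minus bilin_plus bu bv bh) simp_all
 hence bD: "bilin (Cov H i) (Cov H j) (Cov H l) D"
  by (rule bilin_cong) (simp_all add: D_def)
 obtain D' where D': "bilin (Om H i) (Om H j) (Cov H l) D'"
  "\<And>x r. x \<in> carr (Cov H i) ==> r \<in> carr (Cov H j) ==> D' (prj H i x) (prj H j r) = D x r"
 proof (rule bilin_factor[OF Cov_lm Cov_lm Om_lm Om_lm prj_lhom prj_surj prj_lhom prj_surj bD])
  show "D x r = 0" if x: "x \<in> carr (Cov H i)" "prj H i x = 0" "r \<in> carr (Cov H j)" for x r
  proof -
   obtain x' where x': "x' \<in> carr (Om H (i + 1))" "x = inc H i x'" using ker_prj[OF x(1,2)] by blast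
   have "u 0 r = 0" by (rule bl_zerol[OF u(1) Om_lm x(3)])
   thus ?thesis using x x' lhom_in[OF prj_lhom x(3)] by (simp add: D_def h(3) h2(3) v(2))
  qed
  show "D x r = 0" if x: "x \<in> carr (Cov H i)" "prj H j r = 0" "r \<in> carr (Cov H j)" for x r
  proof -
   obtain y where y: "y \<in> carr (Om H (j + 1))" "r = inc H j y" using ker_prj[OF x(3,2)] by blast
   have "v x 0 = 0" by (rule bl_zeror[OF v(1) Om_lm x(1)])
   thus ?thesis using x y lhom_in[OF prj_lhom x(1)] by (simp add: D_def h(2) h1(3) u(2))
  qed
 qed (rule that)
 have m: "restr (Om H l) (\<lambda>x. - x) \<in> hom l l"
  by (rule restr_lhomI) (simp_all add: lm_minus lm_act_minus)
 show ?thesis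
 proof (rule bilin_null_dual[OF D'(1) Cov_dual lhom_comp[OF prj_lhom m Om_lm] Om_lm Om_lm bilin_plus[OF B12 B21 Om_lm]])
  fix x y assume "x \<in> carr (Om H i)" "y \<in> carr (Om H j)"
  then obtain p r where p: "p \<in> carr (Cov H i)" "x = prj H i p" and r: "r \<in> carr (Cov H j)" "y = prj H j r"
   using prj_surj[of i] prj_surj[of j] by (metis imageE)
  note pi = lhom_in[OF prj_lhom p(1)] and pj = lhom_in[OF prj_lhom r(1)]
  have hr: "prj H (l + 1) (h p r) \<in> carr (Om H (l + 1))" by (rule lhom_in[OF prj_lhom bl_in[OF h(1) p(1) r(1)]])
  have "prj H l (D' x y) = prj H l (inc H l (prj H (l + 1) (h p r)) - (u (prj H i p) r + v p (prj H j r)))"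
   unfolding p(2) r(2) D'(2)[OF p(1) r(1)] D_def ..
  also have "\<dots> = - (B12 x y + B21 x y)"
   using p r pi pj bl_in[OF u(1) pi r(1)] bl_in[OF v(1) p(1) pj] lhom_in[OF inc_lhom hr] u(3)[OF pi r(1)] v(3)[OF p(1) pj]
   by (simp add: lhom_diff[OF prj_lhom] lm_add lhom_add[OF prj_lhom] prj_inc[OF hr])
  finally show "B12 x y + B21 x y = (restr (Om H l) (\<lambda>x. - x) \<circ> prj H l) (D' x y)"
   using lhom_in[OF prj_lhom bl_in[OF D'(1) \<open>x \<in> carr (Om H i)\<close> \<open>y \<in> carr (Om H j)\<close>]] by simp
 qed
qed

lemma scalar_pairing:
 fixes N :: "('a, 'n::ab_group_add) lmod"
 assumes N: "left_module N" shows "bilin (Om H 0) N N (\<lambda>s y. smul N (core_in H s) y)"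
proof (rule bilinI)
 fix a s y assume s: "s \<in> carr (Om H 0)" and y: "y \<in> carr N"
 have "act N a (smul N (core_in H s) y) = smul N (core_in H s) (act N a y)"
  using y N by (simp add: act_smul)
 also have "act N a y = (\<Sum>p\<leftarrow>\<Delta> a. act N (scale (\<epsilon> (fst p)) (snd p)) y)"
  using counit_left[of a] lm_sum_act[OF N y, of "\<lambda>p. scale (\<epsilon> (fst p)) (snd p)" "\<Delta> a"] by (simp add: split_def)
 also have "smul N (core_in H s) \<dots> = (\<Sum>p\<leftarrow>\<Delta> a. smul N (core_in H s) (act N (scale (\<epsilon> (fst p)) (snd p)) y))"
  unfolding smul_def using y N by (intro lm_act_sum_list) (simp_all add: lm_act)
 also have "\<dots> = (\<Sum>p\<leftarrow>\<Delta> a. smul N (core_in H (act (Om H 0) (fst p) s)) (act N (snd p) y))"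
  using s y N by (intro sum_list_cong) (simp add: lhom_act[OF core_in_lhom] smul_def lm_mult[symmetric] lm_act scale_mult_left mult.commute
    scale_one_mult)
 finally show "act N a (smul N (core_in H s) y) = \<dots>" .
next
 fix c s y assume s: "s \<in> carr (Om H 0)" and y: "y \<in> carr N"
 have m: "smul N (c * d) y = smul N c (smul N d y)" for c d
  using y N by (simp add: smul_def lm_mult[symmetric] scale_one_mult mult.commute)
 show "smul N (core_in H (smul (Om H 0) c s)) y = smul N c (smul N (core_in H s) y)"
  by (simp only: lhom_smul[OF core_in_lhom s] smul_T m)
 show "smul N (core_in H s) (smul N c y) = smul N c (smul N (core_in H s) y)"
  by (simp only: m[symmetric] mult.commute)
qed (auto simp: N smul_in smul_add lhom_add[OF core_in_lhom] smul_def lm_act_add_left scale_left_distrib lm_act lm_act_add)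

text \<open>The pairing of \<open>\<Omega>\<^sup>-\<^sup>a k\<close> and \<open>\<Omega>\<^sup>-\<^sup>b k\<close> is obtained
 from the action of \<open>k\<close> on \<open>\<Omega>\<^sup>-\<^sup>b k\<close> by shifting the first variable
 \<open>a\<close> times.\<close>

lemma pairings_ex: "\<exists>\<Theta>. (\<forall>b y s. \<Theta> 0 b s y = smul (Om H (- int b)) (core_in H s) y) \<and>
  (\<forall>a b. bhom (- int a) (- int b) (- int a - int b) (\<Theta> a b) \<and>
    bladder1 (- int (Suc a)) (- int b) (- int (Suc a) - int b) (\<Theta> a b) (\<Theta> (Suc a) b))"
proof -
 have "\<exists>\<Theta>. \<forall>a. (bhom (- int a) (- int b) (- int a - int b) (\<Theta> a) \<and>
    (a = 0 \<longrightarrow> \<Theta> a = (\<lambda>s y. smul (Om H (- int b)) (core_in H s) y))) \<and>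
   bladder1 (- int (Suc a)) (- int b) (- int (Suc a) - int b) (\<Theta> a) (\<Theta> (Suc a))" for b
 proof (rule dependent_nat_choice)
  show "\<exists>B. bhom (- int 0) (- int b) (- int 0 - int b) B \<and>
    (0 = (0::nat) \<longrightarrow> B = (\<lambda>s y. smul (Om H (- int b)) (core_in H s) y))"
   using scalar_pairing[of "Om H (- int b)"] by simp
 next
  fix B a assume B: "bhom (- int a) (- int b) (- int a - int b) B \<and>
    (a = 0 \<longrightarrow> B = (\<lambda>s y. smul (Om H (- int b)) (core_in H s) y))"
  hence "bhom (- int (Suc a) + 1) (- int b) (- int (Suc a) - int b + 1) B" by (simp add: algebra_simps)
  then obtain B' where "bhom (- int (Suc a)) (- int b) (- int (Suc a) - int b) B'"
   "bladder1 (- int (Suc a)) (- int b) (- int (Suc a) - int b) B B'" by (rule bladder1_ex)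
  thus "\<exists>B'. (bhom (- int (Suc a)) (- int b) (- int (Suc a) - int b) B' \<and>
    (Suc a = 0 \<longrightarrow> B' = (\<lambda>s y. smul (Om H (- int b)) (core_in H s) y))) \<and>
    bladder1 (- int (Suc a)) (- int b) (- int (Suc a) - int b) B B'" by blast
 qed
 then obtain \<Theta> where \<Theta>: "\<And>b a. (bhom (- int a) (- int b) (- int a - int b) (\<Theta> b a) \<and>
    (a = 0 \<longrightarrow> \<Theta> b a = (\<lambda>s y. smul (Om H (- int b)) (core_in H s) y))) \<and>
   bladder1 (- int (Suc a)) (- int b) (- int (Suc a) - int b) (\<Theta> b a) (\<Theta> b (Suc a))" by metis
 show ?thesis
 proof (intro exI[of _ "\<lambda>a b. \<Theta> b a"] conjI allI)
  show "\<Theta> b 0 s y = smul (Om H (- int b)) (core_in H s) y" for b s y using \<Theta>[of 0 b] by simp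
 qed (use \<Theta> in blast)+
qed

lemma bilin_null_plus: assumes "bilin_null X Y Z B" "bilin_null X Y Z C" "left_module Z"
 shows "bilin_null X Y Z (\<lambda>x y. B x y + C x y)"
proof -
 from assms obtain L L' where "set L \<subseteq> {G. bilin X Y regular G} \<times> carr Z" "set L' \<subseteq> {G. bilin X Y regular G} \<times> carr Z"
  "\<forall>x\<in>carr X. \<forall>y\<in>carr Y. B x y = (\<Sum>q\<leftarrow>L. act Z (fst q x y) (snd q))"
  "\<forall>x\<in>carr X. \<forall>y\<in>carr Y. C x y = (\<Sum>q\<leftarrow>L'. act Z (fst q x y) (snd q))"
  unfolding bilin_null_def by blast
 thus ?thesis using assms unfolding bilin_null_def
  by (intro conjI exI[of _ "L @ L'"]) (auto intro: bilin_plus)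
qed

lemma bilin_null_uminus: assumes "bilin_null X Y Z B" "left_module Z"
 shows "bilin_null X Y Z (\<lambda>x y. - B x y)"
proof -
 from assms obtain L where L: "set L \<subseteq> {G. bilin X Y regular G} \<times> carr Z"
  "\<forall>x\<in>carr X. \<forall>y\<in>carr Y. B x y = (\<Sum>q\<leftarrow>L. act Z (fst q x y) (snd q))"
  unfolding bilin_null_def by blast
 have "(\<Sum>q\<leftarrow>map (\<lambda>q. (fst q, - snd q)) L. act Z (fst q x y) (snd q)) = (\<Sum>q\<leftarrow>L. - act Z (fst q x y) (snd q))" for x y
  unfolding map_map o_def fst_conv snd_conv using assms(2)
  by (intro sum_list_cong) (auto dest!: subsetD[OF L(1)] simp: lm_act_minus)
 hence "\<forall>x\<in>carr X. \<forall>y\<in>carr Y. - B x y = (\<Sum>q\<leftarrow>map (\<lambda>q. (fst q, - snd q)) L. act Z (fst q x y) (snd q))"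
  using L(2) by (simp add: sum_list_uminus)
 moreover have "set (map (\<lambda>q. (fst q, - snd q)) L) \<subseteq> {G. bilin X Y regular G} \<times> carr Z"
  using assms(2) by (auto dest!: subsetD[OF L(1)] simp: lm_minus)
 ultimately show ?thesis using assms unfolding bilin_null_def by (blast intro: bilin_uminus)
qed

lemma bilin_null_zero: "left_module Z ==> bilin_null X Y Z (\<lambda>x y. 0)"
 unfolding bilin_null_def by (auto simp: bilin_zero intro!: exI[of _ "[]"])

text \<open>An invariant vector is the same as a map from the trivial module.\<close>

definition invar :: "('a, 'x::ab_group_add) lmod \<Rightarrow> 'x \<Rightarrow> bool" where
 "invar X x \<longleftrightarrow> x \<in> carr X \<and> (\<forall>a. act X a x = smul X (\<epsilon> a) x)"

lemma bl_suml: "bilin X Y Z B ==> left_module X ==> y \<in> carr Y ==> (\<And>q. q \<in> set L ==> f q \<in> carr X)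
  ==> B (\<Sum>q\<leftarrow>L. f q) y = (\<Sum>q\<leftarrow>L. B (f q) y)"
 by (induction L) (auto simp: bl_zerol bl_addl lm_sum_list)

lemma bl_sumr: "bilin X Y Z B ==> left_module Y ==> x \<in> carr X ==> (\<And>q. q \<in> set L ==> f q \<in> carr Y)
  ==> B x (\<Sum>q\<leftarrow>L. f q) = (\<Sum>q\<leftarrow>L. B x (f q))"
 by (induction L) (auto simp: bl_zeror bl_addr lm_sum_list)

text \<open>By the counit laws an invariant bilinear map is linear over the algebra in one variable once the other one is an
 invariant vector.\<close>

lemma bilin_fix_right:
 assumes B: "bilin X Y Z B" and y: "invar Y y" and lm: "left_module X"
 shows "restr X (\<lambda>x. B x y) \<in> lhom X Z"
proof (rule restr_lhomI[OF lm])
 have yc: "y \<in> carr Y" using y by (simp add: invar_def)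
 fix a x assume x: "x \<in> carr X"
 have "act Z a (B x y) = (\<Sum>p\<leftarrow>\<Delta> a. B (act X (fst p) x) (act Y (snd p) y))" by (rule bl_inv[OF B x yc])
 also have "\<dots> = (\<Sum>p\<leftarrow>\<Delta> a. B (act X (scale (\<epsilon> (snd p)) (fst p)) x) y)"
  using y x yc lm by (intro sum_list_cong) (simp add: invar_def bl_sl[OF B] bl_sr[OF B] lm_act act_scale)
 also have "\<dots> = B (\<Sum>p\<leftarrow>\<Delta> a. act X (scale (\<epsilon> (snd p)) (fst p)) x) y"
  using x lm by (intro bl_suml[OF B lm yc, symmetric]) (simp add: lm_act)
 also have "(\<Sum>p\<leftarrow>\<Delta> a. act X (scale (\<epsilon> (snd p)) (fst p)) x) = act X a x"
  using counit_right[of a] lm_sum_act[OF lm x, of "\<lambda>p. scale (\<epsilon> (snd p)) (fst p)" "\<Delta> a"] by (simp add: split_def)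
 finally show "B (act X a x) y = act Z a (B x y)" ..
qed (use y in \<open>auto simp: invar_def bl_in[OF B] bl_addl[OF B]\<close>)

lemma bilin_fix_left:
 assumes B: "bilin X Y Z B" and x: "invar X x" and lm: "left_module Y"
 shows "restr Y (\<lambda>y. B x y) \<in> lhom Y Z"
proof (rule restr_lhomI[OF lm])
 have xc: "x \<in> carr X" using x by (simp add: invar_def)
 fix a y assume y: "y \<in> carr Y"
 have "act Z a (B x y) = (\<Sum>p\<leftarrow>\<Delta> a. B (act X (fst p) x) (act Y (snd p) y))" by (rule bl_inv[OF B xc y])
 also have "\<dots> = (\<Sum>p\<leftarrow>\<Delta> a. B x (act Y (scale (\<epsilon> (fst p)) (snd p)) y))"
  using y x xc lm by (intro sum_list_cong) (simp add: invar_def bl_sl[OF B] bl_sr[OF B] lm_act act_scale)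
 also have "\<dots> = B x (\<Sum>p\<leftarrow>\<Delta> a. act Y (scale (\<epsilon> (fst p)) (snd p)) y)"
  using y lm by (intro bl_sumr[OF B lm xc, symmetric]) (simp add: lm_act)
 also have "(\<Sum>p\<leftarrow>\<Delta> a. act Y (scale (\<epsilon> (fst p)) (snd p)) y) = act Y a y"
  using counit_left[of a] lm_sum_act[OF lm y, of "\<lambda>p. scale (\<epsilon> (fst p)) (snd p)" "\<Delta> a"] by (simp add: split_def)
 finally show "B x (act Y a y) = act Z a (B x y)" ..
qed (use x in \<open>auto simp: invar_def bl_in[OF B] bl_addr[OF B]\<close>)

lemma bilin_null_fix_left:
 assumes D: "bilin_null X Y Z D" and x: "invar X x" and lm: "left_module Y" "left_module Z"
 shows "null_map Y Z (restr Y (\<lambda>y. D x y))"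
proof -
 from D obtain L where L: "set L \<subseteq> {G. bilin X Y regular G} \<times> carr Z"
  "\<forall>x\<in>carr X. \<forall>y\<in>carr Y. D x y = (\<Sum>q\<leftarrow>L. act Z (fst q x y) (snd q))"
  unfolding bilin_null_def by blast
 let ?L = "map (\<lambda>q. (restr Y (\<lambda>y. fst q x y), snd q)) L"
 have "set ?L \<subseteq> lhom Y regular \<times> carr Z"
  by (auto dest!: subsetD[OF L(1)] intro: bilin_fix_left[OF _ x lm(1)])
 moreover have "\<forall>y\<in>carr Y. restr Y (\<lambda>y. D x y) y = (\<Sum>q\<leftarrow>?L. act Z (fst q y) (snd q))"
  using L(2) x by (simp add: o_def invar_def)
 moreover have "restr Y (\<lambda>y. D x y) \<in> lhom Y Z"
  using D by (intro bilin_fix_left[OF _ x lm(1)]) (simp add: bilin_null_def)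
 ultimately show ?thesis unfolding null_map_def by blast
qed

lemma bladder1_ladder:
 assumes "bladder1 i j l B B'" "invar (Om H j) y"
 shows "ladder i l (restr (Om H i) (\<lambda>x. B' x y)) (restr (Om H (i + 1)) (\<lambda>x. B x y))"
proof -
 obtain h where h: "bilin (Cov H i) (Om H j) (Cov H l) h"
   "\<And>x y. x \<in> carr (Om H (i + 1)) ==> y \<in> carr (Om H j) ==> h (inc H i x) y = inc H l (B x y)"
   "\<And>x y. x \<in> carr (Cov H i) ==> y \<in> carr (Om H j) ==> prj H l (h x y) = B' (prj H i x) y"
  using assms(1) unfolding bladder1_def by blast
 have "y \<in> carr (Om H j)" using assms(2) by (simp add: invar_def)
 thus ?thesis unfolding heller_ladder_def
  by (intro bexI[OF _ bilin_fix_right[OF h(1) assms(2) Cov_lm]])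
    (simp add: h lhom_in[OF inc_lhom] lhom_in[OF prj_lhom])
qed

lemma bladder2_ladder:
 assumes "bladder2 i j l B B'" "invar (Om H i) x"
 shows "ladder j l (restr (Om H j) (\<lambda>y. B' x y)) (restr (Om H (j + 1)) (\<lambda>y. B x y))"
proof -
 obtain h where h: "bilin (Om H i) (Cov H j) (Cov H l) h"
   "\<And>x y. x \<in> carr (Om H i) ==> y \<in> carr (Om H (j + 1)) ==> h x (inc H j y) = inc H l (B x y)"
   "\<And>x y. x \<in> carr (Om H i) ==> y \<in> carr (Cov H j) ==> prj H l (h x y) = B' x (prj H j y)"
  using assms(1) unfolding bladder2_def by blast
 have "x \<in> carr (Om H i)" using assms(2) by (simp add: invar_def)
 thus ?thesis unfolding heller_ladder_def
  by (intro bexI[OF _ bilin_fix_left[OF h(1) assms(2) Cov_lm]])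
    (simp add: h lhom_in[OF inc_lhom] lhom_in[OF prj_lhom])
qed

lemma bladder1_plus:
 assumes "bladder1 i j l B B'" "bladder1 i j l C C'" "bhom (i + 1) j (l + 1) B" "bhom (i + 1) j (l + 1) C"
 shows "bladder1 i j l (\<lambda>x y. B x y + C x y) (\<lambda>x y. B' x y + C' x y)"
proof -
 obtain h where h: "bilin (Cov H i) (Om H j) (Cov H l) h"
   "\<And>x y. x \<in> carr (Om H (i + 1)) ==> y \<in> carr (Om H j) ==> h (inc H i x) y = inc H l (B x y)"
   "\<And>x y. x \<in> carr (Cov H i) ==> y \<in> carr (Om H j) ==> prj H l (h x y) = B' (prj H i x) y"
  using assms(1) unfolding bladder1_def by blast
 obtain k where k: "bilin (Cov H i) (Om H j) (Cov H l) k"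
   "\<And>x y. x \<in> carr (Om H (i + 1)) ==> y \<in> carr (Om H j) ==> k (inc H i x) y = inc H l (C x y)"
   "\<And>x y. x \<in> carr (Cov H i) ==> y \<in> carr (Om H j) ==> prj H l (k x y) = C' (prj H i x) y"
  using assms(2) unfolding bladder1_def by blast
 show ?thesis unfolding bladder1_def
  by (intro exI[of _ "\<lambda>x y. h x y + k x y"] conjI bilin_plus[OF h(1) k(1) Cov_lm] ballI)
    (simp_all add: h(2,3) k(2,3) lhom_add[OF inc_lhom] lhom_add[OF prj_lhom] bl_in[OF assms(3)] bl_in[OF assms(4)]
     bl_in[OF h(1)] bl_in[OF k(1)])
qed

lemma bladder1_uminus:
 assumes "bladder1 i j l B B'" "bhom (i + 1) j (l + 1) B"
 shows "bladder1 i j l (\<lambda>x y. - B x y) (\<lambda>x y. - B' x y)"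
proof -
 obtain h where h: "bilin (Cov H i) (Om H j) (Cov H l) h"
   "\<And>x y. x \<in> carr (Om H (i + 1)) ==> y \<in> carr (Om H j) ==> h (inc H i x) y = inc H l (B x y)"
   "\<And>x y. x \<in> carr (Cov H i) ==> y \<in> carr (Om H j) ==> prj H l (h x y) = B' (prj H i x) y"
  using assms(1) unfolding bladder1_def by blast
 show ?thesis unfolding bladder1_def
  by (intro exI[of _ "\<lambda>x y. - h x y"] conjI bilin_uminus[OF h(1) Cov_lm] ballI)
    (simp_all add: h(2,3) lhom_minus[OF inc_lhom] lhom_minus[OF prj_lhom] bl_in[OF assms(2)] bl_in[OF h(1)])
qed

text \<open>Equality up to sign in the stable category.\<close>

definition sseq :: "int \<Rightarrow> int \<Rightarrow> ('u \<Rightarrow> 'u) \<Rightarrow> ('u \<Rightarrow> 'u) \<Rightarrow> bool" where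
 "sseq i j f g \<longleftrightarrow> seq i j f g \<or> seq i j f (\<lambda>x. - g x)"

lemma seq_sseq: "seq i j f g ==> sseq i j f g"
 by (simp add: sseq_def)

lemma sseq_trans: assumes "sseq i j f g" "sseq i j g h" shows "sseq i j f h"
proof -
 have tr: "seq i j p r" if "seq i j p q" "seq i j q r" for p q r by (rule steq_trans[OF that Om_lm])
 have m: "seq i j (\<lambda>x. - g x) (\<lambda>x. - k x)" if "seq i j g k" for k by (rule steq_uminus[OF that Om_lm])
 from assms(2) consider "seq i j g h" | "seq i j g (\<lambda>x. - h x)" unfolding sseq_def by blast
 thus ?thesis
 proof cases
  case 1
  thus ?thesis using assms(1) tr[of f g h] tr[of f "\<lambda>x. - g x" "\<lambda>x. - h x"] m[of h]
   unfolding sseq_def by blast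
 next
  case 2
  have "seq i j (\<lambda>x. - g x) h" using m[OF 2] by simp
  thus ?thesis using assms(1) tr[of f g "\<lambda>x. - h x"] tr[of f "\<lambda>x. - g x" h] 2
   unfolding sseq_def by blast
 qed
qed

lemma sseq_sym: assumes "sseq i j f g" shows "sseq i j g f"
 using assms unfolding sseq_def
proof
 assume "seq i j f (\<lambda>x. - g x)"
 from steq_sym[OF steq_uminus[OF this Om_lm] Om_lm] show "seq i j g f \<or> seq i j g (\<lambda>x. - f x)" by simp
qed (simp add: steq_sym)

lemma sseq_comp_right: assumes "sseq i j f g" "h \<in> hom l i" shows "sseq l j (f \<circ> h) (g \<circ> h)"
 using assms(1) unfolding sseq_def
proof
 assume "seq i j f g"
 from steq_comp[OF steq_refl[OF assms(2) Om_lm] this Om_lm Om_lm Om_lm]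
 show "seq l j (f \<circ> h) (g \<circ> h) \<or> seq l j (f \<circ> h) (\<lambda>x. - (g \<circ> h) x)" by simp
next
 assume "seq i j f (\<lambda>x. - g x)"
 from steq_comp[OF steq_refl[OF assms(2) Om_lm] this Om_lm Om_lm Om_lm]
 show "seq l j (f \<circ> h) (g \<circ> h) \<or> seq l j (f \<circ> h) (\<lambda>x. - (g \<circ> h) x)" by (simp add: o_def)
qed

lemma ladder_Sh_step:
 assumes "f0 \<in> hom c d" "f \<in> hom (c + j) (d + j)" "ladder (c + j) (d + j) f g"
  "seq (c + (j + 1)) (d + (j + 1)) g (Sh (j + 1) c d f0)"
 shows "seq (c + j) (d + j) f (Sh j c d f0)"
proof -
 obtain F where F: "chain c d F" "F 0 = f0" "F j = Sh j c d f0" using Sh_chain[OF assms(1)] by blast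
 have l: "ladder (c + j) (d + j) (F j) (F (j + 1))" using F(1) by (simp add: chain_def)
 have F1: "F (j + 1) \<in> hom (c + j + 1) (d + j + 1)" using chain_hom[OF F(1), of "j + 1"] by (simp add: add.assoc)
 have g: "seq (c + j + 1) (d + j + 1) g (Sh (j + 1) c d f0)" using assms(4) by (simp add: add.assoc)
 have "seq (c + (j + 1)) (d + (j + 1)) (F (j + 1)) (Sh (j + 1) c d f0)"
  by (rule chain_Sh[OF F(1)]) (simp add: F(2) steq_refl assms(1))
 hence "seq (c + j + 1) (d + j + 1) (F (j + 1)) (Sh (j + 1) c d f0)" by (simp add: add.assoc)
 from steq_trans[OF g steq_sym[OF this Om_lm] Om_lm]
 have n: "nul (c + j + 1) (d + j + 1) (\<lambda>x. g x - F (j + 1) x)" by (simp add: steq_def)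
 have "nul (c + j) (d + j) (\<lambda>x. f x - F j x)"
  by (rule ladder_null_down[OF ladder_minus[OF assms(3) l steq_lhom(1)[OF g] F1] n])
    (simp add: lhom_minus_fun assms(2) chain_hom[OF F(1)])
 thus ?thesis using F(3) assms(2) chain_hom[OF F(1), of j] by (simp add: steq_def)
qed

text \<open>By induction on \<open>a\<close>: the shifts in the two variables anticommute, so that the pairing defined by
 shifts in the first variable is, up to sign, also compatible with shifts in the second one.\<close>

lemma pairing_second_shift:
 assumes \<Theta>0: "\<And>b y s. \<Theta> 0 b s y = smul (Om H (- int b)) (core_in H s) y"
  and \<Theta>: "\<And>a b. bhom (- int a) (- int b) (- int a - int b) (\<Theta> a b)"
  and \<Theta>1: "\<And>a b. bladder1 (- int (Suc a)) (- int b) (- int (Suc a) - int b) (\<Theta> a b) (\<Theta> (Suc a) b)"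
 shows "\<exists>B. bhom (- int a) (- int (Suc b)) (- int a - int (Suc b)) B \<and>
  bladder2 (- int a) (- int (Suc b)) (- int a - int (Suc b)) (\<Theta> a b) B \<and>
  (bnul (- int a) (- int (Suc b)) (- int a - int (Suc b)) (\<lambda>x y. B x y - \<Theta> a (Suc b) x y) \<or>
   bnul (- int a) (- int (Suc b)) (- int a - int (Suc b)) (\<lambda>x y. B x y + \<Theta> a (Suc b) x y))"
proof (induction a)
 case 0
 have "bladder2 0 (- int (Suc b)) (- int (Suc b)) (\<Theta> 0 b) (\<Theta> 0 (Suc b))"
  unfolding bladder2_def
 proof (intro exI conjI ballI)
  show "bilin (Om H 0) (Cov H (- int (Suc b))) (Cov H (- int (Suc b)))
    (\<lambda>s y. smul (Cov H (- int (Suc b))) (core_in H s) y)" by (rule scalar_pairing) simp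
  fix x y assume "x \<in> carr (Om H 0)" "y \<in> carr (Om H (- int (Suc b) + 1))"
  thus "smul (Cov H (- int (Suc b))) (core_in H x) (inc H (- int (Suc b)) y) = inc H (- int (Suc b)) (\<Theta> 0 b x y)"
   using lhom_smul[OF inc_lhom, of y "- int (Suc b)" "core_in H x"] by (simp add: \<Theta>0)
 next
  fix x y assume "y \<in> carr (Cov H (- int (Suc b)))"
  thus "prj H (- int (Suc b)) (smul (Cov H (- int (Suc b))) (core_in H x) y) = \<Theta> 0 (Suc b) x (prj H (- int (Suc b)) y)"
   unfolding \<Theta>0 by (rule lhom_smul[OF prj_lhom])
 qed
 moreover have "bhom 0 (- int (Suc b)) (- int (Suc b)) (\<Theta> 0 (Suc b))" using \<Theta>[of 0 "Suc b"] by simp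
 moreover have "bnul 0 (- 1 - int b) (- 1 - int b) (\<lambda>x y. 0)" by (rule bilin_null_zero[OF Om_lm])
 ultimately show ?case by (intro exI[of _ "\<Theta> 0 (Suc b)"]) simp
next
 case (Suc a)
 then obtain B2 where B2: "bhom (- int a) (- int (Suc b)) (- int a - int (Suc b)) B2"
  "bladder2 (- int a) (- int (Suc b)) (- int a - int (Suc b)) (\<Theta> a b) B2"
  "bnul (- int a) (- int (Suc b)) (- int a - int (Suc b)) (\<lambda>x y. B2 x y - \<Theta> a (Suc b) x y) \<or>
   bnul (- int a) (- int (Suc b)) (- int a - int (Suc b)) (\<lambda>x y. B2 x y + \<Theta> a (Suc b) x y)" by blast
 define i where "i = - int (Suc a)"
 define j where "j = - int (Suc b)"
 define l where "l = - int (Suc a) - int (Suc b)"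
 have lin: "- int a - int b = l + 1 + 1" "- int a - int (Suc b) = l + 1" "- int (Suc a) - int b = l + 1"
  "- int (Suc a) - int (Suc b) = l" by (simp_all add: l_def)
 have ijn: "- int a = i + 1" "- int b = j + 1" "- int (Suc a) = i" "- int (Suc b) = j" by (simp_all add: i_def j_def)
 have t: "bhom (i + 1) (j + 1) (l + 1 + 1) (\<Theta> a b)" "bhom i (j + 1) (l + 1) (\<Theta> (Suc a) b)"
  "bhom (i + 1) j (l + 1) (\<Theta> a (Suc b))" "bhom i j l (\<Theta> (Suc a) (Suc b))"
  using \<Theta>[of a b] \<Theta>[of "Suc a" b] \<Theta>[of a "Suc b"] \<Theta>[of "Suc a" "Suc b"]
  unfolding lin unfolding ijn by auto
 have t1: "bladder1 i (j + 1) (l + 1) (\<Theta> a b) (\<Theta> (Suc a) b)" "bladder1 i j l (\<Theta> a (Suc b)) (\<Theta> (Suc a) (Suc b))"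
  using \<Theta>1[of a b] \<Theta>1[of a "Suc b"] unfolding lin unfolding ijn by auto
 have b2: "bhom (i + 1) j (l + 1) B2" "bladder2 (i + 1) j (l + 1) (\<Theta> a b) B2"
  "bnul (i + 1) j (l + 1) (\<lambda>x y. B2 x y - \<Theta> a (Suc b) x y) \<or> bnul (i + 1) j (l + 1) (\<lambda>x y. B2 x y + \<Theta> a (Suc b) x y)"
  using B2 unfolding lin unfolding ijn by auto
 obtain B12 where b12: "bhom i j l B12" "bladder2 i j l (\<Theta> (Suc a) b) B12" by (rule bladder2_ex[OF t(2)])
 obtain B21 where b21: "bhom i j l B21" "bladder1 i j l B2 B21" by (rule bladder1_ex[OF b2(1)])
 have ac: "bnul i j l (\<lambda>x y. B12 x y + B21 x y)"
  by (rule bladder_anticommute[OF t(1,2) b2(1) b12(1) b21(1) t1(1) b2(2) b12(2) b21(2)])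
 have d: "bnul i j l (\<lambda>x y. B12 x y + E x y)" if "bnul i j l (\<lambda>x y. B21 x y - E x y)" for E
 proof -
  have "bnul i j l (\<lambda>x y. (B12 x y + B21 x y) + - (B21 x y - E x y))"
   by (rule bilin_null_plus[OF ac bilin_null_uminus[OF that Om_lm] Om_lm])
  thus ?thesis by simp
 qed
 note mT = bladder1_uminus[OF t1(2) t(3)]
 from b2(3) have "bnul i j l (\<lambda>x y. B12 x y - \<Theta> (Suc a) (Suc b) x y) \<or> bnul i j l (\<lambda>x y. B12 x y + \<Theta> (Suc a) (Suc b) x y)"
 proof
  assume n: "bnul (i + 1) j (l + 1) (\<lambda>x y. B2 x y - \<Theta> a (Suc b) x y)"
  have "bnul i j l (\<lambda>x y. B21 x y + - \<Theta> (Suc a) (Suc b) x y)"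
   by (rule bladder1_null[OF bladder1_plus[OF b21(2) mT b2(1) bilin_uminus[OF t(3) Om_lm]] _
      bilin_plus[OF b21(1) bilin_uminus[OF t(4) Om_lm] Om_lm]]) (use n in simp)
  thus ?thesis using d[of "\<Theta> (Suc a) (Suc b)"] by simp
 next
  assume n: "bnul (i + 1) j (l + 1) (\<lambda>x y. B2 x y + \<Theta> a (Suc b) x y)"
  have "bnul i j l (\<lambda>x y. B21 x y + \<Theta> (Suc a) (Suc b) x y)"
   by (rule bladder1_null[OF bladder1_plus[OF b21(2) t1(2) b2(1) t(3)] n bilin_plus[OF b21(1) t(4) Om_lm]])
  thus ?thesis using d[of "\<lambda>x y. - \<Theta> (Suc a) (Suc b) x y"] by simp
 qed
 thus ?case using b12 unfolding lin unfolding ijn by blast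
qed

lemma Sh_seq_rev: assumes "f \<in> hom a b" "g \<in> hom a b" "seq (a + j) (b + j) (Sh j a b f) (Sh j a b g)"
 shows "seq a b f g"
proof -
 have "nul (a + j) (b + j) (Sh j a b (\<lambda>x. f x - g x))"
  using steq_null[OF Sh_minus[OF assms(1,2), of j] _ Om_lm] assms(3) by (simp add: steq_def)
 thus ?thesis using Sh_null_rev[OF lhom_minus_fun[OF assms(1,2) Om_lm]] assms by (simp add: steq_def)
qed

lemma Sh_sseq_rev: assumes "f \<in> hom a b" "g \<in> hom a b" "sseq (a + j) (b + j) (Sh j a b f) (Sh j a b g)"
 shows "sseq a b f g"
 using assms(3) unfolding sseq_def
proof
 assume "seq (a + j) (b + j) (Sh j a b f) (\<lambda>x. - Sh j a b g x)"
 from steq_trans[OF this steq_sym[OF Sh_uminus[OF assms(2)] Om_lm] Om_lm]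
 have "seq a b f (\<lambda>x. - g x)" by (rule Sh_seq_rev[OF assms(1) lhom_uminus[OF assms(2) Om_lm]])
 thus "seq a b f g \<or> seq a b f (\<lambda>x. - g x)" ..
qed (use Sh_seq_rev[OF assms(1,2)] in blast)

text \<open>Classes of degree \<open>a\<close> and \<open>b\<close> are maps \<open>k \<rightarrow> \<Omega>\<^sup>-\<^sup>a
 k\<close> and \<open>k \<rightarrow> \<Omega>\<^sup>-\<^sup>b k\<close>, that is, invariant vectors. Evaluating the
 pairing with one variable fixed at such a vector gives a shift of the other map, so both products are, up to sign,
 the value of the pairing at the two vectors.\<close>

lemma graded_commutative_coshift:
 assumes np: "\<And>s. core_in H (core_out H s) = s" and f: "f \<in> hom 0 (- int a)" and g: "g \<in> hom 0 (- int b)"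
 shows "sseq 0 (- int a - int b) (Sh (- int a) 0 (- int b) g \<circ> f) (Sh (- int b) 0 (- int a) f \<circ> g)"
proof -
 obtain \<Theta> where \<Theta>0: "\<And>b y s. \<Theta> 0 b s y = smul (Om H (- int b)) (core_in H s) y"
  and \<Theta>: "\<And>a b. bhom (- int a) (- int b) (- int a - int b) (\<Theta> a b)"
  and \<Theta>1: "\<And>a b. bladder1 (- int (Suc a)) (- int b) (- int (Suc a) - int b) (\<Theta> a b) (\<Theta> (Suc a) b)"
  using pairings_ex by blast
 define o1 where "o1 = core_out H 1"
 have o1: "o1 \<in> carr (Om H 0)" by (simp add: o1_def lhom_in[OF core_out_lhom])
 have os: "s = smul (Om H 0) (core_in H s) o1" if "s \<in> carr (Om H 0)" for s
  using lhom_smul[OF core_out_lhom, of 1 "core_in H s"] core_out_in[OF that] by (simp add: o1_def)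
 have val: "h s = smul (Om H j) (core_in H s) (h o1)" if "h \<in> hom 0 j" "s \<in> carr (Om H 0)" for h j s
  using lhom_smul[OF that(1) o1, of "core_in H s"] os[OF that(2)] by simp
 have inv: "invar (Om H j) (h o1)" if h: "h \<in> hom 0 j" for h j
  unfolding invar_def
 proof (intro conjI allI)
  show "h o1 \<in> carr (Om H j)" by (rule lhom_in[OF h o1])
  fix a
  have "act (Om H 0) a o1 = smul (Om H 0) (\<epsilon> a) o1"
   using lhom_act[OF core_out_lhom, of 1 a] lhom_smul[OF core_out_lhom, of 1 "\<epsilon> a"] by (simp add: o1_def)
  thus "act (Om H j) a (h o1) = smul (Om H j) (\<epsilon> a) (h o1)"
   using lhom_act[OF h o1, of a] lhom_smul[OF h o1, of "\<epsilon> a"] by simp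
 qed
 have L: "seq (- int a) (- int a - int b) (restr (Om H (- int a)) (\<lambda>x. \<Theta> a b x (g o1))) (Sh (- int a) 0 (- int b) g)"
  if g: "g \<in> hom 0 (- int b)" for a b g
 proof (induction a)
  case 0
  have "restr (Om H 0) (\<lambda>x. \<Theta> 0 b x (g o1)) = g"
   by (rule lhom_eqI[of _ "Om H 0" "Om H (- int b)"])
     (use bilin_fix_right[OF \<Theta>[of 0 b] inv[OF g]] g in \<open>auto simp: \<Theta>0 val[OF g, symmetric]\<close>)
  thus ?case using g by (simp add: Sh_0 steq_refl)
 next
  case (Suc a)
  have "seq (0 + - int (Suc a)) (- int b + - int (Suc a)) (restr (Om H (- int (Suc a))) (\<lambda>x. \<Theta> (Suc a) b x (g o1)))
    (Sh (- int (Suc a)) 0 (- int b) g)"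
  proof (rule ladder_Sh_step[OF g])
   show "restr (Om H (- int (Suc a))) (\<lambda>x. \<Theta> (Suc a) b x (g o1)) \<in> hom (0 + - int (Suc a)) (- int b + - int (Suc a))"
    using bilin_fix_right[OF \<Theta>[of "Suc a" b] inv[OF g] Om_lm] by (simp add: algebra_simps)
   show "ladder (0 + - int (Suc a)) (- int b + - int (Suc a)) (restr (Om H (- int (Suc a))) (\<lambda>x. \<Theta> (Suc a) b x (g o1)))
     (restr (Om H (- int a)) (\<lambda>x. \<Theta> a b x (g o1)))"
    using bladder1_ladder[OF \<Theta>1[of a b] inv[OF g]] by (simp add: algebra_simps)
   show "seq (0 + (- int (Suc a) + 1)) (- int b + (- int (Suc a) + 1)) (restr (Om H (- int a)) (\<lambda>x. \<Theta> a b x (g o1)))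
     (Sh (- int (Suc a) + 1) 0 (- int b) g)" using Suc by (simp add: algebra_simps)
  qed
  thus ?case by (simp add: algebra_simps)
 qed
 have R: "sseq (- int b) (- int a - int b) (restr (Om H (- int b)) (\<lambda>y. \<Theta> a b (f o1) y)) (Sh (- int b) 0 (- int a) f)" for b
 proof (induction b)
  case 0
  have id0: "idm 0 \<in> hom 0 (- int 0)" by (simp add: idm_hom)
  have "seq (- int a) (- int a) (restr (Om H (- int a)) (\<lambda>x. \<Theta> a 0 x o1)) (Sh (- int a) 0 0 (idm 0))"
   using L[OF id0, of a] o1 by simp
  moreover have "seq (- int a) (- int a) (Sh (- int a) 0 0 (idm 0)) (idm (- int a))" using Sh_id[of 0 "- int a"] by simp
  ultimately have l: "seq (- int a) (- int a) (restr (Om H (- int a)) (\<lambda>x. \<Theta> a 0 x o1)) (idm (- int a))"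
   using steq_trans[OF _ _ Om_lm] by blast
  have "restr (Om H 0) (\<lambda>y. \<Theta> a 0 (f o1) y) = restr (Om H (- int a)) (\<lambda>x. \<Theta> a 0 x o1) \<circ> f"
  proof (rule lhom_eqI[OF _ lhom_comp[OF f steq_lhom(1)[OF l] Om_lm]])
   show "restr (Om H 0) (\<lambda>y. \<Theta> a 0 (f o1) y) \<in> hom 0 (- int a)"
    using bilin_fix_left[OF \<Theta>[of a 0] inv[OF f]] by simp
   fix s assume s: "s \<in> carr (Om H 0)"
   have T0: "bhom (- int a) 0 (- int a) (\<Theta> a 0)" using \<Theta>[of a 0] by simp
   have "\<Theta> a 0 (f o1) s = \<Theta> a 0 (f o1) (smul (Om H 0) (core_in H s) o1)"
    using os[OF s] by (rule arg_cong)
   also have "\<dots> = smul (Om H (- int a)) (core_in H s) (\<Theta> a 0 (f o1) o1)"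
    by (rule bl_sr[OF T0 lhom_in[OF f o1] o1])
   also have "\<dots> = \<Theta> a 0 (f s) o1"
    unfolding val[OF f s] by (rule bl_sl[OF T0 lhom_in[OF f o1] o1, symmetric])
   finally show "restr (Om H 0) (\<lambda>y. \<Theta> a 0 (f o1) y) s = (restr (Om H (- int a)) (\<lambda>x. \<Theta> a 0 x o1) \<circ> f) s"
    using s lhom_in[OF f s] by simp
  qed
  hence "seq 0 (- int a) (restr (Om H 0) (\<lambda>y. \<Theta> a 0 (f o1) y)) f"
   using steq_comp[OF steq_refl[OF f Om_lm] l Om_lm Om_lm Om_lm] idm_comp[OF f] by simp
  thus ?case using f by (simp add: Sh_0 seq_sseq)
 next
  case (Suc b)
  obtain B where B: "bhom (- int a) (- int (Suc b)) (- int a - int (Suc b)) B"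
    "bladder2 (- int a) (- int (Suc b)) (- int a - int (Suc b)) (\<Theta> a b) B"
    "bnul (- int a) (- int (Suc b)) (- int a - int (Suc b)) (\<lambda>x y. B x y - \<Theta> a (Suc b) x y) \<or>
    bnul (- int a) (- int (Suc b)) (- int a - int (Suc b)) (\<lambda>x y. B x y + \<Theta> a (Suc b) x y)"
   using pairing_second_shift[OF \<Theta>0 \<Theta> \<Theta>1] by blast
  define j where "j = - int (Suc b)"
  have j1: "- int a - int (Suc b) = - int a + j" and j2: "- int (Suc b) = j" and j3: "j + 1 = - int b"
   by (simp_all add: j_def)
  define Bx where "Bx = restr (Om H j) (\<lambda>y. B (f o1) y)"
  define Tx where "Tx = restr (Om H j) (\<lambda>y. \<Theta> a (Suc b) (f o1) y)"
  have hs: "Bx \<in> hom j (- int a + j)" "Tx \<in> hom j (- int a + j)"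
   using bilin_fix_left[OF B(1) inv[OF f] Om_lm] bilin_fix_left[OF \<Theta>[of a "Suc b"] inv[OF f] Om_lm]
   unfolding j1 unfolding j2 by (simp_all add: Bx_def Tx_def)
  have lad: "ladder j (- int a + j) Bx (restr (Om H (- int b)) (\<lambda>y. \<Theta> a b (f o1) y))"
   using bladder2_ladder[OF B(2) inv[OF f]] unfolding j1 unfolding j2 by (simp add: Bx_def j3)
  have st: "seq j (- int a + j) Bx (Sh j 0 (- int a) e)"
   if "e \<in> hom 0 (- int a)" "seq (- int b) (- int a - int b) (restr (Om H (- int b)) (\<lambda>y. \<Theta> a b (f o1) y)) (Sh (- int b) 0 (- int a) e)" for e
  proof -
   have "seq (0 + j) (- int a + j) Bx (Sh j 0 (- int a) e)"
   proof (rule ladder_Sh_step[OF that(1)])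
    show "seq (0 + (j + 1)) (- int a + (j + 1)) (restr (Om H (- int b)) (\<lambda>y. \<Theta> a b (f o1) y)) (Sh (j + 1) 0 (- int a) e)"
     using that(2) by (simp add: j3)
   qed (use hs lad in simp_all)
   thus ?thesis by simp
  qed
  have "sseq j (- int a + j) Bx (Sh j 0 (- int a) f)"
   using Suc unfolding sseq_def
  proof
   assume "seq (- int b) (- int a - int b) (restr (Om H (- int b)) (\<lambda>y. \<Theta> a b (f o1) y)) (\<lambda>x. - Sh (- int b) 0 (- int a) f x)"
   moreover have "seq (- int b) (- int a - int b) (Sh (- int b) 0 (- int a) (\<lambda>x. - f x)) (\<lambda>x. - Sh (- int b) 0 (- int a) f x)"
    using Sh_uminus[OF f, of "- int b"] by simp
   ultimately have "seq j (- int a + j) Bx (Sh j 0 (- int a) (\<lambda>x. - f x))"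
    using steq_trans[OF _ steq_sym[OF _ Om_lm] Om_lm] by (intro st lhom_uminus[OF f Om_lm]) blast
   moreover have "seq j (- int a + j) (Sh j 0 (- int a) (\<lambda>x. - f x)) (\<lambda>x. - Sh j 0 (- int a) f x)"
    using Sh_uminus[OF f, of j] by simp
   ultimately show "seq j (- int a + j) Bx (Sh j 0 (- int a) f) \<or> seq j (- int a + j) Bx (\<lambda>x. - Sh j 0 (- int a) f x)"
    using steq_trans[OF _ _ Om_lm] by blast
  qed (use st[OF f] in blast)
  moreover have "sseq j (- int a + j) Bx Tx"
   using B(3) unfolding sseq_def
  proof
   assume "bnul (- int a) (- int (Suc b)) (- int a - int (Suc b)) (\<lambda>x y. B x y - \<Theta> a (Suc b) x y)"
   from bilin_null_fix_left[OF this inv[OF f] Om_lm Om_lm]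
   have "nul j (- int a + j) (restr (Om H j) (\<lambda>y. B (f o1) y - \<Theta> a (Suc b) (f o1) y))" unfolding j1 unfolding j2 .
   also have "restr (Om H j) (\<lambda>y. B (f o1) y - \<Theta> a (Suc b) (f o1) y) = (\<lambda>y. Bx y - Tx y)"
    by (auto simp: Bx_def Tx_def restr_def fun_eq_iff)
   finally show "seq j (- int a + j) Bx Tx \<or> seq j (- int a + j) Bx (\<lambda>x. - Tx x)" using hs by (simp add: steq_def)
  next
   assume "bnul (- int a) (- int (Suc b)) (- int a - int (Suc b)) (\<lambda>x y. B x y + \<Theta> a (Suc b) x y)"
   from bilin_null_fix_left[OF this inv[OF f] Om_lm Om_lm]
   have "nul j (- int a + j) (restr (Om H j) (\<lambda>y. B (f o1) y + \<Theta> a (Suc b) (f o1) y))" unfolding j1 unfolding j2 .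
   also have "restr (Om H j) (\<lambda>y. B (f o1) y + \<Theta> a (Suc b) (f o1) y) = (\<lambda>y. Bx y - - Tx y)"
    by (auto simp: Bx_def Tx_def restr_def fun_eq_iff)
   finally show "seq j (- int a + j) Bx Tx \<or> seq j (- int a + j) Bx (\<lambda>x. - Tx x)" using hs
    by (auto simp: steq_def lhom_uminus)
  qed
  ultimately have "sseq j (- int a + j) Tx (Sh j 0 (- int a) f)" using sseq_sym sseq_trans by blast
  thus ?case unfolding Tx_def j1 unfolding j2 .
 qed
 have "sseq 0 (- int a - int b) (restr (Om H (- int a)) (\<lambda>x. \<Theta> a b x (g o1)) \<circ> f) (Sh (- int a) 0 (- int b) g \<circ> f)"
  by (rule sseq_comp_right[OF seq_sseq[OF L[OF g]] f])
 moreover have "sseq 0 (- int a - int b) (restr (Om H (- int b)) (\<lambda>y. \<Theta> a b (f o1) y) \<circ> g) (Sh (- int b) 0 (- int a) f \<circ> g)"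
  by (rule sseq_comp_right[OF R g])
 moreover have "restr (Om H (- int a)) (\<lambda>x. \<Theta> a b x (g o1)) \<circ> f = restr (Om H (- int b)) (\<lambda>y. \<Theta> a b (f o1) y) \<circ> g"
 proof (rule lhom_eqI[OF lhom_comp[OF f steq_lhom(1)[OF L[OF g]] Om_lm] lhom_comp[OF g _ Om_lm]])
  show "restr (Om H (- int b)) (\<lambda>y. \<Theta> a b (f o1) y) \<in> hom (- int b) (- int a - int b)"
   by (rule bilin_fix_left[OF \<Theta> inv[OF f] Om_lm])
  fix s assume s: "s \<in> carr (Om H 0)"
  show "(restr (Om H (- int a)) (\<lambda>x. \<Theta> a b x (g o1)) \<circ> f) s = (restr (Om H (- int b)) (\<lambda>y. \<Theta> a b (f o1) y) \<circ> g) s"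
   using bl_sl[OF \<Theta> lhom_in[OF f o1] lhom_in[OF g o1], of "core_in H s"]
    bl_sr[OF \<Theta> lhom_in[OF f o1] lhom_in[OF g o1], of "core_in H s"] val[OF f s] val[OF g s] lhom_in[OF f s] lhom_in[OF g s]
   by simp
 qed
 ultimately show ?thesis using sseq_trans[OF sseq_sym, of _ _ _ _ "Sh (- int b) 0 (- int a) f \<circ> g"] by simp
qed

text \<open>Shifting by \<open>- a\<close> and \<open>- b\<close> reduces the claim to maps out of \<open>\<Omega>\<^sup>0
 k\<close>.\<close>

lemma graded_commutative:
 assumes f: "f \<in> hom a 0" and g: "g \<in> hom b 0" and ab: "a \<ge> 0" "b \<ge> 0"
 shows "sseq (a + b) 0 (f \<circ> Sh a b 0 g) (g \<circ> Sh b a 0 f)"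
proof -
 have sf: "Sh b a 0 f \<in> hom (a + b) b" and sgg: "Sh a b 0 g \<in> hom (a + b) a"
  using Sh_hom[OF f, of b] Sh_hom[OF g, of a] by (simp_all add: add.commute)
 have hs: "f \<circ> Sh a b 0 g \<in> hom (a + b) 0" "g \<circ> Sh b a 0 f \<in> hom (a + b) 0"
  using lhom_comp[OF sgg f Om_lm] lhom_comp[OF sf g Om_lm] by auto
 from core_cases show ?thesis
 proof
  assume "dual_basis T"
  from null_if_projective[OF this lhom_minus_fun[OF hs Om_lm]] hs show ?thesis
   by (intro seq_sseq) (simp only: steq_def simp_thms)
 next
  assume np: "\<forall>s. core_in H (core_out H s) = s"
  have ab': "a = int (nat a)" "b = int (nat b)" using ab by auto
  have key: "seq 0 (- a - b) (Sh (- a - b) (a + b) 0 (g \<circ> Sh b a 0 f)) (Sh (- a) 0 (- b) (Sh (- b) b 0 g) \<circ> Sh (- a) a 0 f)"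
   if f: "f \<in> hom a 0" and g: "g \<in> hom b 0" for f g a b
  proof -
   have sf: "Sh b a 0 f \<in> hom (a + b) b" using Sh_hom[OF f, of b] by simp
   have k1: "seq 0 (- a - b) (Sh (- a - b) (a + b) 0 (g \<circ> Sh b a 0 f)) (Sh (- a - b) b 0 g \<circ> Sh (- a - b) (a + b) b (Sh b a 0 f))"
    using Sh_comp[OF sf g, of "- a - b"] by simp
   have k2: "seq 0 (- a) (Sh (- a - b) (a + b) b (Sh b a 0 f)) (Sh (- a) a 0 f)"
    using Sh_Sh[OF f, of b "- a - b"] by simp
   have k3: "seq (- a) (- a - b) (Sh (- a) 0 (- b) (Sh (- b) b 0 g)) (Sh (- a - b) b 0 g)"
    using Sh_Sh[OF g, of "- b" "- a"] by (simp add: algebra_simps)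
   show ?thesis
    by (rule steq_trans[OF k1 steq_comp[OF k2 steq_sym[OF k3 Om_lm] Om_lm Om_lm Om_lm] Om_lm])
  qed
  have f1: "Sh (- a) a 0 f \<in> hom 0 (- int (nat a))" and g1: "Sh (- b) b 0 g \<in> hom 0 (- int (nat b))"
   using Sh_hom[OF f, of "- a"] Sh_hom[OF g, of "- b"] ab by simp_all
  have "sseq 0 (- int (nat a) - int (nat b)) (Sh (- int (nat a)) 0 (- int (nat b)) (Sh (- b) b 0 g) \<circ> Sh (- a) a 0 f)
     (Sh (- int (nat b)) 0 (- int (nat a)) (Sh (- a) a 0 f) \<circ> Sh (- b) b 0 g)"
   by (rule graded_commutative_coshift[OF _ f1 g1]) (use np in blast)
  hence "sseq 0 (- a - b) (Sh (- a) 0 (- b) (Sh (- b) b 0 g) \<circ> Sh (- a) a 0 f)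
     (Sh (- b) 0 (- a) (Sh (- a) a 0 f) \<circ> Sh (- b) b 0 g)" using ab by simp
  moreover have "seq 0 (- a - b) (Sh (- a - b) (a + b) 0 (f \<circ> Sh a b 0 g)) (Sh (- b) 0 (- a) (Sh (- a) a 0 f) \<circ> Sh (- b) b 0 g)"
  proof -
   have "- b - a = - a - b" by simp
   with key[OF g f] show ?thesis by (simp only: add.commute[of b a])
  qed
  ultimately have "sseq 0 (- a - b) (Sh (- a - b) (a + b) 0 (f \<circ> Sh a b 0 g)) (Sh (- a - b) (a + b) 0 (g \<circ> Sh b a 0 f))"
   using key[OF f g] sseq_sym sseq_trans seq_sseq by blast
  thus ?thesis using Sh_sseq_rev[OF hs, of "- a - b"] by simp
 qed
qed

end

section \<open>Quotients of groups of functions\<close>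

text \<open>Both stable homomorphisms and cohomology classes are cosets of functions under pointwise addition; the following
 treats the two cases at once.\<close>

definition fgrp :: "('x \<Rightarrow> 'y::ab_group_add) set \<Rightarrow> ('x \<Rightarrow> 'y) monoid" where
 "fgrp C = \<lparr>carrier = C, monoid.mult = (\<lambda>f g x. f x + g x), one = (\<lambda>x. 0)\<rparr>"

definition addset :: "('x \<Rightarrow> 'y::ab_group_add) set \<Rightarrow> bool" where
 "addset C \<longleftrightarrow> (\<lambda>x. 0) \<in> C \<and> (\<forall>f\<in>C. \<forall>g\<in>C. (\<lambda>x. f x + g x) \<in> C) \<and> (\<forall>f\<in>C. (\<lambda>x. - f x) \<in> C)"

text \<open>The coset of \<open>f\<close>, described by differences.\<close>

definition cls :: "('x \<Rightarrow> 'y::ab_group_add) set \<Rightarrow> ('x \<Rightarrow> 'y) \<Rightarrow> ('x \<Rightarrow> 'y) set" where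
 "cls K f = {g. (\<lambda>x. g x - f x) \<in> K}"

lemma addsetD: "addset C ==> (\<lambda>x. 0) \<in> C" "addset C ==> f \<in> C ==> g \<in> C ==> (\<lambda>x. f x + g x) \<in> C"
 "addset C ==> f \<in> C ==> (\<lambda>x. - f x) \<in> C"
 by (simp_all add: addset_def)

lemma addset_minus: "addset C ==> f \<in> C ==> g \<in> C ==> (\<lambda>x. f x - g x) \<in> C"
 using addsetD(2)[of C f "\<lambda>x. - g x"] addsetD(3)[of C g] by simp

lemma fgrp_comm_group: assumes "addset C" shows "comm_group (fgrp C)"
proof (rule comm_groupI)
 fix f assume "f \<in> carrier (fgrp C)"
 thus "\<exists>g\<in>carrier (fgrp C). g \<otimes>\<^bsub>fgrp C\<^esub> f = \<one>\<^bsub>fgrp C\<^esub>"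
  using addsetD(3)[OF assms, of f] by (intro bexI[of _ "\<lambda>x. - f x"]) (simp_all add: fgrp_def)
qed (use addsetD[OF assms] in \<open>auto simp: fgrp_def algebra_simps\<close>)

lemma fgrp_inv: assumes "addset C" "f \<in> C" shows "inv\<^bsub>fgrp C\<^esub> f = (\<lambda>x. - f x)"
proof -
 interpret comm_group "fgrp C" by (rule fgrp_comm_group[OF assms(1)])
 show ?thesis using addsetD(3)[OF assms] assms(2) by (intro inv_equality) (simp_all add: fgrp_def)
qed

lemma fgrp_subgroup: assumes "addset C" "addset K" "K \<subseteq> C" shows "subgroup K (fgrp C)"
proof -
 interpret comm_group "fgrp C" by (rule fgrp_comm_group[OF assms(1)])
 show ?thesis
 proof (rule subgroupI)
  show "inv\<^bsub>fgrp C\<^esub> f \<in> K" if "f \<in> K" for f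
   using that assms addsetD(3)[of K f] by (subst fgrp_inv) (auto simp: subset_iff)
 qed (use assms addsetD[OF assms(2)] in \<open>auto simp: fgrp_def\<close>)
qed

lemma coset_cls: assumes "addset K" shows "K #>\<^bsub>fgrp C\<^esub> f = cls K f"
proof (rule Set.set_eqI)
 fix g
 show "g \<in> K #>\<^bsub>fgrp C\<^esub> f \<longleftrightarrow> g \<in> cls K f"
 proof
  assume "g \<in> cls K f"
  thus "g \<in> K #>\<^bsub>fgrp C\<^esub> f" unfolding r_coset_def cls_def fgrp_def
   by (auto intro!: bexI[of _ "\<lambda>x. g x - f x"])
 qed (auto simp: r_coset_def cls_def fgrp_def)
qed

lemma cls_self: "addset K ==> f \<in> cls K f"
 by (simp add: cls_def addsetD)

lemma cls_eq: assumes "addset K" shows "cls K f = cls K g \<longleftrightarrow> (\<lambda>x. f x - g x) \<in> K"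
proof
 assume "cls K f = cls K g"
 thus "(\<lambda>x. f x - g x) \<in> K" using cls_self[OF assms, of f] by (simp add: cls_def)
next
 assume fg: "(\<lambda>x. f x - g x) \<in> K"
 show "cls K f = cls K g"
 proof (rule Set.set_eqI)
  fix h
  have "(\<lambda>x. h x - g x) \<in> K" if "(\<lambda>x. h x - f x) \<in> K" using addsetD(2)[OF assms that fg] by simp
  moreover have "(\<lambda>x. h x - f x) \<in> K" if "(\<lambda>x. h x - g x) \<in> K" using addset_minus[OF assms that fg] by simp
  ultimately show "h \<in> cls K f \<longleftrightarrow> h \<in> cls K g" by (auto simp: cls_def)
 qed
qed

lemma cls_mem_eq: "addset K ==> g \<in> cls K f ==> cls K g = cls K f"
 by (simp add: cls_eq) (simp add: cls_def)

definition qgrp :: "('x \<Rightarrow> 'y::ab_group_add) set \<Rightarrow> ('x \<Rightarrow> 'y) set \<Rightarrow> ('x \<Rightarrow> 'y) set monoid" where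
 "qgrp C K = fgrp C Mod K"

locale fquot =
 fixes C K :: "('x \<Rightarrow> 'y::ab_group_add) set"
 assumes C: "addset C" and K: "addset K" and KC: "K \<subseteq> C"
begin

lemma q_comm_group: "comm_group (qgrp C K)"
 unfolding qgrp_def by (rule comm_group.abelian_FactGroup[OF fgrp_comm_group[OF C] fgrp_subgroup[OF C K KC]])

lemma q_group: "group (qgrp C K)"
 using q_comm_group by (rule comm_group.axioms(2))

lemma q_carrier: "carrier (qgrp C K) = cls K ` C"
 unfolding qgrp_def FactGroup_def RCOSETS_def by (auto simp: coset_cls[OF K]) (auto simp: fgrp_def)

lemma q_one: "\<one>\<^bsub>qgrp C K\<^esub> = cls K (\<lambda>x. 0)"
 by (simp add: qgrp_def FactGroup_def cls_def)

lemma q_mult: assumes "f \<in> C" "g \<in> C" shows "cls K f \<otimes>\<^bsub>qgrp C K\<^esub> cls K g = cls K (\<lambda>x. f x + g x)"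
proof -
 have "K \<lhd> fgrp C" by (rule comm_group.subgroup_imp_normal[OF fgrp_comm_group[OF C] fgrp_subgroup[OF C K KC]])
 from normal.rcos_sum[OF this, of f g] assms show ?thesis
  by (simp add: qgrp_def coset_cls[OF K]) (simp add: fgrp_def)
qed

lemma q_zero_iff: "cls K f = \<one>\<^bsub>qgrp C K\<^esub> \<longleftrightarrow> f \<in> K"
 by (simp add: q_one cls_eq[OF K])

lemma q_rep: assumes "X \<in> carrier (qgrp C K)" "z \<in> X" shows "z \<in> C" "X = cls K z"
proof -
 obtain f where f: "f \<in> C" "X = cls K f" using assms(1) q_carrier by auto
 have "(\<lambda>x. z x - f x) \<in> C" using assms(2) f KC by (auto simp: cls_def)
 from addsetD(2)[OF C this f(1)] show "z \<in> C" by simp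
 show "X = cls K z" using cls_mem_eq[OF K] assms(2) f by simp
qed

lemma q_nonempty: assumes "X \<in> carrier (qgrp C K)" shows "(SOME z. z \<in> X) \<in> X"
proof -
 obtain f where "X = cls K f" using assms q_carrier by auto
 hence "f \<in> X" using cls_self[OF K] by simp
 thus ?thesis using someI[of "\<lambda>z. z \<in> X" f] by simp
qed

lemma addset_sum: "finite A ==> (\<And>i. i \<in> A ==> F i \<in> C) ==> (\<lambda>x. \<Sum>i\<in>A. F i x) \<in> C"
 by (induction A rule: finite_induct) (auto simp: addsetD[OF C])

lemma q_finprod: "finite A ==> (\<And>i. i \<in> A ==> F i \<in> C) ==>
  finprod (qgrp C K) (\<lambda>i. cls K (F i)) A = cls K (\<lambda>x. \<Sum>i\<in>A. F i x)"
proof (induction A rule: finite_induct)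
 case empty
 thus ?case by (simp add: comm_monoid.finprod_empty[OF comm_group.axioms(1)[OF q_comm_group]] q_one)
next
 case (insert i A)
 interpret comm_group "qgrp C K" by (rule q_comm_group)
 have "finprod (qgrp C K) (\<lambda>i. cls K (F i)) (insert i A) = cls K (F i) \<otimes>\<^bsub>qgrp C K\<^esub> cls K (\<lambda>x. \<Sum>i\<in>A. F i x)"
  using insert by (subst finprod_insert) (auto simp: q_carrier)
 also have "\<dots> = cls K (\<lambda>x. \<Sum>i\<in>insert i A. F i x)"
  using insert addset_sum[of A F] by (subst q_mult) auto
 finally show ?case .
qed

end

lemma hom_group_fgrp: "hom_group M N = fgrp (lhom M N)"
 by (simp add: hom_group_def fgrp_def)

lemma addset_lhom: "left_module N ==> addset (lhom M N)"
 by (simp add: addset_def lhom_0 lhom_plus lhom_uminus)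

lemma hom_group_carrier: "(hom_group M N)\<lparr>carrier := C\<rparr> = fgrp C"
 by (simp add: hom_group_def fgrp_def)

section \<open>Cohomology classes as stable maps\<close>

context symmetric_hopf begin

lemma dual_basis_lift_image:
 fixes P :: "('a, 'p::ab_group_add) lmod" and Y :: "('a, 'y::ab_group_add) lmod" and Z :: "('a, 'z::ab_group_add) lmod"
 assumes P: "dual_basis P" and f: "f \<in> lhom P Y" and g: "g \<in> lhom Z Y" and lZ: "left_module Z"
  and im: "\<And>x. x \<in> carr P ==> f x \<in> g ` carr Z"
 obtains h where "h \<in> lhom P Z" "\<And>x. x \<in> carr P ==> g (h x) = f x"
proof -
 have lP: "left_module P" using P by (rule dual_basis_lm)
 obtain L where L: "set L \<subseteq> lhom P regular \<times> carr P"
  "\<And>x. x \<in> carr P ==> x = (\<Sum>p\<leftarrow>L. act P (fst p x) (snd p))" using P by (auto simp: dual_basis_def)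
 define s where "s w = inv_into (carr Z) g (f w)" for w
 have s: "s w \<in> carr Z" "g (s w) = f w" if "w \<in> carr P" for w
  using im[OF that] by (simp_all add: s_def inv_into_into f_inv_into_f)
 let ?L = "map (\<lambda>p. (fst p, s (snd p))) L"
 have "set ?L \<subseteq> lhom P regular \<times> carr Z" using s by (auto dest!: subsetD[OF L(1)])
 thus thesis
 proof (rule that[OF null_lhom[OF null_mapI[OF _ lP lZ]]])
  fix x assume x: "x \<in> carr P"
  have "g (\<Sum>p\<leftarrow>L. act Z (fst p x) (s (snd p))) = (\<Sum>p\<leftarrow>L. g (act Z (fst p x) (s (snd p))))"
   using s lZ by (intro lhom_sum_list[OF g]) (auto dest!: subsetD[OF L(1)] intro!: lm_act)
  also have "\<dots> = (\<Sum>p\<leftarrow>L. f (act P (fst p x) (snd p)))"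
   using s by (intro sum_list_cong) (auto dest!: subsetD[OF L(1)] simp: lhom_act[OF g] lhom_act[OF f])
  also have "\<dots> = f (\<Sum>p\<leftarrow>L. act P (fst p x) (snd p))"
   using lP by (intro lhom_sum_list[OF f, symmetric]) (auto dest!: subsetD[OF L(1)] intro!: lm_act)
  also have "\<dots> = f x" using L(2)[OF x] by simp
  finally show "g (restr P (\<lambda>x. \<Sum>p\<leftarrow>?L. act Z (fst p x) (snd p)) x) = f x" using x by (simp add: o_def)
 qed
qed

end

locale hopf_resolution = hopf_heller scale \<Delta> \<epsilon> S H
 for scale :: "'k::field \<Rightarrow> 'a::ring_1 \<Rightarrow> 'a" and \<Delta> \<epsilon> S and H :: "('a, 'u::ab_group_add, 'k) heller" +
 fixes Q :: "('a, 'q::ab_group_add, 'k) resolution"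
 assumes resolution: "projective_resolution (trivial_module \<epsilon>) Q"
begin

lemma res_dual [simp]: "dual_basis (res Q n)"
proof (rule projective_dual_basis)
 show "projective (res Q n)" using resolution by (simp add: projective_resolution_def)
qed

lemma res_lm [simp]: "left_module (res Q n)"
 by (rule dual_basis_lm) simp

lemma bd_lhom: "bd Q n \<in> lhom (res Q (Suc n)) (res Q n)" and aug_lhom: "aug Q \<in> lhom (res Q 0) T"
 and aug_surj: "aug Q ` carr (res Q 0) = UNIV" and bd_exact_0: "bd Q 0 ` carr (res Q (Suc 0)) = lker (res Q 0) (aug Q)"
 and bd_exact: "bd Q (Suc n) ` carr (res Q (Suc (Suc n))) = lker (res Q (Suc n)) (bd Q n)"
 using resolution by (simp_all add: projective_resolution_def)

lemma aug_bd: "x \<in> carr (res Q (Suc 0)) ==> aug Q (bd Q 0 x) = 0"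
 using bd_exact_0 by (auto simp: lker_def)

lemma bd_bd: "x \<in> carr (res Q (Suc (Suc n))) ==> bd Q n (bd Q (Suc n) x) = 0"
 using bd_exact[of n] by (auto simp: lker_def)

lemma bd_exactI: "x \<in> carr (res Q (Suc n)) ==> bd Q n x = 0 ==> x \<in> bd Q (Suc n) ` carr (res Q (Suc (Suc n)))"
 using bd_exact[of n] by (simp add: lker_def)

lemma bd_exactI_0: "x \<in> carr (res Q 0) ==> aug Q x = 0 ==> x \<in> bd Q 0 ` carr (res Q (Suc 0))"
 using bd_exact_0 by (simp add: lker_def)

text \<open>A chain map from a complex of projectives to the resolution is determined up to homotopy by its augmentation;
 \<open>hz\<close> corrects the augmentation in degree \<open>0\<close>.\<close>

lemma homotopy:
 fixes C :: "nat \<Rightarrow> ('a, 'c::ab_group_add) lmod"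
 assumes C: "\<And>i. dual_basis (C i)" and d: "\<And>i. d i \<in> lhom (C (Suc i)) (C i)"
  and dd: "\<And>i x. x \<in> carr (C (Suc (Suc i))) ==> d i (d (Suc i) x) = 0"
  and G: "\<And>i. G i \<in> lhom (C i) (res Q i)"
  and Gd: "\<And>i x. x \<in> carr (C (Suc i)) ==> bd Q i (G (Suc i) x) = G i (d i x)"
  and hz: "hz \<in> lhom (C 0) (res Q 0)" "\<And>x. x \<in> carr (C 0) ==> aug Q (hz x) = aug Q (G 0 x)"
   "\<And>x. x \<in> carr (C (Suc 0)) ==> hz (d 0 x) = 0"
 shows "\<exists>t. (\<forall>i. t i \<in> lhom (C i) (res Q (Suc i))) \<and> (\<forall>x\<in>carr (C 0). bd Q 0 (t 0 x) = G 0 x - hz x) \<and>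
   (\<forall>i. \<forall>x\<in>carr (C (Suc i)). bd Q (Suc i) (t (Suc i) x) = G (Suc i) x - t i (d i x))"
proof -
 have lC: "left_module (C i)" for i by (rule dual_basis_lm[OF C])
 have "\<exists>t. \<forall>n. (t n \<in> lhom (C n) (res Q (Suc n)) \<and> (\<forall>x\<in>carr (C (Suc n)). bd Q n (t n (d n x)) = G n (d n x)) \<and>
   (n = 0 \<longrightarrow> (\<forall>x\<in>carr (C 0). bd Q 0 (t n x) = G 0 x - hz x))) \<and>
   (\<forall>x\<in>carr (C (Suc n)). bd Q (Suc n) (t (Suc n) x) = G (Suc n) x - t n (d n x))"
 proof (rule dependent_nat_choice)
  have f: "(\<lambda>x. G 0 x - hz x) \<in> lhom (C 0) (res Q 0)" by (rule lhom_minus_fun[OF G hz(1) res_lm])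
  have "G 0 x - hz x \<in> bd Q 0 ` carr (res Q (Suc 0))" if x: "x \<in> carr (C 0)" for x
   by (rule bd_exactI_0[OF lhom_in[OF f x]])
     (use x in \<open>simp add: lhom_diff[OF aug_lhom] lhom_in[OF G] lhom_in[OF hz(1)] hz(2)\<close>)
  then obtain t where t: "t \<in> lhom (C 0) (res Q (Suc 0))" "\<And>x. x \<in> carr (C 0) ==> bd Q 0 (t x) = G 0 x - hz x"
   by (rule dual_basis_lift_image[OF C f bd_lhom res_lm]) (assumption | rule that)+
  thus "\<exists>t. t \<in> lhom (C 0) (res Q (Suc 0)) \<and> (\<forall>x\<in>carr (C (Suc 0)). bd Q 0 (t (d 0 x)) = G 0 (d 0 x)) \<and>
   (0 = (0::nat) \<longrightarrow> (\<forall>x\<in>carr (C 0). bd Q 0 (t x) = G 0 x - hz x))"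
   using hz(3) lhom_in[OF d] by (intro exI[of _ t]) simp
 next
  fix t n
  assume "t \<in> lhom (C n) (res Q (Suc n)) \<and> (\<forall>x\<in>carr (C (Suc n)). bd Q n (t (d n x)) = G n (d n x)) \<and>
   (n = 0 \<longrightarrow> (\<forall>x\<in>carr (C 0). bd Q 0 (t x) = G 0 x - hz x))"
  hence t: "t \<in> lhom (C n) (res Q (Suc n))" "\<And>x. x \<in> carr (C (Suc n)) ==> bd Q n (t (d n x)) = G n (d n x)" by auto
  have td: "t \<circ> d n \<in> lhom (C (Suc n)) (res Q (Suc n))" by (rule lhom_comp[OF d t(1) lC])
  have f: "(\<lambda>x. G (Suc n) x - (t \<circ> d n) x) \<in> lhom (C (Suc n)) (res Q (Suc n))"
   by (rule lhom_minus_fun[OF G td res_lm])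
  have "G (Suc n) x - (t \<circ> d n) x \<in> bd Q (Suc n) ` carr (res Q (Suc (Suc n)))" if x: "x \<in> carr (C (Suc n))" for x
   by (rule bd_exactI[OF lhom_in[OF f x]])
     (use x lhom_in[OF td x] in \<open>simp add: lhom_diff[OF bd_lhom] lhom_in[OF G] Gd t(2)\<close>)
  then obtain t' where t': "t' \<in> lhom (C (Suc n)) (res Q (Suc (Suc n)))"
   "\<And>x. x \<in> carr (C (Suc n)) ==> bd Q (Suc n) (t' x) = G (Suc n) x - (t \<circ> d n) x"
   by (rule dual_basis_lift_image[OF C f bd_lhom res_lm]) (assumption | rule that)+
  thus "\<exists>t'. (t' \<in> lhom (C (Suc n)) (res Q (Suc (Suc n))) \<and>
   (\<forall>x\<in>carr (C (Suc (Suc n))). bd Q (Suc n) (t' (d (Suc n) x)) = G (Suc n) (d (Suc n) x)) \<and>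
   (Suc n = 0 \<longrightarrow> (\<forall>x\<in>carr (C 0). bd Q 0 (t' x) = G 0 x - hz x))) \<and>
   (\<forall>x\<in>carr (C (Suc n)). bd Q (Suc n) (t' x) = G (Suc n) x - t (d n x))"
   using lhom_in[OF d] dd lhom_zero[OF t(1) lC] by (intro exI[of _ t']) simp
 qed
 then obtain t where t: "\<forall>n. (t n \<in> lhom (C n) (res Q (Suc n)) \<and> (\<forall>x\<in>carr (C (Suc n)). bd Q n (t n (d n x)) = G n (d n x)) \<and>
   (n = 0 \<longrightarrow> (\<forall>x\<in>carr (C 0). bd Q 0 (t n x) = G 0 x - hz x))) \<and>
   (\<forall>x\<in>carr (C (Suc n)). bd Q (Suc n) (t (Suc n) x) = G (Suc n) x - t n (d n x))" by blast
 thus ?thesis by (intro exI[of _ t]) blast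
qed

text \<open>The covers of the Heller system form a projective resolution of the core with this differential.\<close>

definition cov_d :: "nat \<Rightarrow> 'u \<Rightarrow> 'u" where "cov_d n = inc H (int n) \<circ> prj H (int (Suc n))"

lemma int_Suc_plus: "int (Suc n) = int n + 1"
 by simp

lemma cov_d_lhom: "cov_d n \<in> lhom (Cov H (int (Suc n))) (Cov H (int n))"
 unfolding cov_d_def using lhom_comp[OF prj_lhom inc_lhom[of "int n"] Om_lm] by (simp add: add.commute)

lemma inc_nat_lhom: "inc H (int n) \<in> lhom (Om H (int (Suc n))) (Cov H (int n))"
 using inc_lhom[of "int n"] by (simp add: add.commute)

lemma prj_inc_nat: "y \<in> carr (Om H (int (Suc n))) ==> prj H (int n) (inc H (int n) y) = 0"
 using prj_inc[of y "int n"] by (simp add: add.commute)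

lemma factor_prj_nat:
 fixes Y :: "('a, 'y::ab_group_add) lmod"
 assumes "f \<in> lhom (Cov H (int n)) Y" "\<And>x. x \<in> carr (Om H (int (Suc n))) ==> f (inc H (int n) x) = 0"
 obtains g where "g \<in> lhom (Om H (int n)) Y" "\<And>x. x \<in> carr (Cov H (int n)) ==> g (prj H (int n) x) = f x"
proof (rule factor_prj[OF assms(1)])
 show "f (inc H (int n) x) = 0" if "x \<in> carr (Om H (int n + 1))" for x
  using assms(2)[of x] that by (simp add: add.commute)
qed (rule that)

lemma cov_d_d: "x \<in> carr (Cov H (int (Suc (Suc n)))) ==> cov_d n (cov_d (Suc n) x) = 0"
 using prj_inc_nat[OF lhom_in[OF prj_lhom], of x "Suc n"] by (simp add: cov_d_def lhom_zero[OF inc_nat_lhom] del: of_nat_Suc)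

lemma Om_nat_surj: "y \<in> carr (Om H (int n)) ==> \<exists>x\<in>carr (Cov H (int n)). y = prj H (int n) x"
 using prj_surj[of "int n"] by auto

text \<open>The usual lifting of the augmentation along projectives; \<open>comparison_from_ex\<close> is the converse
 direction.\<close>

lemma comparison_to_ex: "\<exists>s. (\<forall>n. s n \<in> lhom (Cov H (int n)) (res Q n)) \<and>
  (\<forall>x\<in>carr (Cov H 0). aug Q (s 0 x) = core_in H (prj H 0 x)) \<and>
  (\<forall>n. \<forall>x\<in>carr (Cov H (int (Suc n))). bd Q n (s (Suc n) x) = s n (cov_d n x))"
proof -
 have "\<exists>s. \<forall>n. (s n \<in> lhom (Cov H (int n)) (res Q n) \<and>
   (\<forall>x\<in>carr (Cov H (int (Suc n))). s n (cov_d n x) \<in> bd Q n ` carr (res Q (Suc n))) \<and>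
   (n = 0 \<longrightarrow> (\<forall>x\<in>carr (Cov H 0). aug Q (s n x) = core_in H (prj H 0 x)))) \<and>
   (\<forall>x\<in>carr (Cov H (int (Suc n))). bd Q n (s (Suc n) x) = s n (cov_d n x))"
 proof (rule dependent_nat_choice)
  have f: "core_in H \<circ> prj H 0 \<in> lhom (Cov H 0) T" by (rule lhom_comp[OF prj_lhom core_in_lhom Om_lm])
  have im: "(core_in H \<circ> prj H 0) x \<in> aug Q ` carr (res Q 0)" for x using aug_surj by simp
  obtain s where s: "s \<in> lhom (Cov H 0) (res Q 0)" "\<And>x. x \<in> carr (Cov H 0) ==> aug Q (s x) = (core_in H \<circ> prj H 0) x"
   by (rule dual_basis_lift_image[OF Cov_dual f aug_lhom res_lm im]) (rule that)
  have "s (cov_d 0 x) \<in> bd Q 0 ` carr (res Q (Suc 0))" if x: "x \<in> carr (Cov H (int (Suc 0)))" for x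
  proof (rule bd_exactI_0)
   have "cov_d 0 x \<in> carr (Cov H 0)" using lhom_in[OF cov_d_lhom x] by simp
   moreover have "prj H 0 (cov_d 0 x) = 0"
    using prj_inc_nat[OF lhom_in[OF prj_lhom x]] by (simp add: cov_d_def)
   ultimately show "s (cov_d 0 x) \<in> carr (res Q 0)" "aug Q (s (cov_d 0 x)) = 0"
    using s lhom_zero[OF core_in_lhom Om_lm] by (simp_all add: lhom_in[OF s(1)])
  qed
  thus "\<exists>s. s \<in> lhom (Cov H (int 0)) (res Q 0) \<and>
   (\<forall>x\<in>carr (Cov H (int (Suc 0))). s (cov_d 0 x) \<in> bd Q 0 ` carr (res Q (Suc 0))) \<and>
   (0 = (0::nat) \<longrightarrow> (\<forall>x\<in>carr (Cov H 0). aug Q (s x) = core_in H (prj H 0 x)))"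
   using s by (intro exI[of _ s]) simp
 next
  fix s n assume "s \<in> lhom (Cov H (int n)) (res Q n) \<and>
   (\<forall>x\<in>carr (Cov H (int (Suc n))). s (cov_d n x) \<in> bd Q n ` carr (res Q (Suc n))) \<and>
   (n = 0 \<longrightarrow> (\<forall>x\<in>carr (Cov H 0). aug Q (s x) = core_in H (prj H 0 x)))"
  hence s: "s \<in> lhom (Cov H (int n)) (res Q n)"
   "\<And>x. x \<in> carr (Cov H (int (Suc n))) ==> (s \<circ> cov_d n) x \<in> bd Q n ` carr (res Q (Suc n))" by auto
  obtain s' where s': "s' \<in> lhom (Cov H (int (Suc n))) (res Q (Suc n))"
   "\<And>x. x \<in> carr (Cov H (int (Suc n))) ==> bd Q n (s' x) = (s \<circ> cov_d n) x"
   by (rule dual_basis_lift_image[OF Cov_dual lhom_comp[OF cov_d_lhom s(1) Cov_lm] bd_lhom res_lm s(2)])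
     (assumption | rule that)+
  have "s' (cov_d (Suc n) x) \<in> bd Q (Suc n) ` carr (res Q (Suc (Suc n)))" if x: "x \<in> carr (Cov H (int (Suc (Suc n))))" for x
   using s'(2)[OF lhom_in[OF cov_d_lhom x]] cov_d_d[OF x] lhom_zero[OF s(1) Cov_lm]
   by (intro bd_exactI lhom_in[OF s'(1)] lhom_in[OF cov_d_lhom x]) simp
  thus "\<exists>s'. (s' \<in> lhom (Cov H (int (Suc n))) (res Q (Suc n)) \<and>
   (\<forall>x\<in>carr (Cov H (int (Suc (Suc n)))). s' (cov_d (Suc n) x) \<in> bd Q (Suc n) ` carr (res Q (Suc (Suc n)))) \<and>
   (Suc n = 0 \<longrightarrow> (\<forall>x\<in>carr (Cov H 0). aug Q (s' x) = core_in H (prj H 0 x)))) \<and>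
   (\<forall>x\<in>carr (Cov H (int (Suc n))). bd Q n (s' x) = s (cov_d n x))"
   using s' by (intro exI[of _ s']) simp
 qed
 then obtain s where "\<forall>n. (s n \<in> lhom (Cov H (int n)) (res Q n) \<and>
   (\<forall>x\<in>carr (Cov H (int (Suc n))). s n (cov_d n x) \<in> bd Q n ` carr (res Q (Suc n))) \<and>
   (n = 0 \<longrightarrow> (\<forall>x\<in>carr (Cov H 0). aug Q (s n x) = core_in H (prj H 0 x)))) \<and>
   (\<forall>x\<in>carr (Cov H (int (Suc n))). bd Q n (s (Suc n) x) = s n (cov_d n x))" by blast
 thus ?thesis by (intro exI[of _ s]) blast
qed

text \<open>A comparison map from the covers of the Heller system to the resolution.\<close>

definition cmp :: "nat \<Rightarrow> 'u \<Rightarrow> 'q" where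
 "cmp = (SOME s. (\<forall>n. s n \<in> lhom (Cov H (int n)) (res Q n)) \<and>
  (\<forall>x\<in>carr (Cov H 0). aug Q (s 0 x) = core_in H (prj H 0 x)) \<and>
  (\<forall>n. \<forall>x\<in>carr (Cov H (int (Suc n))). bd Q n (s (Suc n) x) = s n (cov_d n x)))"

lemma cmp_lhom: "cmp n \<in> lhom (Cov H (int n)) (res Q n)"
 and cmp_aug: "x \<in> carr (Cov H 0) ==> aug Q (cmp 0 x) = core_in H (prj H 0 x)"
 and cmp_bd: "x \<in> carr (Cov H (int (Suc n))) ==> bd Q n (cmp (Suc n) x) = cmp n (cov_d n x)"
 using someI_ex[OF comparison_to_ex] unfolding cmp_def[symmetric] by blast+

lemma comparison_from_ex: "\<exists>p. (\<forall>n. p n \<in> lhom (res Q n) (Cov H (int n))) \<and>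
  (\<forall>x\<in>carr (res Q 0). prj H 0 (p 0 x) = core_out H (aug Q x)) \<and>
  (\<forall>n. \<forall>x\<in>carr (res Q (Suc n)). cov_d n (p (Suc n) x) = p n (bd Q n x))"
proof -
 have "\<exists>p. \<forall>n. (p n \<in> lhom (res Q n) (Cov H (int n)) \<and>
   (\<forall>x\<in>carr (res Q (Suc n)). prj H (int n) (p n (bd Q n x)) = 0) \<and>
   (n = 0 \<longrightarrow> (\<forall>x\<in>carr (res Q 0). prj H 0 (p n x) = core_out H (aug Q x)))) \<and>
   (\<forall>x\<in>carr (res Q (Suc n)). cov_d n (p (Suc n) x) = p n (bd Q n x))"
 proof (rule dependent_nat_choice)
  have f: "core_out H \<circ> aug Q \<in> lhom (res Q 0) (Om H 0)" by (rule lhom_comp[OF aug_lhom core_out_lhom left_module_T])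
  obtain p where p: "p \<in> lhom (res Q 0) (Cov H 0)" "\<And>x. x \<in> carr (res Q 0) ==> prj H 0 (p x) = (core_out H \<circ> aug Q) x"
   by (rule dual_basis_lift[OF res_dual f prj_lhom prj_surj Cov_lm Om_lm]) (rule that)
  thus "\<exists>p. p \<in> lhom (res Q 0) (Cov H (int 0)) \<and> (\<forall>x\<in>carr (res Q (Suc 0)). prj H (int 0) (p (bd Q 0 x)) = 0) \<and>
   (0 = (0::nat) \<longrightarrow> (\<forall>x\<in>carr (res Q 0). prj H 0 (p x) = core_out H (aug Q x)))"
   by (intro exI[of _ p]) (simp add: lhom_in[OF bd_lhom] aug_bd lhom_zero[OF core_out_lhom])
 next
  fix p n assume "p \<in> lhom (res Q n) (Cov H (int n)) \<and>
   (\<forall>x\<in>carr (res Q (Suc n)). prj H (int n) (p (bd Q n x)) = 0) \<and>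
   (n = 0 \<longrightarrow> (\<forall>x\<in>carr (res Q 0). prj H 0 (p x) = core_out H (aug Q x)))"
  hence p: "p \<in> lhom (res Q n) (Cov H (int n))"
   "\<And>x. x \<in> carr (res Q (Suc n)) ==> prj H (int n) ((p \<circ> bd Q n) x) = 0" by auto
  obtain k where k: "k \<in> lhom (res Q (Suc n)) (Om H (int n + 1))"
   "\<And>x. x \<in> carr (res Q (Suc n)) ==> inc H (int n) (k x) = (p \<circ> bd Q n) x"
   by (rule factor_inc[OF res_lm lhom_comp[OF bd_lhom p(1) res_lm] p(2)]) (assumption | rule that)+
  have k': "k \<in> lhom (res Q (Suc n)) (Om H (int (Suc n)))" using k(1) by (simp add: add.commute)
  obtain p' where p': "p' \<in> lhom (res Q (Suc n)) (Cov H (int (Suc n)))"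
   "\<And>x. x \<in> carr (res Q (Suc n)) ==> prj H (int (Suc n)) (p' x) = k x"
   by (rule dual_basis_lift[OF res_dual k' prj_lhom prj_surj Cov_lm Om_lm]) (rule that)
  have "prj H (int (Suc n)) (p' (bd Q (Suc n) x)) = 0" if x: "x \<in> carr (res Q (Suc (Suc n)))" for x
  proof -
   note b = lhom_in[OF bd_lhom x]
   have "inc H (int n) (k (bd Q (Suc n) x)) = inc H (int n) 0"
    using k(2)[OF b] bd_bd[OF x] lhom_zero[OF p(1)] lhom_zero[OF inc_lhom] by simp
   hence "k (bd Q (Suc n) x) = 0"
    using inc_inj[of "int n"] lhom_in[OF k(1) b] by (simp add: inj_on_def lm_zero)
   thus ?thesis using p'(2)[OF b] by simp
  qed
  thus "\<exists>p'. (p' \<in> lhom (res Q (Suc n)) (Cov H (int (Suc n))) \<and>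
   (\<forall>x\<in>carr (res Q (Suc (Suc n))). prj H (int (Suc n)) (p' (bd Q (Suc n) x)) = 0) \<and>
   (Suc n = 0 \<longrightarrow> (\<forall>x\<in>carr (res Q 0). prj H 0 (p' x) = core_out H (aug Q x)))) \<and>
   (\<forall>x\<in>carr (res Q (Suc n)). cov_d n (p' x) = p (bd Q n x))"
   using p' k(2) unfolding cov_d_def by (intro exI[of _ p']) (simp del: of_nat_Suc)
 qed
 then obtain p where "\<forall>n. (p n \<in> lhom (res Q n) (Cov H (int n)) \<and>
   (\<forall>x\<in>carr (res Q (Suc n)). prj H (int n) (p n (bd Q n x)) = 0) \<and>
   (n = 0 \<longrightarrow> (\<forall>x\<in>carr (res Q 0). prj H 0 (p n x) = core_out H (aug Q x)))) \<and>
   (\<forall>x\<in>carr (res Q (Suc n)). cov_d n (p (Suc n) x) = p n (bd Q n x))" by blast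
 thus ?thesis by (intro exI[of _ p]) blast
qed

lemma cocycle_lhom: "z \<in> cocycles T Q n ==> z \<in> lhom (res Q n) T"
 and cocycle_bd: "z \<in> cocycles T Q n ==> x \<in> carr (res Q (Suc n)) ==> z (bd Q n x) = 0"
 by (simp_all add: cocycles_def)

text \<open>The stable map \<open>\<Omega>\<^sup>n k \<rightarrow> \<Omega>\<^sup>0 k\<close> of a cocycle \<open>z\<close>:
 pulled back to the covers by \<open>cmp\<close>, the cocycle vanishes on the image of the differential and so
 factors through \<open>\<Omega>\<^sup>n k\<close>.\<close>

definition bar :: "nat \<Rightarrow> ('q \<Rightarrow> 'k) \<Rightarrow> 'u \<Rightarrow> 'u" where
 "bar n z = (SOME f. f \<in> lhom (Om H (int n)) (Om H 0) \<and>
   (\<forall>x\<in>carr (Cov H (int n)). f (prj H (int n) x) = core_out H (z (cmp n x))))"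

lemma assumes "z \<in> cocycles T Q n"
 shows bar_hom: "bar n z \<in> hom (int n) 0"
  and bar_prj: "x \<in> carr (Cov H (int n)) ==> bar n z (prj H (int n) x) = core_out H (z (cmp n x))"
proof -
 note z = cocycle_lhom[OF assms]
 have "core_out H \<circ> (z \<circ> cmp n) \<in> lhom (Cov H (int n)) (Om H 0)"
  by (rule lhom_comp[OF lhom_comp[OF cmp_lhom z res_lm] core_out_lhom left_module_T])
 then obtain f where "f \<in> hom (int n) 0" "\<And>x. x \<in> carr (Cov H (int n)) ==> f (prj H (int n) x) = (core_out H \<circ> (z \<circ> cmp n)) x"
 proof (rule factor_prj_nat)
  fix y assume "y \<in> carr (Om H (int (Suc n)))"
  then obtain x where x: "x \<in> carr (Cov H (int (Suc n)))" "y = prj H (int (Suc n)) x" using Om_nat_surj by blast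
  have "cmp n (inc H (int n) y) = bd Q n (cmp (Suc n) x)" using cmp_bd[OF x(1)] x(2) by (simp add: cov_d_def)
  thus "(core_out H \<circ> (z \<circ> cmp n)) (inc H (int n) y) = 0"
   using cocycle_bd[OF assms lhom_in[OF cmp_lhom x(1)]] lhom_zero[OF core_out_lhom] by simp
 qed (rule that)
 hence "\<exists>f. f \<in> lhom (Om H (int n)) (Om H 0) \<and>
   (\<forall>x\<in>carr (Cov H (int n)). f (prj H (int n) x) = core_out H (z (cmp n x)))" by auto
 from someI_ex[OF this] show "bar n z \<in> hom (int n) 0"
  "x \<in> carr (Cov H (int n)) ==> bar n z (prj H (int n) x) = core_out H (z (cmp n x))"
  unfolding bar_def[symmetric] by auto
qed

lemma addset_cocycles: "addset (cocycles T Q n)"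
 unfolding addset_def cocycles_def by (auto simp: lhom_0 lhom_plus lhom_uminus)

lemma bar_plus: assumes "z \<in> cocycles T Q n" "z' \<in> cocycles T Q n"
 shows "bar n (\<lambda>x. z x + z' x) = (\<lambda>x. bar n z x + bar n z' x)"
proof -
 have s: "(\<lambda>x. z x + z' x) \<in> cocycles T Q n" using addset_cocycles assms by (rule addsetD(2))
 show ?thesis
 proof (rule lhom_eqI[OF bar_hom[OF s] lhom_plus[OF bar_hom[OF assms(1)] bar_hom[OF assms(2)] Om_lm]])
  fix y assume "y \<in> carr (Om H (int n))"
  then obtain x where "x \<in> carr (Cov H (int n))" "y = prj H (int n) x" using Om_nat_surj by blast
  thus "bar n (\<lambda>x. z x + z' x) y = bar n z y + bar n z' y"
   using assms s by (simp add: bar_prj lhom_add[OF core_out_lhom])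
 qed
qed

lemma bar_coboundary: assumes "z \<in> coboundaries T Q n" "z \<in> cocycles T Q n" shows "nul (int n) 0 (bar n z)"
proof (cases n)
 case 0
 hence z: "z = (\<lambda>x. 0)" using assms(1) by (simp add: coboundaries_def)
 have "bar n z = (\<lambda>x. 0)"
 proof (rule lhom_eqI[OF bar_hom[OF assms(2)] lhom_0[OF Om_lm]])
  fix y assume "y \<in> carr (Om H (int n))"
  then obtain x where "x \<in> carr (Cov H (int n))" "y = prj H (int n) x" using Om_nat_surj by blast
  thus "bar n z y = 0" using assms(2) lhom_zero[OF core_out_lhom] by (simp add: bar_prj) (simp add: z)
 qed
 thus ?thesis by (simp add: null_zero)
next
 case (Suc m)
 then obtain h where h: "h \<in> lhom (res Q m) T" "z = h \<circ> bd Q m" using assms(1) by (auto simp: coboundaries_def)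
 let ?v = "core_out H \<circ> (h \<circ> cmp m)"
 have v: "?v \<in> lhom (Cov H (int m)) (Om H 0)"
  by (rule lhom_comp[OF lhom_comp[OF cmp_lhom h(1) res_lm] core_out_lhom left_module_T])
 have "bar n z = ?v \<circ> inc H (int m)"
 proof (rule lhom_eqI[OF bar_hom[OF assms(2)]])
  show "?v \<circ> inc H (int m) \<in> hom (int n) 0" using lhom_comp[OF inc_nat_lhom v Cov_lm] Suc by simp
  fix y assume "y \<in> carr (Om H (int n))"
  then obtain x where x: "x \<in> carr (Cov H (int n))" "y = prj H (int n) x" using Om_nat_surj by blast
  hence "bar n z y = core_out H (h (bd Q m (cmp (Suc m) x)))"
   using bar_prj[OF assms(2) x(1)] Suc h(2) by (simp del: of_nat_Suc)
  also have "bd Q m (cmp (Suc m) x) = cmp m (inc H (int m) y)" using cmp_bd[of x m] x Suc by (simp add: cov_d_def)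
  finally show "bar n z y = (?v \<circ> inc H (int m)) y" by simp
 qed
 thus ?thesis using null_through[OF Cov_dual inc_nat_lhom v] Suc by simp
qed

lemma bar_surj: assumes "f \<in> hom (int n) 0" shows "\<exists>z\<in>cocycles T Q n. seq (int n) 0 (bar n z) f"
proof -
 obtain p where p: "\<And>n. p n \<in> lhom (res Q n) (Cov H (int n))"
  "\<And>x. x \<in> carr (res Q 0) ==> prj H 0 (p 0 x) = core_out H (aug Q x)"
  "\<And>n x. x \<in> carr (res Q (Suc n)) ==> cov_d n (p (Suc n) x) = p n (bd Q n x)" using comparison_from_ex by blast
 have prj_d: "prj H (int n) (cov_d n x) = 0" if "x \<in> carr (Cov H (int (Suc n)))" for n x
  using prj_inc_nat[OF lhom_in[OF prj_lhom that]] by (simp add: cov_d_def)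
 have "\<exists>k. \<forall>n. k n \<in> hom (int n) (int n) \<and> (\<forall>x\<in>carr (Cov H (int n)). k n (prj H (int n) x) = prj H (int n) (p n (cmp n x)))"
 proof (rule choice, rule allI)
  fix n
  have "prj H (int n) \<circ> (p n \<circ> cmp n) \<in> lhom (Cov H (int n)) (Om H (int n))"
   by (rule lhom_comp[OF lhom_comp[OF cmp_lhom p(1) res_lm] prj_lhom Cov_lm])
  then obtain k where "k \<in> hom (int n) (int n)" "\<And>x. x \<in> carr (Cov H (int n)) ==> k (prj H (int n) x) = (prj H (int n) \<circ> (p n \<circ> cmp n)) x"
  proof (rule factor_prj_nat)
   fix y assume "y \<in> carr (Om H (int (Suc n)))"
   then obtain x where x: "x \<in> carr (Cov H (int (Suc n)))" "y = prj H (int (Suc n)) x" using Om_nat_surj by blast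
   have "p n (cmp n (inc H (int n) y)) = cov_d n (p (Suc n) (cmp (Suc n) x))"
    using cmp_bd[OF x(1)] p(3)[OF lhom_in[OF cmp_lhom x(1)]] x(2) by (simp add: cov_d_def)
   thus "(prj H (int n) \<circ> (p n \<circ> cmp n)) (inc H (int n) y) = 0"
    using prj_d[OF lhom_in[OF p(1) lhom_in[OF cmp_lhom x(1)]]] by simp
  qed (rule that)
  thus "\<exists>k. k \<in> hom (int n) (int n) \<and> (\<forall>x\<in>carr (Cov H (int n)). k (prj H (int n) x) = prj H (int n) (p n (cmp n x)))"
   by auto
 qed
 then obtain k where k: "\<And>n. k n \<in> hom (int n) (int n)"
  "\<And>n x. x \<in> carr (Cov H (int n)) ==> k n (prj H (int n) x) = prj H (int n) (p n (cmp n x))" by blast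
 have "seq (int n) (int n) (k n) (idm (int n))" for n
 proof (induction n)
  case 0
  have "k 0 = idm (int 0)"
  proof (rule lhom_eqI[OF k(1) idm_hom])
   fix y assume y: "y \<in> carr (Om H (int 0))"
   then obtain x where x: "x \<in> carr (Cov H (int 0))" "y = prj H (int 0) x" using Om_nat_surj by blast
   thus "k 0 y = idm (int 0) y" using k(2)[OF x(1)] p(2)[of "cmp 0 x"] lhom_in[OF cmp_lhom x(1)] y
    by (simp add: cmp_aug core_out_in)
  qed
  thus ?case by (simp add: steq_refl idm_hom)
 next
  case (Suc n)
  have "ladder (int n) (int n) (k n) (k (Suc n))"
   unfolding heller_ladder_def
  proof (intro bexI[OF _ lhom_comp[OF cmp_lhom p(1) res_lm]] conjI ballI)
   show "prj H (int n) ((p n \<circ> cmp n) x) = k n (prj H (int n) x)" if "x \<in> carr (Cov H (int n))" for x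
    using k(2)[OF that] by simp
   fix y assume "y \<in> carr (Om H (int n + 1))"
   hence "y \<in> carr (Om H (int (Suc n)))" by (simp add: add.commute)
   then obtain x where x: "x \<in> carr (Cov H (int (Suc n)))" "y = prj H (int (Suc n)) x" using Om_nat_surj by blast
   have "p n (cmp n (inc H (int n) y)) = cov_d n (p (Suc n) (cmp (Suc n) x))"
    using cmp_bd[OF x(1)] p(3)[OF lhom_in[OF cmp_lhom x(1)]] x(2) by (simp add: cov_d_def)
   also have "\<dots> = inc H (int n) (k (Suc n) y)" using k(2)[OF x(1)] x(2) by (simp add: cov_d_def)
   finally show "(p n \<circ> cmp n) (inc H (int n) y) = inc H (int n) (k (Suc n) y)" by simp
  qed
  from ladder_minus[OF this ladder_id] k(1)[of "Suc n"]
  have "ladder (int n) (int n) (\<lambda>x. k n x - idm (int n) x) (\<lambda>x. k (Suc n) x - idm (int n + 1) x)"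
   by (simp add: idm_hom add.commute)
  from ladder_null_up[OF this] Suc k(1)[of "Suc n"]
  have "nul (int n + 1) (int n + 1) (\<lambda>x. k (Suc n) x - idm (int n + 1) x)"
   by (simp add: steq_def lhom_minus_fun idm_hom add.commute)
  thus ?case using k(1)[of "Suc n"] by (simp add: steq_def idm_hom add.commute)
 qed
 note kid = this
 define z where "z = core_in H \<circ> (f \<circ> (prj H (int n) \<circ> p n))"
 have "z \<in> lhom (res Q n) T" unfolding z_def
  by (rule lhom_comp[OF lhom_comp[OF lhom_comp[OF p(1) prj_lhom Cov_lm] assms Om_lm] core_in_lhom Om_lm])
 moreover have "z (bd Q n x) = 0" if x: "x \<in> carr (res Q (Suc n))" for x
  using p(3)[OF x, symmetric] prj_d[OF lhom_in[OF p(1) x]] lhom_zero[OF assms] lhom_zero[OF core_in_lhom] by (simp add: z_def)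
 ultimately have z: "z \<in> cocycles T Q n" by (simp add: cocycles_def)
 have "bar n z = f \<circ> k n"
 proof (rule lhom_eqI[OF bar_hom[OF z] lhom_comp[OF k(1) assms Om_lm]])
  fix y assume "y \<in> carr (Om H (int n))"
  then obtain x where x: "x \<in> carr (Cov H (int n))" "y = prj H (int n) x" using Om_nat_surj by blast
  have "f (prj H (int n) (p n (cmp n x))) \<in> carr (Om H 0)"
   by (rule lhom_in[OF assms lhom_in[OF prj_lhom lhom_in[OF p(1) lhom_in[OF cmp_lhom x(1)]]]])
  thus "bar n z y = (f \<circ> k n) y" using x bar_prj[OF z x(1)] k(2)[OF x(1)] by (simp add: z_def core_out_in)
 qed
 hence "seq (int n) 0 (bar n z) f"
  using steq_comp[OF kid steq_refl[OF assms Om_lm] Om_lm Om_lm Om_lm] comp_idm[OF assms] by simp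
 with z show ?thesis by blast
qed

lemma lift_cocycle: assumes "y \<in> cocycles T Q b" "cocycle_lift Q a z F" shows "y \<circ> F b \<in> cocycles T Q (a + b)"
proof -
 have F: "F b \<in> lhom (res Q (a + b)) (res Q b)" "\<And>x. x \<in> carr (res Q (Suc (a + b))) ==> F b (bd Q (a + b) x) = bd Q b (F (Suc b) x)"
  "F (Suc b) \<in> lhom (res Q (Suc (a + b))) (res Q (Suc b))"
  using assms(2) unfolding cocycle_lift_def by auto (metis add_Suc_right)
 show ?thesis unfolding cocycles_def
  using lhom_comp[OF F(1) cocycle_lhom[OF assms(1)] res_lm] F(2) cocycle_bd[OF assms(1) lhom_in[OF F(3)]] by simp
qed

text \<open>A lift of the cocycle to a chain map of the resolution is carried by the comparison to a ladder of maps between the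
 sequences of the Heller system, up to a homotopy that is invisible stably.\<close>

lemma bar_mult:
 assumes np: "\<And>s. core_in H (core_out H s) = s"
  and y: "y \<in> cocycles T Q b" and z: "z \<in> cocycles T Q a" and F: "cocycle_lift Q a z F"
 shows "seq (int (a + b)) 0 (bar (a + b) (y \<circ> F b)) (bar b y \<circ> Sh (int b) (int a) 0 (bar a z))"
proof -
 define w where "w = bar a z"
 have w: "w \<in> hom (int a) 0" unfolding w_def by (rule bar_hom[OF z])
 obtain Fc where Fc: "chain (int a) 0 Fc" "Fc 0 = w" "Fc (int b) = Sh (int b) (int a) 0 w" using Sh_chain[OF w] by blast
 have "\<exists>h. \<forall>i. h i \<in> lhom (Cov H (int (a + i))) (Cov H (int i)) \<and>
   (\<forall>x\<in>carr (Cov H (int (a + i))). prj H (int i) (h i x) = Fc (int i) (prj H (int (a + i)) x)) \<and>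
   (\<forall>x\<in>carr (Om H (int (Suc (a + i)))). h i (inc H (int (a + i)) x) = inc H (int i) (Fc (int (Suc i)) x))"
 proof (rule choice, rule allI)
  fix i
  have "ladder (int a + int i) (0 + int i) (Fc (int i)) (Fc (int i + 1))" using Fc(1) unfolding chain_def by blast
  thus "\<exists>h. h \<in> lhom (Cov H (int (a + i))) (Cov H (int i)) \<and>
   (\<forall>x\<in>carr (Cov H (int (a + i))). prj H (int i) (h x) = Fc (int i) (prj H (int (a + i)) x)) \<and>
   (\<forall>x\<in>carr (Om H (int (Suc (a + i)))). h (inc H (int (a + i)) x) = inc H (int i) (Fc (int (Suc i)) x))"
   unfolding heller_ladder_def by (simp add: Bex_def ac_simps)
 qed
 then obtain h where h: "\<And>i. h i \<in> lhom (Cov H (int (a + i))) (Cov H (int i))"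
  "\<And>i x. x \<in> carr (Cov H (int (a + i))) ==> prj H (int i) (h i x) = Fc (int i) (prj H (int (a + i)) x)"
  "\<And>i x. x \<in> carr (Om H (int (Suc (a + i)))) ==> h i (inc H (int (a + i)) x) = inc H (int i) (Fc (int (Suc i)) x)"
  by blast
 have F': "\<And>i. F i \<in> lhom (res Q (a + i)) (res Q i)" "\<And>x. x \<in> carr (res Q a) ==> aug Q (F 0 x) = z x"
  "\<And>i x. x \<in> carr (res Q (Suc (a + i))) ==> bd Q i (F (Suc i) x) = F i (bd Q (a + i) x)"
  using F by (auto simp: cocycle_lift_def)
 \<comment> \<open>Two chain maps with the same augmentation; their difference is homotopic to zero.\<close>
 define G where "G i x = (F i \<circ> cmp (a + i)) x - (cmp i \<circ> h i) x" for i x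
 note Fs = lhom_comp[OF cmp_lhom F'(1) res_lm] and sh = lhom_comp[OF h(1) cmp_lhom Cov_lm]
 have G: "G i \<in> lhom (Cov H (int (a + i))) (res Q i)" for i
  unfolding G_def by (rule lhom_minus_fun[OF Fs sh res_lm])
 have Gd: "bd Q i (G (Suc i) x) = G i (cov_d (a + i) x)" if x: "x \<in> carr (Cov H (int (a + Suc i)))" for i x
 proof -
  have x': "x \<in> carr (Cov H (int (Suc (a + i))))" using x by simp
  have hx: "h (Suc i) x \<in> carr (Cov H (int (Suc i)))" by (rule lhom_in[OF h(1) x])
  have "cov_d i (h (Suc i) x) = h i (cov_d (a + i) x)"
   using h(2)[OF x] h(3)[OF lhom_in[OF prj_lhom x']] by (simp add: cov_d_def)
  hence "bd Q i ((cmp (Suc i) \<circ> h (Suc i)) x) = (cmp i \<circ> h i) (cov_d (a + i) x)" by (simp add: cmp_bd[OF hx])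
  moreover have "bd Q i ((F (Suc i) \<circ> cmp (a + Suc i)) x) = (F i \<circ> cmp (a + i)) (cov_d (a + i) x)"
   using F'(3)[of "cmp (Suc (a + i)) x" i] lhom_in[OF cmp_lhom x'] cmp_bd[OF x'] by simp
  ultimately show ?thesis unfolding G_def using lhom_in[OF Fs x] lhom_in[OF sh x]
   by (simp add: lhom_diff[OF bd_lhom])
 qed
 have G0: "aug Q (G 0 x) = 0" if x: "x \<in> carr (Cov H (int (a + 0)))" for x
 proof -
  have x': "x \<in> carr (Cov H (int a))" using x by simp
  have "aug Q ((cmp 0 \<circ> h 0) x) = core_in H (prj H 0 (h 0 x))" using lhom_in[OF h(1) x] by (simp add: cmp_aug)
  also have "prj H 0 (h 0 x) = core_out H (z (cmp a x))" using h(2)[OF x] Fc(2) bar_prj[OF z x'] by (simp add: w_def)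
  finally have "aug Q ((cmp 0 \<circ> h 0) x) = z (cmp a x)" by (simp add: np)
  moreover have "aug Q ((F 0 \<circ> cmp (a + 0)) x) = z (cmp a x)" using F'(2) lhom_in[OF cmp_lhom x'] by simp
  ultimately show ?thesis unfolding G_def using lhom_in[OF Fs x] lhom_in[OF sh x] by (simp add: lhom_diff[OF aug_lhom])
 qed
 have "\<exists>t. (\<forall>i. t i \<in> lhom (Cov H (int (a + i))) (res Q (Suc i))) \<and>
   (\<forall>x\<in>carr (Cov H (int (a + 0))). bd Q 0 (t 0 x) = G 0 x - (\<lambda>x. 0) x) \<and>
   (\<forall>i. \<forall>x\<in>carr (Cov H (int (a + Suc i))). bd Q (Suc i) (t (Suc i) x) = G (Suc i) x - t i (cov_d (a + i) x))"
 proof (rule homotopy[where C = "\<lambda>i. Cov H (int (a + i))" and d = "\<lambda>i. cov_d (a + i)" and hz = "\<lambda>x. 0"])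
  show "cov_d (a + i) \<in> lhom (Cov H (int (a + Suc i))) (Cov H (int (a + i)))" for i
   using cov_d_lhom[of "a + i"] by simp
  show "cov_d (a + i) (cov_d (a + Suc i) x) = 0" if "x \<in> carr (Cov H (int (a + Suc (Suc i))))" for i x
   using cov_d_d[of x "a + i"] that by simp
 qed (use G Gd G0 lhom_zero[OF aug_lhom res_lm] in \<open>auto simp: lhom_0\<close>)
 then obtain t where t: "\<And>i. t i \<in> lhom (Cov H (int (a + i))) (res Q (Suc i))"
   "\<And>x. x \<in> carr (Cov H (int (a + 0))) ==> bd Q 0 (t 0 x) = G 0 x - 0"
   "\<And>i x. x \<in> carr (Cov H (int (a + Suc i))) ==> bd Q (Suc i) (t (Suc i) x) = G (Suc i) x - t i (cov_d (a + i) x)"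
  by blast
 note yF = lift_cocycle[OF y F]
 have Fcb: "Fc (int b) \<in> hom (int (a + b)) (int b)" using chain_hom[OF Fc(1), of "int b"] by simp
 have rhs: "bar b y \<circ> Fc (int b) \<in> hom (int (a + b)) 0" by (rule lhom_comp[OF Fcb bar_hom[OF y] Om_lm])
 have diff: "bar (a + b) (y \<circ> F b) (prj H (int (a + b)) x) - (bar b y \<circ> Fc (int b)) (prj H (int (a + b)) x)
   = core_out H (y (G b x))" if x: "x \<in> carr (Cov H (int (a + b)))" for x
 proof -
  have "(bar b y \<circ> Fc (int b)) (prj H (int (a + b)) x) = core_out H (y (cmp b (h b x)))"
   using h(2)[OF x, symmetric] bar_prj[OF y lhom_in[OF h(1) x]] by simp
  moreover have "y (G b x) = y (F b (cmp (a + b) x)) - y (cmp b (h b x))"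
   unfolding G_def using lhom_in[OF Fs x] lhom_in[OF sh x] by (simp add: lhom_diff[OF cocycle_lhom[OF y]])
  ultimately show ?thesis using bar_prj[OF yF x] by (simp add: lhom_diff[OF core_out_lhom])
 qed
 have "nul (int (a + b)) 0 (\<lambda>x. bar (a + b) (y \<circ> F b) x - (bar b y \<circ> Fc (int b)) x)" (is "nul _ _ ?D")
 proof (cases b)
  case 0
  have "?D = (\<lambda>x. 0)"
  proof (rule lhom_eqI[OF lhom_minus_fun[OF bar_hom[OF yF] rhs Om_lm] lhom_0[OF Om_lm]])
   fix u assume "u \<in> carr (Om H (int (a + b)))"
   then obtain x where x: "x \<in> carr (Cov H (int (a + b)))" "u = prj H (int (a + b)) x" using Om_nat_surj by blast
   have "y (bd Q b (t b x)) = 0" by (rule cocycle_bd[OF y lhom_in[OF t(1) x(1)]])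
   hence "y (G b x) = 0" using t(2)[of x] x(1) 0 by simp
   thus "?D u = 0" using diff[OF x(1)] x(2) lhom_zero[OF core_out_lhom] by simp
  qed
  thus ?thesis by (simp only: null_zero[OF Om_lm])
 next
  case (Suc c)
  let ?v = "core_out H \<circ> (y \<circ> t c)"
  have v: "?v \<in> lhom (Cov H (int (a + c))) (Om H 0)"
   by (rule lhom_comp[OF lhom_comp[OF t(1) _ res_lm] core_out_lhom left_module_T])
     (use cocycle_lhom[OF y] Suc in simp)
  have "?D = ?v \<circ> inc H (int (a + c))"
  proof (rule lhom_eqI[OF lhom_minus_fun[OF bar_hom[OF yF] rhs Om_lm]])
   show "?v \<circ> inc H (int (a + c)) \<in> hom (int (a + b)) 0" using lhom_comp[OF inc_nat_lhom v Cov_lm] Suc by simp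
   fix u assume "u \<in> carr (Om H (int (a + b)))"
   then obtain x where x: "x \<in> carr (Cov H (int (a + b)))" "u = prj H (int (a + b)) x" using Om_nat_surj by blast
   have xc: "x \<in> carr (Cov H (int (a + Suc c)))" "x \<in> carr (Cov H (int (Suc (a + c))))" using x(1) Suc by simp_all
   have "y (bd Q b (t b x)) = 0" by (rule cocycle_bd[OF y lhom_in[OF t(1) x(1)]])
   moreover have "bd Q b (t b x) = G b x - t c (cov_d (a + c) x)" using t(3)[OF xc(1)] Suc by simp
   moreover have "t c (cov_d (a + c) x) \<in> carr (res Q b)"
    using lhom_in[OF t(1) lhom_in[OF cov_d_lhom xc(2)]] Suc by simp
   ultimately have "y (G b x) = y (t c (cov_d (a + c) x))"
    using lhom_in[OF G x(1)] by (simp add: lhom_diff[OF cocycle_lhom[OF y]])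
   thus "?D u = (?v \<circ> inc H (int (a + c))) u" using diff[OF x(1)] x(2) Suc by (simp add: cov_d_def)
  qed
  thus ?thesis using null_through[OF Cov_dual inc_nat_lhom v] Suc by simp
 qed
 thus ?thesis using bar_hom[OF yF] rhs Fc(3) by (simp add: steq_def w_def)
qed

end

context symmetric_hopf begin

lemma steq_sum:
 assumes "finite A" "\<And>i. i \<in> A ==> steq X Y (F i) (G i)" "left_module Y"
 shows "steq X Y (\<lambda>x. \<Sum>i\<in>A. F i x) (\<lambda>x. \<Sum>i\<in>A. G i x)"
 using assms(1,2) by (induction A rule: finite_induct) (simp_all add: steq_refl lhom_0 assms(3) steq_plus)

lemma lhom_sum: "finite A ==> (\<And>i. i \<in> A ==> F i \<in> lhom X Y) ==> left_module Y ==> (\<lambda>x. \<Sum>i\<in>A. F i x) \<in> lhom X Y"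
 by (induction A rule: finite_induct) (simp_all add: lhom_0 lhom_plus)

end

context hopf_resolution begin

section \<open>The cohomology ring acts through stable maps\<close>

abbreviation E :: "nat \<Rightarrow> ('q \<Rightarrow> 'k) set monoid" where "E \<equiv> ext_deg T Q"
abbreviation R :: "(nat \<Rightarrow> ('q \<Rightarrow> 'k) set) ring" where "R \<equiv> cohomology_ring T Q"

lemma coboundary_cocycle: "coboundaries T Q n \<subseteq> cocycles T Q n"
proof (cases n)
 case 0
 thus ?thesis using addset_cocycles[of n] by (auto simp: coboundaries_def addset_def)
next
 case (Suc m)
 thus ?thesis
  using lhom_comp[OF bd_lhom _ res_lm] by (auto simp: coboundaries_def cocycles_def bd_bd lhom_zero)
qed

lemma addset_coboundaries: "addset (coboundaries T Q n)"
proof (cases n)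
 case 0
 thus ?thesis by (auto simp: coboundaries_def addset_def)
next
 case (Suc m)
 have p: "(\<lambda>x. f x + g x) \<in> coboundaries T Q n" if fg: "f \<in> coboundaries T Q n" "g \<in> coboundaries T Q n" for f g
 proof -
  obtain h h' where "h \<in> lhom (res Q m) T" "h' \<in> lhom (res Q m) T" "f = h \<circ> bd Q m" "g = h' \<circ> bd Q m"
   using fg Suc by (auto simp: coboundaries_def)
  hence "(\<lambda>x. f x + g x) = (\<lambda>x. h x + h' x) \<circ> bd Q m" "(\<lambda>x. h x + h' x) \<in> lhom (res Q m) T"
   by (auto simp: lhom_plus)
  thus ?thesis unfolding coboundaries_def Suc by auto
 qed
 have m: "(\<lambda>x. - f x) \<in> coboundaries T Q n" if f: "f \<in> coboundaries T Q n" for f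
 proof -
  obtain h where "h \<in> lhom (res Q m) T" "f = h \<circ> bd Q m"
   using f Suc by (auto simp: coboundaries_def)
  hence "(\<lambda>x. - f x) = (\<lambda>x. - h x) \<circ> bd Q m" "(\<lambda>x. - h x) \<in> lhom (res Q m) T"
   by (auto simp: lhom_uminus)
  thus ?thesis unfolding coboundaries_def Suc by auto
 qed
 have "(\<lambda>x. 0) = (\<lambda>x. 0) \<circ> bd Q m" by auto
 hence "(\<lambda>x. 0) \<in> coboundaries T Q n"
  unfolding coboundaries_def Suc using lhom_0[OF left_module_T, of "res Q m"] by auto
 with p m show ?thesis unfolding addset_def by blast
qed

sublocale E: fquot "cocycles T Q n" "coboundaries T Q n" for n
 by unfold_locales (rule addset_cocycles addset_coboundaries coboundary_cocycle)+

lemma ext_deg_qgrp: "E n = qgrp (cocycles T Q n) (coboundaries T Q n)"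
 unfolding ext_deg_def qgrp_def hom_group_carrier ..

lemma ext_class_cls: "ext_class T Q n f = cls (coboundaries T Q n) f"
 unfolding ext_class_def hom_group_fgrp by (rule coset_cls[OF addset_coboundaries])

lemma cocycle_lift_ex: assumes z: "z \<in> cocycles T Q a" shows "\<exists>F. cocycle_lift Q a z F"
proof -
 have "\<exists>F. \<forall>n. (F n \<in> lhom (res Q (a + n)) (res Q n) \<and>
   (\<forall>x\<in>carr (res Q (Suc (a + n))). F n (bd Q (a + n) x) \<in> bd Q n ` carr (res Q (Suc n))) \<and>
   (n = 0 \<longrightarrow> (\<forall>x\<in>carr (res Q a). aug Q (F n x) = z x))) \<and>
   (\<forall>x\<in>carr (res Q (Suc (a + n))). bd Q n (F (Suc n) x) = F n (bd Q (a + n) x))"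
 proof (rule dependent_nat_choice)
  have im: "z x \<in> aug Q ` carr (res Q 0)" for x using aug_surj by simp
  obtain F where F: "F \<in> lhom (res Q a) (res Q 0)" "\<And>x. x \<in> carr (res Q a) ==> aug Q (F x) = z x"
   by (rule dual_basis_lift_image[OF res_dual cocycle_lhom[OF z] aug_lhom res_lm im]) (rule that)
  have "F (bd Q a x) \<in> bd Q 0 ` carr (res Q (Suc 0))" if "x \<in> carr (res Q (Suc a))" for x
   using that by (intro bd_exactI_0) (simp_all add: lhom_in[OF F(1)] lhom_in[OF bd_lhom] F(2) cocycle_bd[OF z])
  thus "\<exists>F. F \<in> lhom (res Q (a + 0)) (res Q 0) \<and>
   (\<forall>x\<in>carr (res Q (Suc (a + 0))). F (bd Q (a + 0) x) \<in> bd Q 0 ` carr (res Q (Suc 0))) \<and>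
   (0 = (0::nat) \<longrightarrow> (\<forall>x\<in>carr (res Q a). aug Q (F x) = z x))"
   using F by (intro exI[of _ F]) simp
 next
  fix F n assume "F \<in> lhom (res Q (a + n)) (res Q n) \<and>
   (\<forall>x\<in>carr (res Q (Suc (a + n))). F (bd Q (a + n) x) \<in> bd Q n ` carr (res Q (Suc n))) \<and>
   (n = 0 \<longrightarrow> (\<forall>x\<in>carr (res Q a). aug Q (F x) = z x))"
  hence F: "F \<in> lhom (res Q (a + n)) (res Q n)"
   "\<And>x. x \<in> carr (res Q (Suc (a + n))) ==> (F \<circ> bd Q (a + n)) x \<in> bd Q n ` carr (res Q (Suc n))" by auto
  obtain F' where F': "F' \<in> lhom (res Q (Suc (a + n))) (res Q (Suc n))"
   "\<And>x. x \<in> carr (res Q (Suc (a + n))) ==> bd Q n (F' x) = (F \<circ> bd Q (a + n)) x"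
   by (rule dual_basis_lift_image[OF res_dual lhom_comp[OF bd_lhom F(1) res_lm] bd_lhom res_lm F(2)])
     (assumption | rule that)+
  have "F' (bd Q (Suc (a + n)) x) \<in> bd Q (Suc n) ` carr (res Q (Suc (Suc n)))" if x: "x \<in> carr (res Q (Suc (Suc (a + n))))" for x
   using F'(2)[OF lhom_in[OF bd_lhom x]] bd_bd[OF x] lhom_zero[OF F(1)]
   by (intro bd_exactI lhom_in[OF F'(1)] lhom_in[OF bd_lhom x]) simp
  thus "\<exists>F'. (F' \<in> lhom (res Q (a + Suc n)) (res Q (Suc n)) \<and>
   (\<forall>x\<in>carr (res Q (Suc (a + Suc n))). F' (bd Q (a + Suc n) x) \<in> bd Q (Suc n) ` carr (res Q (Suc (Suc n)))) \<and>
   (Suc n = 0 \<longrightarrow> (\<forall>x\<in>carr (res Q a). aug Q (F' x) = z x))) \<and>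
   (\<forall>x\<in>carr (res Q (Suc (a + n))). bd Q n (F' x) = F (bd Q (a + n) x))"
   using F' by (intro exI[of _ F']) simp
 qed
 then obtain F where "\<forall>n. (F n \<in> lhom (res Q (a + n)) (res Q n) \<and>
   (\<forall>x\<in>carr (res Q (Suc (a + n))). F n (bd Q (a + n) x) \<in> bd Q n ` carr (res Q (Suc n))) \<and>
   (n = 0 \<longrightarrow> (\<forall>x\<in>carr (res Q a). aug Q (F n x) = z x))) \<and>
   (\<forall>x\<in>carr (res Q (Suc (a + n))). bd Q n (F (Suc n) x) = F n (bd Q (a + n) x))" by blast
 thus ?thesis unfolding cocycle_lift_def by (intro exI[of _ F]) auto
qed

lemma ext_mul_well_defined:
 assumes y: "y \<in> cocycles T Q b" "y' \<in> cocycles T Q b" "(\<lambda>x. y x - y' x) \<in> coboundaries T Q b"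
  and z: "z \<in> cocycles T Q a" "z' \<in> cocycles T Q a" "(\<lambda>x. z x - z' x) \<in> coboundaries T Q a"
  and F: "cocycle_lift Q a z F" "cocycle_lift Q a z' F'"
 shows "(\<lambda>x. (y \<circ> F b) x - (y' \<circ> F' b) x) \<in> coboundaries T Q (a + b)"
proof -
 have F1: "\<And>i. F i \<in> lhom (res Q (a + i)) (res Q i)" "\<And>x. x \<in> carr (res Q a) ==> aug Q (F 0 x) = z x"
  "\<And>i x. x \<in> carr (res Q (Suc (a + i))) ==> bd Q i (F (Suc i) x) = F i (bd Q (a + i) x)"
  using F(1) by (auto simp: cocycle_lift_def)
 have F2: "\<And>i. F' i \<in> lhom (res Q (a + i)) (res Q i)" "\<And>x. x \<in> carr (res Q a) ==> aug Q (F' 0 x) = z' x"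
  "\<And>i x. x \<in> carr (res Q (Suc (a + i))) ==> bd Q i (F' (Suc i) x) = F' i (bd Q (a + i) x)"
  using F(2) by (auto simp: cocycle_lift_def)
 note yl = cocycle_lhom[OF y(1)] and yl' = cocycle_lhom[OF y(2)]
 define G where "G i x = F i x - F' i x" for i x
 have G: "G i \<in> lhom (res Q (a + i)) (res Q i)" for i
  unfolding G_def by (rule lhom_minus_fun[OF F1(1) F2(1) res_lm])
 have Gd: "bd Q i (G (Suc i) x) = G i (bd Q (a + i) x)" if x: "x \<in> carr (res Q (a + Suc i))" for i x
  using x F1(3)[of x i] F2(3)[of x i] lhom_in[OF F1(1) x] lhom_in[OF F2(1) x] by (simp add: G_def lhom_diff[OF bd_lhom])
 have G0: "aug Q (G 0 x) = z x - z' x" if x: "x \<in> carr (res Q (a + 0))" for x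
  using x lhom_in[OF F1(1) x] lhom_in[OF F2(1) x] by (simp add: G_def lhom_diff[OF aug_lhom] F1(2) F2(2))
 have "\<exists>k. k \<in> lhom (res Q (a + 0)) (res Q 0) \<and> (\<forall>x\<in>carr (res Q (a + 0)). aug Q (k x) = aug Q (G 0 x)) \<and>
   (\<forall>x\<in>carr (res Q (a + Suc 0)). k (bd Q (a + 0) x) = 0) \<and> (y \<circ> k) \<in> coboundaries T Q (a + 0)"
  if "b = 0"
 proof (cases a)
  case 0
  hence "z x - z' x = 0" for x using z(3) by (simp add: coboundaries_def fun_eq_iff)
  hence "aug Q (G 0 x) = 0" if "x \<in> carr (res Q 0)" for x using G0[of x] 0 that by simp
  thus ?thesis using lhom_zero[OF aug_lhom] lhom_zero[OF yl] 0 addset_coboundaries[of 0]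
   by (intro exI[of _ "\<lambda>x. 0"]) (simp add: lhom_0 o_def addset_def)
 next
  case (Suc m)
  then obtain h where h: "h \<in> lhom (res Q m) T" "(\<lambda>x. z x - z' x) = h \<circ> bd Q m" using z(3) by (auto simp: coboundaries_def)
  have im: "h x \<in> aug Q ` carr (res Q 0)" for x using aug_surj by simp
  obtain l where l: "l \<in> lhom (res Q m) (res Q 0)" "\<And>x. x \<in> carr (res Q m) ==> aug Q (l x) = h x"
   by (rule dual_basis_lift_image[OF res_dual h(1) aug_lhom res_lm im]) (rule that)
  have "y \<circ> (l \<circ> bd Q m) = (y \<circ> l) \<circ> bd Q m" "y \<circ> l \<in> lhom (res Q m) T"
   using lhom_comp[OF l(1) _ res_lm, where g = y and Z = T] yl that by (auto simp: o_def)
  hence "y \<circ> (l \<circ> bd Q m) \<in> coboundaries T Q (Suc m)" by (auto simp: coboundaries_def)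
  moreover have "aug Q (l (bd Q m x)) = z x - z' x" if "x \<in> carr (res Q (Suc m))" for x
   using l(2)[OF lhom_in[OF bd_lhom that]] fun_cong[OF h(2), of x] by simp
  ultimately show ?thesis using Suc G0 lhom_comp[OF bd_lhom l(1) res_lm] bd_bd lhom_zero[OF l(1)]
   by (intro exI[of _ "l \<circ> bd Q m"]) simp
 qed
 moreover have "\<exists>k. k \<in> lhom (res Q (a + 0)) (res Q 0) \<and> (\<forall>x\<in>carr (res Q (a + 0)). aug Q (k x) = aug Q (G 0 x)) \<and>
   (\<forall>x\<in>carr (res Q (a + Suc 0)). k (bd Q (a + 0) x) = 0)"
 proof (cases a)
  case 0
  hence "z x - z' x = 0" for x using z(3) by (simp add: coboundaries_def fun_eq_iff)
  hence "aug Q (G 0 x) = 0" if "x \<in> carr (res Q 0)" for x using G0[of x] 0 that by simp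
  thus ?thesis using lhom_zero[OF aug_lhom] 0
   by (intro exI[of _ "\<lambda>x. 0"]) (simp add: lhom_0)
 next
  case (Suc m)
  then obtain h where h: "h \<in> lhom (res Q m) T" "(\<lambda>x. z x - z' x) = h \<circ> bd Q m" using z(3) by (auto simp: coboundaries_def)
  have im: "h x \<in> aug Q ` carr (res Q 0)" for x using aug_surj by simp
  obtain l where l: "l \<in> lhom (res Q m) (res Q 0)" "\<And>x. x \<in> carr (res Q m) ==> aug Q (l x) = h x"
   by (rule dual_basis_lift_image[OF res_dual h(1) aug_lhom res_lm im]) (rule that)
  have "aug Q (l (bd Q m x)) = z x - z' x" if "x \<in> carr (res Q (Suc m))" for x
   using l(2)[OF lhom_in[OF bd_lhom that]] fun_cong[OF h(2), of x] by simp
  thus ?thesis using Suc G0 lhom_comp[OF bd_lhom l(1) res_lm] bd_bd lhom_zero[OF l(1)]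
   by (intro exI[of _ "l \<circ> bd Q m"]) simp
 qed
 ultimately obtain k where k: "k \<in> lhom (res Q (a + 0)) (res Q 0)" "\<And>x. x \<in> carr (res Q (a + 0)) ==> aug Q (k x) = aug Q (G 0 x)"
  "\<And>x. x \<in> carr (res Q (a + Suc 0)) ==> k (bd Q (a + 0) x) = 0" "b = 0 ==> (y \<circ> k) \<in> coboundaries T Q (a + 0)" by metis
 have "\<exists>t. (\<forall>i. t i \<in> lhom (res Q (a + i)) (res Q (Suc i))) \<and>
   (\<forall>x\<in>carr (res Q (a + 0)). bd Q 0 (t 0 x) = G 0 x - k x) \<and>
   (\<forall>i. \<forall>x\<in>carr (res Q (a + Suc i)). bd Q (Suc i) (t (Suc i) x) = G (Suc i) x - t i (bd Q (a + i) x))"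
 proof (rule homotopy[where C = "\<lambda>i. res Q (a + i)" and d = "\<lambda>i. bd Q (a + i)"])
  show "bd Q (a + i) \<in> lhom (res Q (a + Suc i)) (res Q (a + i))" for i using bd_lhom[of "a + i"] by simp
  show "bd Q (a + i) (bd Q (a + Suc i) x) = 0" if "x \<in> carr (res Q (a + Suc (Suc i)))" for i x
   using bd_bd[of x "a + i"] that by simp
 qed (use G Gd k in auto)
 then obtain t where t: "\<And>i. t i \<in> lhom (res Q (a + i)) (res Q (Suc i))"
   "\<And>x. x \<in> carr (res Q (a + 0)) ==> bd Q 0 (t 0 x) = G 0 x - k x"
   "\<And>i x. x \<in> carr (res Q (a + Suc i)) ==> bd Q (Suc i) (t (Suc i) x) = G (Suc i) x - t i (bd Q (a + i) x)"
  by blast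
 have yG: "y \<circ> G b \<in> coboundaries T Q (a + b)"
 proof (cases b)
  case 0
  have "y \<circ> G 0 = y \<circ> k"
  proof (rule lhom_eqI[OF lhom_comp[OF G _ res_lm] lhom_comp[OF k(1) _ res_lm]])
   fix x assume x: "x \<in> carr (res Q (a + 0))"
   have "y (bd Q 0 (t 0 x)) = 0" using cocycle_bd[OF y(1)] lhom_in[OF t(1) x] 0 by simp
   thus "(y \<circ> G 0) x = (y \<circ> k) x"
    using yl 0 lhom_diff[of y "res Q 0" T "G 0 x" "k x"] lhom_in[OF G x] lhom_in[OF k(1) x] by (simp add: t(2)[OF x])
  qed (use yl 0 in auto)
  thus ?thesis using k(4) 0 by simp
 next
  case (Suc c)
  have ytc: "y \<circ> t c \<in> lhom (res Q (a + c)) T" using lhom_comp[OF t(1) _ res_lm, where g = y and Z = T] yl Suc by simp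
  have "y \<circ> G b = (y \<circ> t c) \<circ> bd Q (a + c)"
  proof (rule lhom_eqI[OF lhom_comp[OF G yl res_lm]])
   show "y \<circ> t c \<circ> bd Q (a + c) \<in> lhom (res Q (a + b)) T" using lhom_comp[OF bd_lhom ytc res_lm] Suc by simp
   fix x assume x: "x \<in> carr (res Q (a + b))"
   have "y (bd Q b (t b x)) = 0" by (rule cocycle_bd[OF y(1) lhom_in[OF t(1) x]])
   moreover have "bd Q b (t b x) = G b x - t c (bd Q (a + c) x)" using t(3)[of x c] x Suc by simp
   moreover have "t c (bd Q (a + c) x) \<in> carr (res Q b)" using lhom_in[OF t(1) lhom_in[OF bd_lhom, of x "a + c"]] x Suc by simp
   ultimately show "(y \<circ> G b) x = (y \<circ> t c \<circ> bd Q (a + c)) x"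
    using lhom_in[OF G x] by (simp add: lhom_diff[OF yl])
  qed
  thus ?thesis using ytc Suc by (auto simp: coboundaries_def)
 qed
 have yy: "(\<lambda>x. y x - y' x) \<circ> F' b \<in> coboundaries T Q (a + b)"
 proof (cases b)
  case 0
  hence "(\<lambda>x. y x - y' x) = (\<lambda>x. 0)" using y(3) by (simp add: coboundaries_def)
  hence "(\<lambda>x. y x - y' x) \<circ> F' b = (\<lambda>x. 0)" by (simp add: fun_eq_iff)
  thus ?thesis using addset_coboundaries by (simp add: addset_def)
 next
  case (Suc c)
  then obtain h where h: "h \<in> lhom (res Q c) T" "(\<lambda>x. y x - y' x) = h \<circ> bd Q c" using y(3) by (auto simp: coboundaries_def)
  have hF: "h \<circ> F' c \<in> lhom (res Q (a + c)) T" by (rule lhom_comp[OF F2(1) h(1) res_lm])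
  have "(h \<circ> bd Q c) \<circ> F' b = (h \<circ> F' c) \<circ> bd Q (a + c)"
  proof (rule lhom_eqI[of _ "res Q (a + b)" T _ T])
   show "h \<circ> bd Q c \<circ> F' b \<in> lhom (res Q (a + b)) T"
    using lhom_comp[OF F2(1)[of b] lhom_comp[OF bd_lhom h(1) res_lm, folded Suc] res_lm] by simp
   show "h \<circ> F' c \<circ> bd Q (a + c) \<in> lhom (res Q (a + b)) T" using lhom_comp[OF bd_lhom hF res_lm] Suc by simp
  qed (use F2(3)[of _ c] Suc in simp)
  thus ?thesis unfolding h(2) using hF Suc by (auto simp: coboundaries_def)
 qed
 have "(\<lambda>x. (y \<circ> F b) x - (y' \<circ> F' b) x) = (\<lambda>x. (y \<circ> G b) x + ((\<lambda>x. y x - y' x) \<circ> F' b) x)"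
 proof
  fix x
  show "(y \<circ> F b) x - (y' \<circ> F' b) x = (y \<circ> G b) x + ((\<lambda>x. y x - y' x) \<circ> F' b) x"
  proof (cases "x \<in> carr (res Q (a + b))")
   case True
   thus ?thesis using lhom_in[OF F1(1) True] lhom_in[OF F2(1) True] by (simp add: G_def lhom_diff[OF yl])
  next
   case False
   thus ?thesis using lhom_out[OF F1(1) False] lhom_out[OF F2(1) False] lhom_zero[OF yl] by (simp add: G_def)
  qed
 qed
 thus ?thesis using addsetD(2)[OF addset_coboundaries yG yy] by simp
qed

lemma ext_mul_class:
 assumes y: "y \<in> cocycles T Q b" and z: "z \<in> cocycles T Q a" and F: "cocycle_lift Q a z F"
 shows "ext_mul T Q b a (ext_class T Q b y) (ext_class T Q a z) = ext_class T Q (a + b) (y \<circ> F b)"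
proof -
 have "ext_class T Q (a + b) (y' \<circ> F' b) = ext_class T Q (a + b) (y \<circ> F b)"
  if "y' \<in> ext_class T Q b y" "z' \<in> ext_class T Q a z" "cocycle_lift Q a z' F'" for y' z' F'
 proof -
  have d: "(\<lambda>x. y' x - y x) \<in> coboundaries T Q b" "(\<lambda>x. z' x - z x) \<in> coboundaries T Q a"
   using that(1,2) by (simp_all add: ext_class_cls cls_def)
  have "y' \<in> cocycles T Q b" using addsetD(2)[OF addset_cocycles subsetD[OF coboundary_cocycle d(1)] y] by simp
  moreover have "z' \<in> cocycles T Q a" using addsetD(2)[OF addset_cocycles subsetD[OF coboundary_cocycle d(2)] z] by simp
  ultimately show ?thesis unfolding ext_class_cls cls_eq[OF addset_coboundaries]
   by (rule ext_mul_well_defined[OF _ y d(1) _ z d(2) that(3) F])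
 qed
 moreover have "y \<in> ext_class T Q b y" "z \<in> ext_class T Q a z"
  using cls_self[OF addset_coboundaries] by (simp_all add: ext_class_cls)
 ultimately show ?thesis unfolding ext_mul_def using F by blast
qed

lemma carrier_R: "x \<in> carrier R \<longleftrightarrow> (\<forall>n. x n \<in> carrier (E n)) \<and> finite {n. x n \<noteq> \<one>\<^bsub>E n\<^esub>}"
proof -
 have g: "group (E i)" for i unfolding ext_deg_qgrp by (rule E.q_group)
 have "carrier R = carrier (sum_group UNIV E)" by (simp add: cohomology_ring_def)
 thus ?thesis by (auto simp: carrier_sum_group[OF g] PiE_iff)
qed

text \<open>An arbitrary cocycle in the class of degree \<open>n\<close>.\<close>

definition rp :: "(nat \<Rightarrow> ('q \<Rightarrow> 'k) set) \<Rightarrow> nat \<Rightarrow> 'q \<Rightarrow> 'k" where "rp x n = (SOME z. z \<in> x n)"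

lemma rp: assumes "x n \<in> carrier (E n)" shows "rp x n \<in> cocycles T Q n" "ext_class T Q n (rp x n) = x n"
proof -
 have c: "x n \<in> carrier (qgrp (cocycles T Q n) (coboundaries T Q n))" using assms by (simp add: ext_deg_qgrp)
 from E.q_rep[OF c E.q_nonempty[OF c]] show "rp x n \<in> cocycles T Q n" "ext_class T Q n (rp x n) = x n"
  by (simp_all add: rp_def ext_class_cls)
qed

text \<open>The stable map of the component of degree \<open>n\<close> of a cohomology class.\<close>

definition bt :: "(nat \<Rightarrow> ('q \<Rightarrow> 'k) set) \<Rightarrow> nat \<Rightarrow> 'u \<Rightarrow> 'u" where "bt x n = bar n (rp x n)"

lemma bt_eq: assumes "x n \<in> carrier (E n)" "x n = ext_class T Q n z" "z \<in> cocycles T Q n"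
 shows "seq (int n) 0 (bt x n) (bar n z)"
proof -
 note r = rp[of x n, OF assms(1)]
 have d: "(\<lambda>v. rp x n v - z v) \<in> coboundaries T Q n"
  using r(2) assms(2) by (simp add: ext_class_cls cls_eq[OF addset_coboundaries])
 note dc = subsetD[OF coboundary_cocycle d]
 have "bar n (rp x n) = (\<lambda>v. bar n (\<lambda>v. rp x n v - z v) v + bar n z v)"
  using bar_plus[OF dc assms(3)] by simp
 hence "(\<lambda>v. bar n (rp x n) v - bar n z v) = bar n (\<lambda>v. rp x n v - z v)" by (simp add: fun_eq_iff)
 thus ?thesis using bar_coboundary[OF d dc] bar_hom[OF r(1)] bar_hom[OF assms(3)] by (simp add: steq_def bt_def)
qed

lemma bt_hom: "x n \<in> carrier (E n) ==> bt x n \<in> hom (int n) 0"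
 unfolding bt_def by (rule bar_hom[OF rp(1)])

lemma one_E: "\<one>\<^bsub>E n\<^esub> = ext_class T Q n (\<lambda>x. 0)"
 by (simp add: ext_deg_qgrp E.q_one ext_class_cls)

lemma zero_cocycle: "(\<lambda>x. 0) \<in> cocycles T Q n"
 using addset_cocycles by (simp add: addset_def)

lemma bt_one: assumes "x n \<in> carrier (E n)" "x n = \<one>\<^bsub>E n\<^esub>" shows "nul (int n) 0 (bt x n)"
proof -
 have "(\<lambda>x. 0) \<in> coboundaries T Q n" using addset_coboundaries by (simp add: addset_def)
 from steq_null[OF bt_eq[of x n "\<lambda>x. 0", OF assms(1) _ zero_cocycle] bar_coboundary[OF this zero_cocycle] Om_lm]
 show ?thesis using assms(2) by (simp add: one_E)
qed

lemma bt_add: assumes "x n \<in> carrier (E n)" "y n \<in> carrier (E n)" "w n \<in> carrier (E n)" "w n = x n \<otimes>\<^bsub>E n\<^esub> y n"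
 shows "seq (int n) 0 (bt w n) (\<lambda>v. bt x n v + bt y n v)"
proof -
 note r = rp[of x n, OF assms(1)] rp[of y n, OF assms(2)]
 have "w n = ext_class T Q n (\<lambda>v. rp x n v + rp y n v)"
  unfolding assms(4) r(2,4)[symmetric] ext_deg_qgrp ext_class_cls by (rule E.q_mult[OF r(1,3)])
 from bt_eq[of w n, OF assms(3) this addsetD(2)[OF addset_cocycles r(1,3)]]
 show ?thesis unfolding bar_plus[OF r(1,3)] bt_def .
qed

lemma bar_sum: "finite A ==> (\<And>i. i \<in> A ==> u i \<in> cocycles T Q n) ==>
  bar n (\<lambda>v. \<Sum>i\<in>A. u i v) = (\<lambda>v. \<Sum>i\<in>A. bar n (u i) v)"
proof (induction A rule: finite_induct)
 case empty
 have "bar n (\<lambda>v. 0 + 0) = (\<lambda>v. bar n (\<lambda>v. 0) v + bar n (\<lambda>v. 0) v)" by (rule bar_plus[OF zero_cocycle zero_cocycle])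
 thus ?case by (simp add: fun_eq_iff)
next
 case (insert i A)
 hence "bar n (\<lambda>v. u i v + (\<Sum>i\<in>A. u i v)) = (\<lambda>v. bar n (u i) v + bar n (\<lambda>v. \<Sum>i\<in>A. u i v) v)"
  by (intro bar_plus E.addset_sum) auto
 thus ?case using insert by simp
qed

lemma R_mult_rep:
 assumes "x \<in> carrier R" "y \<in> carrier R"
 obtains u F where "\<And>b. b \<le> n ==> u b \<in> cocycles T Q n" "\<And>b. b \<le> n ==> cocycle_lift Q (n - b) (rp y (n - b)) (F b)"
  "\<And>b. b \<le> n ==> u b = rp x b \<circ> F b b" "(x \<otimes>\<^bsub>R\<^esub> y) n = ext_class T Q n (\<lambda>v. \<Sum>b\<le>n. u b v)"
proof -
 have xy: "x b \<in> carrier (E b)" "y b \<in> carrier (E b)" for b using assms by (simp_all add: carrier_R)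
 note rx = rp[of x, OF xy(1)] and ry = rp[of y, OF xy(2)]
 have "\<exists>F. \<forall>b. cocycle_lift Q (n - b) (rp y (n - b)) (F b)"
  by (rule choice) (use cocycle_lift_ex[OF ry(1)] in blast)
 then obtain F where F: "\<And>b. cocycle_lift Q (n - b) (rp y (n - b)) (F b)" by blast
 define u where "u b = rp x b \<circ> F b b" for b
 have u: "u b \<in> cocycles T Q n" if "b \<le> n" for b
  unfolding u_def using lift_cocycle[OF rx(1)[of b] F[of b]] that by simp
 have m: "ext_mul T Q b (n - b) (x b) (y (n - b)) = ext_class T Q n (u b)" if "b \<le> n" for b
  using ext_mul_class[OF rx(1)[of b] ry(1) F[of b]] that unfolding rx(2) ry(2) by (simp add: u_def)
 have "(x \<otimes>\<^bsub>R\<^esub> y) n = finprod (E n) (\<lambda>b. ext_mul T Q b (n - b) (x b) (y (n - b))) {..n}"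
  by (simp add: cohomology_ring_def)
 also have "\<dots> = finprod (E n) (\<lambda>b. ext_class T Q n (u b)) {..n}"
  by (rule comm_monoid.finprod_cong')
    (use E.q_comm_group u m in \<open>auto simp: ext_deg_qgrp comm_group.axioms(1) E.q_carrier ext_class_cls\<close>)
 also have "\<dots> = ext_class T Q n (\<lambda>v. \<Sum>b\<le>n. u b v)"
  unfolding ext_deg_qgrp ext_class_cls by (rule E.q_finprod) (use u in auto)
 finally have "(x \<otimes>\<^bsub>R\<^esub> y) n = \<dots>" .
 thus thesis by (intro that[of u F]) (use u F in \<open>auto simp: u_def\<close>)
qed

lemma bt_mult: assumes "x \<in> carrier R" "y \<in> carrier R" "x \<otimes>\<^bsub>R\<^esub> y \<in> carrier R" and np: "\<And>s. core_in H (core_out H s) = s"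
 shows "seq (int n) 0 (bt (x \<otimes>\<^bsub>R\<^esub> y) n)
  (\<lambda>v. \<Sum>b\<le>n. (bt x b \<circ> Sh (int b) (int (n - b)) 0 (bt y (n - b))) v)"
proof -
 obtain u F where u: "\<And>b. b \<le> n ==> u b \<in> cocycles T Q n" "\<And>b. b \<le> n ==> cocycle_lift Q (n - b) (rp y (n - b)) (F b)"
  "\<And>b. b \<le> n ==> u b = rp x b \<circ> F b b" "(x \<otimes>\<^bsub>R\<^esub> y) n = ext_class T Q n (\<lambda>v. \<Sum>b\<le>n. u b v)"
  by (rule R_mult_rep[OF assms(1,2)]) (rule that)
 have xy: "x b \<in> carrier (E b)" "y b \<in> carrier (E b)" "(x \<otimes>\<^bsub>R\<^esub> y) b \<in> carrier (E b)" for b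
  using assms(1-3) by (simp_all add: carrier_R)
 have "seq (int n) 0 (bt (x \<otimes>\<^bsub>R\<^esub> y) n) (bar n (\<lambda>v. \<Sum>b\<le>n. u b v))"
  by (rule bt_eq[of "x \<otimes>\<^bsub>R\<^esub> y", OF xy(3) u(4) E.addset_sum]) (simp_all add: u(1))
 also have "bar n (\<lambda>v. \<Sum>b\<le>n. u b v) = (\<lambda>v. \<Sum>b\<le>n. bar n (u b) v)"
  by (rule bar_sum) (simp_all add: u(1))
 finally have 1: "seq (int n) 0 (bt (x \<otimes>\<^bsub>R\<^esub> y) n) (\<lambda>v. \<Sum>b\<le>n. bar n (u b) v)" .
 have "seq (int n) 0 (bar n (u b)) (bt x b \<circ> Sh (int b) (int (n - b)) 0 (bt y (n - b)))" if "b \<le> n" for b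
  using bar_mult[OF np rp(1)[of x b, OF xy(1)] rp(1)[of y "n - b", OF xy(2)] u(2)[OF that]] that u(3)[OF that]
  by (simp add: bt_def)
 hence "seq (int n) 0 (\<lambda>v. \<Sum>b\<le>n. bar n (u b) v) (\<lambda>v. \<Sum>b\<le>n. (bt x b \<circ> Sh (int b) (int (n - b)) 0 (bt y (n - b))) v)"
  unfolding comp_def by (intro steq_sum) simp_all
 from steq_trans[OF 1 this Om_lm] show ?thesis .
qed

lemma R_mult_degree_0: assumes "x \<in> carrier R" "y \<in> carrier R" "x 0 = \<one>\<^bsub>E 0\<^esub> \<or> y 0 = \<one>\<^bsub>E 0\<^esub>"
 shows "(x \<otimes>\<^bsub>R\<^esub> y) 0 = \<one>\<^bsub>E 0\<^esub>"
proof -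
 obtain u F where u: "\<And>b. b \<le> 0 ==> u b \<in> cocycles T Q 0" "\<And>b. b \<le> 0 ==> cocycle_lift Q (0 - b) (rp y (0 - b)) (F b)"
  "\<And>b. b \<le> 0 ==> u b = rp x b \<circ> F b b" "(x \<otimes>\<^bsub>R\<^esub> y) 0 = ext_class T Q 0 (\<lambda>v. \<Sum>b\<le>0. u b v)"
  by (rule R_mult_rep[OF assms(1,2)]) (rule that)
 have xy: "x b \<in> carrier (E b)" "y b \<in> carrier (E b)" for b using assms(1,2) by (simp_all add: carrier_R)
 have z: "w 0 = \<one>\<^bsub>E 0\<^esub> ==> w 0 \<in> carrier (E 0) ==> rp w 0 = (\<lambda>x. 0)" for w
  using rp(2)[of w 0] by (simp add: one_E ext_class_cls cls_eq[OF addset_coboundaries])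
   (simp add: coboundaries_def fun_eq_iff)
 note ru = rp[of x 0, OF xy(1)]
 have F: "F 0 0 \<in> lhom (res Q 0) (res Q 0)" "\<And>v. v \<in> carr (res Q 0) ==> aug Q (F 0 0 v) = rp y 0 v"
  using u(2)[of 0] by (auto simp: cocycle_lift_def)
 have "u 0 = (\<lambda>v. 0)"
 proof (rule lhom_eqI[OF cocycle_lhom[OF u(1)] lhom_0[OF left_module_T]])
  fix v assume v: "v \<in> carr (res Q 0)"
  from assms(3) show "u 0 v = 0"
  proof
   assume "x 0 = \<one>\<^bsub>E 0\<^esub>"
   thus ?thesis using u(3)[of 0] z[of x] xy(1)[of 0] by simp
  next
   assume "y 0 = \<one>\<^bsub>E 0\<^esub>"
   hence "aug Q (F 0 0 v) = 0" using z[of y] xy(2)[of 0] F(2)[OF v] by simp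
   then obtain w where "w \<in> carr (res Q (Suc 0))" "F 0 0 v = bd Q 0 w" using bd_exactI_0[OF lhom_in[OF F(1) v]] by blast
   thus ?thesis using u(3)[of 0] cocycle_bd[OF ru(1)] by simp
  qed
 qed simp
 thus ?thesis using u(4) by (simp add: one_E)
qed

section \<open>Graded ideals of stable maps are finitely generated\<close>

text \<open>A graded right ideal of stable maps of positive degree.\<close>

definition gideal :: "(nat \<Rightarrow> ('u \<Rightarrow> 'u) set) \<Rightarrow> bool" where
 "gideal W \<longleftrightarrow> (\<forall>j\<ge>1. W j \<subseteq> hom (int j) 0 \<and> (\<lambda>x. 0) \<in> W j \<and>
   (\<forall>f\<in>W j. \<forall>g\<in>W j. (\<lambda>x. f x + g x) \<in> W j) \<and> (\<forall>f\<in>W j. (\<lambda>x. - f x) \<in> W j) \<and>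
   (\<forall>f g. f \<in> W j \<longrightarrow> seq (int j) 0 g f \<longrightarrow> g \<in> W j) \<and>
   (\<forall>i. \<forall>f\<in>W j. \<forall>g\<in>hom (int i) 0. f \<circ> Sh (int j) (int i) 0 g \<in> W (i + j)))"

lemma gidealD: assumes "gideal W" "j \<ge> 1"
 shows "f \<in> W j ==> f \<in> hom (int j) 0" "(\<lambda>x. 0) \<in> W j" "f \<in> W j ==> g \<in> W j ==> (\<lambda>x. f x + g x) \<in> W j"
  "f \<in> W j ==> (\<lambda>x. - f x) \<in> W j" "f \<in> W j ==> seq (int j) 0 g f ==> g \<in> W j"
  "f \<in> W j ==> g \<in> hom (int i) 0 ==> f \<circ> Sh (int j) (int i) 0 g \<in> W (i + j)"
 using assms unfolding gideal_def by blast+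

lemma gideal_null: "gideal W ==> j \<ge> 1 ==> nul (int j) 0 f ==> f \<in> W j"
 by (rule gidealD(5)[OF _ _ gidealD(2)]) (auto simp: steq_zero_iff)

lemma gideal_sum: assumes "gideal W" "j \<ge> 1" "finite A" "\<And>i. i \<in> A ==> F i \<in> W j"
 shows "(\<lambda>x. \<Sum>i\<in>A. F i x) \<in> W j"
 using assms(3,4) by (induction A rule: finite_induct) (simp_all add: gidealD(2,3)[OF assms(1,2)])

text \<open>By graded commutativity a right ideal is also a left ideal.\<close>

lemma gideal_left: assumes W: "gideal W" "j \<ge> 1" and f: "f \<in> W j" and g: "g \<in> hom (int i) 0"
 shows "g \<circ> Sh (int i) (int j) 0 f \<in> W (i + j)"
proof -
 have "sseq (int j + int i) 0 (f \<circ> Sh (int j) (int i) 0 g) (g \<circ> Sh (int i) (int j) 0 f)"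
  by (rule graded_commutative[OF gidealD(1)[OF W f] g]) simp_all
 hence "sseq (int (i + j)) 0 (g \<circ> Sh (int i) (int j) 0 f) (f \<circ> Sh (int j) (int i) 0 g)"
  using sseq_sym by (simp add: add.commute)
 moreover have r: "f \<circ> Sh (int j) (int i) 0 g \<in> W (i + j)" by (rule gidealD(6)[OF W f g])
 moreover have "i + j \<ge> 1" using W(2) by simp
 ultimately show ?thesis unfolding sseq_def
  using gidealD(5)[OF W(1) \<open>i + j \<ge> 1\<close> r] gidealD(5)[OF W(1) \<open>i + j \<ge> 1\<close> gidealD(4)[OF W(1) \<open>i + j \<ge> 1\<close> r]] by blast
qed

text \<open>The ideal of the cohomology ring that corresponds to a graded ideal; the component of degree \<open>0\<close> is
 zero because a graded ideal only speaks about positive degrees.\<close>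

definition ring_ideal :: "(nat \<Rightarrow> ('u \<Rightarrow> 'u) set) \<Rightarrow> (nat \<Rightarrow> ('q \<Rightarrow> 'k) set) set" where
 "ring_ideal W = {x \<in> carrier R. x 0 = \<one>\<^bsub>E 0\<^esub> \<and> (\<forall>j\<ge>1. bt x j \<in> W j)}"

lemma ring_ideal: assumes W: "gideal W" and R: "ring R" and np: "\<And>s. core_in H (core_out H s) = s"
 shows "ideal (ring_ideal W) R"
proof -
 interpret R: ring R by (rule R)
 have deg: "x n \<in> carrier (E n)" if "x \<in> carrier R" for x n using that by (simp add: carrier_R)
 have addn: "(x \<oplus>\<^bsub>R\<^esub> y) n = x n \<otimes>\<^bsub>E n\<^esub> y n" for x y n by (simp add: cohomology_ring_def)
 have zn: "\<zero>\<^bsub>R\<^esub> n = \<one>\<^bsub>E n\<^esub>" for n by (simp add: cohomology_ring_def)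
 have btadd: "seq (int n) 0 (bt (x \<oplus>\<^bsub>R\<^esub> y) n) (\<lambda>v. bt x n v + bt y n v)" if "x \<in> carrier R" "y \<in> carrier R" for x y n
  by (rule bt_add[where x = x and n = n and y = y and w = "x \<oplus>\<^bsub>R\<^esub> y",
     OF deg[OF that(1)] deg[OF that(2)] deg[OF R.a_closed[OF that]] addn])
 interpret E0: comm_group "E 0" unfolding ext_deg_qgrp by (rule E.q_comm_group)
 have sub: "subgroup (ring_ideal W) (add_monoid R)"
 proof (rule R.add.subgroupI)
  show "ring_ideal W \<subseteq> carrier R" by (auto simp: ring_ideal_def)
  have "\<zero>\<^bsub>R\<^esub> \<in> ring_ideal W" unfolding ring_ideal_def
   using R.zero_closed deg[OF R.zero_closed] zn by (auto intro!: gideal_null[OF W] bt_one)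
  thus "ring_ideal W \<noteq> {}" by blast
  show "x \<oplus>\<^bsub>R\<^esub> y \<in> ring_ideal W" if "x \<in> ring_ideal W" "y \<in> ring_ideal W" for x y
  proof -
   have xy: "x \<in> carrier R" "y \<in> carrier R" using that by (simp_all add: ring_ideal_def)
   have "bt (x \<oplus>\<^bsub>R\<^esub> y) j \<in> W j" if "j \<ge> 1" for j
    by (rule gidealD(5)[OF W that gidealD(3)[OF W that] btadd[OF xy]])
      (use \<open>x \<in> ring_ideal W\<close> \<open>y \<in> ring_ideal W\<close> that in \<open>auto simp: ring_ideal_def\<close>)
   thus ?thesis using that xy by (simp add: ring_ideal_def addn)
  qed
  show "\<ominus>\<^bsub>R\<^esub> x \<in> ring_ideal W" if x: "x \<in> ring_ideal W" for x
  proof -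
   have xc: "x \<in> carrier R" "\<ominus>\<^bsub>R\<^esub> x \<in> carrier R" using x by (auto simp: ring_ideal_def)
   have s: "\<ominus>\<^bsub>R\<^esub> x \<oplus>\<^bsub>R\<^esub> x = \<zero>\<^bsub>R\<^esub>" using xc by (simp add: R.l_neg)
   have "bt (\<ominus>\<^bsub>R\<^esub> x) j \<in> W j" if j: "j \<ge> 1" for j
   proof -
    have "nul (int j) 0 (bt \<zero>\<^bsub>R\<^esub> j)" by (rule bt_one) (use deg[OF R.zero_closed] zn in auto)
    hence "nul (int j) 0 (\<lambda>v. bt (\<ominus>\<^bsub>R\<^esub> x) j v + bt x j v)"
     using steq_null[OF steq_sym[OF btadd[OF xc(2,1)] Om_lm]] s by simp
    hence "seq (int j) 0 (bt (\<ominus>\<^bsub>R\<^esub> x) j) (\<lambda>v. - bt x j v)"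
     using bt_hom[of x j, OF deg[OF xc(1)]] bt_hom[of "\<ominus>\<^bsub>R\<^esub> x" j, OF deg[OF xc(2)]] by (simp add: steq_def lhom_uminus)
    thus ?thesis using gidealD(5)[OF W j gidealD(4)[OF W j]] x j by (auto simp: ring_ideal_def)
   qed
   moreover have "(\<ominus>\<^bsub>R\<^esub> x) 0 = \<one>\<^bsub>E 0\<^esub>"
    using fun_cong[OF s, of 0] x deg[OF xc(2)] by (simp add: addn zn ring_ideal_def)
   ultimately show ?thesis using xc by (simp add: ring_ideal_def)
  qed
 qed
 have mult: "x \<otimes>\<^bsub>R\<^esub> y \<in> ring_ideal W" if xy: "x \<in> carrier R" "y \<in> carrier R" and or: "x \<in> ring_ideal W \<or> y \<in> ring_ideal W" for x y
 proof -
  have c: "x \<otimes>\<^bsub>R\<^esub> y \<in> carrier R" using xy by simp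
  have "bt (x \<otimes>\<^bsub>R\<^esub> y) n \<in> W n" if n: "n \<ge> 1" for n
  proof (rule gidealD(5)[OF W n _ bt_mult[OF xy c np]], rule gideal_sum[OF W n])
   fix b assume "b \<in> {..n}"
   hence b: "b \<le> n" by simp
   note hx = bt_hom[of x b, OF deg[OF xy(1)]] and hy = bt_hom[of y "n - b", OF deg[OF xy(2)]]
   have sh: "Sh (int b) (int (n - b)) 0 (bt y (n - b)) \<in> hom (int n) (int b)"
    using Sh_hom[OF hy, of "int b"] b by (simp add: of_nat_diff)
   from or show "bt x b \<circ> Sh (int b) (int (n - b)) 0 (bt y (n - b)) \<in> W n"
   proof
    assume x: "x \<in> ring_ideal W"
    show ?thesis
    proof (cases "b = 0")
     case True
     hence "nul (int b) 0 (bt x b)" using x deg[OF xy(1)] by (intro bt_one) (auto simp: ring_ideal_def)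
     from null_comp_right[OF this sh Om_lm] show ?thesis by (rule gideal_null[OF W n])
    next
     case False
     hence "b \<ge> 1" by simp
     thus ?thesis using gidealD(6)[OF W \<open>b \<ge> 1\<close> _ hy, of "bt x b"] x b by (simp add: ring_ideal_def)
    qed
   next
    assume y: "y \<in> ring_ideal W"
    show ?thesis
    proof (cases "n - b = 0")
     case True
     hence "nul (int (n - b)) 0 (bt y (n - b))" using y deg[OF xy(2)] by (intro bt_one) (auto simp: ring_ideal_def)
     from Sh_null[OF this, of "int b"] have "nul (int n) (int b) (Sh (int b) (int (n - b)) 0 (bt y (n - b)))"
      using b by (simp add: of_nat_diff)
     from null_comp_left[OF this hx Om_lm] show ?thesis by (rule gideal_null[OF W n])
    next
     case False
     hence "n - b \<ge> 1" by simp
     thus ?thesis using gideal_left[OF W \<open>n - b \<ge> 1\<close> _ hx, of "bt y (n - b)"] y b by (simp add: ring_ideal_def)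
    qed
   qed
  qed simp
  moreover have "(x \<otimes>\<^bsub>R\<^esub> y) 0 = \<one>\<^bsub>E 0\<^esub>"
   by (rule R_mult_degree_0[OF xy]) (use or in \<open>auto simp: ring_ideal_def\<close>)
  ultimately show ?thesis using c by (simp add: ring_ideal_def)
 qed
 show ?thesis
 proof (rule idealI[OF R sub])
  fix a x assume "a \<in> ring_ideal W" "x \<in> carrier R"
  thus "x \<otimes>\<^bsub>R\<^esub> a \<in> ring_ideal W" "a \<otimes>\<^bsub>R\<^esub> x \<in> ring_ideal W"
   using mult by (auto simp: ring_ideal_def)
 qed
qed

text \<open>The maps in degree \<open>j\<close> in the right ideal generated by the pairs (degree, map) in \<open>Z\<close>.\<close>

definition rspan :: "(int \<times> ('u \<Rightarrow> 'u)) set \<Rightarrow> int \<Rightarrow> ('u \<Rightarrow> 'u) set" where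
 "rspan Z j = {f \<in> hom j 0. \<exists>r. (\<forall>p\<in>Z. r p \<in> hom j (fst p)) \<and> seq j 0 f (\<lambda>x. \<Sum>p\<in>Z. snd p (r p x))}"

lemma rspan_comp: assumes Z: "finite Z" "\<And>p. p \<in> Z ==> snd p \<in> hom (fst p) 0" and f: "f \<in> rspan Z j" and g: "g \<in> hom i j"
 shows "f \<circ> g \<in> rspan Z i"
proof -
 obtain r where fh: "f \<in> hom j 0" and r: "\<And>p. p \<in> Z ==> r p \<in> hom j (fst p)" "seq j 0 f (\<lambda>x. \<Sum>p\<in>Z. snd p (r p x))"
  using f by (auto simp: rspan_def)
 have "seq i 0 (f \<circ> g) ((\<lambda>x. \<Sum>p\<in>Z. snd p (r p x)) \<circ> g)"
  by (rule steq_comp[OF steq_refl[OF g Om_lm] r(2) Om_lm Om_lm Om_lm])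
 thus ?thesis unfolding rspan_def using lhom_comp[OF g fh Om_lm] lhom_comp[OF g r(1) Om_lm]
  by (intro CollectI conjI exI[of _ "\<lambda>p. r p \<circ> g"]) (auto simp: o_def)
qed

lemma rspan_plus: assumes Z: "finite Z" "\<And>p. p \<in> Z ==> snd p \<in> hom (fst p) 0" and f: "f \<in> rspan Z j" and g: "g \<in> rspan Z j"
 shows "(\<lambda>x. f x + g x) \<in> rspan Z j"
proof -
 obtain r where fh: "f \<in> hom j 0" and r: "\<And>p. p \<in> Z ==> r p \<in> hom j (fst p)" "seq j 0 f (\<lambda>x. \<Sum>p\<in>Z. snd p (r p x))"
  using f by (auto simp: rspan_def)
 obtain s where gh: "g \<in> hom j 0" and s: "\<And>p. p \<in> Z ==> s p \<in> hom j (fst p)" "seq j 0 g (\<lambda>x. \<Sum>p\<in>Z. snd p (s p x))"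
  using g by (auto simp: rspan_def)
 have eq: "(\<Sum>p\<in>Z. snd p (r p x)) + (\<Sum>p\<in>Z. snd p (s p x)) = (\<Sum>p\<in>Z. snd p (r p x + s p x))" for x
  unfolding sum.distrib[symmetric]
 proof (rule sum.cong[OF refl])
  fix p assume p: "p \<in> Z"
  show "snd p (r p x) + snd p (s p x) = snd p (r p x + s p x)"
   by (cases "x \<in> carr (Om H j)")
     (simp_all add: lhom_add[OF Z(2)[OF p]] lhom_in[OF r(1)[OF p]] lhom_in[OF s(1)[OF p]] lhom_out[OF r(1)[OF p]] lhom_out[OF s(1)[OF p]]
      lhom_zero[OF Z(2)[OF p]])
 qed
 have "seq j 0 (\<lambda>x. f x + g x) (\<lambda>x. \<Sum>p\<in>Z. snd p (r p x + s p x))"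
  using steq_plus[OF r(2) s(2) Om_lm] unfolding eq .
 thus ?thesis unfolding rspan_def using lhom_plus[OF fh gh Om_lm] lhom_plus[OF r(1) s(1) Om_lm]
  by (intro CollectI conjI exI[of _ "\<lambda>p x. r p x + s p x"]) auto
qed

lemma rspan_zero: "(\<And>p. p \<in> Z ==> snd p \<in> hom (fst p) 0) ==> (\<lambda>x. 0) \<in> rspan Z j"
 unfolding rspan_def
proof (intro CollectI conjI exI[of _ "\<lambda>p x. 0"])
 assume Z: "\<And>p. p \<in> Z ==> snd p \<in> hom (fst p) 0"
 have "(\<Sum>p\<in>Z. snd p 0) = 0" using lhom_zero[OF Z Om_lm] by simp
 thus "seq j 0 (\<lambda>x. 0) (\<lambda>x. \<Sum>p\<in>Z. snd p 0)" by (simp only: steq_refl lhom_0 Om_lm)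
qed (auto simp: lhom_0)

lemma rspan_uminus: assumes Z: "finite Z" "\<And>p. p \<in> Z ==> snd p \<in> hom (fst p) 0" and f: "f \<in> rspan Z j"
 shows "(\<lambda>x. - f x) \<in> rspan Z j"
proof -
 have fh: "f \<in> hom j 0" using f by (simp add: rspan_def)
 have m: "restr (Om H j) (\<lambda>x. - x) \<in> hom j j"
  by (rule restr_lhomI) (simp_all add: lm_minus lm_act_minus)
 have "f \<circ> restr (Om H j) (\<lambda>x. - x) = (\<lambda>x. - f x)"
  by (rule ext) (simp add: restr_def lhom_minus[OF fh] lhom_zero[OF fh] lhom_out[OF fh])
 thus ?thesis using rspan_comp[OF Z f m] by simp
qed

lemma rspan_cong: assumes "f \<in> rspan Z j" "seq j 0 g f" shows "g \<in> rspan Z j"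
proof -
 obtain r where "\<forall>p\<in>Z. r p \<in> hom j (fst p)" "seq j 0 f (\<lambda>x. \<Sum>p\<in>Z. snd p (r p x))"
  using assms(1) by (auto simp: rspan_def)
 thus ?thesis unfolding rspan_def using steq_trans[OF assms(2) _ Om_lm] steq_lhom(1)[OF assms(2)] by blast
qed

lemma rspan_base: assumes Z: "finite Z" "\<And>p. p \<in> Z ==> snd p \<in> hom (fst p) 0" and p: "(j, f) \<in> Z" shows "f \<in> rspan Z j"
proof -
 have fh: "f \<in> hom j 0" using Z(2)[OF p] by simp
 let ?r = "\<lambda>q. if q = (j, f) then idm j else (\<lambda>x. 0)"
 have "(\<Sum>q\<in>Z. snd q (?r q x)) = f x" for x
 proof -
  have "(\<Sum>q\<in>Z. snd q (?r q x)) = (\<Sum>q\<in>Z. if q = (j, f) then f (idm j x) else 0)"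
   using lhom_zero[OF Z(2)] by (intro sum.cong) auto
  also have "\<dots> = f x" using Z(1) p fun_cong[OF comp_idm[OF fh], of x] by simp
  finally show ?thesis .
 qed
 thus ?thesis unfolding rspan_def using fh
  by (intro CollectI conjI exI[of _ ?r]) (auto simp: steq_refl idm_hom lhom_0)
qed

lemma rspan_mono: assumes "finite Z'" "Z \<subseteq> Z'" "\<And>p. p \<in> Z' ==> snd p \<in> hom (fst p) 0" "f \<in> rspan Z j" shows "f \<in> rspan Z' j"
proof -
 obtain r where fh: "f \<in> hom j 0" and r: "\<And>p. p \<in> Z ==> r p \<in> hom j (fst p)" "seq j 0 f (\<lambda>x. \<Sum>p\<in>Z. snd p (r p x))"
  using assms(4) by (auto simp: rspan_def)
 let ?r = "\<lambda>p. if p \<in> Z then r p else (\<lambda>x. 0)"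
 have "(\<Sum>p\<in>Z'. snd p (?r p x)) = (\<Sum>p\<in>Z. snd p (r p x))" for x
  using assms lhom_zero[OF assms(3)] by (intro sum.mono_neutral_cong_right) auto
 thus ?thesis unfolding rspan_def using fh r by (intro CollectI conjI exI[of _ ?r]) (auto simp: lhom_0)
qed

text \<open>The generators of the corresponding ideal of the cohomology ring, split into their homogeneous components, form
 \<open>Z\<close>. The graded right ideal spanned by \<open>Z\<close> also corresponds to an ideal of the ring; this
 contains the generators, hence the ideal of \<open>W\<close>.\<close>

theorem gideal_finitely_generated:
 assumes W: "gideal W" and R: "noetherian_ring R" and np: "\<And>s. core_in H (core_out H s) = s"
 obtains Z where "finite Z" "\<And>d f. (d, f) \<in> Z ==> d \<ge> 1 \<and> f \<in> W (nat d)"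
  "\<And>j f. j \<ge> 1 ==> f \<in> W j ==> f \<in> rspan Z (int j)"
proof -
 interpret R: noetherian_ring R by (rule R)
 have ring: "ring R" by (rule R.ring_axioms)
 obtain A where A: "A \<subseteq> carrier R" "finite A" "ring_ideal W = genideal R A"
  using R.finetely_gen[OF ring_ideal[OF W ring np]] by blast
 have AI: "A \<subseteq> ring_ideal W" using R.genideal_self[OF A(1)] A(3) by simp
 have deg: "x n \<in> carrier (E n)" if "x \<in> carrier R" for x n using that by (simp add: carrier_R)
 define Z where "Z = (\<Union>x\<in>A. (\<lambda>n. (int n, bt x n)) ` {n. n \<ge> 1 \<and> x n \<noteq> \<one>\<^bsub>E n\<^esub>})"
 have fZ: "finite Z" unfolding Z_def
 proof (intro finite_UN_I[OF A(2)] finite_imageI)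
  fix x assume "x \<in> A"
  hence "finite {n. x n \<noteq> \<one>\<^bsub>E n\<^esub>}" using A(1) carrier_R by blast
  thus "finite {n. n \<ge> 1 \<and> x n \<noteq> \<one>\<^bsub>E n\<^esub>}" by (rule rev_finite_subset) auto
 qed
 have ZW: "d \<ge> 1 \<and> f \<in> W (nat d)" if "(d, f) \<in> Z" for d f
  using that AI by (auto simp: Z_def ring_ideal_def)
 have Zh: "snd p \<in> hom (fst p) 0" if "p \<in> Z" for p
 proof -
  have "fst p \<ge> 1 \<and> snd p \<in> W (nat (fst p))" using ZW[of "fst p" "snd p"] that by simp
  hence "nat (fst p) \<ge> 1" "snd p \<in> W (nat (fst p))" "int (nat (fst p)) = fst p" by auto
  thus ?thesis using gidealD(1)[OF W] by metis
 qed
 have gs: "gideal (\<lambda>j. rspan Z (int j))" unfolding gideal_def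
 proof (intro allI impI conjI ballI)
  fix j
  show "rspan Z (int j) \<subseteq> hom (int j) 0" by (auto simp: rspan_def)
  fix i f g assume "f \<in> rspan Z (int j)" "g \<in> hom (int i) 0"
  thus "f \<circ> Sh (int j) (int i) 0 g \<in> rspan Z (int (i + j))"
   using rspan_comp[OF fZ Zh, of f "int j" "Sh (int j) (int i) 0 g" "int (i + j)"] Sh_hom[of g "int i" 0 "int j"] by simp
 qed (use rspan_zero[OF Zh] rspan_plus[OF fZ Zh] rspan_uminus[OF fZ Zh] rspan_cong in auto)
 have "A \<subseteq> ring_ideal (\<lambda>j. rspan Z (int j))"
 proof
  fix x assume x: "x \<in> A"
  hence xc: "x \<in> carrier R" using A(1) by blast
  have "bt x j \<in> rspan Z (int j)" if j: "j \<ge> 1" for j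
  proof (cases "x j = \<one>\<^bsub>E j\<^esub>")
   case True
   show ?thesis using gideal_null[OF gs j bt_one[of x j, OF deg[OF xc] True]] by simp
  next
   case False
   hence "(int j, bt x j) \<in> Z" using x j by (auto simp: Z_def)
   thus ?thesis using rspan_base[OF fZ Zh] by blast
  qed
  thus "x \<in> ring_ideal (\<lambda>j. rspan Z (int j))" using x AI by (auto simp: ring_ideal_def)
 qed
 hence sub: "ring_ideal W \<subseteq> ring_ideal (\<lambda>j. rspan Z (int j))"
  unfolding A(3) by (rule R.genideal_minimal[OF ring_ideal[OF gs ring np]])
 have "f \<in> rspan Z (int j)" if j: "j \<ge> 1" and f: "f \<in> W j" for j f
 proof -
  obtain z where z: "z \<in> cocycles T Q j" "seq (int j) 0 (bar j z) f" using bar_surj[OF gidealD(1)[OF W j f]] by blast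
  define x where "x n = (if n = j then ext_class T Q j z else \<one>\<^bsub>E n\<^esub>)" for n
  have one: "\<one>\<^bsub>E n\<^esub> \<in> carrier (E n)" for n
   unfolding ext_deg_qgrp using group.is_monoid[OF E.q_group] by (rule monoid.one_closed)
  have xj: "x j \<in> carrier (E j)" using z(1) by (auto simp: x_def ext_deg_qgrp E.q_carrier ext_class_cls)
  have xc: "x \<in> carrier R" unfolding carrier_R
  proof
   show "\<forall>n. x n \<in> carrier (E n)" using xj one by (simp add: x_def)
   have "{n. x n \<noteq> \<one>\<^bsub>E n\<^esub>} \<subseteq> {j}" by (auto simp: x_def)
   thus "finite {n. x n \<noteq> \<one>\<^bsub>E n\<^esub>}" by (rule finite_subset) simp
  qed
  have bf: "seq (int j) 0 (bt x j) f"
   by (rule steq_trans[OF bt_eq[of x j, OF xj _ z(1)] z(2) Om_lm]) (simp add: x_def)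
  have "bt x i \<in> W i" if "i \<ge> 1" for i
  proof (cases "i = j")
   case True
   thus ?thesis using gidealD(5)[OF W j f bf] by simp
  next
   case False
   hence "x i = \<one>\<^bsub>E i\<^esub>" by (simp add: x_def)
   thus ?thesis by (rule gideal_null[OF W that bt_one[of x i, OF deg[OF xc]]])
  qed
  hence "x \<in> ring_ideal W" using xc j by (simp add: ring_ideal_def x_def)
  hence "bt x j \<in> rspan Z (int j)" using sub j by (auto simp: ring_ideal_def)
  thus ?thesis by (rule rspan_cong[OF _ steq_sym[OF bf Om_lm]])
 qed
 thus thesis by (intro that[of Z] fZ ZW)
qed

end

context symmetric_hopf begin

section \<open>Spaces of homomorphisms are finite dimensional\<close>

text \<open>A homomorphism is determined by the values at finitely many generators, and these are finitely many vectors with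
 finitely many coordinates in the algebra; all of them are stored in a single finitely supported family.\<close>

lemma lhom_finite_dimensional:
 fixes X :: "('a, 'x::ab_group_add) lmod" and Y :: "('a, 'y::ab_group_add) lmod"
 assumes X: "fg_module X" and Y: "fg_module Y" and K: "K \<subseteq> lhom X Y" "(\<lambda>x. 0) \<in> K"
  "\<And>f g. f \<in> K ==> g \<in> K ==> (\<lambda>x. f x + g x) \<in> K" "\<And>c f. f \<in> K ==> (\<lambda>x. smul Y c (f x)) \<in> K"
 obtains B where "finite B" "B \<subseteq> K" "\<And>f. f \<in> K ==> \<exists>c. f = (\<lambda>x. \<Sum>b\<in>B. smul Y (c b) (b x))"
proof -
 have lX: "left_module X" and lY: "left_module Y" using X Y by (simp_all add: fg_lm)
 obtain G where G: "finite G" "G \<subseteq> carr X" "\<And>x. x \<in> carr X ==> \<exists>r. x = (\<Sum>g\<in>G. act X (r g) g)"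
  using X by (auto simp: fg_module_def)
 obtain gs where gs: "set gs = G" using finite_list[OF G(1)] by blast
 obtain r q j where q: "q \<in> lhom (free_module r) Y"
  and j: "\<And>x. x \<in> carr Y ==> j x \<in> carr (free_module r)" "\<And>x. x \<in> carr Y ==> q (j x) = x"
  "\<And>x y. x \<in> carr Y ==> y \<in> carr Y ==> j (x + y) = j x + j y"
  "\<And>x c. x \<in> carr Y ==> j (smul Y c x) = pscale c (j x)"
  by (rule free_cover[OF Y]) (rule that)
 have gc: "gs ! i \<in> carr X" if "i < length gs" for i using that gs G(2) nth_mem by blast
 define P where "P = {..<length gs} \<times> {..<r}"
 have fP: "finite P" by (simp add: P_def)
 \<comment> \<open>A pair of a generator and a coordinate is coded by a natural number.\<close>
 define \<Phi> where "\<Phi> f = (\<Sum>p\<in>P. Poly_Mapping.single (prod_encode p) (lookup (j (f (gs ! fst p))) (snd p)))" for f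
 have lk: "lookup (\<Sum>p\<in>P. Poly_Mapping.single (prod_encode p) (F p)) (prod_encode t) = (if t \<in> P then F t else 0)" for F t
  using fP by (simp add: lookup_sum lookup_single when_def prod_encode_eq)
 have fg: "f (gs ! i) \<in> carr Y" if "f \<in> lhom X Y" "i < length gs" for f i using lhom_in[OF that(1) gc[OF that(2)]] .
 have Padd: "\<Phi> (\<lambda>x. f x + g x) = \<Phi> f + \<Phi> g" if "f \<in> lhom X Y" "g \<in> lhom X Y" for f g
  unfolding \<Phi>_def sum.distrib[symmetric] using fg that
  by (intro sum.cong) (auto simp: P_def j(3) lookup_add single_add)
 have Psc: "\<Phi> (\<lambda>x. smul Y c (f x)) = pscale c (\<Phi> f)" if "f \<in> lhom X Y" for c f
  unfolding \<Phi>_def V.scale_sum_right using fg that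
  by (intro sum.cong) (auto simp: P_def j(4) lookup_pscale lookup_single when_def intro!: poly_mapping_eqI)
 have inj: "f = g" if fgl: "f \<in> lhom X Y" "g \<in> lhom X Y" and eq: "\<Phi> f = \<Phi> g" for f g
 proof (rule lhom_eqI[OF fgl])
  have v: "f (gs ! i) = g (gs ! i)" if i: "i < length gs" for i
  proof -
   have "lookup (j (f (gs ! i))) l = lookup (j (g (gs ! i))) l" for l
   proof (cases "l < r")
    case True
    hence "(i, l) \<in> P" using i by (simp add: P_def)
    thus ?thesis using arg_cong[OF eq, of "\<lambda>p. lookup p (prod_encode (i, l))"] by (simp add: \<Phi>_def lk)
   next
    case False
    thus ?thesis using j(1)[OF fg[OF fgl(1) i]] j(1)[OF fg[OF fgl(2) i]] by (simp add: carr_free)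
   qed
   hence "j (f (gs ! i)) = j (g (gs ! i))" by (rule poly_mapping_eqI)
   thus ?thesis using j(2)[OF fg[OF fgl(1) i]] j(2)[OF fg[OF fgl(2) i]] by metis
  qed
  hence vG: "f g' = g g'" if "g' \<in> G" for g' using that gs by (metis in_set_conv_nth)
  fix x assume "x \<in> carr X"
  then obtain c where c: "x = (\<Sum>g\<in>G. act X (c g) g)" using G(3) by blast
  have "(\<Sum>g\<in>I. act X (c g) g) \<in> carr X \<and> f (\<Sum>g\<in>I. act X (c g) g) = g (\<Sum>g\<in>I. act X (c g) g)" if "I \<subseteq> G" for I
   using finite_subset[OF that G(1)] that
  proof (induction I rule: finite_induct)
   case empty
   thus ?case using lX by (simp add: lm_zero lhom_zero[OF fgl(1)] lhom_zero[OF fgl(2)])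
  next
   case (insert g' I)
   hence "g' \<in> carr X" using G(2) by blast
   thus ?case using insert lX vG[of g']
    by (simp add: lm_add lm_act lhom_add[OF fgl(1)] lhom_add[OF fgl(2)] lhom_act[OF fgl(1)] lhom_act[OF fgl(2)])
  qed
  thus "f x = g x" using c by blast
 qed
 have sub: "V.subspace (\<Phi> ` K)" unfolding V.subspace_def
 proof (intro conjI ballI allI)
  have "\<Phi> (\<lambda>x. smul Y 0 0) = pscale 0 (\<Phi> (\<lambda>x. 0))" by (rule Psc) (simp add: lhom_0 lY)
  hence "\<Phi> (\<lambda>x. 0) = 0" using lY by (simp add: smul_zero)
  thus "0 \<in> \<Phi> ` K" using K(2) by (intro rev_image_eqI[of "\<lambda>x. 0"]) auto
  show "x + y \<in> \<Phi> ` K" if xy: "x \<in> \<Phi> ` K" "y \<in> \<Phi> ` K" for x y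
  proof -
   obtain f g where fg: "f \<in> K" "g \<in> K" "x = \<Phi> f" "y = \<Phi> g" using xy by blast
   have l: "f \<in> lhom X Y" "g \<in> lhom X Y" using fg K(1) by auto
   show ?thesis by (rule rev_image_eqI[OF K(3)[OF fg(1,2)]]) (simp only: Padd[OF l] fg(3,4))
  qed
  show "pscale c x \<in> \<Phi> ` K" if x: "x \<in> \<Phi> ` K" for c x
  proof -
   obtain f where f: "f \<in> K" "x = \<Phi> f" using x by blast
   have l: "f \<in> lhom X Y" using f K(1) by auto
   show ?thesis by (rule rev_image_eqI[OF K(4)[OF f(1)]]) (simp only: Psc[OF l] f(2))
  qed
 qed
 obtain A where A: "finite A" "span A = UNIV" using fin_dim unfolding finite_dimensional_def by blast
 define S where "S = (\<lambda>(p, a). Poly_Mapping.single (prod_encode p) a) ` (P \<times> A)"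
 have fS: "finite S" using fP A(1) by (simp add: S_def)
 have sS: "Poly_Mapping.single (prod_encode p) a \<in> V.span S" if p: "p \<in> P" for p a
 proof -
  have "a \<in> span A" using A by simp
  thus ?thesis
  proof (induction rule: span_induct_alt)
   case base
   thus ?case by (simp add: V.span_zero)
  next
   case (step c x y)
   have e: "Poly_Mapping.single (prod_encode p) (scale c x + y) = pscale c (Poly_Mapping.single (prod_encode p) x) + Poly_Mapping.single (prod_encode p) y"
    by (intro poly_mapping_eqI) (simp add: lookup_add lookup_pscale lookup_single when_def)
   have "Poly_Mapping.single (prod_encode p) x \<in> V.span S" using p step(1) by (intro V.span_base) (force simp: S_def)
   thus ?case unfolding e by (intro V.span_add V.span_scale step(2))
  qed
 qed
 have "\<Phi> f \<in> V.span S" for f unfolding \<Phi>_def by (intro V.span_sum sS)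
 hence KS: "\<Phi> ` K \<subseteq> V.span S" by blast
 obtain B' where B': "B' \<subseteq> \<Phi> ` K" "V.independent B'" "\<Phi> ` K \<subseteq> V.span B'"
  using V.maximal_independent_subset[of "\<Phi> ` K"] by blast
 have fB': "finite B'" using V.independent_span_bound[OF fS B'(2)] B'(1) KS by blast
 define B where "B = inv_into K \<Phi> ` B'"
 have inv: "inv_into K \<Phi> v \<in> K" "\<Phi> (inv_into K \<Phi> v) = v" if "v \<in> B'" for v
  using that B'(1) by (auto simp: inv_into_into f_inv_into_f)
 have injB: "inj_on (inv_into K \<Phi>) B'" by (rule inj_on_inverseI[of _ \<Phi>]) (simp add: inv)
 have BK: "B \<subseteq> K" using inv(1) by (auto simp: B_def)
 show thesis
 proof (rule that[of B])
  fix f assume f: "f \<in> K"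
  hence "\<Phi> f \<in> V.span B'" using B'(3) by blast
  then obtain u where u: "\<Phi> f = (\<Sum>v\<in>B'. pscale (u v) v)" using V.span_finite[OF fB'] by auto
  define c where "c b = u (\<Phi> b)" for b
  have "(\<lambda>x. \<Sum>b\<in>I. smul Y (c b) (b x)) \<in> K \<and> \<Phi> (\<lambda>x. \<Sum>b\<in>I. smul Y (c b) (b x)) = (\<Sum>b\<in>I. pscale (c b) (\<Phi> b))"
   if "I \<subseteq> B" for I
  proof -
   have "finite I" using that fB' by (auto simp: B_def intro: finite_subset)
   from this that show ?thesis
   proof (induction I rule: finite_induct)
    case empty
    have "\<Phi> (\<lambda>x. smul Y 0 0) = pscale 0 (\<Phi> (\<lambda>x. 0))" by (rule Psc) (simp add: lhom_0 lY)
    thus ?case using K(2) lY by (simp add: smul_zero)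
   next
    case (insert b I)
    hence b: "b \<in> K" "b \<in> lhom X Y" using BK K(1) by auto
    have s: "(\<lambda>x. smul Y (c b) (b x)) \<in> K" by (rule K(4)[OF b(1)])
    have "(\<lambda>x. smul Y (c b) (b x) + (\<Sum>b\<in>I. smul Y (c b) (b x))) \<in> K" using insert by (intro K(3) s) auto
    moreover have "\<Phi> (\<lambda>x. smul Y (c b) (b x) + (\<Sum>b\<in>I. smul Y (c b) (b x))) =
      \<Phi> (\<lambda>x. smul Y (c b) (b x)) + \<Phi> (\<lambda>x. \<Sum>b\<in>I. smul Y (c b) (b x))"
     by (rule Padd) (use s insert K(1) in auto)
    ultimately show ?case using insert Psc[OF b(2)] by simp
   qed
  qed
  from this[OF order.refl] have k: "(\<lambda>x. \<Sum>b\<in>B. smul Y (c b) (b x)) \<in> K"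
   and p: "\<Phi> (\<lambda>x. \<Sum>b\<in>B. smul Y (c b) (b x)) = (\<Sum>b\<in>B. pscale (c b) (\<Phi> b))" by auto
  have "(\<Sum>b\<in>B. pscale (c b) (\<Phi> b)) = (\<Sum>v\<in>B'. pscale (u v) v)"
   unfolding B_def by (subst sum.reindex[OF injB]) (auto simp: c_def inv intro!: sum.cong)
  hence "f = (\<lambda>x. \<Sum>b\<in>B. smul Y (c b) (b x))"
   using f k K(1) u p by (intro inj) auto
  thus "\<exists>c. f = (\<lambda>x. \<Sum>b\<in>B. smul Y (c b) (b x))" by (rule exI[of _ c])
 qed (use BK fB' in \<open>auto simp: B_def\<close>)
qed

end

section \<open>Cofinite right ideals are finitely generated\<close>

context hopf_heller begin

lemma Sh_sum_comp:
 assumes "finite I" "\<And>p. p \<in> I ==> s p \<in> hom a (fst p)" "\<And>p. p \<in> I ==> snd p \<in> hom (fst p) 0"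
 shows "seq (a + k) k (Sh k a 0 (\<lambda>x. \<Sum>p\<in>I. snd p (s p x))) (\<lambda>x. \<Sum>p\<in>I. (Sh k (fst p) 0 (snd p) \<circ> Sh k a (fst p) (s p)) x)"
 using assms
proof (induction I rule: finite_induct)
 case empty
 thus ?case using Sh_zero[of a k 0] by simp
next
 case (insert q I)
 have h: "snd q \<circ> s q \<in> hom a 0" by (rule lhom_comp[OF insert(4) insert(5) Om_lm]) auto
 have "snd p \<circ> s p \<in> hom a 0" if "p \<in> I" for p by (rule lhom_comp[OF insert(4) insert(5) Om_lm]) (use that in auto)
 from lhom_sum[OF insert(1) this Om_lm] have hI: "(\<lambda>x. \<Sum>p\<in>I. snd p (s p x)) \<in> hom a 0" by simp
 have a: "seq (a + k) k (Sh k a 0 (\<lambda>x. (snd q \<circ> s q) x + (\<Sum>p\<in>I. snd p (s p x))))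
   (\<lambda>x. Sh k a 0 (snd q \<circ> s q) x + Sh k a 0 (\<lambda>x. \<Sum>p\<in>I. snd p (s p x)) x)"
  using Sh_plus[OF h hI, of k] by simp
 have b: "seq (a + k) k (Sh k a 0 (snd q \<circ> s q)) (Sh k (fst q) 0 (snd q) \<circ> Sh k a (fst q) (s q))"
  using Sh_comp[of "s q" a "fst q" "snd q" 0 k] insert by simp
 have c: "seq (a + k) k (Sh k a 0 (\<lambda>x. \<Sum>p\<in>I. snd p (s p x))) (\<lambda>x. \<Sum>p\<in>I. (Sh k (fst p) 0 (snd p) \<circ> Sh k a (fst p) (s p)) x)"
  by (rule insert.IH) (use insert in auto)
 from steq_trans[OF a steq_plus[OF b c Om_lm] Om_lm] show ?case using insert by simp
qed

end

context hopf_resolution begin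

text \<open>The annihilator \<open>W\<close> of \<open>Z\<close> is itself finitely generated. A product \<open>b r\<close> of
 a generator \<open>b\<close> with a class \<open>r\<close> of large degree vanishes, since \<open>r\<close> lies in
 the right ideal generated by \<open>Z\<close> and \<open>b\<close> annihilates \<open>Z\<close>.\<close>

lemma annihilator_bounded:
 assumes R: "noetherian_ring R" and np: "\<And>s. core_in H (core_out H s) = s"
  and Z: "finite Z" "\<And>d z. (d, z) \<in> Z ==> d \<ge> 1 \<and> z \<in> hom d 0"
  and gen: "\<And>j f. j \<ge> int N ==> f \<in> hom j 0 ==> f \<in> rspan Z j"
 obtains D where "\<And>j f. j \<ge> int D ==> f \<in> hom j 0 ==>
   (\<And>d z. (d, z) \<in> Z ==> nul (d + j) 0 (f \<circ> Sh j d 0 z)) ==> nul j 0 f"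
proof -
 have Zh: "snd p \<in> hom (fst p) 0" if "p \<in> Z" for p using Z(2)[of "fst p" "snd p"] that by simp
 define W where "W j = {f \<in> hom (int j) 0. \<forall>(d, z)\<in>Z. nul (d + int j) 0 (f \<circ> Sh (int j) d 0 z)}" for j
 have shz: "Sh j d 0 z \<in> hom (d + j) j" if "(d, z) \<in> Z" for j d z
  using Sh_hom[of z d 0 j] Z(2)[OF that] by simp
 have Wn: "nul (d + int j) 0 (f \<circ> Sh (int j) d 0 z)" if "f \<in> W j" "(d, z) \<in> Z" for j f d z
  using that unfolding W_def by blast
 have "gideal W" unfolding gideal_def
 proof (intro allI impI conjI ballI)
  fix j :: nat assume j: "1 \<le> j"
  show "W j \<subseteq> hom (int j) 0" by (auto simp: W_def)
  show "(\<lambda>x. 0) \<in> W j" by (auto simp: W_def lhom_0 o_def null_zero)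
  show "(\<lambda>x. f x + g x) \<in> W j" if "f \<in> W j" "g \<in> W j" for f g
  proof -
   have "nul (d + int j) 0 (\<lambda>x. (f \<circ> Sh (int j) d 0 z) x + (g \<circ> Sh (int j) d 0 z) x)" if "(d, z) \<in> Z" for d z
    by (rule null_plus[OF Wn Wn Om_lm]) (use that \<open>f \<in> W j\<close> \<open>g \<in> W j\<close> in simp_all)
   moreover have "(\<lambda>x. f x + g x) \<in> hom (int j) 0"
    by (rule lhom_plus[OF _ _ Om_lm]) (use that in \<open>auto simp: W_def\<close>)
   ultimately show ?thesis by (auto simp: W_def o_def)
  qed
  show "(\<lambda>x. - f x) \<in> W j" if "f \<in> W j" for f
  proof -
   have "nul (d + int j) 0 (\<lambda>x. - (f \<circ> Sh (int j) d 0 z) x)" if "(d, z) \<in> Z" for d z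
    by (rule null_uminus[OF Wn Om_lm]) (use that \<open>f \<in> W j\<close> in simp_all)
   moreover have "(\<lambda>x. - f x) \<in> hom (int j) 0"
    by (rule lhom_uminus[OF _ Om_lm]) (use that in \<open>auto simp: W_def\<close>)
   ultimately show ?thesis by (auto simp: W_def o_def)
  qed
  show "g \<in> W j" if f: "f \<in> W j" and s: "seq (int j) 0 g f" for f g
   unfolding W_def
  proof (intro CollectI conjI ballI, rule steq_lhom(1)[OF s], clarify)
   fix d z assume dz: "(d, z) \<in> Z"
   have "nul (d + int j) 0 (f \<circ> Sh (int j) d 0 z)" by (rule Wn[OF f dz])
   thus "nul (d + int j) 0 (g \<circ> Sh (int j) d 0 z)"
    by (rule steq_null[OF steq_comp[OF steq_refl[OF shz[OF dz] Om_lm] s Om_lm Om_lm Om_lm] _ Om_lm])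
  qed
  fix i :: nat and f g assume f: "f \<in> W j" and g: "g \<in> hom (int i) 0"
  have fh: "f \<in> hom (int j) 0" using f by (simp add: W_def)
  have sg: "Sh (int j) (int i) 0 g \<in> hom (int (i + j)) (int j)" using Sh_hom[OF g, of "int j"] by simp
  have "nul (d + int (i + j)) 0 ((f \<circ> Sh (int j) (int i) 0 g) \<circ> Sh (int (i + j)) d 0 z)" if dz: "(d, z) \<in> Z" for d z
  proof -
   have zh: "z \<in> hom d 0" "d \<ge> 0" using Z(2)[OF dz] by auto
   have sz: "Sh (int i) d 0 z \<in> hom (d + int i) (int i)" by (rule shz[OF dz])
   have sgd: "Sh d (int i) 0 g \<in> hom (d + int i) d" using Sh_hom[OF g, of d] by (simp add: add.commute)
   have c: "sseq (d + int i) 0 (z \<circ> Sh d (int i) 0 g) (g \<circ> Sh (int i) d 0 z)"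
    by (rule graded_commutative[OF zh(1) g zh(2)]) simp
   have h1: "z \<circ> Sh d (int i) 0 g \<in> hom (d + int i) 0" "g \<circ> Sh (int i) d 0 z \<in> hom (d + int i) 0"
    using lhom_comp[OF sgd zh(1) Om_lm] lhom_comp[OF sz g Om_lm] by auto
   have n1: "nul (d + int i + int j) 0 (f \<circ> Sh (int j) (d + int i) 0 (z \<circ> Sh d (int i) 0 g))"
   proof -
    have s1: "seq (d + int i + int j) (int j) (Sh (int j) (d + int i) 0 (z \<circ> Sh d (int i) 0 g))
      (Sh (int j) d 0 z \<circ> Sh (int j) (d + int i) d (Sh d (int i) 0 g))"
     using Sh_comp[OF sgd zh(1), of "int j"] by simp
    have "nul (d + int j) 0 (f \<circ> Sh (int j) d 0 z)" by (rule Wn[OF f dz])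
    from null_comp_right[OF this Sh_hom[OF sgd, of "int j"] Om_lm]
    have "nul (d + int i + int j) 0 (f \<circ> (Sh (int j) d 0 z \<circ> Sh (int j) (d + int i) d (Sh d (int i) 0 g)))"
     by (simp add: o_assoc)
    thus ?thesis
     by (rule steq_null[OF steq_comp[OF s1 steq_refl[OF fh Om_lm] Om_lm Om_lm Om_lm] _ Om_lm])
   qed
   have n2: "nul (d + int i + int j) 0 (f \<circ> Sh (int j) (d + int i) 0 (g \<circ> Sh (int i) d 0 z))"
    using sseq_sym[OF c] unfolding sseq_def
   proof
    assume "seq (d + int i) 0 (g \<circ> Sh (int i) d 0 z) (z \<circ> Sh d (int i) 0 g)"
    from steq_comp[OF Sh_cong[OF this, of "int j"] steq_refl[of f "Om H (0 + int j)" "Om H 0"] Om_lm Om_lm Om_lm] fh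
    have "seq (d + int i + int j) 0 (f \<circ> Sh (int j) (d + int i) 0 (g \<circ> Sh (int i) d 0 z)) (f \<circ> Sh (int j) (d + int i) 0 (z \<circ> Sh d (int i) 0 g))" by simp
    from steq_null[OF this n1 Om_lm] show ?thesis .
   next
    assume "seq (d + int i) 0 (g \<circ> Sh (int i) d 0 z) (\<lambda>x. - (z \<circ> Sh d (int i) 0 g) x)"
    from steq_trans[OF Sh_cong[OF this, of "int j"] Sh_uminus[OF h1(1)] Om_lm]
    have "seq (d + int i + int j) (int j) (Sh (int j) (d + int i) 0 (g \<circ> Sh (int i) d 0 z))
      (\<lambda>x. - Sh (int j) (d + int i) 0 (z \<circ> Sh d (int i) 0 g) x)" by simp
    from steq_comp[OF this steq_refl[OF fh Om_lm] Om_lm Om_lm Om_lm]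
    have s: "seq (d + int i + int j) 0 (f \<circ> Sh (int j) (d + int i) 0 (g \<circ> Sh (int i) d 0 z))
      (f \<circ> (\<lambda>x. - Sh (int j) (d + int i) 0 (z \<circ> Sh d (int i) 0 g) x))" .
    have "f \<circ> (\<lambda>x. - Sh (int j) (d + int i) 0 (z \<circ> Sh d (int i) 0 g) x) =
      (\<lambda>x. - (f \<circ> Sh (int j) (d + int i) 0 (z \<circ> Sh d (int i) 0 g)) x)"
    proof
     fix x
     have "Sh (int j) (d + int i) 0 (z \<circ> Sh d (int i) 0 g) x \<in> carr (Om H (int j))"
      using lhom_in[OF Sh_hom[OF h1(1), of "int j"], of x] lhom_out[OF Sh_hom[OF h1(1), of "int j"], of x] lm_zero[OF Om_lm, of "int j"]
      by (cases "x \<in> carr (Om H (d + int i + int j))") auto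
     thus "(f \<circ> (\<lambda>x. - Sh (int j) (d + int i) 0 (z \<circ> Sh d (int i) 0 g) x)) x =
      - (f \<circ> Sh (int j) (d + int i) 0 (z \<circ> Sh d (int i) 0 g)) x" by (simp add: lhom_minus[OF fh])
    qed
    with s have "seq (d + int i + int j) 0 (f \<circ> Sh (int j) (d + int i) 0 (g \<circ> Sh (int i) d 0 z))
      (\<lambda>x. - (f \<circ> Sh (int j) (d + int i) 0 (z \<circ> Sh d (int i) 0 g)) x)" by simp
    from steq_null[OF this null_uminus[OF n1 Om_lm] Om_lm] show ?thesis .
   qed
   have s3: "seq (d + int i + int j) (int j) (Sh (int j) (d + int i) 0 (g \<circ> Sh (int i) d 0 z))
     (Sh (int j) (int i) 0 g \<circ> Sh (int j) (d + int i) (int i) (Sh (int i) d 0 z))"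
    using Sh_comp[OF sz g, of "int j"] by simp
   have s4: "seq (d + int i + int j) (int i + int j) (Sh (int j) (d + int i) (int i) (Sh (int i) d 0 z)) (Sh (int (i + j)) d 0 z)"
    using Sh_Sh[OF zh(1), of "int i" "int j"] by (simp add: add.assoc)
   have sg': "Sh (int j) (int i) 0 g \<in> hom (int i + int j) (int j)" using sg by simp
   have "seq (d + int i + int j) (int j) (Sh (int j) (int i) 0 g \<circ> Sh (int (i + j)) d 0 z) (Sh (int j) (d + int i) 0 (g \<circ> Sh (int i) d 0 z))"
    by (rule steq_sym[OF steq_trans[OF s3 steq_comp[OF s4 steq_refl[OF sg' Om_lm] Om_lm Om_lm Om_lm] Om_lm] Om_lm])
   from steq_comp[OF this steq_refl[OF fh Om_lm] Om_lm Om_lm Om_lm]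
   have "nul (d + int i + int j) 0 (f \<circ> (Sh (int j) (int i) 0 g \<circ> Sh (int (i + j)) d 0 z))"
    by (rule steq_null[OF _ n2 Om_lm])
   thus ?thesis by (simp add: o_assoc add.assoc)
  qed
  thus "f \<circ> Sh (int j) (int i) 0 g \<in> W (i + j)"
   unfolding W_def using lhom_comp[OF sg fh Om_lm] by auto
 qed
 then obtain Z2 where Z2: "finite Z2" "\<And>d f. (d, f) \<in> Z2 ==> d \<ge> 1 \<and> f \<in> W (nat d)"
  "\<And>j f. j \<ge> 1 ==> f \<in> W j ==> f \<in> rspan Z2 (int j)"
  by (rule gideal_finitely_generated[OF _ R np]) (assumption | rule that)+
 obtain D where D: "\<And>p. p \<in> Z2 ==> nat (fst p) \<le> D"
  using finite_nat_set_iff_bounded_le[of "(\<lambda>p. nat (fst p)) ` Z2"] Z2(1) by auto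
 show thesis
 proof (rule that[of "D + N + 1"])
  fix j f assume j: "int (D + N + 1) \<le> j" and f: "f \<in> hom j 0"
   and ann: "\<And>d z. (d, z) \<in> Z ==> nul (d + j) 0 (f \<circ> Sh j d 0 z)"
  have "f \<in> W (nat j)" using f ann j by (auto simp: W_def)
  moreover have "nat j \<ge> 1" using j by simp
  ultimately have "f \<in> rspan Z2 j" using Z2(3)[of "nat j" f] j by simp
  then obtain r where r: "\<And>p. p \<in> Z2 ==> r p \<in> hom j (fst p)" "seq j 0 f (\<lambda>x. \<Sum>p\<in>Z2. snd p (r p x))"
   by (auto simp: rspan_def)
  have "nul j 0 (snd p \<circ> r p)" if p: "p \<in> Z2" for p
  proof -
   obtain e b where eb: "p = (e, b)" by (cases p)
   have e: "e \<ge> 1" "b \<in> W (nat e)" "nat e \<le> D" using Z2(2)[of e b] D[OF p] p eb by auto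
   hence bh: "b \<in> hom e 0" and bz: "\<And>d z. (d, z) \<in> Z ==> nul (d + e) 0 (b \<circ> Sh e d 0 z)" by (auto simp: W_def)
   have rp: "r p \<in> hom j e" using r(1)[OF p] eb by simp
   have r': "Sh (- e) j e (r p) \<in> hom (j - e) 0" using Sh_hom[OF rp, of "- e"] by simp
   have "Sh (- e) j e (r p) \<in> rspan Z (j - e)" by (rule gen[OF _ r']) (use j e in simp)
   then obtain s where s: "\<And>p. p \<in> Z ==> s p \<in> hom (j - e) (fst p)"
    "seq (j - e) 0 (Sh (- e) j e (r p)) (\<lambda>x. \<Sum>p\<in>Z. snd p (s p x))" by (auto simp: rspan_def)
   have t1: "seq j e (Sh e (j - e) 0 (Sh (- e) j e (r p))) (r p)"
    using Sh_Sh[OF rp, of "- e" e] Sh_0[OF rp] by simp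
   have t2: "seq j e (Sh e (j - e) 0 (Sh (- e) j e (r p))) (Sh e (j - e) 0 (\<lambda>x. \<Sum>p\<in>Z. snd p (s p x)))"
    using Sh_cong[OF s(2), of e] by simp
   have sum_shift: "seq j e (Sh e (j - e) 0 (\<lambda>x. \<Sum>p\<in>Z. snd p (s p x)))
     (\<lambda>x. \<Sum>p\<in>Z. (Sh e (fst p) 0 (snd p) \<circ> Sh e (j - e) (fst p) (s p)) x)"
    using Sh_sum_comp[OF Z(1) s(1) Zh, of e] by simp
   have s3: "seq j e (r p) (\<lambda>x. \<Sum>p\<in>Z. (Sh e (fst p) 0 (snd p) \<circ> Sh e (j - e) (fst p) (s p)) x)"
    by (rule steq_trans[OF steq_trans[OF steq_sym[OF t1 Om_lm] t2 Om_lm] sum_shift Om_lm])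
   from steq_comp[OF s3 steq_refl[OF bh Om_lm] Om_lm Om_lm Om_lm]
   have s4: "seq j 0 (b \<circ> r p) (b \<circ> (\<lambda>x. \<Sum>p\<in>Z. (Sh e (fst p) 0 (snd p) \<circ> Sh e (j - e) (fst p) (s p)) x))" .
   have "finite I ==> I \<subseteq> Z ==> (\<lambda>x. \<Sum>p\<in>I. (Sh e (fst p) 0 (snd p) \<circ> Sh e (j - e) (fst p) (s p)) x) \<in> hom j e \<and>
     nul j 0 (b \<circ> (\<lambda>x. \<Sum>p\<in>I. (Sh e (fst p) 0 (snd p) \<circ> Sh e (j - e) (fst p) (s p)) x))" for I
   proof (induction I rule: finite_induct)
    case empty
    thus ?case using lhom_zero[OF bh] by (simp add: lhom_0 o_def null_zero)
   next
    case (insert q I)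
    hence q: "q \<in> Z" and I: "I \<subseteq> Z" by auto
    have h1: "Sh e (fst q) 0 (snd q) \<in> hom (fst q + e) e" and h2: "Sh e (j - e) (fst q) (s q) \<in> hom j (fst q + e)"
     using Sh_hom[OF Zh[OF q], of e] Sh_hom[OF s(1)[OF q], of e] by simp_all
    have "nul (fst q + e) 0 (b \<circ> Sh e (fst q) 0 (snd q))" using bz[of "fst q" "snd q"] q by simp
    from null_comp_right[OF this h2 Om_lm]
    have n: "nul j 0 (b \<circ> (Sh e (fst q) 0 (snd q) \<circ> Sh e (j - e) (fst q) (s q)))" by (simp add: o_assoc)
    have hq: "Sh e (fst q) 0 (snd q) \<circ> Sh e (j - e) (fst q) (s q) \<in> hom j e" by (rule lhom_comp[OF h2 h1 Om_lm])
    let ?u = "Sh e (fst q) 0 (snd q) \<circ> Sh e (j - e) (fst q) (s q)"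
    let ?v = "\<lambda>x. \<Sum>p\<in>I. (Sh e (fst p) 0 (snd p) \<circ> Sh e (j - e) (fst p) (s p)) x"
    have v: "?v \<in> hom j e" "nul j 0 (b \<circ> ?v)" by (rule conjunct1[OF insert.IH[OF I]], rule conjunct2[OF insert.IH[OF I]])
    have "b \<circ> (\<lambda>x. ?u x + ?v x) = (\<lambda>x. (b \<circ> ?u) x + (b \<circ> ?v) x)"
    proof
     fix x
     show "(b \<circ> (\<lambda>x. ?u x + ?v x)) x = (b \<circ> ?u) x + (b \<circ> ?v) x"
      using lhom_add[OF bh lhom_in[OF hq] lhom_in[OF v(1)], of x x] lhom_out[OF hq, of x] lhom_out[OF v(1), of x] lhom_zero[OF bh]
      by (cases "x \<in> carr (Om H j)") simp_all
    qed
    hence "nul j 0 (b \<circ> (\<lambda>x. ?u x + ?v x))" using null_plus[OF n v(2) Om_lm] by simp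
    moreover have "(\<lambda>x. ?u x + ?v x) = (\<lambda>x. \<Sum>p\<in>insert q I. (Sh e (fst p) 0 (snd p) \<circ> Sh e (j - e) (fst p) (s p)) x)"
     by (rule ext) (simp add: insert(1,2))
    ultimately show ?case using lhom_plus[OF hq v(1) Om_lm] by metis
   qed
   from this[OF Z(1) order.refl] have "nul j 0 (b \<circ> (\<lambda>x. \<Sum>p\<in>Z. (Sh e (fst p) 0 (snd p) \<circ> Sh e (j - e) (fst p) (s p)) x))" ..
   from steq_null[OF s4 this Om_lm] show ?thesis using eb by simp
  qed
  hence "seq j 0 (snd p \<circ> r p) (\<lambda>x. 0)" if "p \<in> Z2" for p using that by (intro steq_zero_iff[THEN iffD2] Om_lm)
  from steq_sum[OF Z2(1) this Om_lm]
  have "seq j 0 (\<lambda>x. \<Sum>p\<in>Z2. (snd p \<circ> r p) x) (\<lambda>x. \<Sum>p\<in>Z2. 0)" .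
  hence "nul j 0 (\<lambda>x. \<Sum>p\<in>Z2. (snd p \<circ> r p) x)" by (simp add: steq_zero_iff)
  thus "nul j 0 f" using steq_null[OF r(2) _ Om_lm] by simp
 qed
qed

text \<open>Tate duality pairs degree \<open>j\<close> with degree \<open>- 1 - j\<close>; what is not annihilated by
 \<open>Z\<close> on one side is generated by \<open>Z\<close> on the other. The sequence \<open>0 \<rightarrow>
 \<Omega>\<^sup>0 k \<rightarrow> Cov \<rightarrow> \<Omega>\<^sup>-\<^sup>1 k \<rightarrow> 0\<close> is the
 cosyzygy to which the general statement is applied.\<close>

lemma negative_degrees:
 assumes np: "\<And>s. core_in H (core_out H s) = s" and Z: "finite Z" "\<And>d z. (d, z) \<in> Z ==> z \<in> hom d 0"
  and ann: "\<And>f. f \<in> hom j 0 ==> (\<And>d z. (d, z) \<in> Z ==> nul (d + j) 0 (f \<circ> Sh j d 0 z)) ==> nul j 0 f"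
  and f: "f \<in> hom (- 1 - j) 0"
 shows "f \<in> rspan Z (- 1 - j)"
proof -
 have Zh: "snd p \<in> hom (fst p) 0" if "p \<in> Z" for p using Z(2)[of "fst p" "snd p"] that by simp
 define w where "w = Sh j (- 1 - j) 0 f"
 have w: "w \<in> hom (- 1) j" using Sh_hom[OF f, of j] by (simp add: w_def)
 have shz: "Sh j (fst p) 0 (snd p) \<in> hom (fst p + j) j" if "p \<in> Z" for p using Sh_hom[OF Zh[OF that], of j] by simp
 define i0 where "i0 = inc H (- 1) \<circ> core_out H"
 have inc1: "inc H (- 1) \<in> lhom (Om H 0) (Cov H (- 1))" and inj1: "inj_on (inc H (- 1)) (carr (Om H 0))"
  and ker1: "inc H (- 1) ` carr (Om H 0) = lker (Cov H (- 1)) (prj H (- 1))"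
  using inc_lhom[of "- 1"] inc_inj[of "- 1"] inc_ker[of "- 1"] by simp_all
 have i0: "i0 \<in> lhom T (Cov H (- 1))" unfolding i0_def by (rule lhom_comp[OF core_out_lhom inc1 Om_lm])
 have cout: "core_out H ` UNIV = carr (Om H 0)"
 proof
  show "core_out H ` UNIV \<subseteq> carr (Om H 0)" using lhom_in[OF core_out_lhom] by (auto simp: carr_T)
  show "carr (Om H 0) \<subseteq> core_out H ` UNIV"
  proof
   fix x assume "x \<in> carr (Om H 0)"
   hence "x = core_out H (core_in H x)" using core_out_in by simp
   thus "x \<in> core_out H ` UNIV" by (rule image_eqI) simp
  qed
 qed
 have "inj (core_out H)" by (rule inj_on_inverseI[of _ "core_in H"]) (rule np)
 hence inj0: "inj i0" unfolding i0_def by (rule comp_inj_on) (simp only: cout inj1)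
 have r0: "range i0 = lker (Cov H (- 1)) (prj H (- 1))" unfolding i0_def image_comp[symmetric] cout ker1 ..
 obtain xs where xs: "\<And>p h. (p, h) \<in> set xs ==> p \<in> Z \<and> h \<in> hom (- 1) (fst p + j)"
  "seq (- 1) j w (\<lambda>y. \<Sum>q\<leftarrow>xs. Sh j (fst (fst q)) 0 (snd (fst q)) (snd q y))"
 proof (rule stable_maps_from_cosyzygy[where N = "Om H j" and I = Z and Ni = "\<lambda>p. Om H (fst p + j)"
    and Z = "\<lambda>p. Sh j (fst p) 0 (snd p)" and w = w, OF Om_fg Om_fg shz _ Cov_dual Cov_fg Om_lm prj_lhom prj_surj i0 inj0 r0 w])
  fix g assume g: "g \<in> lhom (Om H j) T"
   and n: "\<And>p. p \<in> Z ==> null_map (Om H (fst p + j)) T (g \<circ> Sh j (fst p) 0 (snd p))"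
  have cg: "core_out H \<circ> g \<in> hom j 0" by (rule lhom_comp[OF g core_out_lhom left_module_T])
  have "nul j 0 (core_out H \<circ> g)"
  proof (rule ann[OF cg])
   fix d z assume "(d, z) \<in> Z"
   hence "null_map (Om H (d + j)) T (g \<circ> Sh j d 0 z)" using n[of "(d, z)"] by simp
   from null_comp_left[OF this core_out_lhom left_module_T]
   show "nul (d + j) 0 (core_out H \<circ> g \<circ> Sh j d 0 z)" by (simp add: o_assoc)
  qed
  from null_comp_left[OF this core_in_lhom Om_lm]
  have "null_map (Om H j) T (core_in H \<circ> (core_out H \<circ> g))" .
  moreover have "core_in H \<circ> (core_out H \<circ> g) = g" using np by (simp add: fun_eq_iff)
  ultimately show "null_map (Om H j) T g" by simp
 next
  fix xs assume a: "\<And>i h. (i, h) \<in> set xs ==> i \<in> Z \<and> h \<in> hom (- 1) (fst i + j)"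
   and b: "seq (- 1) j w (\<lambda>y. \<Sum>q\<leftarrow>xs. Sh j (fst (fst q)) 0 (snd (fst q)) (snd q y))"
  show thesis by (rule that[OF a b])
 qed
 have trm: "(snd (fst q) \<circ> Sh (- j) (- 1) (fst (fst q) + j) (snd q)) \<in> rspan Z (- 1 - j) \<and>
   seq (- 1 - j) 0 (Sh (- j) (- 1) j (Sh j (fst (fst q)) 0 (snd (fst q)) \<circ> snd q))
    (snd (fst q) \<circ> Sh (- j) (- 1) (fst (fst q) + j) (snd q))" if q: "q \<in> set xs" for q
 proof -
  have p: "fst q \<in> Z" "snd q \<in> hom (- 1) (fst (fst q) + j)" using xs(1)[of "fst q" "snd q"] q by auto
  have sh: "Sh (- j) (- 1) (fst (fst q) + j) (snd q) \<in> hom (- 1 - j) (fst (fst q))"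
   using Sh_hom[OF p(2), of "- j"] by simp
  have a: "seq (- 1 - j) 0 (Sh (- j) (- 1) j (Sh j (fst (fst q)) 0 (snd (fst q)) \<circ> snd q))
    (Sh (- j) (fst (fst q) + j) j (Sh j (fst (fst q)) 0 (snd (fst q))) \<circ> Sh (- j) (- 1) (fst (fst q) + j) (snd q))"
   using Sh_comp[OF p(2) shz[OF p(1)], of "- j"] by simp
  have b: "seq (fst (fst q)) 0 (Sh (- j) (fst (fst q) + j) j (Sh j (fst (fst q)) 0 (snd (fst q)))) (snd (fst q))"
   using Sh_Sh[OF Zh[OF p(1)], of j "- j"] Sh_0[OF Zh[OF p(1)]] by simp
  have "(snd (fst q)) \<in> rspan Z (fst (fst q))" by (rule rspan_base[OF Z(1) Zh]) (use p in auto)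
  from rspan_comp[OF Z(1) Zh this sh]
  have "snd (fst q) \<circ> Sh (- j) (- 1) (fst (fst q) + j) (snd q) \<in> rspan Z (- 1 - j)" by blast
  thus ?thesis using steq_trans[OF a steq_comp[OF steq_refl[OF sh Om_lm] b Om_lm Om_lm Om_lm] Om_lm] by blast
 qed
 have hq: "Sh j (fst (fst q)) 0 (snd (fst q)) \<circ> snd q \<in> hom (- 1) j" if q: "q \<in> set xs" for q
 proof -
  have p: "fst q \<in> Z" "snd q \<in> hom (- 1) (fst (fst q) + j)" using xs(1)[of "fst q" "snd q"] q by auto
  show ?thesis by (rule lhom_comp[OF p(2) shz[OF p(1)] Om_lm])
 qed
 have "Sh (- j) (- 1) j (\<lambda>y. \<Sum>q\<leftarrow>ys. Sh j (fst (fst q)) 0 (snd (fst q)) (snd q y)) \<in> rspan Z (- 1 - j)" if "set ys \<subseteq> set xs" for ys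
  using that
 proof (induction ys)
  case Nil
  have "seq (- 1 - j) 0 (Sh (- j) (- 1) j (\<lambda>x. 0)) (\<lambda>x. 0)" using Sh_zero[of "- 1" "- j" j] by simp
  thus ?case using rspan_cong[OF rspan_zero[OF Zh]] by simp
 next
  case (Cons q ys)
  have q: "q \<in> set xs" using Cons by simp
  have hys: "(\<lambda>y. \<Sum>q\<leftarrow>ys. Sh j (fst (fst q)) 0 (snd (fst q)) (snd q y)) \<in> hom (- 1) j"
   using lhom_sum_list_maps[OF Om_lm, of ys "\<lambda>q. Sh j (fst (fst q)) 0 (snd (fst q)) \<circ> snd q" "Om H (- 1)" j] hq Cons(2) by (auto simp: o_def)
  have a: "seq (- 1 - j) 0 (Sh (- j) (- 1) j (\<lambda>y. (Sh j (fst (fst q)) 0 (snd (fst q)) \<circ> snd q) y + (\<Sum>q\<leftarrow>ys. Sh j (fst (fst q)) 0 (snd (fst q)) (snd q y))))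
    (\<lambda>y. Sh (- j) (- 1) j (Sh j (fst (fst q)) 0 (snd (fst q)) \<circ> snd q) y + Sh (- j) (- 1) j (\<lambda>y. \<Sum>q\<leftarrow>ys. Sh j (fst (fst q)) 0 (snd (fst q)) (snd q y)) y)"
   using Sh_plus[OF hq[OF q] hys, of "- j"] by simp
  have b: "Sh (- j) (- 1) j (Sh j (fst (fst q)) 0 (snd (fst q)) \<circ> snd q) \<in> rspan Z (- 1 - j)"
   by (rule rspan_cong[OF conjunct1[OF trm[OF q]] conjunct2[OF trm[OF q]]])
  have c: "Sh (- j) (- 1) j (\<lambda>y. \<Sum>q\<leftarrow>ys. Sh j (fst (fst q)) 0 (snd (fst q)) (snd q y)) \<in> rspan Z (- 1 - j)"
   using Cons by simp
  from rspan_cong[OF rspan_plus[OF Z(1) Zh b c] a] show ?case by simp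
 qed
 from this[OF order.refl] have r: "Sh (- j) (- 1) j (\<lambda>y. \<Sum>q\<leftarrow>xs. Sh j (fst (fst q)) 0 (snd (fst q)) (snd q y)) \<in> rspan Z (- 1 - j)" .
 have a: "seq (- 1 - j) 0 (Sh (- j) (- 1) j w) (Sh (- j) (- 1) j (\<lambda>y. \<Sum>q\<leftarrow>xs. Sh j (fst (fst q)) 0 (snd (fst q)) (snd q y)))"
  using Sh_cong[OF xs(2), of "- j"] by simp
 have b: "seq (- 1 - j) 0 (Sh (- j) (- 1) j w) f"
  using Sh_Sh[OF f, of j "- j"] Sh_0[OF f] by (simp add: w_def)
 show ?thesis by (rule rspan_cong[OF r steq_trans[OF steq_sym[OF b Om_lm] a Om_lm]])
qed

text \<open>Generators of the positive part serve all degrees of large absolute value; bases of the remaining finitely many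
 degrees are added to them. If the trivial module is projective there is nothing to generate.\<close>

theorem cofinite_right_ideal_finitely_generated:
 assumes R: "noetherian_ring R"
  and K: "\<And>j. K j \<subseteq> hom j 0" "\<And>j. (\<lambda>x. 0) \<in> K j" "\<And>j f g. f \<in> K j ==> g \<in> K j ==> (\<lambda>x. f x + g x) \<in> K j"
   "\<And>j f g. f \<in> K j ==> seq j 0 g f ==> g \<in> K j" "\<And>i j f g. f \<in> K j ==> g \<in> hom i j ==> f \<circ> g \<in> K i"
  and cof: "\<And>j f. \<bar>j\<bar> \<ge> int N ==> f \<in> hom j 0 ==> f \<in> K j"
 obtains Z where "finite Z" "\<And>d z. (d, z) \<in> Z ==> z \<in> K d" "\<And>j f. f \<in> K j ==> f \<in> rspan Z j"
proof -
 from core_cases show thesis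
 proof
  assume "dual_basis T"
  from null_if_projective[OF this] have n: "nul j 0 f" if "f \<in> hom j 0" for f j using that .
  show thesis
  proof (rule that[of "{}"])
   fix j f assume "f \<in> K j"
   hence "f \<in> hom j 0" using K(1) by blast
   thus "f \<in> rspan {} j" using n by (simp add: rspan_def steq_zero_iff)
  qed auto
 next
  assume "\<forall>s. core_in H (core_out H s) = s"
  hence np: "\<And>s. core_in H (core_out H s) = s" by blast
  \<comment> \<open>In degrees below \<open>N\<close> only null maps are admitted, so that \<open>W\<close> lies in \<open>K\<close>.\<close>
  define W where "W j = {f \<in> hom (int j) 0. j \<ge> N \<or> nul (int j) 0 f}" for j
  have gW: "gideal W" unfolding gideal_def
  proof (intro allI impI conjI ballI)
   fix j :: nat assume j: "1 \<le> j"
   show "W j \<subseteq> hom (int j) 0" by (auto simp: W_def)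
   show "(\<lambda>x. 0) \<in> W j" by (auto simp: W_def lhom_0 null_zero)
   show "(\<lambda>x. f x + g x) \<in> W j" if "f \<in> W j" "g \<in> W j" for f g
    using that by (auto simp: W_def lhom_plus null_plus)
   show "(\<lambda>x. - f x) \<in> W j" if "f \<in> W j" for f
    using that by (auto simp: W_def lhom_uminus null_uminus)
   show "g \<in> W j" if f: "f \<in> W j" and s: "seq (int j) 0 g f" for f g
    using f steq_lhom(1)[OF s] steq_null[OF s _ Om_lm] by (auto simp: W_def)
   fix i :: nat and f g assume f: "f \<in> W j" and g: "g \<in> hom (int i) 0"
   have sg: "Sh (int j) (int i) 0 g \<in> hom (int (i + j)) (int j)" using Sh_hom[OF g, of "int j"] by simp
   thus "f \<circ> Sh (int j) (int i) 0 g \<in> W (i + j)"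
    using f lhom_comp[OF sg _ Om_lm] null_comp_right[OF _ sg Om_lm] unfolding W_def by auto
  qed
  obtain Z1 where Z1: "finite Z1" "\<And>d f. (d, f) \<in> Z1 ==> d \<ge> 1 \<and> f \<in> W (nat d)"
   "\<And>j f. j \<ge> 1 ==> f \<in> W j ==> f \<in> rspan Z1 (int j)"
   by (rule gideal_finitely_generated[OF gW R np]) (rule that)
  have Z1h: "d \<ge> 1 \<and> z \<in> hom d 0" and Z1K: "z \<in> K d" if "(d, z) \<in> Z1" for d z
  proof -
   show *: "d \<ge> 1 \<and> z \<in> hom d 0" using Z1(2)[OF that] by (auto simp: W_def)
   from Z1(2)[OF that] have "nat d \<ge> N \<or> nul d 0 z" by (auto simp: W_def)
   thus "z \<in> K d"
   proof
    assume "nat d \<ge> N"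
    hence "int N \<le> \<bar>d\<bar>" by linarith
    thus ?thesis using cof[of d z] * by simp
   next
    assume "nul d 0 z"
    thus ?thesis using K(4)[OF K(2)] by (simp add: steq_zero_iff)
   qed
  qed
  have gen: "f \<in> rspan Z1 j" if "j \<ge> int (N + 1)" "f \<in> hom j 0" for j f
  proof -
   have "f \<in> W (nat j)" "nat j \<ge> 1" using that by (auto simp: W_def)
   thus ?thesis using Z1(3)[of "nat j" f] that by simp
  qed
  obtain D where D: "\<And>j f. j \<ge> int D ==> f \<in> hom j 0 ==>
   (\<And>d z. (d, z) \<in> Z1 ==> nul (d + j) 0 (f \<circ> Sh j d 0 z)) ==> nul j 0 f"
  proof (rule annihilator_bounded[OF R np Z1(1) Z1h gen])
   fix D assume D: "\<And>j f. j \<ge> int D ==> f \<in> hom j 0 ==>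
    (\<And>d z. (d, z) \<in> Z1 ==> nul (d + j) 0 (f \<circ> Sh j d 0 z)) ==> nul j 0 f"
   show thesis
   proof (rule that)
    fix j f assume a: "int D \<le> j" and b: "f \<in> hom j 0" and c: "\<And>d z. (d, z) \<in> Z1 ==> nul (d + j) 0 (f \<circ> Sh j d 0 z)"
    show "nul j 0 f" by (rule D[OF a b c])
   qed
  qed
  have neg: "f \<in> rspan Z1 j" if j: "j \<le> - 1 - int D" and f: "f \<in> hom j 0" for j f
  proof -
   have jj: "j = - 1 - (- 1 - j)" by simp
   have "f \<in> rspan Z1 (- 1 - (- 1 - j))"
   proof (rule negative_degrees[OF np Z1(1)])
    show "f \<in> hom (- 1 - (- 1 - j)) 0" using f jj by simp
   qed (use Z1h D[of "- 1 - j"] j in auto)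
   thus ?thesis by simp
  qed
  have eB: "\<exists>B. finite B \<and> B \<subseteq> K j \<and> (\<forall>f\<in>K j. \<exists>c. f = (\<lambda>x. \<Sum>b\<in>B. smul (Om H 0) (c b) (b x)))" for j
  proof -
   have sc: "(\<lambda>x. smul (Om H 0) c (f x)) \<in> K j" if f: "f \<in> K j" for f c
   proof -
    have fh: "f \<in> hom j 0" using f K(1) by blast
    have s: "restr (Om H j) (smul (Om H j) c) \<in> hom j j"
     by (rule restr_lhomI) (simp_all add: smul_in smul_add act_smul)
    have "f \<circ> restr (Om H j) (smul (Om H j) c) = (\<lambda>x. smul (Om H 0) c (f x))"
     by (rule ext) (simp add: restr_def lhom_smul[OF fh] lhom_out[OF fh] lhom_zero[OF fh] smul_zero)
    thus ?thesis using K(5)[OF f s] by simp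
   qed
   obtain B where "finite B" "B \<subseteq> K j" "\<And>f. f \<in> K j ==> \<exists>c. f = (\<lambda>x. \<Sum>b\<in>B. smul (Om H 0) (c b) (b x))"
    by (rule lhom_finite_dimensional[OF Om_fg Om_fg K(1) K(2) K(3) sc]) (assumption | rule that)+
   thus ?thesis by (intro exI[of _ B] conjI ballI)
  qed
  obtain B where "\<forall>j. finite (B j) \<and> B j \<subseteq> K j \<and> (\<forall>f\<in>K j. \<exists>c. f = (\<lambda>x. \<Sum>b\<in>B j. smul (Om H 0) (c b) (b x)))"
   using choice[OF allI[OF eB]] by (rule exE)
  hence B: "\<And>j. finite (B j)" "\<And>j. B j \<subseteq> K j"
   "\<And>j f. f \<in> K j ==> \<exists>c. f = (\<lambda>x. \<Sum>b\<in>B j. smul (Om H 0) (c b) (b x))" by simp_all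
  define Z where "Z = Z1 \<union> (\<Union>j\<in>{- int D..int N}. Pair j ` B j)"
  have fZ: "finite Z" using Z1(1) B(1) by (simp add: Z_def)
  have ZK: "z \<in> K d" if "(d, z) \<in> Z" for d z using that Z1K B(2) by (auto simp: Z_def)
  have Zh: "snd p \<in> hom (fst p) 0" if "p \<in> Z" for p using ZK[of "fst p" "snd p"] K(1) that by auto
  show thesis
  proof (rule that[OF fZ ZK])
   fix j f assume f: "f \<in> K j"
   hence fh: "f \<in> hom j 0" using K(1) by blast
   have mono: "f \<in> rspan Z j" if "f \<in> rspan Z1 j"
    by (rule rspan_mono[OF fZ _ Zh that]) (auto simp: Z_def)
   show "f \<in> rspan Z j"
   proof (cases "- int D \<le> j \<and> j \<le> int N")
    case True
    obtain c where c: "f = (\<lambda>x. \<Sum>b\<in>B j. smul (Om H 0) (c b) (b x))" using B(3)[OF f] by blast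
    have sm: "(\<lambda>x. smul (Om H 0) (c b) (b x)) \<in> rspan Z j" if b: "b \<in> B j" for b
    proof -
     have bZ: "(j, b) \<in> Z" using b True by (auto simp: Z_def)
     have bh: "b \<in> hom j 0" using Zh[OF bZ] by simp
     have s: "restr (Om H j) (smul (Om H j) (c b)) \<in> hom j j"
      by (rule restr_lhomI) (simp_all add: smul_in smul_add act_smul)
     have "b \<circ> restr (Om H j) (smul (Om H j) (c b)) = (\<lambda>x. smul (Om H 0) (c b) (b x))"
      by (rule ext) (simp add: restr_def lhom_smul[OF bh] lhom_out[OF bh] lhom_zero[OF bh] smul_zero)
     thus ?thesis using rspan_comp[OF fZ Zh rspan_base[OF fZ Zh bZ] s] by simp
    qed
    have "(\<lambda>x. \<Sum>b\<in>I. smul (Om H 0) (c b) (b x)) \<in> rspan Z j" if "I \<subseteq> B j" for I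
     using finite_subset[OF that B(1)] that
    proof (induction I rule: finite_induct)
     case empty
     thus ?case using rspan_zero[OF Zh] by simp
    next
     case (insert b I)
     hence b: "b \<in> B j" and I: "I \<subseteq> B j" by auto
     from rspan_plus[OF fZ Zh sm[OF b] insert.IH[OF I]] show ?case using insert(1,2) by simp
    qed
    from this[OF order.refl] show ?thesis unfolding c .
   next
    case False
    hence "j \<le> - 1 - int D \<or> int (N + 1) \<le> j" by linarith
    thus ?thesis
    proof
     assume "j \<le> - 1 - int D"
     thus ?thesis by (rule mono[OF neg[OF _ fh]])
    next
     assume "int (N + 1) \<le> j"
     thus ?thesis by (rule mono[OF gen[OF _ fh]])
    qed
   qed
  qed
 qed
qed

end

section \<open>The long exact sequence of an extension\<close>

lemma lhom_comp_plus:
 assumes "f \<in> lhom X Y" "g \<in> lhom X Y" "k \<in> lhom Y Z" "left_module Y" "left_module Z"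
 shows "k \<circ> (\<lambda>x. f x + g x) = (\<lambda>x. (k \<circ> f) x + (k \<circ> g) x)"
proof
 fix x
 show "(k \<circ> (\<lambda>x. f x + g x)) x = (k \<circ> f) x + (k \<circ> g) x"
  using assms by (cases "x \<in> carr X") (simp_all add: lhom_add[OF assms(3)] lhom_in lhom_out lhom_zero[OF assms(3,4)])
qed

locale hopf_extension = hopf_resolution scale \<Delta> \<epsilon> S H Q
 for scale :: "'k::field \<Rightarrow> 'a::ring_1 \<Rightarrow> 'a" and \<Delta> \<epsilon> S and H :: "('a, 'u::ab_group_add, 'k) heller"
  and Q :: "('a, 'q::ab_group_add, 'k) resolution" +
 fixes M :: "('a, 'm::ab_group_add) lmod" and m n :: int and \<alpha> :: "'u \<Rightarrow> 'm" and \<beta> :: "'m \<Rightarrow> 'u" and e :: "'u \<Rightarrow> 'u"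
 assumes M_lm: "left_module M" and ses: "short_exact (Om H m) \<alpha> M \<beta> (Om H n)"
  and ext: "extension_class H m n \<alpha> M \<beta> e"
begin

lemma alpha: "\<alpha> \<in> lhom (Om H m) M" and beta: "\<beta> \<in> lhom M (Om H n)" and alpha_inj: "inj_on \<alpha> (carr (Om H m))"
 and alpha_image: "\<alpha> ` carr (Om H m) = lker M \<beta>" and beta_surj: "\<beta> ` carr M = carr (Om H n)"
 using ses by (simp_all add: short_exact_def)

lemma e_hom: "e \<in> hom (n + 1) m"
 using ext by (simp add: extension_class_def)

lemma beta_alpha: "x \<in> carr (Om H m) ==> \<beta> (\<alpha> x) = 0"
 using alpha_image by (auto simp: lker_def)

lemma beta_kernel: "x \<in> carr M ==> \<beta> x = 0 ==> x \<in> \<alpha> ` carr (Om H m)"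
 using alpha_image by (simp add: lker_def)

text \<open>Lift the null map \<open>\<beta> y\<close> to a null map into \<open>M\<close>; the difference takes values in the
 kernel of \<open>\<beta>\<close>.\<close>

lemma exact_middle:
 assumes y: "y \<in> lhom (Om H j) M" and nl: "nul j n (\<beta> \<circ> y)"
 obtains g where "g \<in> hom j m" "steq (Om H j) M y (\<alpha> \<circ> g)"
proof -
 have sj: "x \<in> \<beta> ` carr M" if "x \<in> carr (Om H n)" for x using that beta_surj by simp
 obtain v where v: "null_map (Om H j) M v" "\<And>x. x \<in> carr (Om H j) ==> \<beta> (v x) = (\<beta> \<circ> y) x"
  by (rule null_lift_surj[OF nl beta sj Om_lm M_lm]) (assumption | rule that)+
 have vl: "v \<in> lhom (Om H j) M" by (rule null_lhom[OF v(1)])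
 have d: "(\<lambda>x. y x - v x) \<in> lhom (Om H j) M" by (rule lhom_minus_fun[OF y vl M_lm])
 have im: "y x - v x \<in> \<alpha> ` carr (Om H m)" if x: "x \<in> carr (Om H j)" for x
  by (rule beta_kernel[OF lhom_in[OF d x]]) (simp add: lhom_diff[OF beta M_lm lhom_in[OF y x] lhom_in[OF vl x]] v(2)[OF x])
 obtain g where g: "g \<in> hom j m" "\<And>x. x \<in> carr (Om H j) ==> \<alpha> (g x) = y x - v x"
  by (rule lhom_lift_inj[OF Om_lm Om_lm alpha alpha_inj d im]) (assumption | rule that)+
 have c: "\<alpha> \<circ> g \<in> lhom (Om H j) M" by (rule lhom_comp[OF g(1) alpha Om_lm])
 have "(\<lambda>x. y x - (\<alpha> \<circ> g) x) = v"
  by (rule lhom_eqI[OF lhom_minus_fun[OF y c M_lm] vl]) (simp add: g(2))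
 hence "steq (Om H j) M y (\<alpha> \<circ> g)" using y c v(1) by (simp add: steq_def)
 thus thesis using that g(1) by blast
qed

text \<open>The ladder and the map that defines the extension class give two lifts of the same map from the cover, and their
 difference takes values in the submodule; restricted to \<open>\<Omega>\<^sup>j\<^sup>+\<^sup>1 k\<close> it is
 \<open>e g\<close>.\<close>

lemma connecting_null:
 assumes y: "y \<in> lhom (Om H j) M" and g: "g \<in> hom (j + 1) (n + 1)" and l: "ladder j n (\<beta> \<circ> y) g"
 shows "nul (j + 1) m (e \<circ> g)"
proof -
 obtain h where h: "h \<in> lhom (Cov H n) M" "\<And>x. x \<in> carr (Cov H n) ==> \<beta> (h x) = prj H n x"
   "\<And>x. x \<in> carr (Om H (n + 1)) ==> h (inc H n x) = \<alpha> (e x)"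
  using ext by (auto simp: extension_class_def)
 obtain h' where h': "h' \<in> lhom (Cov H j) (Cov H n)" "\<And>x. x \<in> carr (Cov H j) ==> prj H n (h' x) = \<beta> (y (prj H j x))"
   "\<And>x. x \<in> carr (Om H (j + 1)) ==> h' (inc H j x) = inc H n (g x)"
  using l by (auto simp: heller_ladder_def)
 have u1: "h \<circ> h' \<in> lhom (Cov H j) M" and u2: "y \<circ> prj H j \<in> lhom (Cov H j) M"
  by (rule lhom_comp[OF h'(1) h(1) Cov_lm], rule lhom_comp[OF prj_lhom y Om_lm])
 have u: "(\<lambda>x. (h \<circ> h') x - (y \<circ> prj H j) x) \<in> lhom (Cov H j) M" by (rule lhom_minus_fun[OF u1 u2 M_lm])
 have im: "(h \<circ> h') x - (y \<circ> prj H j) x \<in> \<alpha> ` carr (Om H m)" if x: "x \<in> carr (Cov H j)" for x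
 proof (rule beta_kernel[OF lhom_in[OF u x]])
  show "\<beta> ((h \<circ> h') x - (y \<circ> prj H j) x) = 0"
   unfolding lhom_diff[OF beta M_lm lhom_in[OF u1 x] lhom_in[OF u2 x]]
   by (simp add: h(2)[OF lhom_in[OF h'(1) x]] h'(2)[OF x])
 qed
 obtain w where w: "w \<in> lhom (Cov H j) (Om H m)" "\<And>x. x \<in> carr (Cov H j) ==> \<alpha> (w x) = (h \<circ> h') x - (y \<circ> prj H j) x"
  by (rule lhom_lift_inj[OF Cov_lm Om_lm alpha alpha_inj u im]) (assumption | rule that)+
 have "e \<circ> g = w \<circ> inc H j"
 proof (rule lhom_eqI[OF lhom_comp[OF g e_hom Om_lm] lhom_comp[OF inc_lhom w(1) Cov_lm]])
  fix x assume x: "x \<in> carr (Om H (j + 1))"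
  have i: "inc H j x \<in> carr (Cov H j)" by (rule lhom_in[OF inc_lhom x])
  have "\<alpha> (w (inc H j x)) = \<alpha> (e (g x))"
   using w(2)[OF i] h'(3)[OF x] h(3)[OF lhom_in[OF g x]] prj_inc[OF x] lhom_zero[OF y Om_lm] by simp
  thus "(e \<circ> g) x = (w \<circ> inc H j) x"
   using inj_onD[OF alpha_inj _ lhom_in[OF w(1) i] lhom_in[OF e_hom lhom_in[OF g x]]] by simp
 qed
 thus ?thesis using null_through[OF Cov_dual inc_lhom w(1)] by simp
qed

text \<open>Extend the null map \<open>e g\<close> to the cover and subtract it from the lift given by the extension class; the
 result vanishes on \<open>\<Omega>\<^sup>j\<^sup>+\<^sup>1 k\<close> and factors through \<open>\<Omega>\<^sup>j
 k\<close>.\<close>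

lemma connecting_lift:
 assumes f: "f \<in> hom j n" and g: "g \<in> hom (j + 1) (n + 1)" and l: "ladder j n f g" and nl: "nul (j + 1) m (e \<circ> g)"
 obtains y where "y \<in> lhom (Om H j) M" "\<beta> \<circ> y = f"
proof -
 obtain h where h: "h \<in> lhom (Cov H n) M" "\<And>x. x \<in> carr (Cov H n) ==> \<beta> (h x) = prj H n x"
   "\<And>x. x \<in> carr (Om H (n + 1)) ==> h (inc H n x) = \<alpha> (e x)"
  using ext by (auto simp: extension_class_def)
 obtain h' where h': "h' \<in> lhom (Cov H j) (Cov H n)" "\<And>x. x \<in> carr (Cov H j) ==> prj H n (h' x) = f (prj H j x)"
   "\<And>x. x \<in> carr (Om H (j + 1)) ==> h' (inc H j x) = inc H n (g x)"
  using l by (auto simp: heller_ladder_def)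
 obtain w where w: "null_map (Cov H j) (Om H m) w" "\<And>x. x \<in> carr (Om H (j + 1)) ==> w (inc H j x) = (e \<circ> g) x"
  by (rule null_extend[OF nl inc_lhom inc_inj Om_lm Cov_fg Om_lm]) (rule that)
 have wl: "w \<in> lhom (Cov H j) (Om H m)" by (rule null_lhom[OF w(1)])
 have u1: "h \<circ> h' \<in> lhom (Cov H j) M" and u2: "\<alpha> \<circ> w \<in> lhom (Cov H j) M"
  by (rule lhom_comp[OF h'(1) h(1) Cov_lm], rule lhom_comp[OF wl alpha Om_lm])
 have u: "(\<lambda>x. (h \<circ> h') x - (\<alpha> \<circ> w) x) \<in> lhom (Cov H j) M" by (rule lhom_minus_fun[OF u1 u2 M_lm])
 have z: "(h \<circ> h') (inc H j x) - (\<alpha> \<circ> w) (inc H j x) = 0" if x: "x \<in> carr (Om H (j + 1))" for x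
  by (simp add: h'(3)[OF x] h(3)[OF lhom_in[OF g x]] w(2)[OF x])
 obtain y where y: "y \<in> lhom (Om H j) M" "\<And>x. x \<in> carr (Cov H j) ==> y (prj H j x) = (h \<circ> h') x - (\<alpha> \<circ> w) x"
  by (rule factor_prj[OF u z]) (assumption | rule that)+
 have "\<beta> \<circ> y = f"
 proof (rule lhom_eqI[OF lhom_comp[OF y(1) beta M_lm] f])
  fix x assume "x \<in> carr (Om H j)"
  hence "x \<in> prj H j ` carr (Cov H j)" using prj_surj by simp
  then obtain c where c: "c \<in> carr (Cov H j)" "x = prj H j c" by blast
  have "\<beta> (y x) = \<beta> ((h \<circ> h') c) - \<beta> ((\<alpha> \<circ> w) c)"
   unfolding c(2) y(2)[OF c(1)] by (rule lhom_diff[OF beta M_lm lhom_in[OF u1 c(1)] lhom_in[OF u2 c(1)]])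
  thus "(\<beta> \<circ> y) x = f x"
   using h(2)[OF lhom_in[OF h'(1) c(1)]] h'(2)[OF c(1)] beta_alpha[OF lhom_in[OF wl c(1)]] c(2) by simp
 qed
 thus thesis using that y(1) by blast
qed

section \<open>The kernel of multiplication by the extension class\<close>

text \<open>The classes of degree \<open>j\<close> whose product with the extension class vanishes.\<close>

definition ann :: "int \<Rightarrow> ('u \<Rightarrow> 'u) set" where
 "ann j = {f \<in> hom j 0. nul (j + (n + 1)) m (e \<circ> Sh (n + 1) j 0 f)}"

lemma ann_sub: "ann j \<subseteq> hom j 0"
 by (auto simp: ann_def)

lemma e_null: assumes "seq a (n + 1) f g" "nul a m (e \<circ> g)" shows "nul a m (e \<circ> f)"
 by (rule steq_null[OF steq_comp[OF assms(1) steq_refl[OF e_hom Om_lm] Om_lm Om_lm Om_lm] assms(2) Om_lm])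

lemma Sh_n1: "f \<in> hom j 0 ==> Sh (n + 1) j 0 f \<in> hom (j + (n + 1)) (n + 1)"
 using Sh_hom[of f j 0 "n + 1"] by simp

lemma annI: "f \<in> hom j 0 ==> seq (j + (n + 1)) (n + 1) (Sh (n + 1) j 0 f) g ==> nul (j + (n + 1)) m (e \<circ> g) ==> f \<in> ann j"
 unfolding ann_def using e_null by blast

lemma annD: "f \<in> ann j ==> nul (j + (n + 1)) m (e \<circ> Sh (n + 1) j 0 f)"
 by (simp add: ann_def)

lemma ann_zero: "(\<lambda>x. 0) \<in> ann j"
proof (rule annI)
 show "(\<lambda>x. 0) \<in> hom j 0" by (simp add: lhom_0)
 show "seq (j + (n + 1)) (n + 1) (Sh (n + 1) j 0 (\<lambda>x. 0)) (\<lambda>x. 0)" using Sh_zero[of j "n + 1" 0] by simp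
 have e0: "e \<circ> (\<lambda>x. 0) = (\<lambda>x. 0)" using lhom_zero[OF e_hom Om_lm] by (simp add: fun_eq_iff)
 show "nul (j + (n + 1)) m (e \<circ> (\<lambda>x. 0))" unfolding e0 by (rule null_zero[OF Om_lm])
qed

lemma ann_plus: assumes f: "f \<in> ann j" and g: "g \<in> ann j" shows "(\<lambda>x. f x + g x) \<in> ann j"
proof (rule annI)
 have h: "f \<in> hom j 0" "g \<in> hom j 0" using f g ann_sub by auto
 thus "(\<lambda>x. f x + g x) \<in> hom j 0" by (simp add: lhom_plus)
 show "seq (j + (n + 1)) (n + 1) (Sh (n + 1) j 0 (\<lambda>x. f x + g x)) (\<lambda>x. Sh (n + 1) j 0 f x + Sh (n + 1) j 0 g x)"
  using Sh_plus[OF h, of "n + 1"] by simp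
 show "nul (j + (n + 1)) m (e \<circ> (\<lambda>x. Sh (n + 1) j 0 f x + Sh (n + 1) j 0 g x))"
  unfolding lhom_comp_plus[OF Sh_n1[OF h(1)] Sh_n1[OF h(2)] e_hom Om_lm Om_lm]
  by (rule null_plus[OF annD[OF f] annD[OF g] Om_lm])
qed

lemma ann_cong: assumes f: "f \<in> ann j" and s: "seq j 0 g f" shows "g \<in> ann j"
proof (rule annI[OF steq_lhom(1)[OF s] _ annD[OF f]])
 show "seq (j + (n + 1)) (n + 1) (Sh (n + 1) j 0 g) (Sh (n + 1) j 0 f)" using Sh_cong[OF s, of "n + 1"] by simp
qed

lemma ann_comp: assumes f: "f \<in> ann j" and g: "g \<in> hom i j" shows "f \<circ> g \<in> ann i"
proof (rule annI)
 have h: "f \<in> hom j 0" using f ann_sub by auto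
 show "f \<circ> g \<in> hom i 0" by (rule lhom_comp[OF g h Om_lm])
 show "seq (i + (n + 1)) (n + 1) (Sh (n + 1) i 0 (f \<circ> g)) (Sh (n + 1) j 0 f \<circ> Sh (n + 1) i j g)"
  using Sh_comp[OF g h, of "n + 1"] by simp
 show "nul (i + (n + 1)) m (e \<circ> (Sh (n + 1) j 0 f \<circ> Sh (n + 1) i j g))"
  using null_comp_right[OF annD[OF f] Sh_hom[OF g, of "n + 1"] Om_lm] by (simp add: o_assoc)
qed

lemma ann_lift: assumes f: "f \<in> ann d" obtains y where "y \<in> lhom (Om H (d + n)) M" "\<beta> \<circ> y = Sh n d 0 f"
proof -
 have fh: "f \<in> hom d 0" using f ann_sub by auto
 have s: "Sh n d 0 f \<in> hom (d + n) n" using Sh_hom[OF fh, of n] by simp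
 obtain g where g: "g \<in> hom (d + n + 1) (n + 1)" "ladder (d + n) n (Sh n d 0 f) g" by (rule ladder_up[OF s])
 have "seq (d + n + 1) (n + 1) (Sh 1 (d + n) n (Sh n d 0 f)) (Sh (n + 1) d 0 f)"
  using Sh_Sh[OF fh, of n 1] by (simp add: add.assoc)
 from steq_trans[OF ladder_Sh[OF s g] this Om_lm]
 have a: "seq (d + n + 1) (n + 1) g (Sh (n + 1) d 0 f)" .
 have "nul (d + n + 1) m (e \<circ> Sh (n + 1) d 0 f)" using annD[OF f] by (simp add: add.assoc)
 from connecting_lift[OF s g e_null[OF a this]] show thesis using that by blast
qed

text \<open>Every map into \<open>M\<close> yields an element of the kernel, and \<open>ann_lift\<close> shows that all
 elements arise.\<close>

lemma shift_in_ann: assumes y: "y \<in> lhom (Om H j) M" shows "Sh (- n) j n (\<beta> \<circ> y) \<in> ann (j - n)"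
proof -
 have f: "\<beta> \<circ> y \<in> hom j n" by (rule lhom_comp[OF y beta M_lm])
 obtain g where g: "g \<in> hom (j + 1) (n + 1)" "ladder j n (\<beta> \<circ> y) g" by (rule ladder_up[OF f])
 have jn: "j - n + (n + 1) = j + 1" by simp
 have h: "Sh (- n) j n (\<beta> \<circ> y) \<in> hom (j - n) 0" using Sh_hom[OF f, of "- n"] by simp
 have "seq (j + 1) (n + 1) (Sh (n + 1) (j - n) 0 (Sh (- n) j n (\<beta> \<circ> y))) (Sh 1 j n (\<beta> \<circ> y))"
  using Sh_Sh[OF f, of "- n" "n + 1"] by simp
 from steq_trans[OF this steq_sym[OF ladder_Sh[OF f g] Om_lm] Om_lm]
 show ?thesis using annI[OF h] connecting_null[OF y g] unfolding jn by blast
qed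

end

context hopf_extension begin

text \<open>The part of \<open>y\<close> seen by \<open>\<beta>\<close> lies in the kernel and is a combination of the
 generators; subtracting the same combination of their lifts leaves a map that comes from the submodule.\<close>

lemma decomposition:
 assumes Z: "finite Z" "\<And>p. p \<in> Z ==> snd p \<in> hom (fst p) 0" and span: "\<And>j f. f \<in> ann j ==> f \<in> rspan Z j"
  and Y: "\<And>p. p \<in> Z ==> Y p \<in> lhom (Om H (fst p + n)) M" "\<And>p. p \<in> Z ==> \<beta> \<circ> Y p = Sh n (fst p) 0 (snd p)"
  and y: "y \<in> lhom (Om H j) M"
 obtains g r where "g \<in> hom j m" "\<And>p. p \<in> Z ==> r p \<in> hom j (fst p + n)"
  "steq (Om H j) M y (\<lambda>x. (\<alpha> \<circ> g) x + (\<Sum>p\<in>Z. (Y p \<circ> r p) x))"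
proof -
 have f: "\<beta> \<circ> y \<in> hom j n" by (rule lhom_comp[OF y beta M_lm])
 obtain s where s: "\<And>p. p \<in> Z ==> s p \<in> hom (j - n) (fst p)"
   "seq (j - n) 0 (Sh (- n) j n (\<beta> \<circ> y)) (\<lambda>x. \<Sum>p\<in>Z. snd p (s p x))"
  using span[OF shift_in_ann[OF y]] by (auto simp: rspan_def)
 define r where "r p = Sh n (j - n) (fst p) (s p)" for p
 have r: "r p \<in> hom j (fst p + n)" if "p \<in> Z" for p using Sh_hom[OF s(1)[OF that], of n] by (simp add: r_def)
 have a: "seq j n (Sh n (j - n) 0 (Sh (- n) j n (\<beta> \<circ> y))) (\<beta> \<circ> y)"
  using Sh_Sh[OF f, of "- n" n] Sh_0[OF f] by simp
 have b: "seq j n (Sh n (j - n) 0 (Sh (- n) j n (\<beta> \<circ> y))) (Sh n (j - n) 0 (\<lambda>x. \<Sum>p\<in>Z. snd p (s p x)))"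
  using Sh_cong[OF s(2), of n] by simp
 have c: "seq j n (Sh n (j - n) 0 (\<lambda>x. \<Sum>p\<in>Z. snd p (s p x))) (\<lambda>x. \<Sum>p\<in>Z. (Sh n (fst p) 0 (snd p) \<circ> r p) x)"
  using Sh_sum_comp[OF Z(1) s(1) Z(2), of n] by (simp add: r_def)
 have d: "seq j n (\<beta> \<circ> y) (\<lambda>x. \<Sum>p\<in>Z. (Sh n (fst p) 0 (snd p) \<circ> r p) x)"
  by (rule steq_trans[OF steq_trans[OF steq_sym[OF a Om_lm] b Om_lm] c Om_lm])
 have Yr: "Y p \<circ> r p \<in> lhom (Om H j) M" if "p \<in> Z" for p by (rule lhom_comp[OF r[OF that] Y(1)[OF that] Om_lm])
 let ?t = "\<lambda>x. \<Sum>p\<in>Z. (Y p \<circ> r p) x"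
 have t: "?t \<in> lhom (Om H j) M" by (rule lhom_sum[OF Z(1) Yr M_lm])
 have yt: "(\<lambda>x. y x - ?t x) \<in> lhom (Om H j) M" by (rule lhom_minus_fun[OF y t M_lm])
 have bt: "\<beta> (?t x) = (\<Sum>p\<in>Z. (Sh n (fst p) 0 (snd p) \<circ> r p) x)" if x: "x \<in> carr (Om H j)" for x
 proof -
  have "(\<Sum>p\<in>I. (Y p \<circ> r p) x) \<in> carr M \<and> \<beta> (\<Sum>p\<in>I. (Y p \<circ> r p) x) = (\<Sum>p\<in>I. (Sh n (fst p) 0 (snd p) \<circ> r p) x)" if "I \<subseteq> Z" for I
   using finite_subset[OF that Z(1)] that
  proof (induction I rule: finite_induct)
   case empty
   thus ?case by (simp add: lm_zero[OF M_lm] lhom_zero[OF beta M_lm])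
  next
   case (insert p I)
   hence p: "p \<in> Z" and I: "I \<subseteq> Z" by auto
   have "\<beta> ((Y p \<circ> r p) x) = (Sh n (fst p) 0 (snd p) \<circ> r p) x" using fun_cong[OF Y(2)[OF p], of "r p x"] by simp
   thus ?case using insert.IH[OF I] insert(1,2) lhom_in[OF Yr[OF p] x]
    by (simp add: lm_add[OF M_lm] lhom_add[OF beta])
  qed
  from this[OF order.refl] show ?thesis ..
 qed
 have "\<beta> \<circ> (\<lambda>x. y x - ?t x) = (\<lambda>x. (\<beta> \<circ> y) x - (\<Sum>p\<in>Z. (Sh n (fst p) 0 (snd p) \<circ> r p) x))"
 proof (rule lhom_eqI[OF lhom_comp[OF yt beta M_lm] lhom_minus_fun[OF f steq_lhom(2)[OF d] Om_lm]])
  fix x assume x: "x \<in> carr (Om H j)"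
  show "(\<beta> \<circ> (\<lambda>x. y x - ?t x)) x = (\<beta> \<circ> y) x - (\<Sum>p\<in>Z. (Sh n (fst p) 0 (snd p) \<circ> r p) x)"
   using lhom_diff[OF beta M_lm lhom_in[OF y x] lhom_in[OF t x]] bt[OF x] by simp
 qed
 hence "nul j n (\<beta> \<circ> (\<lambda>x. y x - ?t x))" using d by (simp only: steq_def)
 then obtain g where g: "g \<in> hom j m" "steq (Om H j) M (\<lambda>x. y x - ?t x) (\<alpha> \<circ> g)" by (rule exact_middle[OF yt])
 from steq_plus[OF g(2) steq_refl[OF t M_lm] M_lm]
 have "steq (Om H j) M y (\<lambda>x. (\<alpha> \<circ> g) x + ?t x)" by simp
 thus thesis using that[OF g(1) r] by blast
qed

end

section \<open>Tate cohomology groups and products in terms of stable maps\<close>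

abbreviation nulls :: "('a::ring_1, 'm::ab_group_add) lmod \<Rightarrow> ('a, 'n::ab_group_add) lmod \<Rightarrow> ('m \<Rightarrow> 'n) set" where
 "nulls X N \<equiv> {f. null_map X N f}"

abbreviation scls :: "('a::ring_1, 'm::ab_group_add) lmod \<Rightarrow> ('a, 'n::ab_group_add) lmod \<Rightarrow> ('m \<Rightarrow> 'n) \<Rightarrow> ('m \<Rightarrow> 'n) set" where
 "scls X N \<equiv> cls (nulls X N)"

lemma addset_nulls: "left_module N ==> addset (nulls X N)"
 unfolding addset_def by (simp add: null_zero null_plus null_uminus)

lemma fquot_stable: "left_module N ==> fquot (lhom X N) (nulls X N)"
 by unfold_locales (auto simp: addset_lhom addset_nulls null_lhom)

lemma scls_steq: "steq X N f g ==> left_module N ==> scls X N f = scls X N g"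
 by (simp add: cls_eq[OF addset_nulls] steq_def)

lemma scls_self: "left_module N ==> f \<in> scls X N f"
 by (rule cls_self[OF addset_nulls])

lemma scls_mem: assumes "g \<in> scls X N f" "f \<in> lhom X N" "left_module N" shows "steq X N g f"
proof -
 have n: "null_map X N (\<lambda>x. g x - f x)" using assms(1) by (simp add: cls_def)
 have "g \<in> lhom X N" using lhom_plus[OF null_lhom[OF n] assms(2,3)] by simp
 thus ?thesis using n assms(2) by (simp add: steq_def)
qed

context hopf_heller begin

lemma stable_class_scls:
 fixes X :: "('a, 'x::ab_group_add) lmod" and N :: "('a, 'n::ab_group_add) lmod"
 assumes "left_module X" "left_module N" shows "stable_class X N f = scls X N f"
proof -
 have "projective_maps X N = nulls X N" using projective_maps_iff[OF assms] by auto
 thus ?thesis unfolding stable_class_def hom_group_fgrp by (simp only: coset_cls[OF addset_nulls[OF assms(2)]])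
qed

lemma tate_deg_qgrp:
 fixes N :: "('a, 'n::ab_group_add) lmod"
 assumes "left_module N" shows "tate_deg H N d = qgrp (lhom (Om H d) N) (nulls (Om H d) N)"
proof -
 have "projective_maps (Om H d) N = nulls (Om H d) N" using projective_maps_iff[OF Om_lm assms] by auto
 thus ?thesis by (simp add: tate_deg_def stable_hom_def qgrp_def hom_group_fgrp)
qed

lemma tate_deg_group:
 fixes N :: "('a, 'n::ab_group_add) lmod"
 assumes N: "left_module N" shows "comm_group (tate_deg H N d)" "group (tate_deg H N d)"
  "carrier (tate_deg H N d) = scls (Om H d) N ` lhom (Om H d) N" "\<one>\<^bsub>tate_deg H N d\<^esub> = scls (Om H d) N (\<lambda>x. 0)"
  "scls (Om H d) N f = \<one>\<^bsub>tate_deg H N d\<^esub> \<longleftrightarrow> null_map (Om H d) N f"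
proof -
 interpret fquot "lhom (Om H d) N" "nulls (Om H d) N" by (rule fquot_stable[OF N])
 show "comm_group (tate_deg H N d)" "group (tate_deg H N d)"
  "carrier (tate_deg H N d) = scls (Om H d) N ` lhom (Om H d) N" "\<one>\<^bsub>tate_deg H N d\<^esub> = scls (Om H d) N (\<lambda>x. 0)"
  unfolding tate_deg_qgrp[OF N] by (rule q_comm_group q_group q_carrier q_one)+
 show "scls (Om H d) N f = \<one>\<^bsub>tate_deg H N d\<^esub> \<longleftrightarrow> null_map (Om H d) N f"
  unfolding tate_deg_qgrp[OF N] q_zero_iff by simp
qed

lemma tate_deg_rep:
 fixes N :: "('a, 'n::ab_group_add) lmod"
 assumes N: "left_module N" and X: "X \<in> carrier (tate_deg H N d)"
 obtains y where "y \<in> lhom (Om H d) N" "X = scls (Om H d) N y"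
 using X unfolding tate_deg_group(3)[OF N] by blast

lemma tate_sum_iff:
 fixes N :: "('a, 'n::ab_group_add) lmod"
 assumes N: "left_module N"
 shows "x \<in> carrier (tate_sum H N) \<longleftrightarrow> (\<forall>d. x d \<in> carrier (tate_deg H N d)) \<and> finite {d. x d \<noteq> \<one>\<^bsub>tate_deg H N d\<^esub>}"
 unfolding tate_sum_def by (subst carrier_sum_group[OF tate_deg_group(2)[OF N]]) (simp add: PiE_iff)

lemma tate_homogeneous_closed:
 fixes N :: "('a, 'n::ab_group_add) lmod"
 assumes N: "left_module N" and y: "y \<in> lhom (Om H d) N" shows "tate_homogeneous H N d (scls (Om H d) N y) \<in> carrier (tate_sum H N)"
 unfolding tate_sum_iff[OF N]
proof
 show "\<forall>j. tate_homogeneous H N d (scls (Om H d) N y) j \<in> carrier (tate_deg H N j)"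
  unfolding tate_homogeneous_def tate_deg_group(3,4)[OF N] using y by (auto simp: lhom_0[OF N])
 show "finite {j. tate_homogeneous H N d (scls (Om H d) N y) j \<noteq> \<one>\<^bsub>tate_deg H N j\<^esub>}"
  by (rule finite_subset[of _ "{d}"]) (auto simp: tate_homogeneous_def)
qed

lemma core_out_hom: "z \<in> lhom (Om H a) T ==> core_out H \<circ> z \<in> hom a 0"
 by (rule lhom_comp[OF _ core_out_lhom left_module_T])

text \<open>Stable functoriality of composition and shift makes the union over representatives a single class.\<close>

lemma tate_mul_scls:
 fixes N :: "('a, 'n::ab_group_add) lmod"
 assumes N: "left_module N" and y: "y \<in> lhom (Om H b) N" and z: "z \<in> lhom (Om H a) T"
 shows "tate_mul H N b a (scls (Om H b) N y) (scls (Om H a) T z) = scls (Om H (a + b)) N (y \<circ> Sh b a 0 (core_out H \<circ> z))"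
  (is "_ = ?R")
proof -
 have eq: "stable_class (Om H (a + b)) N (y' \<circ> g) = ?R"
  if a: "y' \<in> scls (Om H b) N y" "z' \<in> scls (Om H a) T z" "shift a 0 (core_out H \<circ> z') b g" for y' z' g
 proof -
  have 1: "steq (Om H b) N y' y" by (rule scls_mem[OF a(1) y N])
  have 2: "steq (Om H a) T z' z" by (rule scls_mem[OF a(2) z left_module_T])
  have 3: "seq a 0 (core_out H \<circ> z') (core_out H \<circ> z)"
   by (rule steq_comp[OF 2 steq_refl[OF core_out_lhom Om_lm] Om_lm left_module_T Om_lm])
  have 4: "seq (a + b) b g (Sh b a 0 (core_out H \<circ> z))"
   using steq_trans[OF shift_Sh[OF a(3)] Sh_cong[OF 3] Om_lm] by simp
  show ?thesis unfolding stable_class_scls[OF Om_lm N] by (rule scls_steq[OF steq_comp[OF 4 1 Om_lm Om_lm N] N])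
 qed
 have ex: "shift a 0 (core_out H \<circ> z) b (Sh b a 0 (core_out H \<circ> z))" by (rule Sh_shift[OF core_out_hom[OF z]])
 show ?thesis unfolding tate_mul_def
 proof
  show "\<Union>{stable_class (Om H (a + b)) N (y' \<circ> g) | y' z' g. y' \<in> scls (Om H b) N y \<and> z' \<in> scls (Om H a) T z \<and>
    shift a 0 (core_out H \<circ> z') b g} \<subseteq> ?R" using eq by (intro Union_least) auto
  show "?R \<subseteq> \<Union>{stable_class (Om H (a + b)) N (y' \<circ> g) | y' z' g. y' \<in> scls (Om H b) N y \<and> z' \<in> scls (Om H a) T z \<and>
    shift a 0 (core_out H \<circ> z') b g}"
   by (rule Union_upper, rule CollectI, rule exI[of _ y], rule exI[of _ z], rule exI[of _ "Sh b a 0 (core_out H \<circ> z)"])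
    (intro conjI ex scls_self N left_module_T eq[OF scls_self[OF N] scls_self[OF left_module_T] ex, symmetric])
 qed
qed

text \<open>If the class of \<open>y\<close> is zero the sum that defines the product is empty, and the right hand side is zero
 as well.\<close>

lemma tate_prod_homogeneous:
 fixes N :: "('a, 'n::ab_group_add) lmod"
 assumes N: "left_module N" and y: "y \<in> lhom (Om H d) N" and z: "z \<in> lhom (Om H (j - d)) T" "r (j - d) = scls (Om H (j - d)) T z"
 shows "tate_prod H N (tate_homogeneous H N d (scls (Om H d) N y)) r j = scls (Om H j) N (y \<circ> Sh d (j - d) 0 (core_out H \<circ> z))"
proof -
 interpret G: comm_group "tate_deg H N j" by (rule tate_deg_group(1)[OF N])
 have s: "Sh d (j - d) 0 (core_out H \<circ> z) \<in> hom j d" using Sh_hom[OF core_out_hom[OF z(1)], of d] by simp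
 have p: "y \<circ> Sh d (j - d) 0 (core_out H \<circ> z) \<in> lhom (Om H j) N" by (rule lhom_comp[OF s y Om_lm])
 have mu: "tate_mul H N d (j - d) (scls (Om H d) N y) (r (j - d)) = scls (Om H j) N (y \<circ> Sh d (j - d) 0 (core_out H \<circ> z))"
  using tate_mul_scls[OF N y z(1)] z(2) by simp
 show ?thesis
 proof (cases "scls (Om H d) N y = \<one>\<^bsub>tate_deg H N d\<^esub>")
  case True
  hence e: "{b. tate_homogeneous H N d (scls (Om H d) N y) b \<noteq> \<one>\<^bsub>tate_deg H N b\<^esub>} = {}"
   by (simp add: tate_homogeneous_def)
  have "null_map (Om H d) N y" using True tate_deg_group(5)[OF N] by blast
  from null_comp_right[OF this s Om_lm]
  have "scls (Om H j) N (y \<circ> Sh d (j - d) 0 (core_out H \<circ> z)) = \<one>\<^bsub>tate_deg H N j\<^esub>" by (simp only: tate_deg_group(5)[OF N])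
  thus ?thesis unfolding tate_prod_def e G.finprod_empty by (rule sym)
 next
  case False
  hence e: "{b. tate_homogeneous H N d (scls (Om H d) N y) b \<noteq> \<one>\<^bsub>tate_deg H N b\<^esub>} = {d}"
   by (auto simp: tate_homogeneous_def)
  have "scls (Om H j) N (y \<circ> Sh d (j - d) 0 (core_out H \<circ> z)) \<in> carrier (tate_deg H N j)"
   unfolding tate_deg_group(3)[OF N] using p by blast
  thus ?thesis unfolding tate_prod_def e
   by (subst G.finprod_insert) (simp_all add: mu[unfolded tate_homogeneous_def] tate_homogeneous_def)
 qed
qed

lemma tate_prod_closed:
 fixes N :: "('a, 'n::ab_group_add) lmod"
 assumes N: "left_module N" and y: "y \<in> lhom (Om H d) N" and r: "r \<in> carrier (tate_sum H T)"
 shows "tate_prod H N (tate_homogeneous H N d (scls (Om H d) N y)) r \<in> carrier (tate_sum H N)"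
proof -
 let ?p = "tate_prod H N (tate_homogeneous H N d (scls (Om H d) N y)) r"
 have rc: "r i \<in> carrier (tate_deg H T i)" and rf: "finite {i. r i \<noteq> \<one>\<^bsub>tate_deg H T i\<^esub>}" for i
  using r unfolding tate_sum_iff[OF left_module_T] by blast+
 have c: "?p j \<in> carrier (tate_deg H N j)" for j
 proof -
  obtain z where z: "z \<in> lhom (Om H (j - d)) T" "r (j - d) = scls (Om H (j - d)) T z"
   by (rule tate_deg_rep[OF left_module_T rc])
  have "Sh d (j - d) 0 (core_out H \<circ> z) \<in> hom j d" using Sh_hom[OF core_out_hom[OF z(1)], of d] by simp
  from lhom_comp[OF this y Om_lm] show ?thesis
   unfolding tate_prod_homogeneous[where r = r, OF N y z] tate_deg_group(3)[OF N] by blast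
 qed
 have o: "?p j = \<one>\<^bsub>tate_deg H N j\<^esub>" if "r (j - d) = \<one>\<^bsub>tate_deg H T (j - d)\<^esub>" for j
 proof -
  have z: "(\<lambda>x. 0) \<in> lhom (Om H (j - d)) T" by (rule lhom_0[OF left_module_T])
  have rz: "r (j - d) = scls (Om H (j - d)) T (\<lambda>x. 0)" using that tate_deg_group(4)[OF left_module_T] by simp
  have co: "core_out H \<circ> (\<lambda>x. 0) = (\<lambda>x. 0)" using lhom_zero[OF core_out_lhom left_module_T] by (simp add: fun_eq_iff)
  have n: "nul j d (Sh d (j - d) 0 (core_out H \<circ> (\<lambda>x. 0)))"
   unfolding co using Sh_null[OF null_zero[OF Om_lm], of "j - d" d 0] by simp
  show ?thesis unfolding tate_prod_homogeneous[where r = r, OF N y z rz] tate_deg_group(5)[OF N]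
   by (rule null_comp_left[OF n y Om_lm])
 qed
 have "{j. ?p j \<noteq> \<one>\<^bsub>tate_deg H N j\<^esub>} \<subseteq> (\<lambda>i. i + d) ` {i. r i \<noteq> \<one>\<^bsub>tate_deg H T i\<^esub>}"
 proof
  fix j assume "j \<in> {j. ?p j \<noteq> \<one>\<^bsub>tate_deg H N j\<^esub>}"
  hence "r (j - d) \<noteq> \<one>\<^bsub>tate_deg H T (j - d)\<^esub>" using o by blast
  thus "j \<in> (\<lambda>i. i + d) ` {i. r i \<noteq> \<one>\<^bsub>tate_deg H T i\<^esub>}" by (intro image_eqI[of _ _ "j - d"]) simp_all
 qed
 thus ?thesis unfolding tate_sum_iff[OF N] using c finite_subset[OF _ finite_imageI[OF rf]] by blast
qed

text \<open>Finite sums in the direct sum are computed in each degree.\<close>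

lemma tate_finsum:
 fixes N :: "('a, 'n::ab_group_add) lmod" and X :: "('r, int \<Rightarrow> ('u \<Rightarrow> 'n) set) module"
 assumes N: "left_module N" and X: "carrier X = carrier (tate_sum H N)" "add X = monoid.mult (tate_sum H N)" "zero X = \<one>\<^bsub>tate_sum H N\<^esub>"
  and G: "finite G" "\<And>g. g \<in> G ==> F g \<in> carrier (tate_sum H N)"
 shows "finsum X F G d = finprod (tate_deg H N d) (\<lambda>g. F g d) G"
proof -
 interpret D: comm_group "tate_deg H N i" for i by (rule tate_deg_group(1)[OF N])
 have g: "group (tate_sum H N)" unfolding tate_sum_def by (rule sum_group) (rule tate_deg_group(2)[OF N])
 have pt: "x i \<in> carrier (tate_deg H N i)" if "x \<in> carrier (tate_sum H N)" for x i using that tate_sum_iff[OF N] by blast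
 have "comm_group (tate_sum H N)"
 proof (rule group.group_comm_groupI[OF g])
  fix x y assume x: "x \<in> carrier (tate_sum H N)" and y: "y \<in> carrier (tate_sum H N)"
  show "x \<otimes>\<^bsub>tate_sum H N\<^esub> y = y \<otimes>\<^bsub>tate_sum H N\<^esub> x"
   unfolding tate_sum_def mult_sum_group using D.m_comm[OF pt[OF x] pt[OF y]] by simp
 qed
 then interpret S: Group.comm_monoid "tate_sum H N" by (rule comm_group.axioms(1))
 interpret A: abelian_monoid X
 proof (rule abelian_monoid.intro, rule comm_monoidI)
  fix x y z assume "x \<in> carrier (add_monoid X)" "y \<in> carrier (add_monoid X)" "z \<in> carrier (add_monoid X)"
  hence "x \<in> carrier (tate_sum H N)" "y \<in> carrier (tate_sum H N)" "z \<in> carrier (tate_sum H N)" by (simp_all add: X(1))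
  note S.m_assoc[OF this]
  thus "x \<otimes>\<^bsub>add_monoid X\<^esub> y \<otimes>\<^bsub>add_monoid X\<^esub> z = x \<otimes>\<^bsub>add_monoid X\<^esub> (y \<otimes>\<^bsub>add_monoid X\<^esub> z)" by (simp add: X(2))
 qed (simp_all add: X S.m_comm)
 have ad: "(add X x y) d = x d \<otimes>\<^bsub>tate_deg H N d\<^esub> y d" for x y by (simp add: X(2) tate_sum_def)
 have ze: "(zero X) d = \<one>\<^bsub>tate_deg H N d\<^esub>" by (simp add: X(3) tate_sum_def)
 show ?thesis using G
 proof (induction G rule: finite_induct)
  case empty
  thus ?case using ze by simp
 next
  case (insert a G)
  have F: "F \<in> G \<rightarrow> carrier X" "F a \<in> carrier X" using insert X(1) by auto
  have "finsum X F (insert a G) = add X (F a) (finsum X F G)"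
   by (rule A.finsum_insert[OF insert(1,2) F])
  hence "finsum X F (insert a G) d = F a d \<otimes>\<^bsub>tate_deg H N d\<^esub> finprod (tate_deg H N d) (\<lambda>g. F g d) G"
   using ad insert.IH insert.prems by simp
  also have "\<dots> = finprod (tate_deg H N d) (\<lambda>g. F g d) (insert a G)"
   using insert pt by (subst D.finprod_insert) auto
  finally show ?case .
 qed
qed

lemma tate_scalar:
 assumes f: "f \<in> lhom (Om H d) T" and x: "x d = scls (Om H d) T f"
 shows "(c \<odot>\<^bsub>tate_ring T H\<^esub> x) d = scls (Om H d) T (\<lambda>v. c * f v)" "(\<lambda>v. c * f v) \<in> lhom (Om H d) T"
  "null_map (Om H d) T f ==> null_map (Om H d) T (\<lambda>v. c * f v)"
proof -
 have m: "(*) c \<in> lhom T T" by (simp add: lhom_def trivial_module_def algebra_simps)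
 have eq: "stable_class (Om H d) T (\<lambda>v. c * g v) = scls (Om H d) T (\<lambda>v. c * f v)" if g: "g \<in> scls (Om H d) T f" for g
  unfolding stable_class_scls[OF Om_lm left_module_T]
  using scls_steq[OF steq_comp[OF scls_mem[OF g f left_module_T] steq_refl[OF m left_module_T] Om_lm left_module_T left_module_T] left_module_T]
  by (simp add: o_def)
 have "(c \<odot>\<^bsub>tate_ring T H\<^esub> x) d = (\<Union>g\<in>scls (Om H d) T f. stable_class (Om H d) T (\<lambda>v. c * g v))"
  by (simp add: tate_ring_def x)
 also have "\<dots> = scls (Om H d) T (\<lambda>v. c * f v)"
  using eq scls_self[OF left_module_T, of f "Om H d"] by auto
 finally show "(c \<odot>\<^bsub>tate_ring T H\<^esub> x) d = scls (Om H d) T (\<lambda>v. c * f v)" .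
 show "(\<lambda>v. c * f v) \<in> lhom (Om H d) T" using lhom_comp[OF f m left_module_T] by (simp add: o_def)
 show "null_map (Om H d) T (\<lambda>v. c * f v)" if "null_map (Om H d) T f"
  using null_comp_left[OF that m left_module_T] by (simp add: o_def)
qed

text \<open>A finite spanning set has only finitely many degrees in its support, and products with homogeneous elements of
 other degrees vanish.\<close>

lemma finite_image_bounded:
 assumes fs: "finitely_spanned UNIV (tate_ring T H)
    ((\<lambda>x. tate_homogeneous H T \<delta> (scls (Om H \<delta>) T z0) \<otimes>\<^bsub>tate_ring T H\<^esub> x) ` carrier (tate_ring T H))"
  and z0: "z0 \<in> lhom (Om H \<delta>) T"
 obtains B where "\<And>a z. \<bar>a\<bar> \<ge> int B ==> z \<in> lhom (Om H a) T ==> null_map (Om H (a + \<delta>)) T (z0 \<circ> Sh \<delta> a 0 (core_out H \<circ> z))"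
proof -
 let ?X = "tate_homogeneous H T \<delta> (scls (Om H \<delta>) T z0)"
 have R: "carrier (tate_ring T H) = carrier (tate_sum H T)" "add (tate_ring T H) = monoid.mult (tate_sum H T)"
  "zero (tate_ring T H) = \<one>\<^bsub>tate_sum H T\<^esub>" "x \<otimes>\<^bsub>tate_ring T H\<^esub> y = tate_prod H T x y" for x y
  by (simp_all add: tate_ring_def)
 interpret D: comm_group "tate_deg H T i" for i by (rule tate_deg_group(1)[OF left_module_T])
 obtain G where G: "finite G" "G \<subseteq> tate_prod H T ?X ` carrier (tate_sum H T)"
  and sp: "\<And>v. v \<in> tate_prod H T ?X ` carrier (tate_sum H T) ==> \<exists>r. v = finsum (tate_ring T H) (\<lambda>g. r g \<odot>\<^bsub>tate_ring T H\<^esub> g) G"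
  using fs unfolding finitely_spanned_def R by (auto simp del: mult_sum_group one_sum_group)
 have Gc: "g \<in> carrier (tate_sum H T)" if "g \<in> G" for g
  using that G(2) tate_prod_closed[OF left_module_T z0] by auto
 have Gd: "g i \<in> carrier (tate_deg H T i)" and Gf: "finite {i. g i \<noteq> \<one>\<^bsub>tate_deg H T i\<^esub>}" if "g \<in> G" for g i
  using Gc[OF that] unfolding tate_sum_iff[OF left_module_T] by blast+
 have sc: "(c \<odot>\<^bsub>tate_ring T H\<^esub> g) i \<in> carrier (tate_deg H T i) \<and>
   (g i = \<one>\<^bsub>tate_deg H T i\<^esub> \<longrightarrow> (c \<odot>\<^bsub>tate_ring T H\<^esub> g) i = \<one>\<^bsub>tate_deg H T i\<^esub>)" if g: "g \<in> G" for c g i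
 proof -
  obtain f where f: "f \<in> lhom (Om H i) T" "g i = scls (Om H i) T f" by (rule tate_deg_rep[OF left_module_T Gd[OF g]])
  show ?thesis unfolding tate_scalar(1)[where x = g, OF f] f(2) tate_deg_group(3,5)[OF left_module_T]
   using tate_scalar(2,3)[where x = g, OF f] by blast
 qed
 have scc: "c \<odot>\<^bsub>tate_ring T H\<^esub> g \<in> carrier (tate_sum H T)" if g: "g \<in> G" for c g
  unfolding tate_sum_iff[OF left_module_T]
 proof
  show "\<forall>d. (c \<odot>\<^bsub>tate_ring T H\<^esub> g) d \<in> carrier (tate_deg H T d)" using sc[OF g] by blast
  show "finite {d. (c \<odot>\<^bsub>tate_ring T H\<^esub> g) d \<noteq> \<one>\<^bsub>tate_deg H T d\<^esub>}"
   by (rule finite_subset[OF _ Gf[OF g]]) (use sc[OF g] in blast)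
 qed
 define U where "U = (\<Union>g\<in>G. {i. g i \<noteq> \<one>\<^bsub>tate_deg H T i\<^esub>})"
 have "finite U" unfolding U_def using G(1) Gf by blast
 then obtain B where B: "\<And>i. i \<in> U ==> nat \<bar>i - \<delta>\<bar> \<le> B"
  using finite_nat_set_iff_bounded_le[of "(\<lambda>i. nat \<bar>i - \<delta>\<bar>) ` U"] by auto
 show thesis
 proof (rule that[of "B + 1"])
  fix a z assume a: "\<bar>a\<bar> \<ge> int (B + 1)" and z: "z \<in> lhom (Om H a) T"
  let ?v = "tate_prod H T ?X (tate_homogeneous H T a (scls (Om H a) T z))"
  have "a + \<delta> \<notin> U" using B[of "a + \<delta>"] a by auto
  hence g1: "g (a + \<delta>) = \<one>\<^bsub>tate_deg H T (a + \<delta>)\<^esub>" if "g \<in> G" for g using that by (auto simp: U_def)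
  have "?v \<in> tate_prod H T ?X ` carrier (tate_sum H T)" using tate_homogeneous_closed[OF left_module_T z] by blast
  then obtain r where r: "?v = finsum (tate_ring T H) (\<lambda>g. r g \<odot>\<^bsub>tate_ring T H\<^esub> g) G" using sp by blast
  have "?v (a + \<delta>) = finprod (tate_deg H T (a + \<delta>)) (\<lambda>g. (r g \<odot>\<^bsub>tate_ring T H\<^esub> g) (a + \<delta>)) G"
   unfolding r by (rule tate_finsum[OF left_module_T R(1-3) G(1) scc])
  also have "\<dots> = \<one>\<^bsub>tate_deg H T (a + \<delta>)\<^esub>" by (rule D.finprod_one_eqI) (use sc g1 in blast)
  finally have "?v (a + \<delta>) = \<one>\<^bsub>tate_deg H T (a + \<delta>)\<^esub>" .
  moreover have "?v (a + \<delta>) = scls (Om H (a + \<delta>)) T (z0 \<circ> Sh \<delta> a 0 (core_out H \<circ> z))"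
   using tate_prod_homogeneous[OF left_module_T z0, of z "a + \<delta>" "tate_homogeneous H T a (scls (Om H a) T z)"] z
   by (simp add: tate_homogeneous_def)
  ultimately show "null_map (Om H (a + \<delta>)) T (z0 \<circ> Sh \<delta> a 0 (core_out H \<circ> z))"
   using tate_deg_group(5)[OF left_module_T] by simp
 qed
qed

section \<open>From stable maps to the Tate module\<close>

lemma core_out_core_in: "f \<in> hom a 0 ==> core_out H \<circ> (core_in H \<circ> f) = f"
 by (rule lhom_eqI[OF core_out_hom[OF lhom_comp[OF _ core_in_lhom Om_lm]]]) (auto simp: core_out_in lhom_in)

text \<open>Generators with the same nonzero class have to be merged, because the spanning set is a set of elements. The
 coefficients for the component of degree \<open>j\<close> are placed in degree \<open>j\<close> minus the degree of
 the generator; zero components get zero coefficients, so that all coefficients have finite support.\<close>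

lemma tate_module_finitely_generated:
 fixes N :: "('a, 'n::ab_group_add) lmod"
 assumes N: "left_module N" and J: "finite J" "\<And>i. i \<in> J ==> Y i \<in> lhom (Om H (dg i)) N"
  and span: "\<And>j v. v \<in> lhom (Om H j) N ==>
   \<exists>r. (\<forall>i\<in>J. r i \<in> hom j (dg i)) \<and> steq (Om H j) N v (\<lambda>x. \<Sum>i\<in>J. (Y i \<circ> r i) x)"
 shows "finitely_spanned (carrier (tate_ring T H)) (tate_module H N) (carrier (tate_module H N))"
proof -
 define J0 where "J0 = {i \<in> J. \<not> null_map (Om H (dg i)) N (Y i)}"
 define key where "key i = (dg i, scls (Om H (dg i)) N (Y i))" for i
 define K where "K = key ` J0"
 have fJ0: "finite J0" and fK: "finite K" using J(1) by (simp_all add: J0_def K_def)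
 define y where "y p = Y (inv_into J0 key p)" for p
 have yK: "y p \<in> lhom (Om H (fst p)) N" "snd p = scls (Om H (fst p)) N (y p)" "\<not> null_map (Om H (fst p)) N (y p)" if "p \<in> K" for p
 proof -
  let ?i = "inv_into J0 key p"
  have i: "?i \<in> J0" "key ?i = p" using that by (simp_all add: K_def inv_into_into f_inv_into_f)
  have "?i \<in> J" "\<not> null_map (Om H (dg ?i)) N (Y ?i)" using i(1) unfolding J0_def by blast+
  moreover have "fst p = dg ?i" "snd p = scls (Om H (dg ?i)) N (Y ?i)"
   using arg_cong[OF i(2), of fst] arg_cong[OF i(2), of snd] by (simp_all add: key_def)
  ultimately show "y p \<in> lhom (Om H (fst p)) N" "snd p = scls (Om H (fst p)) N (y p)" "\<not> null_map (Om H (fst p)) N (y p)"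
   using J(2)[of ?i] by (simp_all add: y_def)
 qed
 \<comment> \<open>Generators with equal classes are merged by adding their coefficients.\<close>
 have spanK: "\<exists>r. (\<forall>p\<in>K. r p \<in> hom j (fst p)) \<and> steq (Om H j) N v (\<lambda>x. \<Sum>p\<in>K. (y p \<circ> r p) x)"
  if v: "v \<in> lhom (Om H j) N" for j v
 proof -
  obtain r where r: "\<And>i. i \<in> J ==> r i \<in> hom j (dg i)" "steq (Om H j) N v (\<lambda>x. \<Sum>i\<in>J. (Y i \<circ> r i) x)"
   using span[OF v] by blast
  define r' where "r' p = (\<lambda>x. \<Sum>i\<in>{i \<in> J0. key i = p}. r i x)" for p
  have r': "r' p \<in> hom j (fst p)" if "p \<in> K" for p
  proof -
   have "finite {i \<in> J0. key i = p}" using fJ0 by simp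
   moreover have "r i \<in> hom j (fst p)" if "i \<in> {i \<in> J0. key i = p}" for i
    using that r(1)[of i] by (auto simp: J0_def key_def)
   ultimately show ?thesis unfolding r'_def by (rule lhom_sum[OF _ _ Om_lm])
  qed
  have s1: "steq (Om H j) N (Y i \<circ> r i) (if i \<in> J0 then y (key i) \<circ> r i else (\<lambda>x. 0))" if i: "i \<in> J" for i
  proof (cases "i \<in> J0")
   case True
   hence k: "key i \<in> K" by (simp add: K_def)
   have kk: "fst (key i) = dg i" "snd (key i) = scls (Om H (dg i)) N (Y i)" by (simp_all add: key_def)
   have "scls (Om H (dg i)) N (y (key i)) = scls (Om H (dg i)) N (Y i)" using yK(2)[OF k] unfolding kk by (rule sym)
   hence m: "Y i \<in> scls (Om H (dg i)) N (y (key i))" using scls_self[OF N] by blast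
   have "steq (Om H (dg i)) N (Y i) (y (key i))" by (rule scls_mem[OF m _ N]) (use yK(1)[OF k] in \<open>simp only: kk\<close>)
   from steq_comp[OF steq_refl[OF r(1)[OF i] Om_lm] this Om_lm Om_lm N] show ?thesis using True by simp
  next
   case False
   hence "null_map (Om H (dg i)) N (Y i)" using i by (simp add: J0_def)
   from null_comp_right[OF this r(1)[OF i] Om_lm] show ?thesis using False by (simp add: steq_zero_iff[OF N] del: o_apply)
  qed
  have s2: "(\<Sum>i\<in>J. (if i \<in> J0 then y (key i) \<circ> r i else (\<lambda>x. 0)) x) = (\<Sum>p\<in>K. (y p \<circ> r' p) x)" for x
  proof -
   have "(\<Sum>i\<in>J. (if i \<in> J0 then y (key i) \<circ> r i else (\<lambda>x. 0)) x) = (\<Sum>i\<in>J0. y (key i) (r i x))"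
    by (rule sum.mono_neutral_cong_right[OF J(1)]) (auto simp: J0_def)
   also have "\<dots> = (\<Sum>p\<in>K. \<Sum>i\<in>{i \<in> J0. key i = p}. y (key i) (r i x))"
    unfolding K_def by (rule sum.image_gen[OF fJ0])
   also have "\<dots> = (\<Sum>p\<in>K. y p (r' p x))"
   proof (rule sum.cong[OF refl])
    fix p assume p: "p \<in> K"
    have "(\<Sum>i\<in>I. r i x) \<in> carr (Om H (fst p)) \<and> (\<Sum>i\<in>I. y (key i) (r i x)) = y p (\<Sum>i\<in>I. r i x)"
     if "finite I" "I \<subseteq> {i \<in> J0. key i = p}" for I
     using that
    proof (induction I rule: finite_induct)
     case empty
     thus ?case using lhom_zero[OF yK(1)[OF p] Om_lm] lm_zero[OF Om_lm] by simp
    next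
     case (insert i I)
     hence i: "i \<in> J" "dg i = fst p" "key i = p" by (auto simp: J0_def key_def)
     have c: "r i x \<in> carr (Om H (fst p))"
      using lhom_in[OF r(1)[OF i(1)], of x] lhom_out[OF r(1)[OF i(1)], of x] lm_zero[OF Om_lm] i(2) by (cases "x \<in> carr (Om H j)") auto
     thus ?case using insert i(3) by (simp add: lhom_add[OF yK(1)[OF p]] lm_add[OF Om_lm])
    qed
    from this[OF _ order.refl] show "(\<Sum>i\<in>{i \<in> J0. key i = p}. y (key i) (r i x)) = y p (r' p x)"
     using fJ0 by (simp add: r'_def)
   qed
   finally show ?thesis by simp
  qed
  have "steq (Om H j) N v (\<lambda>x. \<Sum>p\<in>K. (y p \<circ> r' p) x)"
   using steq_trans[OF r(2) steq_sum[OF J(1) s1 N] N] unfolding s2 .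
  thus ?thesis using r' by blast
 qed
 define elt where "elt p = tate_homogeneous H N (fst p) (scls (Om H (fst p)) N (y p))" for p
 have el: "elt p (fst p) \<noteq> \<one>\<^bsub>tate_deg H N (fst p)\<^esub>" "\<And>i. i \<noteq> fst p ==> elt p i = \<one>\<^bsub>tate_deg H N i\<^esub>" "elt p (fst p) = snd p" if "p \<in> K" for p
  using yK[OF that] tate_deg_group(5)[OF N] by (simp_all add: elt_def tate_homogeneous_def)
 have inj: "inj_on elt K"
 proof (rule inj_onI)
  fix p q assume p: "p \<in> K" and q: "q \<in> K" and eq: "elt p = elt q"
  have "fst p = fst q" using el(1)[OF p] el(2)[OF q] eq by metis
  moreover from this have "snd p = snd q" using el(3)[OF p] el(3)[OF q] eq by simp
  ultimately show "p = q" by (rule prod_eqI)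
 qed
 have X: "carrier (tate_module H N) = carrier (tate_sum H N)" "add (tate_module H N) = monoid.mult (tate_sum H N)"
  "zero (tate_module H N) = \<one>\<^bsub>tate_sum H N\<^esub>" "r \<odot>\<^bsub>tate_module H N\<^esub> x = tate_prod H N x r" for r x
  by (simp_all add: tate_module_def)
 show ?thesis unfolding finitely_spanned_def
 proof (intro exI[of _ "elt ` K"] conjI ballI)
  show "finite (elt ` K)" using fK by simp
  show "elt ` K \<subseteq> carrier (tate_module H N)"
   unfolding X(1) using tate_homogeneous_closed[OF N yK(1)] by (auto simp: elt_def)
  fix v assume "v \<in> carrier (tate_module H N)"
  hence vc: "\<And>j. v j \<in> carrier (tate_deg H N j)" and vf: "finite {j. v j \<noteq> \<one>\<^bsub>tate_deg H N j\<^esub>}"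
   unfolding X(1) tate_sum_iff[OF N] by blast+
  have "\<exists>r. (\<forall>p\<in>K. r p \<in> hom j (fst p)) \<and> v j = scls (Om H j) N (\<lambda>x. \<Sum>p\<in>K. (y p \<circ> r p) x) \<and>
    (v j = \<one>\<^bsub>tate_deg H N j\<^esub> \<longrightarrow> r = (\<lambda>p x. 0))" for j
  proof (cases "v j = \<one>\<^bsub>tate_deg H N j\<^esub>")
   case True
   have "(\<Sum>p\<in>K. (y p \<circ> (\<lambda>x. 0)) x) = 0" for x using lhom_zero[OF yK(1) Om_lm] by simp
   thus ?thesis using True tate_deg_group(4)[OF N] by (intro exI[of _ "\<lambda>p x. 0"]) (simp add: lhom_0)
  next
   case False
   obtain w where w: "w \<in> lhom (Om H j) N" "v j = scls (Om H j) N w" by (rule tate_deg_rep[OF N vc])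
   obtain r where r: "\<forall>p\<in>K. r p \<in> hom j (fst p)" "steq (Om H j) N w (\<lambda>x. \<Sum>p\<in>K. (y p \<circ> r p) x)" using spanK[OF w(1)] by blast
   have "v j = scls (Om H j) N (\<lambda>x. \<Sum>p\<in>K. (y p \<circ> r p) x)" unfolding w(2) by (rule scls_steq[OF r(2) N])
   thus ?thesis using False r(1) by (intro exI[of _ r]) (simp only:, simp)
  qed
  from choice[OF allI[OF this]] obtain r where
   rr: "\<forall>j. (\<forall>p\<in>K. r j p \<in> hom j (fst p)) \<and> v j = scls (Om H j) N (\<lambda>x. \<Sum>p\<in>K. (y p \<circ> r j p) x) \<and>
    (v j = \<one>\<^bsub>tate_deg H N j\<^esub> \<longrightarrow> r j = (\<lambda>p x. 0))" by (rule exE)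
  have r: "r j p \<in> hom j (fst p)" if "p \<in> K" for j p using rr that by blast
  have rv: "v j = scls (Om H j) N (\<lambda>x. \<Sum>p\<in>K. (y p \<circ> r j p) x)" for j using rr by blast
  have r0: "r j = (\<lambda>p x. 0)" if "v j = \<one>\<^bsub>tate_deg H N j\<^esub>" for j using rr that by blast
  define t where "t p i = core_in H \<circ> Sh (- fst p) (i + fst p) (fst p) (r (i + fst p) p)" for p i
  define \<rho> where "\<rho> p i = scls (Om H i) T (t p i)" for p i
  have sh: "Sh (- fst p) j (fst p) (r j p) \<in> hom (j - fst p) 0" if "p \<in> K" for j p
   using Sh_hom[OF r[OF that, of j], of "- fst p"] by simp
  have t: "t p i \<in> lhom (Om H i) T" if "p \<in> K" for p i
   unfolding t_def using lhom_comp[OF sh[OF that, of "i + fst p"] core_in_lhom Om_lm] by simp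
  have \<rho>1: "\<rho> p i = \<one>\<^bsub>tate_deg H T i\<^esub>" if p: "p \<in> K" and vi: "v (i + fst p) = \<one>\<^bsub>tate_deg H N (i + fst p)\<^esub>" for p i
  proof -
   have "nul i 0 (Sh (- fst p) (i + fst p) (fst p) (\<lambda>x. 0))"
    using Sh_null[OF null_zero[OF Om_lm], of "i + fst p" "- fst p" "fst p"] by simp
   from null_comp_left[OF this core_in_lhom Om_lm] show ?thesis
    unfolding \<rho>_def tate_deg_group(5)[OF left_module_T] t_def r0[OF vi] .
  qed
  have \<rho>c: "\<rho> p \<in> carrier (tate_sum H T)" if p: "p \<in> K" for p
   unfolding tate_sum_iff[OF left_module_T]
  proof
   show "\<forall>d. \<rho> p d \<in> carrier (tate_deg H T d)" using t[OF p] unfolding \<rho>_def tate_deg_group(3)[OF left_module_T] by blast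
   have "{d. \<rho> p d \<noteq> \<one>\<^bsub>tate_deg H T d\<^esub>} \<subseteq> (\<lambda>j. j - fst p) ` {j. v j \<noteq> \<one>\<^bsub>tate_deg H N j\<^esub>}"
   proof
    fix d assume "d \<in> {d. \<rho> p d \<noteq> \<one>\<^bsub>tate_deg H T d\<^esub>}"
    hence "v (d + fst p) \<noteq> \<one>\<^bsub>tate_deg H N (d + fst p)\<^esub>" using \<rho>1[OF p] by blast
    thus "d \<in> (\<lambda>j. j - fst p) ` {j. v j \<noteq> \<one>\<^bsub>tate_deg H N j\<^esub>}" by (intro image_eqI[of _ _ "d + fst p"]) simp_all
   qed
   thus "finite {d. \<rho> p d \<noteq> \<one>\<^bsub>tate_deg H T d\<^esub>}" using finite_subset[OF _ finite_imageI[OF vf]] by blast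
  qed
  have prod: "tate_prod H N (elt p) (\<rho> p) j = scls (Om H j) N (y p \<circ> r j p)" if p: "p \<in> K" for p j
  proof -
   have tj: "t p (j - fst p) = core_in H \<circ> Sh (- fst p) j (fst p) (r j p)" by (simp add: t_def)
   have "tate_prod H N (elt p) (\<rho> p) j = scls (Om H j) N (y p \<circ> Sh (fst p) (j - fst p) 0 (core_out H \<circ> t p (j - fst p)))"
    unfolding elt_def by (rule tate_prod_homogeneous[OF N yK(1)[OF p] t[OF p]]) (simp add: \<rho>_def)
   also have "\<dots> = scls (Om H j) N (y p \<circ> Sh (fst p) (j - fst p) 0 (Sh (- fst p) j (fst p) (r j p)))"
    unfolding tj core_out_core_in[OF sh[OF p]] ..
   also have "\<dots> = scls (Om H j) N (y p \<circ> r j p)"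
   proof (rule scls_steq[OF steq_comp[OF _ steq_refl[OF yK(1)[OF p] N] Om_lm Om_lm N] N])
    show "seq j (fst p) (Sh (fst p) (j - fst p) 0 (Sh (- fst p) j (fst p) (r j p))) (r j p)"
     using Sh_Sh[OF r[OF p], of j "- fst p" "fst p"] Sh_0[OF r[OF p], of j] by simp
   qed
   finally show ?thesis .
  qed
  let ?k = "inv_into K elt"
  have k: "?k g \<in> K" "elt (?k g) = g" if "g \<in> elt ` K" for g using that by (simp_all add: inv_into_into f_inv_into_f)
  show "\<exists>r. (\<forall>g\<in>elt ` K. r g \<in> carrier (tate_ring T H)) \<and> v = (\<Oplus>\<^bsub>tate_module H N\<^esub>g\<in>elt ` K. r g \<odot>\<^bsub>tate_module H N\<^esub> g)"
  proof (intro exI[of _ "\<lambda>g. \<rho> (?k g)"] conjI ballI ext)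
   show "\<rho> (?k g) \<in> carrier (tate_ring T H)" if "g \<in> elt ` K" for g
    using \<rho>c[OF k(1)[OF that]] by (simp add: tate_ring_def)
   fix j
   interpret D: fquot "lhom (Om H j) N" "nulls (Om H j) N" by (rule fquot_stable[OF N])
   interpret DD: comm_group "tate_deg H N j" by (rule tate_deg_group(1)[OF N])
   have cl: "tate_prod H N g (\<rho> (?k g)) \<in> carrier (tate_sum H N)" if g: "g \<in> elt ` K" for g
    using tate_prod_closed[OF N yK(1)[OF k(1)[OF g]] \<rho>c[OF k(1)[OF g]]] k(2)[OF g] by (simp add: elt_def)
   have "(\<Oplus>\<^bsub>tate_module H N\<^esub>g\<in>elt ` K. \<rho> (?k g) \<odot>\<^bsub>tate_module H N\<^esub> g) j
     = finprod (tate_deg H N j) (\<lambda>g. tate_prod H N g (\<rho> (?k g)) j) (elt ` K)"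
    unfolding X(4) by (rule tate_finsum[OF N X(1-3) _ cl]) (simp add: fK)
   also have "\<dots> = finprod (tate_deg H N j) (\<lambda>g. scls (Om H j) N (y (?k g) \<circ> r j (?k g))) (elt ` K)"
   proof (rule DD.finprod_cong'[OF refl])
    show "(\<lambda>g. scls (Om H j) N (y (?k g) \<circ> r j (?k g))) \<in> elt ` K \<rightarrow> carrier (tate_deg H N j)"
     unfolding tate_deg_group(3)[OF N] using lhom_comp[OF r[OF k(1)] yK(1)[OF k(1)] Om_lm] by blast
    show "tate_prod H N g (\<rho> (?k g)) j = scls (Om H j) N (y (?k g) \<circ> r j (?k g))" if g: "g \<in> elt ` K" for g
     using prod[OF k(1)[OF g], of j] unfolding k(2)[OF g] .
   qed
   also have "\<dots> = scls (Om H j) N (\<lambda>x. \<Sum>g\<in>elt ` K. (y (?k g) \<circ> r j (?k g)) x)"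
    unfolding tate_deg_qgrp[OF N] by (rule D.q_finprod) (use fK lhom_comp[OF r[OF k(1)] yK(1)[OF k(1)] Om_lm] in auto)
   also have "(\<lambda>x. \<Sum>g\<in>elt ` K. (y (?k g) \<circ> r j (?k g)) x) = (\<lambda>x. \<Sum>p\<in>K. (y p \<circ> r j p) x)"
    by (rule ext, subst sum.reindex[OF inj], rule sum.cong) (simp_all add: inv_into_f_f[OF inj])
   finally show "v j = (\<Oplus>\<^bsub>tate_module H N\<^esub>g\<in>elt ` K. \<rho> (?k g) \<odot>\<^bsub>tate_module H N\<^esub> g) j" using rv by simp
  qed
 qed
qed

end

context hopf_extension begin

text \<open>The class \<open>e\<close> is the shift by \<open>m\<close> of the map of \<open>\<xi>\<close>, so shifting a
 vanishing product by \<open>m\<close> gives the claim.\<close>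

lemma ann_cofinite:
 assumes z0: "z0 \<in> lhom (Om H (n + 1 - m)) T" and sh: "shift (n + 1 - m) 0 (core_out H \<circ> z0) m e"
  and f: "f \<in> hom a 0" and nl: "null_map (Om H (a + (n + 1 - m))) T (z0 \<circ> Sh (n + 1 - m) a 0 f)"
 shows "f \<in> ann a"
proof -
 let ?d = "n + 1 - m" and ?c = "core_out H \<circ> z0"
 have c: "?c \<in> hom ?d 0" by (rule core_out_hom[OF z0])
 have s: "Sh ?d a 0 f \<in> hom (a + ?d) ?d" using Sh_hom[OF f, of ?d] by simp
 have n1: "nul (a + ?d) 0 (?c \<circ> Sh ?d a 0 f)" using null_comp_left[OF nl core_out_lhom left_module_T] by (simp add: o_assoc)
 have ad: "a + ?d + m = a + (n + 1)" "?d + m = n + 1" by simp_all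
 have n2: "nul (a + (n + 1)) m (Sh m (a + ?d) 0 (?c \<circ> Sh ?d a 0 f))" using Sh_null[OF n1, of m] by (simp add: ad)
 have 1: "seq (a + (n + 1)) m (Sh m (a + ?d) 0 (?c \<circ> Sh ?d a 0 f)) (Sh m ?d 0 ?c \<circ> Sh m (a + ?d) ?d (Sh ?d a 0 f))"
  using Sh_comp[OF s c, of m] by (simp add: ad)
 have 2: "seq (n + 1) m e (Sh m ?d 0 ?c)" using shift_Sh[OF sh] by (simp add: ad)
 have 3: "seq (a + (n + 1)) (n + 1) (Sh m (a + ?d) ?d (Sh ?d a 0 f)) (Sh (n + 1) a 0 f)"
  using Sh_Sh[OF f, of ?d m] by (simp add: ad)
 have "seq (a + (n + 1)) m (e \<circ> Sh (n + 1) a 0 f) (Sh m ?d 0 ?c \<circ> Sh m (a + ?d) ?d (Sh ?d a 0 f))"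
  by (rule steq_comp[OF steq_sym[OF 3 Om_lm] 2 Om_lm Om_lm Om_lm])
 from steq_null[OF steq_trans[OF this steq_sym[OF 1 Om_lm] Om_lm] n2 Om_lm]
 show ?thesis using f by (simp add: ann_def)
qed

theorem tate_module_of_extension_finitely_generated:
 assumes R: "noetherian_ring R" and z0: "z0 \<in> lhom (Om H (n + 1 - m)) T" and sh: "shift (n + 1 - m) 0 (core_out H \<circ> z0) m e"
  and fs: "finitely_spanned UNIV (tate_ring T H) ((\<lambda>x. tate_homogeneous H T (n + 1 - m) (scls (Om H (n + 1 - m)) T z0)
    \<otimes>\<^bsub>tate_ring T H\<^esub> x) ` carrier (tate_ring T H))"
 shows "finitely_spanned (carrier (tate_ring T H)) (tate_module H M) (carrier (tate_module H M))"
proof -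
 obtain B where B: "\<And>a z. \<bar>a\<bar> \<ge> int B ==> z \<in> lhom (Om H a) T
   ==> null_map (Om H (a + (n + 1 - m))) T (z0 \<circ> Sh (n + 1 - m) a 0 (core_out H \<circ> z))"
  by (rule finite_image_bounded[OF fs z0]) (rule that)
 have cof: "f \<in> ann a" if a: "\<bar>a\<bar> \<ge> int B" and f: "f \<in> hom a 0" for a f
  using B[OF a lhom_comp[OF f core_in_lhom Om_lm]] unfolding core_out_core_in[OF f] by (rule ann_cofinite[OF z0 sh f])
 obtain Z where Z: "finite Z" "\<And>d z. (d, z) \<in> Z ==> z \<in> ann d" "\<And>j f. f \<in> ann j ==> f \<in> rspan Z j"
  by (rule cofinite_right_ideal_finitely_generated[OF R ann_sub ann_zero ann_plus ann_cong ann_comp cof]) (assumption | rule that)+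
 have Za: "snd p \<in> ann (fst p)" if "p \<in> Z" for p using Z(2)[of "fst p" "snd p"] that by simp
 have Zh: "snd p \<in> hom (fst p) 0" if "p \<in> Z" for p using Za[OF that] ann_sub by blast
 have "\<exists>y. y \<in> lhom (Om H (fst p + n)) M \<and> \<beta> \<circ> y = Sh n (fst p) 0 (snd p)" if p: "p \<in> Z" for p
  by (rule ann_lift[OF Za[OF p]]) blast
 hence "\<forall>p. \<exists>y. p \<in> Z \<longrightarrow> y \<in> lhom (Om H (fst p + n)) M \<and> \<beta> \<circ> y = Sh n (fst p) 0 (snd p)" by blast
 from choice[OF this] obtain Y where Y: "\<forall>p. p \<in> Z \<longrightarrow> Y p \<in> lhom (Om H (fst p + n)) M \<and> \<beta> \<circ> Y p = Sh n (fst p) 0 (snd p)"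
  by (rule exE)
 \<comment> \<open>The index \<open>None\<close> stands for the inclusion.\<close>
 let ?J = "insert None (Some ` Z)" and ?Y = "case_option \<alpha> Y" and ?dg = "case_option m (\<lambda>p. fst p + n)"
 show ?thesis
 proof (rule tate_module_finitely_generated[OF M_lm, of ?J ?Y ?dg])
  show "finite ?J" using Z(1) by simp
  show "?Y i \<in> lhom (Om H (?dg i)) M" if "i \<in> ?J" for i using that Y alpha by auto
  fix j v assume v: "v \<in> lhom (Om H j) M"
  obtain g r where gr: "g \<in> hom j m" "\<And>p. p \<in> Z ==> r p \<in> hom j (fst p + n)"
    "steq (Om H j) M v (\<lambda>x. (\<alpha> \<circ> g) x + (\<Sum>p\<in>Z. (Y p \<circ> r p) x))"
  proof (rule decomposition[OF Z(1) Zh Z(3) _ _ v])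
   show "Y p \<in> lhom (Om H (fst p + n)) M" if "p \<in> Z" for p using Y that by blast
   show "\<beta> \<circ> Y p = Sh n (fst p) 0 (snd p)" if "p \<in> Z" for p using Y that by blast
  qed (assumption | rule that)+
  have "(\<Sum>i\<in>?J. (?Y i \<circ> case_option g r i) x) = (\<alpha> \<circ> g) x + (\<Sum>p\<in>Z. (Y p \<circ> r p) x)" for x
   using Z(1) by (simp add: sum.reindex)
  thus "\<exists>s. (\<forall>i\<in>?J. s i \<in> hom j (?dg i)) \<and> steq (Om H j) M v (\<lambda>x. \<Sum>i\<in>?J. (?Y i \<circ> s i) x)"
   using gr by (intro exI[of _ "case_option g r"]) auto
 qed
qed

end

section \<open>The middle term of an extension with a multiplication of finite rank\<close>

theorem theorem3p1:
  fixes scale :: "'k::field \<Rightarrow> 'a::ring_1 \<Rightarrow> 'a"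
    and \<Delta> :: "'a \<Rightarrow> ('a \<times> 'a) list" and \<epsilon> :: "'a \<Rightarrow> 'k" and S :: "'a \<Rightarrow> 'a"
    and H :: "('a, 'u::ab_group_add, 'k) heller"
    and Q :: "('a, 'q::ab_group_add, 'k) resolution"
    and M :: "('a, 'm::ab_group_add) lmod"
    and m n :: int
    and \<alpha> :: "'u \<Rightarrow> 'm" and \<beta> :: "'m \<Rightarrow> 'u"
    and \<xi> :: "('u \<Rightarrow> 'k) set"
  assumes "hopf_algebra scale \<Delta> \<epsilon> S"
    and "finite_dimensional scale"
    and "symmetric_algebra scale"
    and "heller_system (trivial_module \<epsilon>) H"
    and "projective_resolution (trivial_module \<epsilon>) Q"
    and "fg_module M"
    and "short_exact (Om H m) \<alpha> M \<beta> (Om H n)"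
    and "represents_class (trivial_module \<epsilon>) H m n \<alpha> M \<beta> \<xi>"
    and "finitely_spanned (UNIV :: 'k set) (tate_ring (trivial_module \<epsilon>) H)
           ((\<lambda>x. tate_homogeneous H (trivial_module \<epsilon>) (n + 1 - m) \<xi>
                 \<otimes>\<^bsub>tate_ring (trivial_module \<epsilon>) H\<^esub> x) ` carrier (tate_ring (trivial_module \<epsilon>) H))"
    and "noetherian_ring (cohomology_ring (trivial_module \<epsilon>) Q)"
  shows "finitely_spanned (carrier (tate_ring (trivial_module \<epsilon>) H))
           (tate_module H M) (carrier (tate_module H M))"
proof -
  interpret hopf_resolution scale \<Delta> \<epsilon> S H Q
    by (intro hopf_resolution.intro hopf_heller.intro symmetric_hopf.intro hopf_heller_axioms.intro symmetric_hopf_axioms.intro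
      hopf_resolution_axioms.intro assms(1-5))
  have "left_module M" using assms(6) by (rule fg_lm)
  have \<xi>: "\<xi> \<in> carrier (tate_deg H T (n + 1 - m))" using assms(8) by (simp add: represents_class_def)
  obtain z e where z: "z \<in> \<xi>" "extension_class H m n \<alpha> M \<beta> e" "shift (n + 1 - m) 0 (core_out H \<circ> z) m e"
    using assms(8) by (auto simp: represents_class_def)
  interpret fquot "lhom (Om H (n + 1 - m)) T" "nulls (Om H (n + 1 - m)) T" by (rule fquot_stable[OF left_module_T])
  have zh: "z \<in> lhom (Om H (n + 1 - m)) T" and zc: "\<xi> = scls (Om H (n + 1 - m)) T z"
    using q_rep[OF \<xi>[unfolded tate_deg_qgrp[OF left_module_T]] z(1)] by simp_all
  interpret hopf_extension scale \<Delta> \<epsilon> S H Q M m n \<alpha> \<beta> e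
    by unfold_locales (rule \<open>left_module M\<close> assms(7) z(2))+
  show ?thesis
    by (rule tate_module_of_extension_finitely_generated[OF assms(10) zh z(3) assms(9)[unfolded zc]])
qed

end
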